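(* Let $n$ be a positive integer and let $s$ be a real number satisfying one of the following: (i) $2\leq s<\frac{n}{2}$; or (ii) $1\leq s<\frac{2n}{n+1}$; or (iii) $1\leq s<\frac{n}{2}$ and $n$ is even. Let $q=\frac{2n}{n-2s}$. Then the equation $$(-\Delta)^{s}u=|u|^{q-2}u \quad\text{on } \mathbb{R}^{n}$$ has infinitely many sign-changing solutions $u\in H^{s}(\mathbb{R}^{n})$; equivalently, there exist solutions $u_{k}\in H^{s}(\mathbb{R}^{n})$, $k=1,2,\dots$, such that $$\int_{\mathbb{R}^{n}} u_{k}\,(-\Delta)^{s}u_{k}\,dx\longrightarrow\infty \quad\text{as } k\to\infty.$$
   Context: $(-\Delta)^{s}$ denotes the fractional Laplacian on $\mathbb{R}^{n}$, i.e. the operator with Fourier symbol $|\xi|^{2s}$. $H^{s}(\mathbb{R}^{n})$ denotes the completion of compactly supported smooth functions on $\mathbb{R}^{n}$ under the norm $\sqrt{\int_{\mathbb{R}^n} u\,(-\Delta)^{s}u\,dx}$. Solutions are understood in the weak sense, i.e. as critical points in $H^{s}(\mathbb{R}^{n})$ of the functional $J(u)=\frac{1}{2}\int_{\mathbb{R}^{n}} u(-\Delta)^{s}u\,dx-\frac{1}{q}\int_{\mathbb{R}^{n}}|u|^{q}\,dx$. A solution is sign-changing if it takes both positive and negative values on sets of positive measure.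
   Formalization: The condition 2s < n is assumed throughout; it follows from (i), (iii) and from (ii) for n ≥ 3, and only removes n = 2, 1 ≤ s < 4/3, where q is undefined (s = 1) or negative and the functional J is not finite for sign-changing u. *)

theory Defs
  imports "HOL-Analysis.Analysis"
begin

coinductive smooth_fun :: "('a::euclidean_space \<Rightarrow> real) \<Rightarrow> bool" where
  "(\<forall>x. f differentiable (at x)) \<Longrightarrow>
   (\<forall>v. smooth_fun (\<lambda>x. frechet_derivative f (at x) v)) \<Longrightarrow> smooth_fun f"

definition test_fun :: "('a::euclidean_space \<Rightarrow> real) \<Rightarrow> bool" where
  "test_fun f \<longleftrightarrow> smooth_fun f \<and> compact (closure {x. f x \<noteq> 0})"

definition fourier :: "('a::euclidean_space \<Rightarrow> real) \<Rightarrow> 'a \<Rightarrow> complex" where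
  "fourier f \<xi> = (\<integral>x. complex_of_real (f x) * cis (- (x \<bullet> \<xi>)) \<partial>lborel)"

definition frac_lap :: "real \<Rightarrow> ('a::euclidean_space \<Rightarrow> real) \<Rightarrow> 'a \<Rightarrow> real" where
  "frac_lap s f x = Re ((1 / (2 * pi) ^ DIM('a)) *
      (\<integral>\<xi>. cis (x \<bullet> \<xi>) * complex_of_real (norm \<xi> powr (2 * s)) * fourier f \<xi> \<partial>lborel))"

definition frac_form :: "real \<Rightarrow> ('a::euclidean_space \<Rightarrow> real) \<Rightarrow> ('a \<Rightarrow> real) \<Rightarrow> real" where
  "frac_form s f g = (\<integral>x. f x * frac_lap s g x \<partial>lborel)"

text \<open>A sequence of test functions approximating u in H^s: Cauchy for the norm
  sqrt(frac_form s phi phi) and convergent to u in L^q with q = 2n/(n-2s)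
  (the completion is realised as a function space via the Sobolev embedding).\<close>
definition Hs_approx :: "real \<Rightarrow> ('a::euclidean_space \<Rightarrow> real) \<Rightarrow> (nat \<Rightarrow> 'a \<Rightarrow> real) \<Rightarrow> bool" where
  "Hs_approx s u \<phi> \<longleftrightarrow>
     (\<forall>k. test_fun (\<phi> k)) \<and>
     (\<forall>e>0. \<exists>N. \<forall>k\<ge>N. \<forall>l\<ge>N.
         sqrt (frac_form s (\<lambda>x. \<phi> k x - \<phi> l x) (\<lambda>x. \<phi> k x - \<phi> l x)) < e) \<and>
     (\<lambda>k. \<integral>\<^sup>+x. ennreal (\<bar>\<phi> k x - u x\<bar> powr (2 * real DIM('a) / (real DIM('a) - 2 * s))) \<partial>lborel)
        \<longlonglongrightarrow> 0"

definition Hs :: "real \<Rightarrow> ('a::euclidean_space \<Rightarrow> real) set" where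
  "Hs s = {u. u \<in> borel_measurable lborel \<and> (\<exists>\<phi>. Hs_approx s u \<phi>)}"

text \<open>The extension of the bilinear form to H^s; for u = v this is
  integral of u (-Delta)^s u.\<close>
definition Hs_form :: "real \<Rightarrow> ('a::euclidean_space \<Rightarrow> real) \<Rightarrow> ('a \<Rightarrow> real) \<Rightarrow> real" where
  "Hs_form s u v = (THE b. \<forall>\<phi> \<psi>. Hs_approx s u \<phi> \<longrightarrow> Hs_approx s v \<psi> \<longrightarrow>
        (\<lambda>k. frac_form s (\<phi> k) (\<psi> k)) \<longlonglongrightarrow> b)"

text \<open>Weak solution of (-Delta)^s u = |u|^(q-2) u: u in H^s is a critical point of
  J(u) = 1/2 Hs_form u u - 1/q int |u|^q, i.e. J'(u) v = 0 for all v in H^s.\<close>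
definition weak_solution :: "real \<Rightarrow> real \<Rightarrow> ('a::euclidean_space \<Rightarrow> real) \<Rightarrow> bool" where
  "weak_solution s q u \<longleftrightarrow> u \<in> Hs s \<and>
     (\<forall>v \<in> Hs s. Hs_form s u v = (\<integral>x. \<bar>u x\<bar> powr (q - 2) * u x * v x \<partial>lborel))"

definition sign_changing :: "('a::euclidean_space \<Rightarrow> real) \<Rightarrow> bool" where
  "sign_changing u \<longleftrightarrow> emeasure lborel {x. u x > 0} > 0 \<and> emeasure lborel {x. u x < 0} > 0"

end

theory Submission
imports Defs "HOL-Probability.Probability" "HOL-Complex_Analysis.Great_Picard" "HOL-Library.Diagonal_Subsequence"
begin

text \<open>Dual variational method. With \<open>p = 2n/(n+2s)\<close> and \<open>q\<close> its conjugate exponent, a solution is, up to a factor,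
the Riesz potential of a maximiser of the form \<open>B(w,w) = \<integral>\<integral> w(x) |x-y|^(2s-n) w(y)\<close> on the unit ball of \<open>L^p\<close>,
restricted to a symmetry class that is compatible with the conformal invariance of \<open>B\<close>; the larger the energy of the
solution, the smaller the maximum. The classes \<open>X m\<close> are invariant under a group that acts freely (the rotations generated by
a complex structure, on \<open>R^n\<close> for even \<open>n\<close> and on the sphere \<open>S^n\<close>, via stereographic projection, for odd \<open>n\<close>) and odd under
a rotation of order \<open>2^(m+1)\<close> in a plane, which makes distinct classes orthogonal for \<open>B\<close> and the solutions sign-changing.
The invariance forbids concentration (for even \<open>n\<close> after a dilation and by strict subadditivity), so bounded sequences with
energy bounded below are precompact. Hence the maxima are attained, and, an orthogonal sequence with values bounded below having
no Cauchy subsequence, they tend to zero.\<close>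

text \<open>The group is chosen by where a bounded sequence in \<open>L^p\<close> can concentrate:
  if M of its elements send a small ball to disjoint places, the ball carries at most 1/M of the
  mass. Complex structures exist only in even dimension. For odd n one lives on R^(n+1); its
  rotations fix no point of S^n, so neither points of R^n nor infinity can collect mass. For even n
  it lives on R^n and fixes 0 and infinity, and there only an energy argument, resting on 2/p > 1,
  excludes that mass escapes or splits between distant scales. The compactness statement lets the
  class \<open>X (m k)\<close> vary with k: a constant index yields maximisers, a strictly
  increasing one yields arbitrarily small maxima. No functional is differentiated. For a maximising
  sequence the Hoelder and Cauchy-Schwarz inequalities become equalities in the limit, so the limit
  of its potentials is, up to a factor, the potential of its own dual function. Kernel and
  \<open>H^s\<close> meet in two steps: potentials arise by minimising a quadratic functional over
  test functions, and the kernel form equals a weighted L^2 form of transforms because both are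
  mixtures, with weight t^(s-1), of Gaussian forms.\<close>

abbreviation (input) nnint :: "('a::euclidean_space \<Rightarrow> ennreal) \<Rightarrow> ennreal" (binder "NN " 10) where
  "nnint f \<equiv> nn_integral lborel f"

abbreviation (input) lborel2 :: "('a::euclidean_space \<times> 'b::euclidean_space) measure" where
  "lborel2 \<equiv> lborel \<Otimes>\<^sub>M lborel"

abbreviation (input) bmeas :: "('a::topological_space \<Rightarrow> 'b::topological_space) set" where
  "bmeas \<equiv> borel_measurable borel"

abbreviation (input) converges :: "(nat \<Rightarrow> 'a::topological_space) \<Rightarrow> 'a \<Rightarrow> bool" (infixr "~>" 60) where
  "f ~> l \<equiv> f \<longlonglongrightarrow> l"

section \<open>Functions with integrable powers\<close>

lemma nn_integral_affine:
 fixes f :: "'a::euclidean_space => ennreal"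
 assumes [measurable]: "f \<in> bmeas" and c: "c \<noteq> 0"
 shows "(NN x. f x) = ennreal (\<bar>c\<bar>^DIM('a)) * (NN x. f (t + c *\<^sub>R x))"
 by (subst lborel_affine[OF c, of t])
  (simp add: nn_integral_density nn_integral_distr nn_integral_cmult)

lemma integrable_affine:
 fixes f :: "'a::euclidean_space => 'b::{banach, second_countable_topology}"
 assumes f: "integrable lborel f" and c: "c \<noteq> 0"
 shows "integrable lborel (%x. f (t + c *\<^sub>R x))"
proof -
 have m: "(%x. ennreal (norm (f x))) \<in> bmeas" and m': "f \<in> bmeas"
  using f[THEN borel_measurable_integrable] by auto
 show ?thesis
  using f m' nn_integral_affine[OF m c, of t] c
  unfolding integrable_iff_bounded by (auto simp: ennreal_mult_less_top)
qed

lemma integral_affine: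
 fixes f :: "'a::euclidean_space => 'b::{banach, second_countable_topology}"
 assumes f: "integrable lborel f" and c: "c \<noteq> 0"
 shows "(LBINT x. f x) = (\<bar>c\<bar>^DIM('a)) *\<^sub>R (LBINT x. f (t + c *\<^sub>R x))"
 using c f f[THEN borel_measurable_integrable] integrable_affine[OF f c, of t]
 by (subst lborel_affine[OF c, of t]) (simp add: integral_density integral_distr)

lemma integrable_translate:
 fixes f :: "'a::euclidean_space => 'b::{banach, second_countable_topology}"
 shows "integrable lborel f ==> integrable lborel (%x. f (x + t))"
 using integrable_affine[of f 1 t] by (simp add: add.commute)

lemma integral_translate:
 fixes f :: "'a::euclidean_space => 'b::{banach, second_countable_topology}"
 shows "integrable lborel f ==> (LBINT x. f (x + t)) = (LBINT x. f x)"
 using integral_affine[of f 1 t] by (simp add: add.commute)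

lemma nn_integral_translate:
 fixes f :: "'a::euclidean_space => ennreal"
 assumes "f \<in> bmeas"
 shows "(NN x. f (x + t)) = (NN x. f x)"
 using nn_integral_affine[OF assms, of 1 t] by (simp add: add.commute)

lemma integral_reflect:
 fixes f :: "'a::euclidean_space => 'b::{banach, second_countable_topology}"
 assumes "integrable lborel f"
 shows "(LBINT x. f (t - x)) = (LBINT x. f x)"
  and "integrable lborel (%x. f (t - x))"
 using integral_affine[OF assms, of "-1" t] integrable_affine[OF assms, of "-1" t] by auto

lemma integral_odd_zero:
 fixes f :: "'a::euclidean_space => real"
 assumes "integrable lborel f" and "!!x. f (- x) = - f x"
 shows "(LBINT x. f x) = 0"
 using integral_reflect(1)[OF assms(1), of 0] assms(2) by simp

lemma emeasure_ball:
 fixes c :: "'a::euclidean_space"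
 assumes "r \<ge> 0"
 shows "emeasure lborel (ball c r) = ennreal (unit_ball_vol (real DIM('a)) * r ^ DIM('a))"
proof -
 have [simp]: "emeasure lborel (cball c r - ball c r) = 0"
 proof -
  have "measure lborel (ball c r) = measure lborel (cball c r)"
   using content_ball[OF assms, of c] content_cball[OF assms, of c] by simp
  then have "emeasure lborel (ball c r) = emeasure lborel (cball c r)"
   by (metis emeasure_eq_ennreal_measure emeasure_lborel_ball_finite emeasure_lborel_cball_finite
     less_top infinity_ennreal_def order_less_irrefl)
  then show ?thesis
   using emeasure_Diff[of lborel "ball c r" "cball c r"] emeasure_lborel_cball_finite[of c r]
   by (auto simp: ball_subset_cball)
 qed
 have "emeasure lborel (ball c r) = emeasure lborel (cball c r)"
  using content_ball[OF assms, of c] content_cball[OF assms, of c]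
  by (metis emeasure_eq_ennreal_measure emeasure_lborel_ball_finite emeasure_lborel_cball_finite
     less_top infinity_ennreal_def order_less_irrefl)
 then show ?thesis using emeasure_cball[OF assms, of c] by simp
qed

lemma dyadic_between:
 fixes y :: real assumes "y \<ge> 1"
 obtains k :: nat where "2 ^ k \<le> y" "y < 2 ^ Suc k"
proof -
 define k where "k = nat \<lfloor>log 2 y\<rfloor>"
 have l: "log 2 y \<ge> 0" using assms by simp
 have 1: "real k \<le> log 2 y" "log 2 y < real k + 1" using l unfolding k_def by linarith+
 have "2 powr real k \<le> y" using 1(1) assms by (simp add: powr_le_iff)
 moreover have "y < 2 powr (real k + 1)" using 1(2) assms by (simp add: less_powr_iff)
 ultimately show ?thesis using that[of k] by (simp add: powr_realpow powr_add mult.commute)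
qed

text \<open>Dyadic shells take the place of polar coordinates. A point of the k-th shell is charged
  to the whole ball of radius \<open>r / 2^k\<close>, with the weight at half that radius; the
  charges form a geometric series of ratio \<open>2 powr (a - n) < 1\<close>.\<close>

lemma radial_near:
 fixes a :: real
 assumes a: "0 \<le> a" "a < real DIM('a::euclidean_space)"
 obtains C where "C \<ge> 0" "!!r. r > 0 ==>
  (NN x. indicator (ball 0 r) (x::'a) * ennreal (norm x powr (-a))) \<le> ennreal (C * r powr (real DIM('a) - a))"
proof
 let ?n = "real DIM('a)"
 define V where "V = unit_ball_vol ?n"
 define g where "g = 2 powr (a - ?n)"
 have V: "V \<ge> 0" unfolding V_def by simp
 have g: "0 < g" "g < 1" unfolding g_def using a powr_less_cancel_iff[of 2 "a - ?n" 0] by auto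
 define C where "C = V * 2 powr a / (1 - g)"
 show "C \<ge> 0" unfolding C_def using V g by auto
 fix r :: real assume r: "r > 0"
 define h where "h = (%k x. indicator (ball (0::'a) (r / 2^k)) x * ennreal ((r / 2^Suc k) powr (-a)))"
 have hm: "!!k. h k \<in> borel_measurable lborel" unfolding h_def by (intro borel_measurable_times_ennreal borel_measurable_indicator borel_measurable_const) auto
 have pt: "indicator (ball 0 r) x * ennreal (norm x powr (-a)) \<le> (\<Sum>k. h k x)" if x: "x \<noteq> 0" for x
 proof (cases "norm x < r")
  case True
  then have "r / norm x \<ge> 1" using x by (simp add: field_simps)
  from dyadic_between[OF this] obtain k where k: "2 ^ k \<le> r / norm x" "r / norm x < 2 ^ Suc k" by blast
  have 1: "norm x \<le> r / 2^k" "r / 2^Suc k < norm x" using k x by (auto simp: field_simps)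
  have "norm x powr (-a) \<le> (r / 2^Suc k) powr (-a)"
   using 1 r a by (intro powr_mono2') auto
  show ?thesis
  \<comment> \<open>\<open>dyadic_between\<close> admits equality in its lower bound, that is a
    point on the boundary of the open ball of index \<open>k\<close>. Such a point is charged to the
    ball of index \<open>k - 1\<close>, which exists because \<open>norm x < r\<close>.\<close>
  proof (cases "norm x = r / 2^k")
   case False
   then have "indicator (ball 0 r) x * ennreal (norm x powr (-a)) \<le> h k x"
    unfolding h_def using 1 \<open>norm x powr (-a) \<le> _\<close> by (auto simp: indicator_def intro!: ennreal_leI)
   also have "... \<le> (\<Sum>k. h k x)"
    using sum_le_suminf[of "%k. h k x" "{k}"] by simp
   finally show ?thesis .
  next
   case e: True
   have k0: "k \<noteq> 0" using e True by (cases k) auto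
   then obtain j where j: "k = Suc j" by (cases k) auto
   have "indicator (ball 0 r) x * ennreal (norm x powr (-a)) \<le> h j x"
    unfolding h_def using e r j True by (auto simp: indicator_def field_simps)
   also have "... \<le> (\<Sum>k. h k x)"
    using sum_le_suminf[of "%k. h k x" "{j}"] by simp
   finally show ?thesis .
  qed
 qed auto
 have "(NN x. indicator (ball 0 r) (x::'a) * ennreal (norm x powr (-a))) \<le> (NN x. (\<Sum>k. h k x))"
  by (rule nn_integral_mono_AE) (use pt AE_lborel_singleton[of 0] in auto)
 also have "... = (\<Sum>k. (NN x. h k x))" by (rule nn_integral_suminf) (use hm in auto)
 also have "... = (\<Sum>k. ennreal (V * 2 powr a * r powr (?n - a) * g ^ k))"
 proof (rule arg_cong[where f=suminf], rule ext)
  fix k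
  have "(NN x. h k x) = emeasure lborel (ball (0::'a) (r/2^k)) * ennreal ((r / 2^Suc k) powr (-a))"
   unfolding h_def by (subst nn_integral_multc) (auto intro!: borel_measurable_indicator)
  also have "... = ennreal (V * (r/2^k) ^ DIM('a) * (r / 2^Suc k) powr (-a))"
   using emeasure_ball[of "r/2^k" "0::'a"] r V by (simp add: V_def ennreal_mult)
  also have "V * (r/2^k) ^ DIM('a) * (r / 2^Suc k) powr (-a) = V * 2 powr a * r powr (?n - a) * g ^ k"
  proof -
   have "(r/2^k) ^ DIM('a) = r powr ?n * 2 powr (- real k * ?n)"
    using r by (simp add: powr_realpow[symmetric] powr_divide powr_powr powr_minus_divide)
   moreover have "(r / 2^Suc k) powr (-a) = r powr (-a) * 2 powr (real (Suc k) * a)"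
    using r by (simp add: powr_realpow[symmetric] powr_divide powr_powr powr_minus_divide powr_add powr_mult ring_distribs)
   moreover have "g ^ k = 2 powr (real k * (a - ?n))"
    unfolding g_def by (simp add: powr_realpow[symmetric] powr_powr mult.commute)
   ultimately show ?thesis
    by (simp add: powr_add[symmetric] powr_diff algebra_simps powr_minus_divide)
  qed
  finally show "(NN x. h k x) = ennreal (V * 2 powr a * r powr (?n - a) * g ^ k)" .
 qed
 also have "... = ennreal (\<Sum>k. V * 2 powr a * r powr (?n - a) * g ^ k)"
  using g V by (intro suminf_ennreal2 summable_mult) (auto)
 also have "(\<Sum>k. V * 2 powr a * r powr (?n - a) * g ^ k) = V * 2 powr a * r powr (?n - a) * (1 / (1 - g))"
  using g by (subst suminf_mult) (auto simp: suminf_geometric)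
 finally show "(NN x. indicator (ball 0 r) (x::'a) * ennreal (norm x powr (-a))) \<le> ennreal (C * r powr (?n - a))"
  by (simp add: C_def algebra_simps)
qed

text \<open>The mirror image of \<open>radial_near\<close>: the shells grow outwards and the ratio
  is \<open>2 powr (n - a) < 1\<close>.\<close>

lemma radial_far:
 fixes a :: real
 assumes a: "a > real DIM('a::euclidean_space)"
 obtains C where "C \<ge> 0" "!!r. r > 0 ==>
  (NN x. indicator {x. norm x \<ge> r} (x::'a) * ennreal (norm x powr (-a))) \<le> ennreal (C * r powr (real DIM('a) - a))"
proof
 let ?n = "real DIM('a)"
 define V where "V = unit_ball_vol ?n"
 define g where "g = 2 powr (?n - a)"
 have V: "V \<ge> 0" unfolding V_def by simp
 have g: "0 < g" "g < 1" unfolding g_def using a powr_less_cancel_iff[of 2 "?n - a" 0] by auto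
 define C where "C = V * 2 powr ?n / (1 - g)"
 show "C \<ge> 0" unfolding C_def using V g by auto
 fix r :: real assume r: "r > 0"
 define h where "h = (%k x. indicator (ball (0::'a) (r * 2^Suc k)) x * ennreal ((r * 2^k) powr (-a)))"
 have hm: "!!k. h k \<in> borel_measurable lborel" unfolding h_def by (intro borel_measurable_times_ennreal borel_measurable_indicator borel_measurable_const) auto
 have pt: "indicator {x. norm x \<ge> r} x * ennreal (norm x powr (-a)) \<le> (\<Sum>k. h k x)" for x
 proof (cases "norm x \<ge> r")
  case True
  then have "norm x / r \<ge> 1" using r by (simp add: field_simps)
  from dyadic_between[OF this] obtain k where k: "2 ^ k \<le> norm x / r" "norm x / r < 2 ^ Suc k" by blast
  have 1: "r * 2^k \<le> norm x" "norm x < r * 2^Suc k" using k r by (auto simp: field_simps)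
  have "norm x powr (-a) \<le> (r * 2^k) powr (-a)"
   using 1 r a by (intro powr_mono2') auto
  then have "indicator {x. norm x \<ge> r} x * ennreal (norm x powr (-a)) \<le> h k x"
   unfolding h_def using 1 by (auto simp: indicator_def intro!: ennreal_leI)
  also have "... \<le> (\<Sum>k. h k x)"
   using sum_le_suminf[of "%k. h k x" "{k}"] by simp
  finally show ?thesis .
 qed auto
 have "(NN x. indicator {x. norm x \<ge> r} (x::'a) * ennreal (norm x powr (-a))) \<le> (NN x. (\<Sum>k. h k x))"
  by (rule nn_integral_mono) (use pt in auto)
 also have "... = (\<Sum>k. (NN x. h k x))" by (rule nn_integral_suminf) (use hm in auto)
 also have "... = (\<Sum>k. ennreal (V * 2 powr ?n * r powr (?n - a) * g ^ k))"
 proof (rule arg_cong[where f=suminf], rule ext)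
  fix k
  have "(NN x. h k x) = emeasure lborel (ball (0::'a) (r * 2^Suc k)) * ennreal ((r * 2^k) powr (-a))"
   unfolding h_def by (subst nn_integral_multc) (auto intro!: borel_measurable_indicator)
  also have "... = ennreal (V * (r * 2^Suc k) ^ DIM('a) * (r * 2^k) powr (-a))"
   using emeasure_ball[of "r * 2^Suc k" "0::'a"] r V by (simp add: V_def ennreal_mult)
  also have "V * (r * 2^Suc k) ^ DIM('a) * (r * 2^k) powr (-a) = V * 2 powr ?n * r powr (?n - a) * g ^ k"
  proof -
   have "(r * 2^Suc k) ^ DIM('a) = r powr ?n * 2 powr (real (Suc k) * ?n)"
    using r by (simp add: powr_realpow[symmetric] powr_mult powr_powr powr_add ring_distribs)
   moreover have "(r * 2^k) powr (-a) = r powr (-a) * 2 powr (- real k * a)"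
    using r by (simp add: powr_realpow[symmetric] powr_mult powr_powr)
   moreover have "g ^ k = 2 powr (real k * (?n - a))"
    unfolding g_def by (simp add: powr_realpow[symmetric] powr_powr mult.commute)
   ultimately show ?thesis
    by (simp add: powr_add[symmetric] powr_diff algebra_simps powr_minus_divide)
  qed
  finally show "(NN x. h k x) = ennreal (V * 2 powr ?n * r powr (?n - a) * g ^ k)" .
 qed
 also have "... = ennreal (\<Sum>k. V * 2 powr ?n * r powr (?n - a) * g ^ k)"
  using g V by (intro suminf_ennreal2 summable_mult) (auto)
 also have "(\<Sum>k. V * 2 powr ?n * r powr (?n - a) * g ^ k) = V * 2 powr ?n * r powr (?n - a) * (1 / (1 - g))"
  using g by (subst suminf_mult) (auto simp: suminf_geometric)
 finally show "(NN x. indicator {x. norm x \<ge> r} (x::'a) * ennreal (norm x powr (-a))) \<le> ennreal (C * r powr (?n - a))"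
  by (simp add: C_def algebra_simps)
qed

section \<open>Integrability classes, Hoelder's inequality and completeness\<close>

definition Lp :: "real => ('a::euclidean_space => real) => bool" where
 "Lp r f \<longleftrightarrow> f \<in> bmeas \<and> integrable lborel (%x. \<bar>f x\<bar> powr r)"

text \<open>The power of the norm, without the root: it is additive over disjoint sets and so
  behaves as a mass, and \<open>Np p w \<le> 1\<close> still describes the unit ball.\<close>

definition Np :: "real => ('a::euclidean_space => real) => real" where
 "Np r f = (LBINT x. \<bar>f x\<bar> powr r)"

lemma Lp_meas: "Lp r f ==> f \<in> bmeas"
 by (simp add: Lp_def)

lemma Np_nonneg [simp]: "Np r f \<ge> 0" unfolding Np_def by simp

lemma nn_Np: "Lp r f ==> (NN x. ennreal (\<bar>f x\<bar> powr r)) = ennreal (Np r f)"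
 unfolding Lp_def Np_def by (subst nn_integral_eq_integral) auto

lemma LpI_nn:
 assumes [measurable]: "f \<in> bmeas"
  and "(NN x. ennreal (\<bar>f x\<bar> powr r)) \<le> ennreal N" "N \<ge> 0"
 shows "Lp r f" "Np r f \<le> N"
proof -
 have "integrable lborel (%x. \<bar>f x\<bar> powr r)"
  by (rule integrableI_nonneg) (use assms in \<open>auto intro: le_less_trans\<close>)
 then show L: "Lp r f" by (simp add: Lp_def)
 show "Np r f \<le> N" using nn_Np[OF L] assms by simp
qed

text \<open>Young's inequality for \<open>f / A\<close> and \<open>g / B\<close>, integrated.
  \<open>A = B = 1\<close> already gives integrability; the sharp bound takes the two norms for
  \<open>A\<close> and \<open>B\<close>, so that a vanishing norm becomes a separate case.\<close>

lemma Holder: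
 assumes pq: "p > 1" "q > 1" "1/p + 1/q = 1" and f: "Lp p f" and g: "Lp q g"
 shows "integrable lborel (%x. f x * g x)"
  and "(LBINT x. \<bar>f x * g x\<bar>) \<le> Np p f powr (1/p) * Np q g powr (1/q)"
proof -
 have [measurable]: "f \<in> bmeas" "g \<in> bmeas"
  using f g by (auto simp: Lp_def)
 have i: "integrable lborel (%x. \<bar>f x\<bar> powr p / (A powr p) / p + \<bar>g x\<bar> powr q / (B powr q) / q)" for A B
  using f g by (auto simp: Lp_def)
 have Y: "\<bar>f x * g x\<bar> \<le> A * B * (\<bar>f x\<bar> powr p / (A powr p) / p + \<bar>g x\<bar> powr q / (B powr q) / q)" if "A > 0" "B > 0" for A B x
  using Youngs_inequality[OF pq, of "\<bar>f x\<bar>/A" "\<bar>g x\<bar>/B"] that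
  by (simp add: powr_divide abs_mult field_simps)
 show I: "integrable lborel (%x. f x * g x)"
  by (rule Bochner_Integration.integrable_bound[OF integrable_mult_right[OF i[of 1 1], of "1*1"]])
   (use Y[of 1 1] in \<open>auto intro!: AE_I2 order_trans[OF _ abs_ge_self]\<close>)
 show "(LBINT x. \<bar>f x * g x\<bar>) \<le> Np p f powr (1/p) * Np q g powr (1/q)"
 proof (cases "Np p f = 0 \<or> Np q g = 0")
  case True
  then have "AE x in lborel. f x * g x = 0"
  proof
   assume "Np p f = 0"
   then have "AE x in lborel. \<bar>f x\<bar> powr p = 0" using f unfolding Np_def Lp_def
    by (subst (asm) integral_nonneg_eq_0_iff_AE) auto
   then show ?thesis by eventually_elim auto
  next
   assume "Np q g = 0"
   then have "AE x in lborel. \<bar>g x\<bar> powr q = 0" using g unfolding Np_def Lp_def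
    by (subst (asm) integral_nonneg_eq_0_iff_AE) auto
   then show ?thesis by eventually_elim auto
  qed
  then have "(LBINT x. \<bar>f x * g x\<bar>) = (\<integral>x. 0 \<partial>(lborel :: 'a measure))"
   by (intro integral_cong_AE) auto
  then show ?thesis by simp
 next
  case False
  define A where "A = Np p f powr (1/p)"
  define B where "B = Np q g powr (1/q)"
  have AB: "A > 0" "B > 0" "A powr p = Np p f" "B powr q = Np q g"
   using False pq Np_nonneg[of p f] Np_nonneg[of q g] unfolding A_def B_def
   by (auto simp: powr_powr)
  have "(LBINT x. \<bar>f x * g x\<bar>) \<le> (LBINT x. A * B * (\<bar>f x\<bar> powr p / (A powr p) / p + \<bar>g x\<bar> powr q / (B powr q) / q))"
   by (intro integral_mono integrable_mult_right i) (use I Y[OF AB(1,2)] in auto)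
  also have "... = A * B * (Np p f / (A powr p) / p + Np q g / (B powr q) / q)"
   using f g by (simp add: Np_def Lp_def)
  also have "... = A * B" using AB False pq by simp
  finally show ?thesis by (simp add: A_def B_def)
 qed
qed

lemma Holder_abs:
 assumes pq: "p > 1" "q > 1" "1/p + 1/q = 1" and f: "Lp p f" and g: "Lp q g"
 shows "\<bar>LBINT x. f x * g x\<bar> \<le> Np p f powr (1/p) * Np q g powr (1/q)"
 using Holder[OF assms] integral_abs_bound[of lborel "%x. f x * g x"] by linarith

text \<open>Takes the place of Minkowski's inequality. The factor \<open>2 powr r\<close> is
  harmless: it only meets quantities that tend to zero or just have to stay bounded.\<close>

lemma powr_add_le:
 fixes a b r :: real assumes "r \<ge> 0"
 shows "\<bar>a + b\<bar> powr r \<le> 2 powr r * (\<bar>a\<bar> powr r + \<bar>b\<bar> powr r)"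
proof -
 have "\<bar>a + b\<bar> powr r \<le> (2 * max \<bar>a\<bar> \<bar>b\<bar>) powr r"
  using assms by (intro powr_mono2) auto
 also have "... = 2 powr r * (max \<bar>a\<bar> \<bar>b\<bar>) powr r" by (simp add: powr_mult)
 also have "(max \<bar>a\<bar> \<bar>b\<bar>) powr r \<le> \<bar>a\<bar> powr r + \<bar>b\<bar> powr r" by (auto simp: max_def)
 finally show ?thesis by simp
qed

lemma Lp_add:
 assumes "Lp r f" "Lp r g" "r \<ge> 0"
 shows "Lp r (%x. f x + g x)" "Np r (%x. f x + g x) \<le> 2 powr r * (Np r f + Np r g)"
proof -
 have [measurable]: "f \<in> bmeas" "g \<in> bmeas"
  using assms by (auto simp: Lp_def)
 have i: "integrable lborel (%x. 2 powr r * (\<bar>f x\<bar> powr r + \<bar>g x\<bar> powr r))"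
  using assms by (auto simp: Lp_def)
 have j: "integrable lborel (%x. \<bar>f x + g x\<bar> powr r)"
  by (rule Bochner_Integration.integrable_bound[OF i]) (use powr_add_le[OF assms(3)] in auto)
 then show "Lp r (%x. f x + g x)" by (simp add: Lp_def)
 have "Np r (%x. f x + g x) \<le> (LBINT x. 2 powr r * (\<bar>f x\<bar> powr r + \<bar>g x\<bar> powr r))"
  unfolding Np_def by (rule integral_mono[OF j i]) (use powr_add_le[OF assms(3)] in auto)
 also have "... = 2 powr r * (Np r f + Np r g)" using assms by (simp add: Np_def Lp_def)
 finally show "Np r (%x. f x + g x) \<le> 2 powr r * (Np r f + Np r g)" .
qed

lemma Lp_cmult:
 assumes "Lp r f"
 shows "Lp r (%x. c * f x)" "Np r (%x. c * f x) = \<bar>c\<bar> powr r * Np r f"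
 using assms by (auto simp: Lp_def Np_def abs_mult powr_mult)

lemma Lp_diff:
 assumes "Lp r f" "Lp r g" "r \<ge> 0"
 shows "Lp r (%x. f x - g x)" "Np r (%x. f x - g x) \<le> 2 powr r * (Np r f + Np r g)"
 using Lp_add[OF assms(1) Lp_cmult(1)[OF assms(2), of "-1"] assms(3)] Lp_cmult(2)[OF assms(2), of "-1"] by auto

lemma Lp_bounded_by:
 assumes "Lp r g" "f \<in> bmeas" "!!x. \<bar>f x\<bar> \<le> \<bar>g x\<bar>" "r \<ge> 0"
 shows "Lp r f" "Np r f \<le> Np r g"
proof -
 have [measurable]: "f \<in> bmeas" "g \<in> bmeas"
  using assms by (auto simp: Lp_def)
 have i: "integrable lborel (%x. \<bar>g x\<bar> powr r)" using assms by (auto simp: Lp_def)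
 have j: "integrable lborel (%x. \<bar>f x\<bar> powr r)"
  by (rule Bochner_Integration.integrable_bound[OF i]) (use assms in \<open>auto intro!: powr_mono2\<close>)
 then show "Lp r f" by (simp add: Lp_def)
 show "Np r f \<le> Np r g" unfolding Np_def using i j assms by (intro integral_mono) (auto intro!: powr_mono2)
qed

lemma Lp_mult_ind:
 assumes "Lp r f" "A \<in> sets borel" "r \<ge> 0"
 shows "Lp r (%x. f x * indicator A x)" "Np r (%x. f x * indicator A x) \<le> Np r f"
proof -
 have m: "(%x. f x * indicator A x) \<in> bmeas"
  using Lp_meas[OF assms(1)] assms(2) by auto
 have b: "\<bar>f x * indicator A x\<bar> \<le> \<bar>f x\<bar>" for x by (auto simp: indicator_def)
 show "Lp r (%x. f x * indicator A x)" "Np r (%x. f x * indicator A x) \<le> Np r f"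
  using Lp_bounded_by[OF assms(1) m b assms(3)] by auto
qed

lemma Np_zero_AE:
 assumes "Lp r f" "Np r f = 0"
 shows "AE x in lborel. f x = 0"
proof -
 have "AE x in lborel. \<bar>f x\<bar> powr r = 0" using assms unfolding Np_def Lp_def
  by (subst (asm) integral_nonneg_eq_0_iff_AE) auto
 then show ?thesis by eventually_elim auto
qed

lemma ennreal_tendsto_0I:
 fixes f :: "'b => ennreal"
 assumes "!!e::real. e > 0 ==> eventually (%k. f k \<le> ennreal e) F"
 shows "(f \<longlongrightarrow> 0) F"
proof (rule order_tendstoI)
 fix a :: ennreal assume "0 < a"
 then obtain b where b: "0 < b" "b < a" using dense by blast
 then obtain e where e: "b = ennreal e" "e > 0" by (cases b) auto
 show "eventually (%k. f k < a) F"
  using assms[OF e(2)] by eventually_elim (use b e in auto)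
qed auto

text \<open>Riesz-Fischer. A rapidly Cauchy subsequence converges almost everywhere by
  Borel-Cantelli, and Fatou's lemma along it turns this into convergence of the integrals.
  Nonnegative integrals are used because only differences of the sequence are controlled.\<close>

lemma Lp_complete:
 fixes f :: "nat => 'a::euclidean_space => real"
 assumes r: "r > 0" and f[measurable]: "!!k. f k \<in> bmeas"
  and cau: "!!e::real. e > 0 ==> \<exists>N. \<forall>k\<ge>N. \<forall>l\<ge>N. (NN x. ennreal (\<bar>f k x - f l x\<bar> powr r)) \<le> ennreal e"
 obtains g \<sigma> where "g \<in> bmeas"
  "(%k. (NN x. ennreal (\<bar>f k x - g x\<bar> powr r))) ~> 0"
  "strict_mono \<sigma>" "AE x in lborel. (%k. f (\<sigma> k) x) ~> g x"
proof -
 \<comment> \<open>The Chebyshev threshold: an integral below \<open>e i\<close> confines the set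
   where two functions differ by at least \<open>(1/2)^i\<close> to measure at most
   \<open>(1/2)^i\<close>.\<close>
 define e where "e = (%i::nat. (1/2) ^ i * ((1/2) ^ i) powr r :: real)"
 have e0: "e i > 0" for i unfolding e_def by simp
 have "\<exists>N. \<forall>i. \<forall>k\<ge>N i. \<forall>l\<ge>N i. (NN x. ennreal (\<bar>f k x - f l x\<bar> powr r)) \<le> ennreal (e i)"
  by (intro choice allI cau e0)
 then obtain N where N: "!!i k l. k \<ge> N i ==> l \<ge> N i ==> (NN x. ennreal (\<bar>f k x - f l x\<bar> powr r)) \<le> ennreal (e i)"
  by blast
 define \<sigma> where "\<sigma> = rec_nat (N 0) (%i m. max (Suc m) (N (Suc i)))"
 have \<sigma>S: "\<sigma> (Suc i) = max (Suc (\<sigma> i)) (N (Suc i))" for i by (simp add: \<sigma>_def)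
 have sm: "strict_mono \<sigma>" by (rule strict_monoI_Suc) (simp add: \<sigma>S)
 have \<sigma>N: "\<sigma> i \<ge> N i" for i by (cases i) (simp_all add: \<sigma>S, simp add: \<sigma>_def)
 define A where "A = (%i. {x. \<bar>f (\<sigma> (Suc i)) x - f (\<sigma> i) x\<bar> \<ge> (1/2)^i})"
 have Am[measurable]: "A i \<in> sets lborel" for i unfolding A_def by measurable
 have Ae: "emeasure lborel (A i) \<le> ennreal ((1/2)^i)" for i
 proof -
  have "ennreal (((1/2)^i) powr r) * emeasure lborel (A i) = (NN x. ennreal (((1/2)^i) powr r) * indicator (A i) x)"
   by (subst nn_integral_cmult_indicator) measurable
  also have "... \<le> (NN x. ennreal (\<bar>f (\<sigma> (Suc i)) x - f (\<sigma> i) x\<bar> powr r))"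
   by (rule nn_integral_mono) (use r in \<open>auto simp: A_def indicator_def intro!: ennreal_leI powr_mono2\<close>)
  also have "... \<le> ennreal (e i)"
   using \<sigma>N[of i] sm by (intro N) (auto simp: \<sigma>S)
  also have "... = ennreal (((1/2)^i) powr r) * ennreal ((1/2)^i)"
   by (simp add: e_def ennreal_mult mult.commute)
  finally show ?thesis by (subst (asm) ennreal_mult_le_mult_iff) auto
 qed
 have Af: "emeasure lborel (A i) < \<infinity>" for i using Ae[of i] by (simp add: le_less_trans)
 have "measure lborel (A i) \<le> (1/2)^i" for i
  using Ae[of i] by (simp add: measure_def enn2real_leI)
 then have "summable (%i. measure lborel (A i))"
  by (intro summable_comparison_test[OF _ summable_geometric[of "1/2::real"]]) auto
 from borel_cantelli_AE1[OF Am Af this]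
 have "AE x in lborel. eventually (%i. x \<in> space lborel - A i) sequentially" by simp
 then have conv: "AE x in lborel. convergent (%i. f (\<sigma> i) x)"
 proof eventually_elim
  case (elim x)
  then obtain M where M: "!!i. i \<ge> M ==> \<bar>f (\<sigma> (Suc i)) x - f (\<sigma> i) x\<bar> < (1/2)^i"
   unfolding eventually_sequentially A_def by force
  have "summable (%i. f (\<sigma> (Suc i)) x - f (\<sigma> i) x)"
   by (rule summable_comparison_test[OF _ summable_geometric[of "1/2::real"]])
    (use M in \<open>auto intro!: exI[of _ M] less_imp_le\<close>)
  then have "convergent (%n. \<Sum>i<n. f (\<sigma> (Suc i)) x - f (\<sigma> i) x)"
   by (simp add: summable_iff_convergent)
  then have "convergent (%n. f (\<sigma> n) x - f (\<sigma> 0) x)"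
   using sum_lessThan_telescope[of "%i. f (\<sigma> i) x"] by simp
  from convergent_add[OF this convergent_const[of "f (\<sigma> 0) x"]] show ?case by simp
 qed
 define g where "g = (%x. lim (%i. f (\<sigma> i) x))"
 have [measurable]: "g \<in> bmeas" unfolding g_def by measurable
 have lim: "AE x in lborel. (%i. f (\<sigma> i) x) ~> g x"
  using conv by eventually_elim (simp add: g_def convergent_LIMSEQ_iff)
 have "(%k. (NN x. ennreal (\<bar>f k x - g x\<bar> powr r))) ~> 0"
 proof (rule ennreal_tendsto_0I)
  fix e :: real assume "e > 0"
  from cau[OF this] obtain M where M: "!!k l. k \<ge> M ==> l \<ge> M ==> (NN x. ennreal (\<bar>f k x - f l x\<bar> powr r)) \<le> ennreal e" by blast
  have "(NN x. ennreal (\<bar>f k x - g x\<bar> powr r)) \<le> ennreal e" if k: "k \<ge> M" for k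
  proof -
   have "(NN x. ennreal (\<bar>f k x - g x\<bar> powr r))
     = (NN x. liminf (%i. ennreal (\<bar>f k x - f (\<sigma> i) x\<bar> powr r)))"
   proof (rule nn_integral_cong_AE)
    show "AE x in lborel. ennreal (\<bar>f k x - g x\<bar> powr r) = liminf (%i. ennreal (\<bar>f k x - f (\<sigma> i) x\<bar> powr r))"
     using lim
    proof eventually_elim
     case (elim x)
     have "(%i. ennreal (\<bar>f k x - f (\<sigma> i) x\<bar> powr r)) ~> ennreal (\<bar>f k x - g x\<bar> powr r)"
      using r by (intro tendsto_ennrealI tendsto_powr' tendsto_intros elim) auto
     then show ?case using lim_imp_Liminf[OF trivial_limit_sequentially] by metis
    qed
   qed
   also have "... \<le> liminf (%i. (NN x. ennreal (\<bar>f k x - f (\<sigma> i) x\<bar> powr r)))"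
    by (rule nn_integral_liminf) auto
   also have "... \<le> liminf (%i::nat. ennreal e)"
   proof (rule Liminf_mono)
    have "\<sigma> i \<ge> i" for i using sm by (rule seq_suble)
    then have "(NN x. ennreal (\<bar>f k x - f (\<sigma> i) x\<bar> powr r)) \<le> ennreal e" if "i \<ge> M" for i
     using that k by (intro M) (auto intro: order_trans)
    then show "\<forall>\<^sub>F i in sequentially. (NN x. ennreal (\<bar>f k x - f (\<sigma> i) x\<bar> powr r)) \<le> ennreal e"
     by (auto simp: eventually_sequentially)
   qed
   also have "... = ennreal e" by (simp add: Liminf_const)
   finally show ?thesis .
  qed
  then show "\<forall>\<^sub>F k in sequentially. (NN x. ennreal (\<bar>f k x - g x\<bar> powr r)) \<le> ennreal e"
   by (auto simp: eventually_sequentially)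
 qed
 with sm lim show ?thesis by (intro that[of g \<sigma>]) auto
qed

section \<open>Test functions and the Hartley transform\<close>

lemma smooth_fun_D:
 assumes "smooth_fun f"
 shows "f differentiable (at x)" "smooth_fun (%x. frechet_derivative f (at x) v)"
 using assms by (auto elim: smooth_fun.cases)

lemma smooth_fun_deriv:
 assumes "smooth_fun f"
 shows "(f has_derivative frechet_derivative f (at x)) (at x)"
 using smooth_fun_D(1)[OF assms] by (simp add: frechet_derivative_works)

lemma smooth_fun_continuous: "smooth_fun f ==> continuous_on A f"
 by (intro continuous_at_imp_continuous_on ballI differentiable_imp_continuous_within smooth_fun_D(1))

text \<open>Smoothness follows from membership in a set of functions closed under directional
  derivatives. \<open>D\<close> may be any derivative because derivatives are unique, so closure can
  be checked on whatever formula is at hand.\<close>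

lemma smooth_fun_coinductI:
 assumes "f \<in> X" and "!!f x. f \<in> X ==> \<exists>D. (f has_derivative D x) (at x)"
  and "!!f D v. f \<in> X ==> (!!x. (f has_derivative D x) (at x)) ==> (%x. D x v) \<in> X"
 shows "smooth_fun f"
 using assms(1)
proof (coinduction arbitrary: f)
 case smooth_fun
 have d: "f differentiable (at x)" for x using assms(2)[OF smooth_fun] by (auto simp: differentiable_def)
 then have "(f has_derivative frechet_derivative f (at x)) (at x)" for x by (simp add: frechet_derivative_works)
 from assms(3)[OF smooth_fun this] d show ?case by auto
qed

lemma smooth_fun_lincomb:
 assumes "smooth_fun f" "smooth_fun g"
 shows "smooth_fun (%x. a * f x + b * g x)"
proof (rule smooth_fun_coinductI[where X="{h. \<exists>f g. smooth_fun f \<and> smooth_fun g \<and> h = (%x. a * f x + b * g x)}"])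
 show "(%x. a * f x + b * g x) \<in> {h. \<exists>f g. smooth_fun f \<and> smooth_fun g \<and> h = (%x. a * f x + b * g x)}"
  using assms by auto
 have dd: "((%x. a * f x + b * g x) has_derivative (%v. a * frechet_derivative f (at x) v + b * frechet_derivative g (at x) v)) (at x)"
  if "smooth_fun f" "smooth_fun g" for f g :: "'a => real" and x
  using smooth_fun_deriv[OF that(1), of x] smooth_fun_deriv[OF that(2), of x] by (auto intro!: derivative_eq_intros)
 fix h :: "'a => real" assume "h \<in> {h. \<exists>f g. smooth_fun f \<and> smooth_fun g \<and> h = (%x. a * f x + b * g x)}"
 then obtain f g where fg: "smooth_fun f" "smooth_fun g" "h = (%x. a * f x + b * g x)" by auto
 show "\<exists>D. (h has_derivative D x) (at x)" for x using dd[OF fg(1,2), of x] fg(3) by auto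
 fix D v assume "!!x. (h has_derivative D x) (at x)"
 then have "D x = (%v. a * frechet_derivative f (at x) v + b * frechet_derivative g (at x) v)" for x
  using dd[OF fg(1,2), of x] fg(3) has_derivative_unique by blast
 then show "(%x. D x v) \<in> {h. \<exists>f g. smooth_fun f \<and> smooth_fun g \<and> h = (%x. a * f x + b * g x)}"
  using smooth_fun_D(2)[OF fg(1), of v] smooth_fun_D(2)[OF fg(2), of v] by auto
qed

lemma smooth_fun_affine:
 fixes f :: "'a::euclidean_space => real"
 assumes "smooth_fun f"
 shows "smooth_fun (%x. f (t + c *\<^sub>R x))"
\<comment> \<open>The scalar \<open>a\<close> in the invariant absorbs the factor \<open>c\<close>
  that the chain rule produces at each differentiation.\<close>
proof (rule smooth_fun_coinductI[where X="{h. \<exists>f a. smooth_fun f \<and> h = (%x. a * f (t + c *\<^sub>R x))}"])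
 show "(%x. f (t + c *\<^sub>R x)) \<in> {h. \<exists>f a. smooth_fun f \<and> h = (%x. a * f (t + c *\<^sub>R x))}"
  using assms by (intro CollectI exI[of _ f] exI[of _ 1]) auto
 have dd: "((%x. a * f (t + c *\<^sub>R x)) has_derivative (%v. (a * c) * frechet_derivative f (at (t + c *\<^sub>R x)) v)) (at x)"
  if "smooth_fun f" for f :: "'a => real" and x a
 proof -
  have 1: "((%x. t + c *\<^sub>R x) has_derivative (%v. c *\<^sub>R v)) (at x)" by (auto intro!: derivative_eq_intros)
  have 2: "((%x. f (t + c *\<^sub>R x)) has_derivative (%v. frechet_derivative f (at (t + c *\<^sub>R x)) (c *\<^sub>R v))) (at x)"
   using has_derivative_compose[OF 1 smooth_fun_deriv[OF that]] .
  have "linear (frechet_derivative f (at (t + c *\<^sub>R x)))"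
   using smooth_fun_deriv[OF that] by (auto dest: has_derivative_linear)
  then have "frechet_derivative f (at (t + c *\<^sub>R x)) (c *\<^sub>R v) = c * frechet_derivative f (at (t + c *\<^sub>R x)) v" for v
   by (simp add: linear_scale)
  then show ?thesis using has_derivative_mult_right[OF 2, of a] by (simp add: mult.assoc)
 qed
 fix h :: "'a => real" assume "h \<in> {h. \<exists>f a. smooth_fun f \<and> h = (%x. a * f (t + c *\<^sub>R x))}"
 then obtain f a where fg: "smooth_fun f" "h = (%x. a * f (t + c *\<^sub>R x))" by auto
 show "\<exists>D. (h has_derivative D x) (at x)" for x using dd[OF fg(1), of a x] fg(2) by auto
 fix D v assume "!!x. (h has_derivative D x) (at x)"
 then have "D x = (%v. (a * c) * frechet_derivative f (at (t + c *\<^sub>R x)) v)" for x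
  using dd[OF fg(1), of a x] fg(2) has_derivative_unique by blast
 then show "(%x. D x v) \<in> {h. \<exists>f a. smooth_fun f \<and> h = (%x. a * f (t + c *\<^sub>R x))}"
  using smooth_fun_D(2)[OF fg(1), of v] by (intro CollectI exI[of _ "%x. frechet_derivative f (at x) v"] exI[of _ "a*c"]) auto
qed

lemma test_fun_iff: "test_fun f \<longleftrightarrow> smooth_fun f \<and> bounded {x. f x \<noteq> 0}"
 by (simp add: test_fun_def compact_closure)

lemma test_fun_lincomb:
 assumes "test_fun f" "test_fun g" shows "test_fun (%x. a * f x + b * g x)"
proof -
 have "{x. a * f x + b * g x \<noteq> 0} \<subseteq> {x. f x \<noteq> 0} \<union> {x. g x \<noteq> 0}" by auto
 moreover have "bounded ({x. f x \<noteq> 0} \<union> {x. g x \<noteq> 0})" using assms by (simp add: test_fun_iff)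
 ultimately have "bounded {x. a * f x + b * g x \<noteq> 0}" using bounded_subset by blast
 then show ?thesis using assms smooth_fun_lincomb[of f g a b] by (simp add: test_fun_iff)
qed

lemma test_fun_diff: "test_fun f ==> test_fun g ==> test_fun (%x. f x - g x)"
 using test_fun_lincomb[of f g 1 "-1"] by simp

lemma test_fun_affine:
 fixes f :: "'a::euclidean_space => real"
 assumes "test_fun f" "c \<noteq> 0" shows "test_fun (%x. f (t + c *\<^sub>R x))"
proof -
 have "{x. f (t + c *\<^sub>R x) \<noteq> 0} \<subseteq> (%y. (1/c) *\<^sub>R (y - t)) ` {x. f x \<noteq> 0}"
 proof
  fix x assume "x \<in> {x. f (t + c *\<^sub>R x) \<noteq> 0}"
  then show "x \<in> (%y. (1/c) *\<^sub>R (y - t)) ` {x. f x \<noteq> 0}"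
   using assms(2) by (intro image_eqI[of _ _ "t + c *\<^sub>R x"]) auto
 qed
 moreover have "bounded ((%y. (1/c) *\<^sub>R (y - t)) ` {x. f x \<noteq> 0})"
 proof -
  obtain M where M: "!!x. f x \<noteq> 0 ==> norm x \<le> M" using assms(1) by (auto simp: test_fun_iff bounded_iff)
  show ?thesis unfolding bounded_iff
  proof (intro exI[of _ "\<bar>1/c\<bar> * (M + norm t)"] ballI)
   fix z assume "z \<in> (%y. (1/c) *\<^sub>R (y - t)) ` {x. f x \<noteq> 0}"
   then obtain y where y: "f y \<noteq> 0" "z = (1/c) *\<^sub>R (y - t)" by auto
   have "norm (y - t) \<le> M + norm t" using M[OF y(1)] norm_triangle_ineq4[of y t] by linarith
   then show "norm z \<le> \<bar>1/c\<bar> * (M + norm t)" unfolding y(2) norm_scaleR by (intro mult_left_mono) auto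
  qed
 qed
 ultimately show ?thesis using assms smooth_fun_affine bounded_subset unfolding test_fun_iff by blast
qed

lemma test_fun_deriv:
 assumes "test_fun f" shows "test_fun (%x. frechet_derivative f (at x) v)"
proof -
 have "{x. frechet_derivative f (at x) v \<noteq> 0} \<subseteq> closure {x. f x \<noteq> 0}"
 proof (rule ccontr)
  assume "\<not> ?thesis"
  then obtain x where x: "frechet_derivative f (at x) v \<noteq> 0" "x \<in> - closure {x. f x \<noteq> 0}" by auto
  have "(f has_derivative (%_. 0)) (at x)"
  proof (rule has_derivative_transform_within_open[where s="- closure {x. f x \<noteq> 0}" and f="%_. 0"])
   show "!!y. y \<in> - closure {x. f x \<noteq> 0} ==> 0 = f y" using closure_subset[of "{x. f x \<noteq> 0}"] by auto
  qed (use x in auto)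
  then have "frechet_derivative f (at x) = (%_. 0)" by (rule frechet_derivative_at[symmetric])
  then show False using x by simp
 qed
 moreover have "bounded (closure {x. f x \<noteq> 0})" using assms unfolding test_fun_iff by auto
 ultimately show ?thesis using assms smooth_fun_D(2) bounded_subset unfolding test_fun_iff by blast
qed

text \<open>The working class between test functions and \<open>L^p\<close>: it lies in every
  \<open>L^r\<close> with \<open>r \<ge> 1\<close>, has bounded transforms, and, unlike the class of
  test functions, contains truncations of arbitrary measurable functions.\<close>

definition Bd :: "('a::euclidean_space => real) => bool" where
 "Bd f \<longleftrightarrow> f \<in> bmeas \<and> (\<exists>M. \<forall>x. \<bar>f x\<bar> \<le> M) \<and> integrable lborel f"

lemma BdI_support:
 assumes [measurable]: "f \<in> bmeas" and "!!x. \<bar>f x\<bar> \<le> M" and "!!x. f x \<noteq> 0 ==> norm x \<le> R"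
 shows "Bd f"
proof -
 have "integrable lborel (%x::'a. M * indicator (cball 0 R) x)"
  by (intro integrable_mult_right integrable_real_indicator) (auto simp: emeasure_lborel_cball_finite[unfolded infinity_ennreal_def])
 then have "integrable lborel f"
 proof (rule Bochner_Integration.integrable_bound)
  have "\<bar>f x\<bar> \<le> M * indicator (cball 0 R) x" for x
   using assms(2)[of x] assms(3)[of x] by (cases "f x = 0") (auto simp: indicator_def)
  then show "AE x in lborel. norm (f x) \<le> norm (M * indicator (cball 0 R) x)"
   by (intro AE_I2) (auto intro: order_trans[OF _ abs_ge_self])
 qed simp
 then show ?thesis using assms unfolding Bd_def by auto
qed

lemma Bd_continuous_support:
 fixes f :: "'a::euclidean_space => real"
 assumes c: "continuous_on UNIV f" and b: "bounded {x. f x \<noteq> 0}"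
 shows "Bd f"
proof -
 obtain R where R: "!!x. f x \<noteq> 0 ==> norm x \<le> R" using b by (auto simp: bounded_iff)
 have "compact (f ` cball 0 R)" using c by (intro compact_continuous_image continuous_on_subset[OF c]) auto
 then obtain M where "\<forall>y\<in>f ` cball 0 R. norm y \<le> M" using compact_imp_bounded bounded_iff by metis
 then have M: "norm x \<le> R ==> \<bar>f x\<bar> \<le> M" for x by auto
 have "\<bar>f x\<bar> \<le> max M 0" for x using M[of x] R[of x] by (cases "f x = 0") auto
 then show ?thesis
  by (rule BdI_support[OF borel_measurable_continuous_onI[OF c] _ R])
qed

lemma test_fun_Bd: "test_fun f ==> Bd f"
 unfolding test_fun_iff by (intro Bd_continuous_support smooth_fun_continuous) auto

lemma Bd_Lp: assumes "Bd f" "r \<ge> 1" shows "Lp r f"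
proof -
 obtain M where M: "!!x. \<bar>f x\<bar> \<le> M" using assms unfolding Bd_def by auto
 have [measurable]: "f \<in> bmeas" using assms unfolding Bd_def by auto
 have "integrable lborel (%x. M powr (r - 1) * f x)" using assms unfolding Bd_def by auto
 then have "integrable lborel (%x. \<bar>f x\<bar> powr r)"
 proof (rule Bochner_Integration.integrable_bound)
  have "\<bar>f x\<bar> powr r \<le> M powr (r - 1) * \<bar>f x\<bar>" for x
  proof (cases "f x = 0")
   case False
   then have "\<bar>f x\<bar> powr r = \<bar>f x\<bar> powr (r - 1) * \<bar>f x\<bar>" by (simp add: powr_diff)
   also have "... \<le> M powr (r - 1) * \<bar>f x\<bar>" using M[of x] assms by (intro mult_right_mono powr_mono2) auto
   finally show ?thesis .
  qed auto
  then show "AE x in lborel. norm (\<bar>f x\<bar> powr r) \<le> norm (M powr (r - 1) * f x)"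
   by (intro AE_I2) (auto simp: abs_mult)
 qed simp
 then show ?thesis by (simp add: Lp_def)
qed

lemma Bd_meas: "Bd f ==> f \<in> bmeas" and Bd_int: "Bd f ==> integrable lborel f"
 by (auto simp: Bd_def)

section \<open>Cosine, sine and Hartley transforms\<close>

definition cosT :: "('a::euclidean_space => real) => 'a => real" where
 "cosT f xi = (LBINT x. f x * cos (x \<bullet> xi))"
definition sinT :: "('a::euclidean_space => real) => 'a => real" where
 "sinT f xi = (LBINT x. f x * sin (x \<bullet> xi))"
text \<open>The Hartley transform. It is real, and against an even weight the product of two Hartley
  transforms has the same integral as the real part of one Fourier transform times the conjugate of
  the other. The \<open>L^2\<close> theory thus stays real.\<close>

definition hart :: "('a::euclidean_space => real) => 'a => real" where
 "hart f xi = cosT f xi + sinT f xi"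

lemma trig_integrable:
 fixes f :: "'a::euclidean_space => real"
 assumes "integrable lborel f"
 shows "integrable lborel (%x. f x * cos (x \<bullet> xi))" "integrable lborel (%x. f x * sin (x \<bullet> xi))"
proof -
 have [measurable]: "f \<in> bmeas" using assms by auto
 show "integrable lborel (%x. f x * cos (x \<bullet> xi))" "integrable lborel (%x. f x * sin (x \<bullet> xi))"
  by (rule Bochner_Integration.integrable_bound[OF assms]; auto simp: abs_mult mult_left_le)+
qed

lemma trig_meas[measurable]:
 fixes f :: "'a::euclidean_space => real"
 assumes [measurable]: "f \<in> bmeas"
 shows "cosT f \<in> bmeas" "sinT f \<in> bmeas" "hart f \<in> bmeas"
proof -
 show [measurable]: "cosT f \<in> bmeas" unfolding cosT_def by measurable
 show [measurable]: "sinT f \<in> bmeas" unfolding sinT_def by measurable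
 show "hart f \<in> bmeas" unfolding hart_def by measurable
qed

lemma trig_bound:
 fixes f :: "'a::euclidean_space => real"
 assumes "integrable lborel f"
 shows "\<bar>cosT f xi\<bar> \<le> (LBINT x. \<bar>f x\<bar>)" "\<bar>sinT f xi\<bar> \<le> (LBINT x. \<bar>f x\<bar>)" "\<bar>hart f xi\<bar> \<le> 2 * (LBINT x. \<bar>f x\<bar>)"
proof -
 show 1: "\<bar>cosT f xi\<bar> \<le> (LBINT x. \<bar>f x\<bar>)" unfolding cosT_def
  by (rule order_trans[OF integral_abs_bound integral_mono[OF integrable_abs[OF trig_integrable(1)[OF assms]] integrable_abs[OF assms]]])
   (simp add: abs_mult mult_left_le)
 show 2: "\<bar>sinT f xi\<bar> \<le> (LBINT x. \<bar>f x\<bar>)" unfolding sinT_def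
  by (rule order_trans[OF integral_abs_bound integral_mono[OF integrable_abs[OF trig_integrable(2)[OF assms]] integrable_abs[OF assms]]])
   (simp add: abs_mult mult_left_le)
 show "\<bar>hart f xi\<bar> \<le> 2 * (LBINT x. \<bar>f x\<bar>)" unfolding hart_def using 1 2 by linarith
qed

lemma trig_even: "cosT f (- xi) = cosT f xi" "sinT f (- xi) = - sinT f xi"
 by (simp_all add: cosT_def sinT_def)

lemma trig_lin:
 assumes "integrable lborel f" "integrable lborel g"
 shows "hart (%x. a * f x + b * g x) xi = a * hart f xi + b * hart g xi"
 using trig_integrable[OF assms(1), of xi] trig_integrable[OF assms(2), of xi]
 by (simp add: hart_def cosT_def sinT_def ring_distribs mult.assoc)

text \<open>By translation invariance every difference quotient of \<open>g\<close> has integral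
  zero; the mean value theorem and compact support dominate the quotients, so the derivative
  inherits this. Applied to \<open>f\<close> times a cosine or sine it is integration by
  parts.\<close>

lemma integral_deriv_zero:
 fixes g :: "'a::euclidean_space => real"
 assumes d: "!!x. (g has_derivative D x) (at x)" and c: "continuous_on UNIV (%x. D x b)"
  and bd: "bounded {x. g x \<noteq> 0}"
 shows "(LBINT x. D x b) = 0"
proof -
 have gc: "continuous_on UNIV g" using d by (intro continuous_at_imp_continuous_on ballI has_derivative_continuous) auto
 have gB: "Bd g" using Bd_continuous_support[OF gc bd] .
 obtain R where R: "!!x. g x \<noteq> 0 ==> norm x \<le> R" using bd by (auto simp: bounded_iff)
 have Db: "D x b = 0" if "norm x > R" for x
 proof -
  have "(g has_derivative (%_. 0)) (at x)"
  proof (rule has_derivative_transform_within_open[where s="{x. norm x > R}" and f="%_. 0"])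
   show "open {x::'a. norm x > R}" by (intro open_Collect_less continuous_intros)
   show "!!y. y \<in> {x. norm x > R} ==> 0 = g y" using R by force
  qed (use that in auto)
  from has_derivative_unique[OF this d[of x]] show ?thesis by metis
 qed
 have "bounded {x. D x b \<noteq> 0}" unfolding bounded_iff using Db by (intro exI[of _ R]) force
 from Bd_continuous_support[OF c this] obtain M where M: "!!x. \<bar>D x b\<bar> \<le> M" unfolding Bd_def by auto
 have M0: "M \<ge> 0" using M[of 0] by linarith
 define t where "t = (%k::nat. 1 / real (Suc k))"
 have t: "t k > 0" "t k \<le> 1" for k unfolding t_def by auto
 have t0: "t ~> 0" unfolding t_def using LIMSEQ_inverse_real_of_nat by (simp add: inverse_eq_divide)
 define q where "q = (%k x. (g (x + t k *\<^sub>R b) - g x) / t k)"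
 have line: "((%u. g (x + u *\<^sub>R b)) has_real_derivative D (x + u *\<^sub>R b) b) (at u)" for x u
 proof -
  have 1: "((%u. x + u *\<^sub>R b) has_derivative (%v. v *\<^sub>R b)) (at u)" by (auto intro!: derivative_eq_intros)
  have "((%u. g (x + u *\<^sub>R b)) has_derivative (%v. D (x + u *\<^sub>R b) (v *\<^sub>R b))) (at u)"
   using has_derivative_compose[OF 1 d] .
  moreover have "D (x + u *\<^sub>R b) (v *\<^sub>R b) = D (x + u *\<^sub>R b) b * v" for v
   using has_derivative_linear[OF d[of "x + u *\<^sub>R b"]] by (simp add: linear_scale)
  ultimately show ?thesis by (simp add: has_field_derivative_def)
 qed
 have [measurable]: "g \<in> bmeas" using gB by (rule Bd_meas)
 have i1: "integrable lborel (%x. g (x + t k *\<^sub>R b))" for k using integrable_translate[OF Bd_int[OF gB]] .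
 have i0: "(LBINT x. q k x) = 0" for k
  unfolding q_def using i1[of k] Bd_int[OF gB] integral_translate[OF Bd_int[OF gB], of "t k *\<^sub>R b"] by simp
 have "(%k. (LBINT x. q k x)) ~> (LBINT x. D x b)"
 \<comment> \<open>The steps \<open>t k\<close> are at most 1, so all quotients vanish outside
   radius \<open>R + norm b\<close>.\<close>
 proof (rule integral_dominated_convergence[where w="%x. M * indicator (cball 0 (R + norm b)) x"])
  show "integrable lborel (%x::'a. M * indicator (cball 0 (R + norm b)) x)"
   by (intro integrable_mult_right integrable_real_indicator) (auto simp: emeasure_lborel_cball_finite[unfolded infinity_ennreal_def])
  show "AE x in lborel. (%k. q k x) ~> D x b"
  proof (rule AE_I2)
   fix x
   have "((%u. (g (x + u *\<^sub>R b) - g x) / u) \<longlongrightarrow> D x b) (at 0)"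
    using line[of x 0] by (simp add: has_field_derivative_iff)
   from filterlim_compose[OF this, of t sequentially] show "(%k. q k x) ~> D x b"
    unfolding q_def using t0 t(1) by (auto simp: filterlim_at less_imp_neq[symmetric])
  qed
  show "AE x in lborel. norm (q k x) \<le> M * indicator (cball 0 (R + norm b)) x" for k
  proof (rule AE_I2)
   fix x
   obtain z where z: "g (x + t k *\<^sub>R b) - g (x + 0 *\<^sub>R b) = (t k - 0) * D (x + z *\<^sub>R b) b"
    using MVT2[of 0 "t k" "%u. g (x + u *\<^sub>R b)" "%u. D (x + u *\<^sub>R b) b"] line t(1) by blast
   then have "q k x = D (x + z *\<^sub>R b) b" unfolding q_def using t(1)[of k] by (simp add: field_simps)
   then have 1: "\<bar>q k x\<bar> \<le> M" using M by simp
   have "q k x = 0" if "norm x > R + norm b"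
   proof -
    have "norm (t k *\<^sub>R b) \<le> norm b" using t[of k] by (simp add: mult_left_le_one_le)
    then have "norm (x + t k *\<^sub>R b) > R" using that norm_triangle_ineq4[of "x + t k *\<^sub>R b" "t k *\<^sub>R b"] by simp
    moreover have "norm x > R" using that norm_ge_zero[of b] by linarith
    ultimately show ?thesis unfolding q_def using R[of x] R[of "x + t k *\<^sub>R b"] by force
   qed
   then show "norm (q k x) \<le> M * indicator (cball 0 (R + norm b)) x"
    using 1 by (cases "norm x > R + norm b") (auto simp: indicator_def)
  qed
  show "(%x. D x b) \<in> borel_measurable lborel" using borel_measurable_continuous_onI[OF c] by simp
  show "!!k. q k \<in> borel_measurable lborel" unfolding q_def by measurable
 qed
 then show ?thesis using i0 by (simp add: LIMSEQ_const_iff)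
qed

lemma trig_deriv:
 assumes "test_fun f"
 shows "cosT (%x. frechet_derivative f (at x) b) xi = (b \<bullet> xi) * sinT f xi"
  and "sinT (%x. frechet_derivative f (at x) b) xi = - (b \<bullet> xi) * cosT f xi"
proof -
 let ?D = "%x. frechet_derivative f (at x)"
 have sf: "smooth_fun f" using assms by (simp add: test_fun_iff)
 note hd = smooth_fun_deriv[OF sf]
 have cf: "continuous_on UNIV f" using smooth_fun_continuous[OF sf] .
 have cd: "continuous_on UNIV (%x. ?D x b)" using smooth_fun_continuous[OF smooth_fun_D(2)[OF sf]] .
 have ti: "integrable lborel f" "integrable lborel (%x. ?D x b)"
  using test_fun_Bd[OF assms] test_fun_Bd[OF test_fun_deriv[OF assms]] by (auto simp: Bd_def)
 have bd1: "bounded {x. f x * cos (x \<bullet> xi) \<noteq> 0}" "bounded {x. f x * sin (x \<bullet> xi) \<noteq> 0}"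
  using assms by (auto simp: test_fun_iff intro: bounded_subset)
 have "(LBINT x. ?D x b * cos (x \<bullet> xi) - f x * sin (x \<bullet> xi) * (b \<bullet> xi)) = 0"
 proof (rule integral_deriv_zero[OF _ _ bd1(1), where D="%x v. ?D x v * cos (x \<bullet> xi) - f x * sin (x \<bullet> xi) * (v \<bullet> xi)"])
  show "((%x. f x * cos (x \<bullet> xi)) has_derivative (%v. ?D x v * cos (x \<bullet> xi) - f x * sin (x \<bullet> xi) * (v \<bullet> xi))) (at x)" for x
   using hd[of x] by (auto intro!: derivative_eq_intros simp: algebra_simps)
 qed (intro continuous_intros cd cf)
 then show "cosT (%x. ?D x b) xi = (b \<bullet> xi) * sinT f xi"
  using trig_integrable[OF ti(1), of xi] trig_integrable[OF ti(2), of xi] by (simp add: cosT_def sinT_def mult.commute)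
 have "(LBINT x. ?D x b * sin (x \<bullet> xi) + f x * cos (x \<bullet> xi) * (b \<bullet> xi)) = 0"
 proof (rule integral_deriv_zero[OF _ _ bd1(2), where D="%x v. ?D x v * sin (x \<bullet> xi) + f x * cos (x \<bullet> xi) * (v \<bullet> xi)"])
  show "((%x. f x * sin (x \<bullet> xi)) has_derivative (%v. ?D x v * sin (x \<bullet> xi) + f x * cos (x \<bullet> xi) * (v \<bullet> xi))) (at x)" for x
   using hd[of x] by (auto intro!: derivative_eq_intros simp: algebra_simps)
 qed (intro continuous_intros cd cf)
 then show "sinT (%x. ?D x b) xi = - (b \<bullet> xi) * cosT f xi"
  using trig_integrable[OF ti(1), of xi] trig_integrable[OF ti(2), of xi] by (simp add: cosT_def sinT_def mult.commute)
qed

lemma trig_decay_dir: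
 assumes "test_fun f"
 shows "\<exists>M. \<forall>xi. \<bar>b \<bullet> xi\<bar> ^ k * \<bar>cosT f xi\<bar> \<le> M \<and> \<bar>b \<bullet> xi\<bar> ^ k * \<bar>sinT f xi\<bar> \<le> M"
 using assms
proof (induction k arbitrary: f)
 case 0
 then show ?case using trig_bound(1,2)[of f] test_fun_Bd[of f] by (auto simp: Bd_def)
next
 case (Suc k)
 from Suc.IH[OF test_fun_deriv[OF Suc.prems, of b]] obtain M where
  M: "!!xi. \<bar>b \<bullet> xi\<bar> ^ k * \<bar>cosT (%x. frechet_derivative f (at x) b) xi\<bar> \<le> M"
   "!!xi. \<bar>b \<bullet> xi\<bar> ^ k * \<bar>sinT (%x. frechet_derivative f (at x) b) xi\<bar> \<le> M" by blast
 show ?case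
  using M by (intro exI[of _ M]) (simp add: trig_deriv[OF Suc.prems] abs_mult mult.assoc mult.left_commute)
qed

text \<open>A derivative in direction b costs a factor \<open>b \<bullet> xi\<close>, so every power
  of that factor times the transform is bounded. Powers of \<open>norm xi\<close> are dominated by
  those of the coordinates.\<close>

lemma hart_decay:
 fixes f :: "'a::euclidean_space => real"
 assumes "test_fun f"
 obtains M where "M \<ge> 0" "!!xi. norm xi ^ k * \<bar>hart f xi\<bar> \<le> M"
proof -
 have "\<forall>b. \<exists>M. \<forall>xi. \<bar>b \<bullet> xi\<bar> ^ k * \<bar>cosT f xi\<bar> \<le> M \<and> \<bar>b \<bullet> xi\<bar> ^ k * \<bar>sinT f xi\<bar> \<le> M"
  using trig_decay_dir[OF assms] by blast
 then obtain M where M: "!!b xi. \<bar>b \<bullet> xi\<bar> ^ k * \<bar>cosT f xi\<bar> \<le> M b" "!!b xi. \<bar>b \<bullet> xi\<bar> ^ k * \<bar>sinT f xi\<bar> \<le> M b"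
  by metis
 have M0: "M b \<ge> 0" for b
 proof -
  have "0 \<le> \<bar>b \<bullet> 0\<bar> ^ k * \<bar>cosT f 0\<bar>" by simp
  then show ?thesis using M(1)[of b 0] by linarith
 qed
 let ?n = "real DIM('a)"
 have pw: "norm xi ^ k \<le> ?n ^ k * (\<Sum>b\<in>Basis. \<bar>b \<bullet> xi\<bar> ^ k)" for xi :: 'a
 proof -
  define m where "m = Max ((%b. \<bar>b \<bullet> xi\<bar>) ` Basis)"
  have "m \<in> (%b. \<bar>b \<bullet> xi\<bar>) ` Basis" unfolding m_def by (intro Max_in) auto
  then obtain b where b: "b \<in> Basis" "m = \<bar>b \<bullet> xi\<bar>" by auto
  have le: "\<bar>b \<bullet> xi\<bar> \<le> m" if "b \<in> Basis" for b using that unfolding m_def by auto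
  have "norm xi \<le> (\<Sum>b\<in>Basis. \<bar>xi \<bullet> b\<bar>)" by (rule norm_le_l1)
  also have "... \<le> (\<Sum>b\<in>(Basis::'a set). m)" by (intro sum_mono) (use le in \<open>auto simp: inner_commute\<close>)
  finally have "norm xi \<le> ?n * m" by simp
  then have "norm xi ^ k \<le> (?n * m) ^ k" by (intro power_mono) auto
  also have "... = ?n ^ k * \<bar>b \<bullet> xi\<bar> ^ k" using b by (simp add: power_mult_distrib)
  also have "\<bar>b \<bullet> xi\<bar> ^ k \<le> (\<Sum>b\<in>Basis. \<bar>b \<bullet> xi\<bar> ^ k)"
   using member_le_sum[of b Basis "%b. \<bar>b \<bullet> xi\<bar> ^ k"] b by auto
  finally show ?thesis by (simp add: mult_left_mono)
 qed
 show ?thesis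
 proof (rule that[of "?n ^ k * (\<Sum>b\<in>Basis. 2 * M b)"])
  show "0 \<le> ?n ^ k * (\<Sum>b\<in>Basis. 2 * M b)" using M0 by (intro mult_nonneg_nonneg sum_nonneg) auto
  fix xi :: 'a
  have "norm xi ^ k * \<bar>hart f xi\<bar> \<le> (?n ^ k * (\<Sum>b\<in>Basis. \<bar>b \<bullet> xi\<bar> ^ k)) * \<bar>hart f xi\<bar>"
   using pw by (intro mult_right_mono) auto
  also have "... = ?n ^ k * (\<Sum>b\<in>Basis. \<bar>b \<bullet> xi\<bar> ^ k * \<bar>hart f xi\<bar>)" by (simp add: sum_distrib_right mult.assoc)
  also have "... \<le> ?n ^ k * (\<Sum>b\<in>Basis. 2 * M b)"
  proof (intro mult_left_mono sum_mono)
   fix b :: 'a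
   have "\<bar>b \<bullet> xi\<bar> ^ k * \<bar>hart f xi\<bar> \<le> \<bar>b \<bullet> xi\<bar> ^ k * (\<bar>cosT f xi\<bar> + \<bar>sinT f xi\<bar>)"
    unfolding hart_def by (intro mult_left_mono) auto
   then show "\<bar>b \<bullet> xi\<bar> ^ k * \<bar>hart f xi\<bar> \<le> 2 * M b" using M(1)[of b xi] M(2)[of b xi] by (simp add: ring_distribs)
  qed auto
  finally show "norm xi ^ k * \<bar>hart f xi\<bar> \<le> ?n ^ k * (\<Sum>b\<in>Basis. 2 * M b)" .
 qed
qed

lemma hart_weight_integrable:
 fixes f :: "'a::euclidean_space => real"
 assumes f: "test_fun f" and a: "a > - real DIM('a)"
 shows "integrable lborel (%xi. norm xi powr a * hart f xi)"
proof -
 let ?n = "real DIM('a)"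
 have [measurable]: "f \<in> bmeas" using test_fun_Bd[OF f] by (auto simp: Bd_def)
 \<comment> \<open>The decay order has to exceed the exponent of the weight by more than n for
   integrability at infinity; near 0 the condition \<open>a > - n\<close> takes over.\<close>
 define k where "k = nat \<lceil>\<bar>a\<bar> + ?n\<rceil> + 1"
 have k: "real k - a > ?n" unfolding k_def by linarith
 obtain M0 where M0: "M0 \<ge> 0" "!!xi. norm xi ^ 0 * \<bar>hart f xi\<bar> \<le> M0" using hart_decay[OF f, where k=0] by blast
 obtain M1 where M1: "M1 \<ge> 0" "!!xi. norm xi ^ k * \<bar>hart f xi\<bar> \<le> M1" using hart_decay[OF f, where k=k] by blast
 \<comment> \<open>Inside the unit ball a positive power is simply bounded by 1, hence the exponent
   \<open>max 0 (-a)\<close>.\<close>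
 obtain C0 where C0: "C0 \<ge> 0" "!!r. r > 0 ==> (NN x. indicator (ball 0 r) (x::'a) * ennreal (norm x powr (-(max 0 (-a))))) \<le> ennreal (C0 * r powr (?n - max 0 (-a)))"
 proof -
  have "0 \<le> max 0 (-a)" "max 0 (-a) < ?n" using a by auto
  from radial_near[OF this] show ?thesis using that by blast
 qed
 obtain C1 where C1: "C1 \<ge> 0" "!!r. r > 0 ==> (NN x. indicator {x. norm x \<ge> r} (x::'a) * ennreal (norm x powr (-(real k - a)))) \<le> ennreal (C1 * r powr (?n - (real k - a)))"
  using radial_far[where 'a='a, of "real k - a"] k by blast
 define A where "A = (%x::'a. indicator (ball 0 1) x * ennreal (norm x powr (-(max 0 (-a)))))"
 define E where "E = (%x::'a. indicator {x. norm x \<ge> 1} x * ennreal (norm x powr (-(real k - a))))"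
 have [measurable]: "A \<in> borel_measurable lborel" unfolding A_def measurable_lborel2
  by (intro borel_measurable_times_ennreal borel_measurable_indicator) auto
 have "{x::'a. norm x \<ge> 1} \<in> sets borel" by measurable
 then have [measurable]: "E \<in> borel_measurable lborel" unfolding E_def measurable_lborel2
  by (intro borel_measurable_times_ennreal borel_measurable_indicator) auto
 have "(NN xi. ennreal (norm (norm xi powr a * hart f xi))) \<le> (NN xi. ennreal M0 * A xi + ennreal M1 * E xi)"
 proof (rule nn_integral_mono)
  fix xi :: 'a
  show "ennreal (norm (norm xi powr a * hart f xi)) \<le> ennreal M0 * A xi + ennreal M1 * E xi"
  proof (cases "norm xi < 1")
   case True
   have "norm xi powr a \<le> norm xi powr (-(max 0 (-a)))"
   proof (cases "xi = 0")
    case False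
    then show ?thesis using True by (intro powr_mono') auto
   qed auto
   then have "norm (norm xi powr a * hart f xi) \<le> norm xi powr (-(max 0 (-a))) * M0"
    using M0(2)[of xi] by (simp add: abs_mult mult_mono)
   then show ?thesis using True M0 by (auto simp: A_def E_def ennreal_mult[symmetric] mult.commute intro!: ennreal_leI)
  next
   case False
   then have nz: "norm xi > 0" by linarith
   have "\<bar>hart f xi\<bar> \<le> M1 * norm xi powr (- real k)"
    using M1(2)[of xi] nz by (simp add: powr_minus powr_realpow field_simps)
   then have "norm (norm xi powr a * hart f xi) \<le> norm xi powr a * (M1 * norm xi powr (- real k))"
    by (simp add: abs_mult mult_left_mono)
   also have "... = M1 * norm xi powr (-(real k - a))" by (simp add: powr_diff powr_minus field_simps powr_add)
   finally show ?thesis using False M1 by (auto simp: A_def E_def ennreal_mult[symmetric] intro!: ennreal_leI)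
  qed
 qed
 also have "... = ennreal M0 * (NN xi. A xi) + ennreal M1 * (NN xi. E xi)"
  by (simp add: nn_integral_add nn_integral_cmult)
 also have "... \<le> ennreal M0 * ennreal C0 + ennreal M1 * ennreal C1"
  using C0(2)[of 1] C1(2)[of 1] unfolding A_def E_def by (intro add_mono mult_left_mono) auto
 also have "... < \<infinity>" by (simp add: ennreal_mult_less_top)
 finally show ?thesis by (intro integrableI_bounded) auto
qed

lemma hart_weight2_integrable:
 fixes f g :: "'a::euclidean_space => real"
 assumes f: "test_fun f" and g: "integrable lborel g" and a: "a > - real DIM('a)"
 shows "integrable lborel (%xi. norm xi powr a * (hart f xi * hart g xi))"
proof -
 define M where "M = 2 * (LBINT x. \<bar>g x\<bar>)"
 have [measurable]: "f \<in> bmeas" "g \<in> bmeas" using test_fun_Bd[OF f] g by (auto simp: Bd_def)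
 show ?thesis
 proof (rule Bochner_Integration.integrable_bound[OF integrable_mult_right[OF hart_weight_integrable[OF f a], of M]])
  have "\<bar>hart g xi\<bar> \<le> M" for xi using trig_bound(3)[OF g] unfolding M_def .
  then have "\<bar>norm xi powr a * hart f xi\<bar> * \<bar>hart g xi\<bar> \<le> \<bar>norm xi powr a * hart f xi\<bar> * \<bar>M\<bar>" for xi
   by (intro mult_left_mono) (auto intro: order_trans[OF _ abs_ge_self])
  then show "AE xi in lborel. norm (norm xi powr a * (hart f xi * hart g xi)) \<le> norm (M * (norm xi powr a * hart f xi))"
   by (intro AE_I2) (simp add: abs_mult mult.commute mult.left_commute)
 qed measurable
qed

lemma integrable_product:
 fixes f :: "'a::euclidean_space => real" and g :: "'b::euclidean_space => real"
 assumes f: "integrable lborel f" and g: "integrable lborel g"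
 shows "integrable lborel2 (%z. f (fst z) * g (snd z))"
proof -
 have [measurable]: "f \<in> bmeas" "g \<in> bmeas" using f g by auto
 show ?thesis
 proof (rule lborel_pair.Fubini_integrable)
  show "integrable lborel (%x. (LBINT y. norm (f (fst (x, y)) * g (snd (x, y)))))"
   using f g by (simp add: abs_mult)
  show "AE x in lborel. integrable lborel (%y. f (fst (x, y)) * g (snd (x, y)))"
   using g by simp
 qed measurable
qed

lemma fourier_trig:
 fixes f :: "'a::euclidean_space => real"
 assumes "integrable lborel f"
 shows "fourier f xi = Complex (cosT f xi) (- sinT f xi)"
proof -
 have [measurable]: "f \<in> bmeas" using assms by auto
 have i: "integrable lborel (%x. complex_of_real (f x) * cis (- (x \<bullet> xi)))"
  by (rule Bochner_Integration.integrable_bound[OF assms]) (auto simp: norm_mult cis_conv_exp intro!: borel_measurable_times borel_measurable_continuous_onI continuous_intros)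
 show ?thesis
  unfolding fourier_def
  using integral_Re[OF i] integral_Im[OF i]
  by (intro complex_eqI) (simp_all add: cosT_def sinT_def)
qed

lemma trig_weight_integrable:
 fixes f :: "'a::euclidean_space => real"
 assumes f: "test_fun f" and a: "a > - real DIM('a)"
 shows "integrable lborel (%xi. norm xi powr a * cosT f xi)" "integrable lborel (%xi. norm xi powr a * sinT f xi)"
proof -
 note i = hart_weight_integrable[OF f a]
 have j: "integrable lborel (%xi. norm xi powr a * hart f (- xi))" using integral_reflect(2)[OF i, of 0] by simp
 have c: "(norm xi powr a * hart f xi + norm xi powr a * hart f (- xi)) / 2 = norm xi powr a * cosT f xi"
  "(norm xi powr a * hart f xi - norm xi powr a * hart f (- xi)) / 2 = norm xi powr a * sinT f xi" for xi
  by (simp_all add: hart_def trig_even algebra_simps)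
 show "integrable lborel (%xi. norm xi powr a * cosT f xi)" "integrable lborel (%xi. norm xi powr a * sinT f xi)"
  using Bochner_Integration.integrable_add[OF i j] Bochner_Integration.integrable_diff[OF i j]
  unfolding c[symmetric] by auto
qed

lemma frac_lap_trig:
 fixes g :: "'a::euclidean_space => real"
 assumes g: "test_fun g" and s: "s > 0"
 shows "frac_lap s g x = 1 / (2*pi) ^ DIM('a) * (LBINT xi. norm xi powr (2 * s) * (cosT g xi * cos (x \<bullet> xi) + sinT g xi * sin (x \<bullet> xi)))"
proof -
 have gi: "integrable lborel g" using test_fun_Bd[OF g] by (auto simp: Bd_def)
 have [measurable]: "g \<in> bmeas" using gi by auto
 have a: "2 * s > - real DIM('a)" using s by (smt (verit) of_nat_0_le_iff)
 note w = trig_weight_integrable[OF g a]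
 let ?h = "%xi. cis (x \<bullet> xi) * complex_of_real (norm xi powr (2 * s)) * fourier g xi"
 have mc: "(%xi. cis (x \<bullet> xi)) \<in> bmeas"
  unfolding cis_conv_exp by (intro borel_measurable_continuous_onI continuous_intros)
 have mf: "fourier g \<in> bmeas"
 proof -
  have "fourier g = (%xi. complex_of_real (cosT g xi) - \<i> * complex_of_real (sinT g xi))"
   using fourier_trig[OF gi] by (auto simp: complex_eq_iff)
  then show ?thesis by simp
 qed
 have i: "integrable lborel ?h"
 proof (rule Bochner_Integration.integrable_bound[OF Bochner_Integration.integrable_add[OF integrable_abs[OF w(1)] integrable_abs[OF w(2)]]])
  show "AE xi in lborel. norm (?h xi) \<le> norm (\<bar>norm xi powr (2 * s) * cosT g xi\<bar> + \<bar>norm xi powr (2 * s) * sinT g xi\<bar>)"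
  proof (rule AE_I2)
   fix xi :: 'a
   have "norm (fourier g xi) \<le> \<bar>cosT g xi\<bar> + \<bar>sinT g xi\<bar>"
    using cmod_le[of "fourier g xi"] by (simp add: fourier_trig[OF gi])
   then have "norm xi powr (2 * s) * norm (fourier g xi) \<le> norm xi powr (2 * s) * (\<bar>cosT g xi\<bar> + \<bar>sinT g xi\<bar>)"
    by (intro mult_left_mono) auto
   then show "norm (?h xi) \<le> norm (\<bar>norm xi powr (2 * s) * cosT g xi\<bar> + \<bar>norm xi powr (2 * s) * sinT g xi\<bar>)"
    by (simp add: norm_mult abs_mult ring_distribs)
  qed
  show "?h \<in> borel_measurable lborel" using mc mf by measurable
 qed
 have "Re (LBINT xi. ?h xi) = (LBINT xi. norm xi powr (2 * s) * (cosT g xi * cos (x \<bullet> xi) + sinT g xi * sin (x \<bullet> xi)))"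
  unfolding integral_Re[OF i, symmetric]
  by (intro Bochner_Integration.integral_cong) (auto simp: fourier_trig[OF gi] algebra_simps)
 moreover have "frac_lap s g x = Re (complex_of_real (1 / (2*pi) ^ DIM('a)) * (LBINT xi. ?h xi))"
  unfolding frac_lap_def by simp
 ultimately show ?thesis by (simp only: Re_complex_of_real Im_complex_of_real times_complex.simps)
qed

text \<open>Plancherel for the form without inverting a transform: insert the integral that defines
  \<open>frac_lap\<close>, exchange the two integrals and recognise the transforms of
  \<open>f\<close>.\<close>

lemma frac_form_hart:
 fixes f g :: "'a::euclidean_space => real"
 assumes f: "test_fun f" and g: "test_fun g" and s: "s > 0"
 shows "frac_form s f g = 1 / (2*pi) ^ DIM('a) * (LBINT xi. norm xi powr (2 * s) * (hart f xi * hart g xi))"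
proof -
 have a: "2 * s > - real DIM('a)" using s by (smt (verit) of_nat_0_le_iff)
 have fi: "integrable lborel f" and gi: "integrable lborel g" using test_fun_Bd[OF g] test_fun_Bd[OF f] by (auto simp: Bd_def)
 have [measurable]: "f \<in> bmeas" "g \<in> bmeas" using gi fi by auto
 note w = trig_weight_integrable[OF g a]
 define h where "h = (%x xi. f x * (norm xi powr (2 * s) * (cosT g xi * cos (x \<bullet> xi) + sinT g xi * sin (x \<bullet> xi))))"
 have hi: "integrable lborel2 (case_prod h)"
 proof (rule Bochner_Integration.integrable_bound[OF integrable_product[OF fi Bochner_Integration.integrable_add[OF integrable_abs[OF w(1)] integrable_abs[OF w(2)]]]])
  show "AE z in lborel2. norm (case_prod h z) \<le> norm (f (fst z) * (\<bar>norm (snd z) powr (2 * s) * cosT g (snd z)\<bar> + \<bar>norm (snd z) powr (2 * s) * sinT g (snd z)\<bar>))"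
  proof (rule AE_I2)
   fix z :: "'a \<times> 'a"
   obtain x xi where z: "z = (x, xi)" by (cases z) auto
   have "\<bar>cosT g xi * cos (x \<bullet> xi) + sinT g xi * sin (x \<bullet> xi)\<bar> \<le> \<bar>cosT g xi\<bar> + \<bar>sinT g xi\<bar>"
    by (rule order_trans[OF abs_triangle_ineq]) (auto simp: abs_mult intro!: add_mono mult_left_le)
   then have le: "\<bar>f x\<bar> * (norm xi powr (2 * s) * \<bar>cosT g xi * cos (x \<bullet> xi) + sinT g xi * sin (x \<bullet> xi)\<bar>) \<le> \<bar>f x\<bar> * (norm xi powr (2 * s) * (\<bar>cosT g xi\<bar> + \<bar>sinT g xi\<bar>))"
    by (intro mult_left_mono) auto
   show "norm (case_prod h z) \<le> norm (f (fst z) * (\<bar>norm (snd z) powr (2 * s) * cosT g (snd z)\<bar> + \<bar>norm (snd z) powr (2 * s) * sinT g (snd z)\<bar>))"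
   proof -
    have "norm (case_prod h z) = \<bar>f x\<bar> * (norm xi powr (2 * s) * \<bar>cosT g xi * cos (x \<bullet> xi) + sinT g xi * sin (x \<bullet> xi)\<bar>)"
     by (simp add: z h_def abs_mult)
    moreover have "norm (f (fst z) * (\<bar>norm (snd z) powr (2 * s) * cosT g (snd z)\<bar> + \<bar>norm (snd z) powr (2 * s) * sinT g (snd z)\<bar>)) = \<bar>f x\<bar> * (norm xi powr (2 * s) * (\<bar>cosT g xi\<bar> + \<bar>sinT g xi\<bar>))"
     by (simp add: z abs_mult abs_of_nonneg distrib_left[symmetric] del: distrib_left)
    ultimately show ?thesis using le by simp
   qed
  qed
  show "case_prod h \<in> borel_measurable lborel2" unfolding h_def by measurable
 qed
 have "frac_form s f g = 1 / (2*pi) ^ DIM('a) * (LBINT x. (LBINT xi. h x xi))"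
  unfolding frac_form_def frac_lap_trig[OF g s] h_def by (simp add: mult.left_commute)
 also have "(LBINT x. (LBINT xi. h x xi)) = (LBINT xi. (LBINT x. h x xi))"
  using lborel_pair.Fubini_integral[OF hi] by simp
 also have "... = (LBINT xi. norm xi powr (2 * s) * (cosT f xi * cosT g xi + sinT f xi * sinT g xi))"
 proof (intro Bochner_Integration.integral_cong refl)
  fix xi
  have "(LBINT x. h x xi) = (LBINT x. (norm xi powr (2 * s) * cosT g xi) * (f x * cos (x \<bullet> xi)) + (norm xi powr (2 * s) * sinT g xi) * (f x * sin (x \<bullet> xi)))"
   by (intro Bochner_Integration.integral_cong) (auto simp: h_def algebra_simps)
  also have "... = (norm xi powr (2 * s) * cosT g xi) * cosT f xi + (norm xi powr (2 * s) * sinT g xi) * sinT f xi"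
   using trig_integrable[OF fi, of xi] by (simp add: cosT_def sinT_def)
  finally show "(LBINT x. h x xi) = norm xi powr (2 * s) * (cosT f xi * cosT g xi + sinT f xi * sinT g xi)"
   by (simp add: algebra_simps)
 qed
 \<comment> \<open>Averaging over \<open>xi\<close> and \<open>- xi\<close> removes the mixed
   products of cosine and sine parts, because the weight is even.\<close>
 also have "... = (LBINT xi. norm xi powr (2 * s) * (hart f xi * hart g xi))"
 proof -
  note i = hart_weight2_integrable[OF f gi a]
  have j: "integrable lborel (%xi. norm xi powr (2 * s) * (hart f (- xi) * hart g (- xi)))"
   using integral_reflect(2)[OF i, of 0] by simp
  have "(LBINT xi. norm xi powr (2 * s) * (cosT f xi * cosT g xi + sinT f xi * sinT g xi))
   = (LBINT xi. (norm xi powr (2 * s) * (hart f xi * hart g xi) + norm xi powr (2 * s) * (hart f (- xi) * hart g (- xi))) / 2)"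
   by (intro Bochner_Integration.integral_cong) (auto simp: hart_def trig_even algebra_simps)
  also have "... = ((LBINT xi. norm xi powr (2 * s) * (hart f xi * hart g xi)) + (LBINT xi. norm xi powr (2 * s) * (hart f (- xi) * hart g (- xi)))) / 2"
   using i j by simp
  also have "(LBINT xi. norm xi powr (2 * s) * (hart f (- xi) * hart g (- xi))) = (LBINT xi. norm xi powr (2 * s) * (hart f xi * hart g xi))"
   using integral_reflect(1)[OF i, of 0] by simp
  finally show ?thesis by simp
 qed
 finally show ?thesis .
qed

section \<open>The Riesz form\<close>

lemma measurable_indicator_ball:
 "(%z. indicator (ball (fst z) e) (snd z) :: ennreal) \<in> borel_measurable (borel \<Otimes>\<^sub>M (borel :: 'a::euclidean_space measure))"
proof -
 have "Measurable.pred (borel \<Otimes>\<^sub>M borel) (%x. dist (fst x::'a) (snd x) < e)" by measurable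
 then have "{z. dist (fst z :: 'a) (snd z) < e} \<in> sets (borel \<Otimes>\<^sub>M borel)"
  by (simp add: pred_def space_pair_measure)
 then have "(indicator {z. dist (fst z :: 'a) (snd z) < e} :: _ => ennreal) \<in> borel_measurable (borel \<Otimes>\<^sub>M borel)"
  by (rule borel_measurable_indicator)
 moreover have "(%z. indicator (ball (fst z) e) (snd z) :: ennreal) = indicator {z. dist (fst z :: 'a) (snd z) < e}"
  by (auto simp: indicator_def)
 ultimately show ?thesis by simp
qed

locale crit =
 fixes s nn :: real and TY :: "'a::euclidean_space itself"
 assumes s0: "s > 0" and sn: "2 * s < nn" and DIM_nn[simp]: "real DIM('a) = nn"
begin

abbreviation lam :: real where "lam \<equiv> nn - 2 * s"
definition p :: real where "p = 2 * nn / (nn + 2 * s)"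
definition q :: real where "q = 2 * nn / (nn - 2 * s)"

lemma nn_pos: "nn > 0" using s0 sn by linarith
lemma two_powr_nn: "2 powr nn = 2 ^ DIM('a)"
 by (metis DIM_nn powr_realpow zero_less_numeral)
lemma lam_pos: "lam > 0" using sn by linarith
lemma p1: "p > 1" unfolding p_def using s0 sn by (simp add: field_simps)
lemma p2: "p < 2" unfolding p_def using s0 sn by (simp add: field_simps)
lemma q2: "q > 2" unfolding q_def using s0 sn by (simp add: field_simps)
lemma pq: "1/p + 1/q = 1" unfolding p_def q_def using s0 sn by (simp add: field_simps)
lemma q1: "q > 1" using q2 by simp
lemma p0: "p \<ge> 0" using p1 by simp
lemma qp: "1/q + 1/p = 1" using pq by simp
lemma two_div_p: "2 / p = 1 + 2 * s / nn" unfolding p_def using s0 sn by (simp add: field_simps)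
lemma pm1_q: "(q - 1) * p = q" using pq p1 q1 by (simp add: field_simps)

text \<open>The Riesz kernel without its constant, which enters later as \<open>c0\<close>.\<close>

definition K :: "'a => real" where "K z = norm z powr (- lam)"

lemma K_nonneg[simp]: "K z \<ge> 0" unfolding K_def by simp
lemma K_meas[measurable]: "K \<in> bmeas" unfolding K_def by measurable
lemma K_minus: "K (x - y) = K (y - x)" unfolding K_def by (simp add: norm_minus_commute)

lemma K_meas2[measurable]: "(%z. K (fst z - snd z)) \<in> borel_measurable (borel \<Otimes>\<^sub>M borel)"
 by measurable

text \<open>Hardy-Littlewood-Sobolev inequality on the diagonal. By symmetry only pairs with
  \<open>f x \<le> f y\<close> matter. For fixed y a layer-cake decomposition in levels below
  \<open>f y\<close> reduces the inner integral to integrals of the kernel over superlevel sets,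
  whose measure is controlled by Chebyshev. Integrating the resulting power of the level leaves
  \<open>f y powr (p - 1)\<close>, and the factor \<open>f y\<close> completes it to
  \<open>f y powr p\<close>.\<close>

lemma HLS:
 obtains C where "C > 0" "!!f N. f \<in> bmeas ==> (!!x. f x \<ge> 0) ==> N \<ge> 0
  ==> (NN x. ennreal (f x powr p)) \<le> ennreal N
  ==> (NN x. (NN y. ennreal (f x * K (x - y) * f y))) \<le> ennreal (C * N powr (2/p))"
proof -
 \<comment> \<open>\<kappa> is the power of \<open>N\<close> contributed by one integration of the
   kernel. The level enters with power \<open>- (p * \<kappa>)\<close>, which is integrable at 0 and
   integrates to the power \<open>1 - p * \<kappa> = p - 1\<close>.\<close>
 define \<kappa> where "\<kappa> = 2 * s / nn"
 have \<kappa>: "0 < \<kappa>" "1 - p * \<kappa> = p - 1" "\<kappa> + 1 = 2 / p"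
  using s0 sn two_div_p unfolding \<kappa>_def p_def by (auto simp: field_simps)
 obtain C1 where C1: "C1 \<ge> 0" "!!r. r > 0 ==>
  (NN x. indicator (ball 0 r) (x::'a) * ennreal (norm x powr (-lam))) \<le> ennreal (C1 * r powr (nn - lam))"
  using radial_near[where 'a='a, of lam] lam_pos s0 by auto
 have "0 \<le> p * \<kappa>" "p * \<kappa> < real DIM(real)" using \<kappa> p1 by auto
 from radial_near[OF this] obtain C2 where C2: "C2 \<ge> 0" "!!r. r > 0 ==>
  (NN x. indicator (ball 0 r) (x::real) * ennreal (norm x powr (-(p*\<kappa>)))) \<le> ennreal (C2 * r powr (p - 1))"
  using \<kappa> by auto
 define C3 where "C3 = (C1 + 1) * C2"
 have C3: "C3 \<ge> 0" using C1 C2 unfolding C3_def by simp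
 have main: "(NN x. (NN y. ennreal (f x * K (x - y) * f y))) \<le> ennreal (2 * C3 * N powr (2/p))"
  if fm[measurable]: "f \<in> bmeas" and f0: "!!x. f x \<ge> 0" and N: "N > 0"
   and fN: "(NN x. ennreal (f x powr p)) \<le> ennreal N" for f N
 proof -
  have lev: "emeasure lborel {x. f x > a} \<le> ennreal (N * a powr (-p))" if a: "a > 0" for a
  proof -
   have "ennreal (a powr p) * emeasure lborel {x. f x > a} = (NN x. ennreal (a powr p) * indicator {x. f x > a} x)"
    by (subst nn_integral_cmult_indicator) measurable
   also have "... \<le> (NN x. ennreal (f x powr p))"
    by (rule nn_integral_mono) (use a p1 in \<open>auto simp: indicator_def intro!: ennreal_leI powr_mono2\<close>)
   also have "... \<le> ennreal N" by fact
   also have "... = ennreal (a powr p) * ennreal (N * a powr (-p))"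
    using a N by (simp add: ennreal_mult[symmetric] powr_minus field_simps)
   finally show ?thesis using a by (subst (asm) ennreal_mult_le_mult_iff) auto
  qed
  have lev2: "(NN x. indicator {x. f x > a} x * ennreal (K (x - y)))
    \<le> ennreal ((C1 + 1) * N powr \<kappa> * a powr (-(p*\<kappa>)))" if a: "a > 0" for a y
  proof -
   \<comment> \<open>A ball of radius r has volume of the order of the Chebyshev bound, so the part
     of the superlevel set inside it and the part outside contribute the same power of r.\<close>
   define r where "r = (N * a powr (-p)) powr (1 / nn)"
   have r: "r > 0" unfolding r_def using N a by simp
   have rr: "r powr (nn - lam) = N powr \<kappa> * a powr (-(p*\<kappa>))"
    unfolding r_def \<kappa>_def using N a nn_pos by (simp add: powr_powr powr_mult field_simps)
   have rn: "N * a powr (-p) = r powr nn" unfolding r_def using N a nn_pos by (simp add: powr_powr)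
   have "(NN x. indicator {x. f x > a} x * ennreal (K (x - y)))
    \<le> (NN x. indicator (ball 0 r) (x - y) * ennreal (norm (x - y) powr (-lam)) + ennreal (r powr (-lam)) * indicator {x. f x > a} x)"
   proof (rule nn_integral_mono)
    fix x
    show "indicator {x. f x > a} x * ennreal (K (x - y)) \<le> indicator (ball 0 r) (x - y) * ennreal (norm (x - y) powr (-lam)) + ennreal (r powr (-lam)) * indicator {x. f x > a} x"
    proof (cases "norm (x - y) < r")
     case False
     then have "norm (x - y) powr (-lam) \<le> r powr (-lam)" using r lam_pos by (intro powr_mono2') auto
     then show ?thesis by (auto simp: indicator_def K_def intro!: ennreal_leI)
    qed (auto simp: indicator_def K_def)
   qed
   also have "... = (NN x. indicator (ball 0 r) (x - y) * ennreal (norm (x - y) powr (-lam))) + ennreal (r powr (-lam)) * emeasure lborel {x. f x > a}"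
    proof -
    have 1: "(%x. indicator (ball 0 r) (x - y) * ennreal (norm (x - y) powr (-lam))) \<in> borel_measurable lborel"
    proof -
     have m: "(%x::'a. indicator (ball 0 r) x * ennreal (norm x powr (-lam))) \<in> bmeas"
      by (intro borel_measurable_times_ennreal borel_measurable_indicator) auto
     have d: "(%x. x - y) \<in> bmeas" by measurable
     show ?thesis unfolding measurable_lborel1 measurable_lborel2 using measurable_compose[OF d m] .
    qed
    have 2: "(%x. ennreal (r powr (-lam)) * indicator {x. f x > a} x) \<in> borel_measurable lborel" by measurable
    have 3: "{x. f x > a} \<in> sets lborel" by measurable
    show ?thesis using nn_integral_add[OF 1 2] nn_integral_cmult_indicator[OF 3, of "ennreal (r powr (-lam))"] by simp
   qed
   also have "(NN x. indicator (ball 0 r) (x - y) * ennreal (norm (x - y) powr (-lam)))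
    = (NN x. indicator (ball 0 r) (x::'a) * ennreal (norm x powr (-lam)))"
   proof -
    have m: "(%x::'a. indicator (ball 0 r) x * ennreal (norm x powr (-lam))) \<in> bmeas"
     by (intro borel_measurable_times_ennreal borel_measurable_indicator) auto
    show ?thesis using nn_integral_translate[OF m, of "-y"] by simp
   qed
   also have "... \<le> ennreal (C1 * r powr (nn - lam))" using C1(2) r by blast
   also have "ennreal (r powr (-lam)) * emeasure lborel {x. f x > a} \<le> ennreal (r powr (-lam)) * ennreal (r powr nn)"
    using lev[OF a] rn by (intro mult_left_mono) auto
   also have "ennreal (r powr (-lam)) * ennreal (r powr nn) = ennreal (r powr (nn - lam))"
    by (simp add: ennreal_mult[symmetric] powr_add[symmetric])
   finally show ?thesis unfolding rr using C1 by (simp add: ennreal_plus[symmetric] algebra_simps del: ennreal_plus)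
  qed
  have inner: "(NN x. (if f x \<le> b then ennreal (f x * K (x - y)) else 0)) \<le> ennreal (C3 * N powr \<kappa> * b powr (p - 1))"
   if b: "b > 0" for b y
  proof -
   have "(NN x. (if f x \<le> b then ennreal (f x * K (x - y)) else 0))
    \<le> (NN x. (NN a. indicator {0<..<b} a * (indicator {x. f x > a} x * ennreal (K (x - y)))))"
   proof (rule nn_integral_mono)
    fix x
    show "(if f x \<le> b then ennreal (f x * K (x - y)) else 0) \<le> (NN a. indicator {0<..<b} a * (indicator {x. f x > a} x * ennreal (K (x - y))))"
    proof (cases "f x \<le> b")
     case True
     have "ennreal (f x * K (x - y)) = emeasure lborel {0<..<f x} * ennreal (K (x - y))"
      using f0[of x] by (simp add: ennreal_mult)
     also have "... = (NN a. indicator {0<..<f x} a * ennreal (K (x - y)))"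
      by (subst nn_integral_multc) auto
     also have "... \<le> (NN a. indicator {0<..<b} a * (indicator {x. f x > a} x * ennreal (K (x - y))))"
      by (rule nn_integral_mono) (use True in \<open>auto simp: indicator_def\<close>)
     finally show ?thesis using True by simp
    qed auto
   qed
   also have "... = (NN a. (NN x. indicator {0<..<b} a * (indicator {x. f x > a} x * ennreal (K (x - y)))))"
    by (rule lborel_pair.Fubini') measurable
   also have "... \<le> (NN a. ennreal ((C1 + 1) * N powr \<kappa>) * (indicator (ball 0 b) (a::real) * ennreal (norm a powr (-(p*\<kappa>)))))"
   proof (rule nn_integral_mono)
    fix a :: real
    show "(NN x. indicator {0<..<b} a * (indicator {x. f x > a} x * ennreal (K (x - y))))
     \<le> ennreal ((C1 + 1) * N powr \<kappa>) * (indicator (ball 0 b) a * ennreal (norm a powr (-(p*\<kappa>))))"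
     using lev2[of a y] C1 by (cases "0 < a \<and> a < b") (auto simp: indicator_def ennreal_mult)
   qed
   also have "... = ennreal ((C1 + 1) * N powr \<kappa>) * (NN a. (indicator (ball 0 b) (a::real) * ennreal (norm a powr (-(p*\<kappa>)))))"
    by (rule nn_integral_cmult, unfold measurable_lborel2, intro borel_measurable_times_ennreal borel_measurable_indicator) auto
   also have "... \<le> ennreal ((C1 + 1) * N powr \<kappa>) * ennreal (C2 * b powr (p - 1))"
    using C2(2)[OF b] by (intro mult_left_mono) auto
   also have "... = ennreal (C3 * N powr \<kappa> * b powr (p - 1))"
    unfolding C3_def using C1 C2 by (simp add: ennreal_mult[symmetric] algebra_simps)
   finally show ?thesis .
  qed
  \<comment> \<open>One of the two orders of each pair. Ties are counted twice, which does no harm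
    in an upper bound.\<close>
  define g where "g = (%x y. if f x \<le> f y then ennreal (f x * K (x - y)) * ennreal (f y) else 0)"
  have [measurable]: "case_prod g \<in> borel_measurable (borel \<Otimes>\<^sub>M borel)" unfolding g_def by measurable
  have gb: "(NN y. (NN x. g x y)) \<le> ennreal (C3 * N powr (2/p))"
  proof -
   have "(NN x. g x y) \<le> ennreal (C3 * N powr \<kappa>) * ennreal (f y powr p)" for y
   proof (cases "f y > 0")
    case True
    have "(NN x. g x y) = (NN x. (if f x \<le> f y then ennreal (f x * K (x - y)) else 0) * ennreal (f y))"
     by (rule nn_integral_cong) (auto simp: g_def)
    also have "... = (NN x. (if f x \<le> f y then ennreal (f x * K (x - y)) else 0)) * ennreal (f y)"
     by (rule nn_integral_multc) measurable
    also have "... \<le> ennreal (C3 * N powr \<kappa> * f y powr (p - 1)) * ennreal (f y)"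
     using inner[OF True] by (intro mult_right_mono) auto
    also have "... = ennreal (C3 * N powr \<kappa> * (f y powr (p - 1) * f y))"
     using True C3 by (simp add: ennreal_mult[symmetric] algebra_simps)
    also have "f y powr (p - 1) * f y = f y powr p" using True by (simp add: powr_diff)
    finally show ?thesis using C3 by (simp add: ennreal_mult)
   next
    case False
    then have "f y = 0" using f0[of y] by simp
    then have "g x y = 0" for x by (simp add: g_def)
    then show ?thesis by simp
   qed
   then have "(NN y. (NN x. g x y)) \<le> (NN y. ennreal (C3 * N powr \<kappa>) * ennreal (f y powr p))"
    by (intro nn_integral_mono)
   also have "... = ennreal (C3 * N powr \<kappa>) * (NN y. ennreal (f y powr p))"
    by (rule nn_integral_cmult) measurable
   also have "... \<le> ennreal (C3 * N powr \<kappa>) * ennreal N"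
    using fN by (intro mult_left_mono) auto
   also have "... = ennreal (C3 * N powr (2/p))"
    using C3 N by (simp add: ennreal_mult[symmetric] \<kappa>(3)[symmetric] powr_add algebra_simps)
   finally show ?thesis .
  qed
  have "(NN x. (NN y. ennreal (f x * K (x - y) * f y)))
   \<le> (NN x. (NN y. g x y + g y x))"
  proof (intro nn_integral_mono)
   fix x y
   show "ennreal (f x * K (x - y) * f y) \<le> g x y + g y x"
    unfolding g_def using f0[of x] f0[of y] K_minus[of x y] by (auto simp: ennreal_mult[symmetric] algebra_simps)
  qed
  also have "... = (NN x. (NN y. g x y)) + (NN x. (NN y. g y x))"
   by (subst nn_integral_add[symmetric]) (auto simp: nn_integral_add intro!: nn_integral_cong)
  also have "(NN x. (NN y. g x y)) = (NN y. (NN x. g x y))"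
   by (rule lborel_pair.Fubini'[symmetric]) simp
  also have "(NN y. (NN x. g x y)) + (NN x. (NN y. g y x))
   \<le> ennreal (C3 * N powr (2/p)) + ennreal (C3 * N powr (2/p))"
   using gb by (intro add_mono) auto
  also have "... = ennreal (2 * C3 * N powr (2/p))"
   using C3 by (simp add: ennreal_plus[symmetric] del: ennreal_plus)
  finally show ?thesis .
 qed
 show ?thesis
 proof (rule that[of "2 * C3 + 1"])
  show "2 * C3 + 1 > 0" using C3 by simp
  fix f :: "'a => real" and N :: real
  assume fm[measurable]: "f \<in> bmeas" and f0: "!!x. f x \<ge> 0" and N: "N \<ge> 0"
   and fN: "(NN x. ennreal (f x powr p)) \<le> ennreal N"
  show "(NN x. (NN y. ennreal (f x * K (x - y) * f y))) \<le> ennreal ((2 * C3 + 1) * N powr (2/p))"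
  proof (cases "N = 0")
   case True
   then have "(NN x. ennreal (f x powr p)) = 0" using fN by simp
   then have "AE x in lborel. ennreal (f x powr p) = 0" by (subst (asm) nn_integral_0_iff_AE) auto
   then have z: "AE x in lborel. f x = 0" by eventually_elim (use f0 in auto)
   have "(NN x. (NN y. ennreal (f x * K (x - y) * f y))) = (\<integral>\<^sup>+x. 0 \<partial>(lborel::'a measure))"
    by (rule nn_integral_cong_AE) (use z in \<open>auto elim!: eventually_mono\<close>)
   then show ?thesis by simp
  next
   case False
   then have "N > 0" using N by simp
   from main[OF fm f0 this fN] show ?thesis
    by (rule order_trans) (use C3 in \<open>auto intro!: ennreal_leI mult_right_mono\<close>)
  qed
 qed
qed

definition HC :: real where
 "HC = (SOME C. C > 0 \<and> (\<forall>f N. f \<in> bmeas \<longrightarrow> (\<forall>x. f x \<ge> 0) \<longrightarrow> N \<ge> 0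
  \<longrightarrow> (NN x. ennreal (f x powr p)) \<le> ennreal N
  \<longrightarrow> (NN x. (NN y. ennreal (f x * K (x - y) * f y))) \<le> ennreal (C * N powr (2/p))))"

lemma HC: "HC > 0" "!!f N. f \<in> bmeas ==> (!!x. f x \<ge> 0) ==> N \<ge> 0
  ==> (NN x. ennreal (f x powr p)) \<le> ennreal N
  ==> (NN x. (NN y. ennreal (f x * K (x - y) * f y))) \<le> ennreal (HC * N powr (2/p))"
proof -
 have "\<exists>C. C > 0 \<and> (\<forall>f N. f \<in> bmeas \<longrightarrow> (\<forall>x. f x \<ge> 0) \<longrightarrow> N \<ge> 0
  \<longrightarrow> (NN x. ennreal (f x powr p)) \<le> ennreal N
  \<longrightarrow> (NN x. (NN y. ennreal (f x * K (x - y) * f y))) \<le> ennreal (C * N powr (2/p)))"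
 proof -
  obtain C where "C > 0" "!!f N. f \<in> bmeas ==> (!!x. f x \<ge> 0) ==> N \<ge> 0
  ==> (NN x. ennreal (f x powr p)) \<le> ennreal N
  ==> (NN x. (NN y. ennreal (f x * K (x - y) * f y))) \<le> ennreal (C * N powr (2/p))"
   by (rule HLS) blast
  then show ?thesis by (intro exI[of _ C]) simp
 qed
 from someI_ex[OF this] show "HC > 0" "!!f N. f \<in> bmeas ==> (!!x. f x \<ge> 0) ==> N \<ge> 0
  ==> (NN x. ennreal (f x powr p)) \<le> ennreal N
  ==> (NN x. (NN y. ennreal (f x * K (x - y) * f y))) \<le> ennreal (HC * N powr (2/p))"
  unfolding HC_def[symmetric] by auto
qed

definition B :: "('a => real) => ('a => real) => real" where
 "B v w = (\<integral>z. v (fst z) * K (fst z - snd z) * w (snd z) \<partial>lborel2)"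

text \<open>The bilinear bound is the quadratic one at
  \<open>f = \<bar>v\<bar> + \<bar>w\<bar>\<close>. On the unit ball this f has mass at most
  \<open>2 powr p * 2\<close>, the origin of the constant \<open>BC\<close>;
  \<open>B_abs_bound\<close> removes the normalisation by scaling.\<close>

lemma B_integrable:
 assumes v: "Lp p v" and w: "Lp p w"
 shows "integrable lborel2 (%z. v (fst z) * K (fst z - snd z) * w (snd z))"
  and "Np p v \<le> 1 ==> Np p w \<le> 1 ==> (\<integral>z. \<bar>v (fst z) * K (fst z - snd z) * w (snd z)\<bar> \<partial>lborel2) \<le> HC * (2 powr p * 2) powr (2/p)"
proof -
 have [measurable]: "v \<in> bmeas" "w \<in> bmeas" using v w by (auto simp: Lp_def)
 define f where "f = (%x. \<bar>v x\<bar> + \<bar>w x\<bar>)"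
 have "Lp p (%x. \<bar>v x\<bar>)" "Lp p (%x. \<bar>w x\<bar>)" using v w by (auto simp: Lp_def)
 from Lp_add[OF this p0] have f: "Lp p f" "Np p f \<le> 2 powr p * (Np p v + Np p w)"
  unfolding f_def by (auto simp: Np_def)
 have [measurable]: "f \<in> bmeas" using f by (simp add: Lp_def)
 have f0: "f x \<ge> 0" for x unfolding f_def by simp
 have fN: "(NN x. ennreal (f x powr p)) \<le> ennreal (Np p f)"
  using nn_Np[OF f(1)] f0 by simp
 have "(\<integral>\<^sup>+z. ennreal (norm (v (fst z) * K (fst z - snd z) * w (snd z))) \<partial>lborel2)
  \<le> (\<integral>\<^sup>+z. ennreal (f (fst z) * K (fst z - snd z) * f (snd z)) \<partial>lborel2)"
  by (rule nn_integral_mono) (auto simp: f_def abs_mult intro!: ennreal_leI mult_mono)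
 also have "... = (NN x. (NN y. ennreal (f x * K (x - y) * f y)))"
 proof -
  have "(NN x. (NN y. (%z. ennreal (f (fst z) * K (fst z - snd z) * f (snd z))) (x, y)))
   = (\<integral>\<^sup>+z. ennreal (f (fst z) * K (fst z - snd z) * f (snd z)) \<partial>lborel2)"
   by (rule lborel.nn_integral_fst) measurable
  then show ?thesis by (simp only: fst_conv snd_conv)
 qed
 also have "... \<le> ennreal (HC * Np p f powr (2/p))" by (rule HC(2)[OF _ f0 _ fN]) auto
 finally have le: "(\<integral>\<^sup>+z. ennreal (norm (v (fst z) * K (fst z - snd z) * w (snd z))) \<partial>lborel2) \<le> ennreal (HC * Np p f powr (2/p))" .
 show i: "integrable lborel2 (%z. v (fst z) * K (fst z - snd z) * w (snd z))"
  by (rule integrableI_bounded) (use le in \<open>auto intro: le_less_trans\<close>)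
 assume "Np p v \<le> 1" "Np p w \<le> 1"
 then have "2 powr p * (Np p v + Np p w) \<le> 2 powr p * 2" by (intro mult_left_mono) auto
 then have "Np p f \<le> 2 powr p * 2" using f(2) by linarith
 then have R: "HC * Np p f powr (2/p) \<le> HC * (2 powr p * 2) powr (2/p)"
  using HC(1) p1 by (intro mult_left_mono powr_mono2) auto
 have "ennreal (\<integral>z. \<bar>v (fst z) * K (fst z - snd z) * w (snd z)\<bar> \<partial>lborel2) \<le> ennreal (HC * Np p f powr (2/p))"
  using le i by (subst nn_integral_eq_integral[symmetric]) auto
 then have "(\<integral>z. \<bar>v (fst z) * K (fst z - snd z) * w (snd z)\<bar> \<partial>lborel2) \<le> HC * Np p f powr (2/p)"
  using HC(1) by (subst (asm) ennreal_le_iff) auto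
 from order_trans[OF this R] show "(\<integral>z. \<bar>v (fst z) * K (fst z - snd z) * w (snd z)\<bar> \<partial>lborel2) \<le> HC * (2 powr p * 2) powr (2/p)" .
qed

definition BC :: real where "BC = HC * (2 powr p * 2) powr (2/p)"
lemma BC: "BC > 0" unfolding BC_def using HC(1) by simp

lemma B_cmult: "B (%x. c * v x) w = c * B v w" "B v (%x. c * w x) = c * B v w"
 unfolding B_def by (simp_all add: mult.assoc mult.left_commute[of _ c] flip: integral_mult_right_zero)

lemma B_add:
 assumes "Lp p v" "Lp p v'" "Lp p w"
 shows "B (%x. v x + v' x) w = B v w + B v' w" "B w (%x. v x + v' x) = B w v + B w v'"
 unfolding B_def using assms B_integrable(1)
 by (simp_all add: ring_distribs Bochner_Integration.integral_add)

lemma B_diff: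
 assumes "Lp p v" "Lp p v'" "Lp p w"
 shows "B (%x. v x - v' x) w = B v w - B v' w" "B w (%x. v x - v' x) = B w v - B w v'"
 unfolding B_def using assms B_integrable(1)
 by (simp_all add: ring_distribs Bochner_Integration.integral_diff)

lemma B_AE:
 assumes [measurable]: "v \<in> bmeas" "v' \<in> bmeas" "w \<in> bmeas" "w' \<in> bmeas"
  and "AE x in lborel. v x = v' x" "AE x in lborel. w x = w' x"
 shows "B v w = B v' w'"
 unfolding B_def
proof (rule integral_cong_AE)
 have "AE z in lborel2. v (fst z) = v' (fst z)"
 proof (rule lborel_pair.AE_pair_measure)
  show "{z \<in> space lborel2. v (fst z) = v' (fst z)} \<in> sets lborel2" by measurable
  show "AE x in lborel. AE y in lborel. v (fst (x, y)) = v' (fst (x, y))"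
   using assms(5) by eventually_elim simp
 qed
 moreover have "AE z in lborel2. w (snd z) = w' (snd z)"
 proof (rule lborel_pair.AE_pair_measure)
  show "{z \<in> space lborel2. w (snd z) = w' (snd z)} \<in> sets lborel2" by measurable
 qed (use assms(6) in simp)
 ultimately show "AE z in lborel2. v (fst z) * K (fst z - snd z) * w (snd z) = v' (fst z) * K (fst z - snd z) * w' (snd z)"
  by eventually_elim simp
qed measurable

lemma B_abs_bound:
 assumes v: "Lp p v" and w: "Lp p w"
 shows "(\<integral>z. \<bar>v (fst z) * K (fst z - snd z) * w (snd z)\<bar> \<partial>lborel2) \<le> BC * Np p v powr (1/p) * Np p w powr (1/p)"
proof (cases "Np p v = 0 \<or> Np p w = 0")
 case True
 have [measurable]: "v \<in> bmeas" "w \<in> bmeas" using v w by (auto simp: Lp_def)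
 have "AE z in lborel2. \<bar>v (fst z) * K (fst z - snd z) * w (snd z)\<bar> = 0"
 proof (rule lborel_pair.AE_pair_measure)
  show "{z \<in> space lborel2. \<bar>v (fst z) * K (fst z - snd z) * w (snd z)\<bar> = 0} \<in> sets lborel2" by measurable
  show "AE x in lborel. AE y in lborel. \<bar>v (fst (x, y)) * K (fst (x, y) - snd (x, y)) * w (snd (x, y))\<bar> = 0"
   using True
  proof
   assume "Np p v = 0"
   from Np_zero_AE[OF v this] show ?thesis by eventually_elim simp
  next
   assume "Np p w = 0"
   from Np_zero_AE[OF w this] have "AE y in lborel. w y = 0" .
   then have "AE y in lborel. \<bar>v (fst (x, y)) * K (fst (x, y) - snd (x, y)) * w (snd (x, y))\<bar> = 0" for x
    by eventually_elim simp
   then show ?thesis by simp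
  qed
 qed
 then have "(\<integral>z. \<bar>v (fst z) * K (fst z - snd z) * w (snd z)\<bar> \<partial>lborel2) = (\<integral>z. 0 \<partial>(lborel \<Otimes>\<^sub>M (lborel::'a measure)))"
  by (subst integral_cong_AE[where g="%_. 0"]; measurable; simp)
 then show ?thesis using BC by simp
next
 case False
 define a where "a = Np p v powr (1/p)"
 define b where "b = Np p w powr (1/p)"
 have ab: "a > 0" "b > 0" "a powr p = Np p v" "b powr p = Np p w"
  using False p1 Np_nonneg[of p v] Np_nonneg[of p w] unfolding a_def b_def by (auto simp: powr_powr)
 have 1: "Lp p (%x. 1/a * v x)" "Lp p (%x. 1/b * w x)" using Lp_cmult(1)[OF v, of "1/a"] Lp_cmult(1)[OF w, of "1/b"] by simp_all
 have 2: "Np p (%x. 1/a * v x) \<le> 1" "Np p (%x. 1/b * w x) \<le> 1"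
  unfolding Lp_cmult(2)[OF v] Lp_cmult(2)[OF w] using ab False by (simp_all add: powr_divide)
 from B_integrable(2)[OF 1 2]
 have "(\<integral>z. \<bar>v (fst z) * K (fst z - snd z) * w (snd z)\<bar> / (a * b) \<partial>lborel2) \<le> BC"
  using ab by (simp add: BC_def abs_mult)
 then show ?thesis using ab by (simp add: a_def[symmetric] b_def[symmetric] field_simps)
qed

lemma B_bound:
 assumes v: "Lp p v" and w: "Lp p w"
 shows "\<bar>B v w\<bar> \<le> BC * Np p v powr (1/p) * Np p w powr (1/p)"
 using B_abs_bound[OF assms] integral_abs_bound[of "lborel2" "%z. v (fst z) * K (fst z - snd z) * w (snd z)"]
 unfolding B_def by linarith

lemma B_sym: "B v w = B w v" if v: "Lp p v" and w: "Lp p w"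
proof -
 have [measurable]: "v \<in> bmeas" "w \<in> bmeas" using v w by (auto simp: Lp_def)
 have "B v w = (\<integral>z. (%(x,y). v x * K (x - y) * w y) z \<partial>lborel2)"
  unfolding B_def by (simp add: case_prod_unfold)
 also have "... = (\<integral>(y,x). (%(x,y). v x * K (x - y) * w y) (x, y) \<partial>lborel2)"
  by (rule lborel_pair.integral_product_swap[symmetric]) measurable
 also have "... = B w v"
  unfolding B_def by (intro Bochner_Integration.integral_cong) (auto simp: case_prod_unfold K_minus mult.commute mult.left_commute)
 finally show ?thesis .
qed


text \<open>Two points closer than \<delta> lie together in every ball of radius
  \<open>2 * \<delta>\<close> whose centre is within \<delta> of the first. Applying
  \<open>HC\<close> in each such ball and averaging over the centres gains
  \<open>m powr (2/p - 1)\<close>, because the exponent \<open>2/p\<close> exceeds 1: where no small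
  ball carries much mass, the singularity of the kernel contributes little.\<close>

lemma near_diagonal:
 assumes [measurable]: "f \<in> bmeas" and f0: "!!x. f x \<ge> 0" and N: "N \<ge> 0"
  and fN: "(NN x. ennreal (f x powr p)) \<le> ennreal N" and \<delta>: "\<delta> > 0"
  and m: "m \<ge> 0" "!!z. (NN x. ennreal (f x powr p) * indicator (ball z (2*\<delta>)) x) \<le> ennreal m"
 shows "(NN x. (NN y. ennreal (f x * K (x - y) * f y) * indicator (ball x \<delta>) y))
  \<le> ennreal (2 powr nn * HC * m powr (2/p - 1) * N)"
proof -
 define V where "V = unit_ball_vol nn * \<delta> ^ DIM('a)"
 have V: "V > 0" unfolding V_def using \<delta> nn_pos by simp
 have Vb: "emeasure lborel (ball x \<delta>) = ennreal V" "emeasure lborel (ball x (2*\<delta>)) = ennreal (2 powr nn * V)" for x :: 'a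
  using emeasure_ball[of \<delta> x] emeasure_ball[of "2*\<delta>" x] \<delta> by (auto simp: V_def two_powr_nn power_mult_distrib algebra_simps)
 define k where "k = (%x y. ennreal (f x * K (x - y) * f y))"
 define b where "b = (%z x. indicator (ball (z::'a) (2 * \<delta>)) x :: ennreal)"
 define d where "d = (%z x. indicator (ball (z::'a) \<delta>) x :: ennreal)"
 have [measurable]: "case_prod k \<in> borel_measurable (borel \<Otimes>\<^sub>M borel)" unfolding k_def by measurable
 have [measurable]: "case_prod b \<in> borel_measurable (borel \<Otimes>\<^sub>M borel)" "case_prod d \<in> borel_measurable (borel \<Otimes>\<^sub>M borel)"
  using measurable_indicator_ball[where 'a='a] by (simp_all add: b_def d_def case_prod_unfold)
 have bb: "b z x = indicator (ball z (2*\<delta>)) x" for z x by (auto simp: b_def indicator_def)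
 have bs: "b z x = b x z" for z x by (auto simp: b_def indicator_def dist_commute)
 have "ennreal V * (NN x. (NN y. k x y * d x y))
  = (NN x. ennreal V * (NN y. k x y * d x y))"
  by (rule nn_integral_cmult[symmetric]) measurable
 also have "... = (NN x. (NN y. ennreal V * (k x y * d x y)))"
  by (intro nn_integral_cong nn_integral_cmult[symmetric]) measurable
 \<comment> \<open>\<open>V\<close> is the volume of a set of centres z whose balls contain both
   points, so it is bounded by the integral over z of the two indicators.\<close>
 also have "... \<le> (NN x. (NN y. (NN z. k x y * b z x * b z y)))"
 proof (intro nn_integral_mono)
  fix x y :: 'a
  show "ennreal V * (k x y * d x y) \<le> (NN z. k x y * b z x * b z y)"
  proof (cases "dist x y < \<delta>")
   case True
   have "ennreal V * (k x y * d x y) \<le> k x y * emeasure lborel (ball x \<delta>)"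
    using True by (simp add: Vb d_def mult.commute)
   also have "... = (NN z. k x y * indicator (ball x \<delta>) z)"
    by (simp add: nn_integral_cmult_indicator)
   also have "... \<le> (NN z. k x y * b z x * b z y)"
   proof (rule nn_integral_mono)
    fix z
    show "k x y * indicator (ball x \<delta>) z \<le> k x y * b z x * b z y"
     using True \<delta> dist_triangle[of z y x] by (auto simp: b_def indicator_def dist_commute)
   qed
   finally show ?thesis .
  qed (auto simp: indicator_def d_def)
 qed
 also have "... = (NN x. (NN z. (NN y. k x y * b z x * b z y)))"
  by (intro nn_integral_cong lborel_pair.Fubini') measurable
 also have "... = (NN z. (NN x. (NN y. k x y * b z x * b z y)))"
  by (intro lborel_pair.Fubini') measurable
 also have "... \<le> (NN z. ennreal (HC * m powr (2/p - 1)) * (NN x. ennreal (f x powr p) * b z x))"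
 proof (rule nn_integral_mono)
  fix z
  define g where "g = (%x. f x * indicator (ball z (2*\<delta>)) x)"
  define M where "M = enn2real (NN x. ennreal (f x powr p) * b z x)"
  have fin: "(NN x. ennreal (f x powr p) * b z x) \<le> ennreal m" using m(2)[of z] by (simp add: bb)
  then have M: "ennreal M = (NN x. ennreal (f x powr p) * b z x)"
   unfolding M_def by (intro ennreal_enn2real) (auto intro: le_less_trans)
  have M0: "M \<ge> 0" unfolding M_def by simp
  have Mm: "M \<le> m" using fin M m(1) by (metis ennreal_le_iff)
  have "(NN x. (NN y. k x y * b z x * b z y)) = (NN x. (NN y. ennreal (g x * K (x - y) * g y)))"
   by (intro nn_integral_cong) (auto simp: k_def bb g_def indicator_def)
  also have "... \<le> ennreal (HC * M powr (2/p))"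
  proof (rule HC(2))
   show "(NN x. ennreal (g x powr p)) \<le> ennreal M"
    unfolding M by (intro nn_integral_mono) (auto simp: g_def bb indicator_def)
   show "g \<in> bmeas" unfolding g_def by (intro borel_measurable_times borel_measurable_indicator) auto
  qed (use f0 M0 in \<open>auto simp: g_def\<close>)
  also have "... \<le> ennreal (HC * m powr (2/p - 1)) * ennreal M"
  proof (cases "M = 0")
   case False
   then have "M powr (2/p) = M powr (2/p - 1) * M" using M0 by (simp add: powr_diff)
   also have "... \<le> m powr (2/p - 1) * M"
    using M0 Mm p2 p1 by (intro mult_right_mono powr_mono2) auto
   finally have "HC * M powr (2/p) \<le> HC * (m powr (2/p - 1) * M)" using HC(1) by (intro mult_left_mono) auto
   then show ?thesis using HC(1) M0 by (simp add: ennreal_mult[symmetric] mult.assoc)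
  qed auto
  finally show "(NN x. (NN y. k x y * b z x * b z y)) \<le> ennreal (HC * m powr (2/p - 1)) * (NN x. ennreal (f x powr p) * b z x)"
   by (simp add: M)
 qed
 also have "... = ennreal (HC * m powr (2/p - 1)) * (NN z. (NN x. ennreal (f x powr p) * b z x))"
  by (rule nn_integral_cmult) measurable
 also have "... \<le> ennreal (HC * m powr (2/p - 1)) * (ennreal N * ennreal (2 powr nn * V))"
 proof (rule mult_left_mono)
 \<comment> \<open>Exchanging the order, each x is counted by the centres in a ball of radius
   \<open>2 * \<delta>\<close>; its volume is the source of the factor
   \<open>2 powr nn\<close>.\<close>
 have "(NN z. (NN x. ennreal (f x powr p) * b z x)) = (NN x. (NN z. ennreal (f x powr p) * b z x))"
  by (rule lborel_pair.Fubini') measurable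
 also have "... = (NN x. ennreal (f x powr p) * ennreal (2 powr nn * V))"
  by (intro nn_integral_cong) (simp add: bs[of _ x for x] bb nn_integral_cmult_indicator Vb)
 also have "... = (NN x. ennreal (f x powr p)) * ennreal (2 powr nn * V)"
  by (rule nn_integral_multc) measurable
 also have "... \<le> ennreal N * ennreal (2 powr nn * V)" using fN by (intro mult_right_mono) auto
 finally show "(NN z. (NN x. ennreal (f x powr p) * b z x)) \<le> ennreal N * ennreal (2 powr nn * V)" .
 qed simp
 also have "... = ennreal V * ennreal (2 powr nn * HC * m powr (2/p - 1) * N)"
  using V N HC(1) by (simp add: ennreal_mult[symmetric] algebra_simps)
 finally have "ennreal V * (NN x. (NN y. k x y * d x y)) \<le> ennreal V * ennreal (2 powr nn * HC * m powr (2/p - 1) * N)" .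
 then show ?thesis using V by (subst (asm) ennreal_mult_le_mult_iff) (auto simp: k_def d_def)
qed

end

section \<open>Gaussian and heat kernels\<close>

lemma gauss_1d:
 fixes a t :: real assumes t: "t > 0"
 shows "integrable lborel (%u. exp (complex_of_real (- t * u^2) + \<i> * complex_of_real (a * u)))" (is "integrable lborel ?f")
  and "(LBINT u. exp (complex_of_real (- t * u^2) + \<i> * complex_of_real (a * u))) = complex_of_real (sqrt (pi / t) * exp (- (a^2) / (4 * t)))"
proof -
 \<comment> \<open>The substitution u = c x turns the Gaussian into a multiple of the standard
   normal density, whose characteristic function is known.\<close>
 define c where "c = 1 / sqrt (2 * t)"
 have c: "c > 0" "c^2 = 1 / (2 * t)" unfolding c_def using t by (auto simp: power_divide)
 have e: "std_normal_density x *\<^sub>R iexp ((a * c) * x) = complex_of_real (1 / sqrt (2 * pi)) * ?f (c * x)" for x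
 proof -
  have e1: "- t * (c * x)^2 = - (x^2 / 2)" using c t by (simp add: power_mult_distrib)
  have "?f (c * x) = complex_of_real (exp (- (x^2 / 2))) * iexp ((a * c) * x)"
   unfolding e1 exp_add by (simp only: exp_of_real of_real_mult mult.assoc)
  then show ?thesis by (simp add: std_normal_density_def scaleR_conv_of_real)
 qed
 have i0: "integrable lborel (%x. std_normal_density x *\<^sub>R iexp ((a * c) * x))"
  by (rule Bochner_Integration.integrable_bound[OF integrable_std_normal_moment[of 0]]) (auto simp: norm_mult)
 have s: "complex_of_real (1 / sqrt (2 * pi)) \<noteq> 0" by simp
 have i1: "integrable lborel (%x. ?f (c * x))"
  using integrable_mult_right[OF i0, of "complex_of_real (sqrt (2*pi))"] unfolding e
  by (simp add: mult.assoc[symmetric] del: of_real_divide of_real_mult add: of_real_mult[symmetric])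
 show "integrable lborel ?f"
  using integrable_affine[OF i1, of "1/c" 0] c by simp
 from integral_affine[OF this, of c 0]
 have "(LBINT u. ?f u) = c *\<^sub>R (LBINT x. ?f (c * x))" using c by simp
 moreover have "complex_of_real (1 / sqrt (2 * pi)) * (LBINT x. ?f (c * x)) = complex_of_real (exp (- ((a * c)^2) / 2))"
 proof -
  have "char std_normal_distribution (a * c) = (LBINT x. std_normal_density x *\<^sub>R iexp ((a * c) * x))"
   unfolding char_def by (subst integral_density) auto
  then have "(LBINT x. complex_of_real (1 / sqrt (2 * pi)) * ?f (c * x)) = complex_of_real (exp (- ((a * c)^2) / 2))"
   unfolding e char_std_normal_distribution by simp
  then show ?thesis by simp
 qed
 then have "(LBINT x. ?f (c * x)) = complex_of_real (sqrt (2 * pi) * exp (- ((a * c)^2) / 2))"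
  by (simp add: field_simps)
 moreover have "c * sqrt (2 * pi) = sqrt (pi / t)" unfolding c_def using t by (simp add: real_sqrt_divide real_sqrt_mult)
 moreover have "- ((a * c)^2) / 2 = - (a^2) / (4 * t)" using c by (simp add: power_mult_distrib)
 ultimately show "(LBINT u. ?f u) = complex_of_real (sqrt (pi / t) * exp (- (a^2) / (4 * t)))"
  by (simp add: scaleR_conv_of_real) (metis of_real_mult mult.assoc)
qed

lemma gauss_nd:
 fixes z :: "'a::euclidean_space" assumes t: "t > 0"
 shows "integrable lborel (%x. exp (complex_of_real (- t * (norm x)^2) + \<i> * complex_of_real (z \<bullet> x)))" (is "integrable lborel ?F")
  and "(LBINT x. exp (complex_of_real (- t * (norm x)^2) + \<i> * complex_of_real (z \<bullet> x)))
   = complex_of_real (sqrt (pi / t) ^ DIM('a) * exp (- ((norm z)^2) / (4 * t)))"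
proof -
 define g where "g = (%b u. exp (complex_of_real (- t * u^2) + \<i> * complex_of_real ((z \<bullet> b) * u)))"
 interpret product_sigma_finite "%_::'a. lborel :: real measure" by unfold_locales
 have F: "?F (\<Sum>b\<in>Basis. f b *\<^sub>R b) = (\<Prod>b\<in>Basis. g b (f b))" for f
 proof -
  let ?x = "\<Sum>b\<in>Basis. f b *\<^sub>R b"
  have xb: "?x \<bullet> b = f b" if "b \<in> Basis" for b using that by (simp add: inner_sum_left_Basis)
  have 1: "(norm ?x)^2 = (\<Sum>b\<in>Basis. (f b)^2)"
   unfolding power2_norm_eq_inner euclidean_inner[of ?x ?x] by (intro sum.cong) (auto simp: xb power2_eq_square)
  have 2: "z \<bullet> ?x = (\<Sum>b\<in>Basis. (z \<bullet> b) * f b)"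
   unfolding euclidean_inner[of z ?x] by (intro sum.cong) (auto simp: xb)
  have "complex_of_real (- t * (norm ?x)^2) + \<i> * complex_of_real (z \<bullet> ?x)
   = (\<Sum>b\<in>Basis. complex_of_real (- t * (f b)^2) + \<i> * complex_of_real ((z \<bullet> b) * f b))"
   unfolding 1 2 by (simp add: sum.distrib sum_distrib_left sum_negf sum_subtractf)
  then show ?thesis unfolding g_def by (simp add: exp_sum)
 qed
 have m: "?F \<in> bmeas" by (intro borel_measurable_continuous_onI continuous_intros)
 have gi: "integrable lborel (g b)" for b unfolding g_def by (rule gauss_1d(1)[OF t])
 have ip: "integrable (Pi\<^sub>M Basis (%_. lborel)) (%f. \<Prod>b\<in>Basis. g b (f b))"
  by (rule product_integrable_prod) (auto simp: gi)
 have mm: "(%f. \<Sum>b\<in>Basis. f b *\<^sub>R b) \<in> measurable (Pi\<^sub>M Basis (%_. lborel)) (borel :: 'a measure)" by measurable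
 show "integrable lborel ?F"
  using ip by (subst lborel_eq, subst integrable_distr_eq[OF mm m]) (simp only: F)
 have "(LBINT x. ?F x) = (\<integral>f. (\<Prod>b\<in>Basis. g b (f b)) \<partial>(Pi\<^sub>M Basis (%_. lborel)))"
  by (subst lborel_eq, subst integral_distr[OF mm m]) (simp only: F)
 also have "... = (\<Prod>b\<in>Basis. (LBINT u. g b u))"
  by (rule product_integral_prod) (auto simp: gi)
 also have "... = (\<Prod>b\<in>Basis. complex_of_real (sqrt (pi / t) * exp (- ((z \<bullet> b)^2) / (4 * t))))"
  unfolding g_def gauss_1d(2)[OF t] ..
 also have "... = complex_of_real (sqrt (pi / t) ^ DIM('a) * exp (\<Sum>b\<in>Basis. - ((z \<bullet> b)^2) / (4 * t)))"
  by (simp add: prod.distrib exp_sum)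
 also have "(\<Sum>b\<in>Basis. - ((z \<bullet> b)^2) / (4 * t)) = - ((norm z)^2) / (4 * t)"
  unfolding power2_norm_eq_inner euclidean_inner[of z z] by (simp add: sum_divide_distrib sum_negf power2_eq_square)
 finally show "(LBINT x. ?F x) = complex_of_real (sqrt (pi / t) ^ DIM('a) * exp (- ((norm z)^2) / (4 * t)))" .
qed

text \<open>The heat kernel \<open>(4 pi t)^(-n/2) exp (- (norm z)^2 / (4 t))\<close>, left in the
  shape in which the Gaussian integral delivers it.\<close>

definition Gs :: "real => 'a::euclidean_space => real" where
 "Gs t z = 1 / (2*pi) ^ DIM('a) * (sqrt (pi / t) ^ DIM('a) * exp (- ((norm z)^2) / (4 * t)))"

lemma Gs_meas[measurable]: "Gs t \<in> bmeas" unfolding Gs_def by measurable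
lemma Gs_pos: "t > 0 ==> Gs t z > 0" unfolding Gs_def by simp
lemma Gs_le: "t > 0 ==> Gs t (z::'a::euclidean_space) \<le> Gs t (0::'a)" unfolding Gs_def by (simp add: mult_left_le divide_right_mono)

lemma gauss_cos:
 fixes z :: "'a::euclidean_space" assumes t: "t > 0"
 shows "integrable lborel (%x::'a. exp (- t * (norm x)^2))"
  and "1 / (2*pi) ^ DIM('a) * (LBINT x. exp (- t * (norm x)^2) * cos (z \<bullet> x)) = Gs t z"
  and "(LBINT x. exp (- t * (norm x)^2) * sin (z \<bullet> x)) = 0"
proof -
 note i = gauss_nd(1)[OF t, of z]
 note i0 = gauss_nd(1)[OF t, of "0::'a"]
 have "integrable lborel (%x::'a. Re (exp (complex_of_real (- t * (norm x)^2) + \<i> * complex_of_real (0 \<bullet> x))))"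
  using i0 by (rule integrable_Re)
 then show "integrable lborel (%x::'a. exp (- t * (norm x)^2))" by (simp add: Re_exp)
 have "(LBINT x. exp (- t * (norm x)^2) * cos (z \<bullet> x)) = sqrt (pi / t) ^ DIM('a) * exp (- ((norm z)^2) / (4 * t))"
  using integral_Re[OF i] unfolding gauss_nd(2)[OF t] by (simp add: Re_exp)
 then show "1 / (2*pi) ^ DIM('a) * (LBINT x. exp (- t * (norm x)^2) * cos (z \<bullet> x)) = Gs t z"
  by (simp add: Gs_def)
 show "(LBINT x. exp (- t * (norm x)^2) * sin (z \<bullet> x)) = 0"
  using integral_Im[OF i] unfolding gauss_nd(2)[OF t] by (simp add: Im_exp)
qed

lemma Gs_one:
 shows "integrable lborel (Gs 1 :: 'a::euclidean_space => real)" "(LBINT z. Gs 1 (z::'a)) = 1"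
proof -
 have e: "Gs 1 z = 1 / (2*pi) ^ DIM('a) * sqrt pi ^ DIM('a) * exp (- (1/4) * (norm z)^2)" for z :: 'a
  by (simp add: Gs_def)
 show "integrable lborel (Gs 1 :: 'a => real)"
  using integrable_mult_right[OF gauss_cos(1)[of "1/4" , where 'a='a], of "1 / (2*pi) ^ DIM('a) * sqrt pi ^ DIM('a)"]
  unfolding e[abs_def] by simp
 have "(LBINT z. Gs 1 (z::'a)) = sqrt pi ^ DIM('a) * Gs (1/4) (0::'a)"
  unfolding e using gauss_cos(2)[of "1/4" "0::'a", symmetric] by simp
 also have "... = (sqrt pi * (1 / (2 * pi) * sqrt (4 * pi))) ^ DIM('a)"
  unfolding Gs_def by (simp add: power_mult_distrib power_divide mult.commute)
 also have "sqrt pi * (1 / (2 * pi) * sqrt (4 * pi)) = 1" by (simp add: real_sqrt_mult)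
 finally show "(LBINT z. Gs 1 (z::'a)) = 1" by simp
qed

section \<open>Heat regularisation, Parseval's identity and injectivity of the transform\<close>

lemma integral_product:
 fixes f :: "'a::euclidean_space => real" and g :: "'b::euclidean_space => real"
 assumes f: "integrable lborel f" and g: "integrable lborel g"
 shows "(\<integral>z. f (fst z) * g (snd z) \<partial>lborel2) = (LBINT x. f x) * (LBINT y. g y)"
proof -
 have "integrable lborel2 (%(x,y). f x * g y)"
  using integrable_product[OF assms] by (simp add: case_prod_unfold)
 from lborel_pair.integral_fst'[OF this] show ?thesis by (simp add: case_prod_unfold)
qed

abbreviation cas :: "real => real" where "cas u \<equiv> cos u + sin u"

lemma cas_bound: "\<bar>cas u\<bar> \<le> 2" using abs_cos_le_one[of u] abs_sin_le_one[of u] by linarith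

lemma hart_cas: "integrable lborel f ==> hart f xi = (LBINT x. f x * cas (x \<bullet> xi))"
 using trig_integrable[of f xi] by (simp add: hart_def cosT_def sinT_def ring_distribs)

lemma cas_integrable: "integrable lborel f ==> integrable lborel (%x. f x * cas (x \<bullet> xi))"
 using trig_integrable[of f xi] by (simp add: ring_distribs)

text \<open>For Gaussian weights the kernel form and the frequency form agree by Fubini, as
  everything is absolutely integrable. Later identities are limits of this one
  (\<open>parseval\<close>) or mixtures of it over t
  (\<open>hart_weight_neg_square\<close>).\<close>

lemma gauss_identity:
 fixes w v :: "'a::euclidean_space => real"
 assumes t: "t > 0" and w: "integrable lborel w" and v: "integrable lborel v"
 shows "(\<integral>z. w (fst z) * v (snd z) * Gs t (fst z - snd z) \<partial>lborel2)
  = 1 / (2*pi) ^ DIM('a) * (LBINT xi. exp (- t * (norm xi)^2) * (hart w xi * hart v xi))"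
  and "integrable lborel2 (%z. w (fst z) * v (snd z) * Gs t (fst z - snd z))"
proof -
 have [measurable]: "w \<in> bmeas" "v \<in> bmeas" using w v by auto
 define W where "W = (%z. w (fst z) * v (snd z))"
 have Wi: "integrable (lborel :: ('a \<times> 'a) measure) W" using integrable_product[OF w v] unfolding W_def lborel_prod .
 define h where "h = (%z xi. W z * exp (- t * (norm xi)^2) * (cas (fst z \<bullet> xi) * cas (snd z \<bullet> xi)))"
 have Wm[measurable]: "W \<in> bmeas" using Wi by auto
 have hi: "integrable ((lborel :: ('a \<times> 'a) measure) \<Otimes>\<^sub>M (lborel :: 'a measure)) (case_prod h)"
 proof (rule Bochner_Integration.integrable_bound[OF integrable_mult_right[OF integrable_product[OF Wi gauss_cos(1)[OF t]], of 4]])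
  show "AE u in lborel2. norm (case_prod h u) \<le> norm (4 * (W (fst u) * exp (- t * (norm (snd u))^2)))"
  proof (rule AE_I2)
   fix u :: "('a \<times> 'a) \<times> 'a"
   have c: "\<bar>cas a * cas b\<bar> \<le> 4" for a b
    using mult_mono[OF cas_bound[of a] cas_bound[of b]] by (simp add: abs_mult)
   have "\<bar>W (fst u) * exp (- t * (norm (snd u))^2)\<bar> * \<bar>cas (fst (fst u) \<bullet> snd u) * cas (snd (fst u) \<bullet> snd u)\<bar> \<le> \<bar>W (fst u) * exp (- t * (norm (snd u))^2)\<bar> * 4"
    by (intro mult_left_mono c) auto
   then show "norm (case_prod h u) \<le> norm (4 * (W (fst u) * exp (- t * (norm (snd u))^2)))"
    unfolding h_def case_prod_unfold real_norm_def abs_mult by simp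
  qed
  have "case_prod h = (%u. W (fst u) * exp (- t * (norm (snd u))^2) * (cas (fst (fst u) \<bullet> snd u) * cas (snd (fst u) \<bullet> snd u)))"
   by (auto simp: h_def)
  moreover have "(%u::('a\<times>'a)\<times>'a. exp (- t * (norm (snd u))^2) * (cas (fst (fst u) \<bullet> snd u) * cas (snd (fst u) \<bullet> snd u))) \<in> bmeas"
   by (intro borel_measurable_continuous_onI continuous_intros)
  moreover have "(%u::('a\<times>'a)\<times>'a. W (fst u)) \<in> bmeas"
  proof -
   have "(fst :: ('a\<times>'a)\<times>'a => _) \<in> bmeas" by (intro borel_measurable_continuous_onI continuous_intros)
   from measurable_compose[OF this Wm] show ?thesis .
  qed
  ultimately show "case_prod h \<in> borel_measurable lborel2"
   unfolding lborel_prod by (simp add: mult.assoc)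
 qed
 have in1: "(LBINT xi. h z xi) = (2*pi) ^ DIM('a) * (W z * Gs t (fst z - snd z))" for z
 proof -
  have gi: "integrable lborel (%xi::'a. exp (- t * (norm xi)^2) * cos (xi \<bullet> c))" "integrable lborel (%xi::'a. exp (- t * (norm xi)^2) * sin (xi \<bullet> c))" for c
   using trig_integrable[OF gauss_cos(1)[OF t, where 'a='a]] by auto
  \<comment> \<open>\<open>cas a * cas b = cos (a - b) + sin (a + b)\<close>; the sine part is odd
    in \<open>xi\<close> and integrates to zero.\<close>
  have "h z xi = W z * (exp (- t * (norm xi)^2) * cos (xi \<bullet> (fst z - snd z)) + exp (- t * (norm xi)^2) * sin (xi \<bullet> (fst z + snd z)))" for xi
   unfolding h_def inner_diff_right inner_add_right
   by (simp add: cos_diff sin_add inner_commute algebra_simps)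
  then have "(LBINT xi. h z xi) = W z * ((LBINT xi. exp (- t * (norm xi)^2) * cos (xi \<bullet> (fst z - snd z))) + (LBINT xi. exp (- t * (norm xi)^2) * sin (xi \<bullet> (fst z + snd z))))"
   using gi by simp
  also have "(LBINT xi. exp (- t * (norm xi)^2) * sin (xi \<bullet> (fst z + snd z))) = 0"
   using gauss_cos(3)[OF t, of "fst z + snd z"] by (simp add: inner_commute)
  also have "(LBINT xi. exp (- t * (norm xi)^2) * cos (xi \<bullet> (fst z - snd z))) = (2*pi) ^ DIM('a) * Gs t (fst z - snd z)"
   using gauss_cos(2)[OF t, of "fst z - snd z"] by (simp add: inner_commute field_simps)
  finally show ?thesis by simp
 qed
 have in2: "(LBINT z. h z xi) = exp (- t * (norm xi)^2) * (hart w xi * hart v xi)" for xi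
 proof -
  have "(LBINT z. h z xi) = exp (- t * (norm xi)^2) * (\<integral>z. (%x. w x * cas (x \<bullet> xi)) (fst z) * (%x. v x * cas (x \<bullet> xi)) (snd z) \<partial>lborel2)"
   unfolding lborel_prod integral_mult_right_zero[symmetric]
   by (intro Bochner_Integration.integral_cong) (auto simp: h_def W_def algebra_simps)
  also have "(\<integral>z. (%x. w x * cas (x \<bullet> xi)) (fst z) * (%x. v x * cas (x \<bullet> xi)) (snd z) \<partial>lborel2) = hart w xi * hart v xi"
   unfolding hart_cas[OF w] hart_cas[OF v] by (rule integral_product[OF cas_integrable[OF w] cas_integrable[OF v]])
  finally show ?thesis .
 qed
 have F: "(LBINT z. (LBINT xi. h z xi)) = (LBINT xi. (LBINT z. h z xi))"
  using lborel_pair.Fubini_integral[OF hi] by simp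
 have p: "(2*pi) ^ DIM('a) \<noteq> 0" by simp
 show "(\<integral>z. w (fst z) * v (snd z) * Gs t (fst z - snd z) \<partial>lborel2)
  = 1 / (2*pi) ^ DIM('a) * (LBINT xi. exp (- t * (norm xi)^2) * (hart w xi * hart v xi))"
 proof -
  have d: "a \<noteq> 0 ==> a * X = Y ==> X = 1 / a * Y" for a X Y :: real by auto
  show ?thesis
   by (rule d[OF p]) (use F in \<open>unfold in1 in2 lborel_prod W_def integral_mult_right_zero[of _ "(2*pi) ^ DIM('a)"]\<close>)
 qed
 have "integrable lborel (%z. (LBINT xi. h z xi))" using lborel_pair.integrable_fst'[OF hi] by simp
 then have "integrable lborel (%z. 1 / (2*pi) ^ DIM('a) * ((2*pi) ^ DIM('a) * (W z * Gs t (fst z - snd z))))"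
  unfolding in1 by (rule integrable_mult_right)
 then show "integrable lborel2 (%z. w (fst z) * v (snd z) * Gs t (fst z - snd z))"
  unfolding lborel_prod W_def by simp
qed

text \<open>Heat kernels at times \<open>(r k)^2\<close> form an approximate identity: after the
  substitution x = y + r z the Gaussian no longer depends on k, and continuity of \<open>psi\<close>
  acts under dominated convergence.\<close>

lemma approx_id:
 fixes psi eta :: "'a::euclidean_space => real"
 assumes psi: "Bd psi" "continuous_on UNIV psi" and eta: "integrable lborel eta" and r: "!!k. r k > 0" "r ~> 0"
 shows "(%k. \<integral>z. psi (fst z) * eta (snd z) * Gs ((r k)^2) (fst z - snd z) \<partial>lborel2) ~> (LBINT x. psi x * eta x)"
proof -
 have [measurable]: "psi \<in> bmeas" "eta \<in> bmeas" using psi eta by (auto simp: Bd_def)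
 obtain M where M: "!!x. \<bar>psi x\<bar> \<le> M" using psi by (auto simp: Bd_def)
 have M0: "M \<ge> 0" using M[of 0] by linarith
 define h where "h = (%k u. eta (fst u) * (psi (fst u + r k *\<^sub>R snd u) * Gs 1 (snd u)))"
 have hm[measurable]: "h k \<in> borel_measurable (borel \<Otimes>\<^sub>M borel)" for k unfolding h_def by measurable
 have dom: "integrable lborel2 (%u. M * (eta (fst u) * Gs 1 (snd u)))"
  by (intro integrable_mult_right integrable_product eta Gs_one)
 have hb: "norm (h k u) \<le> norm (M * (eta (fst u) * Gs 1 (snd u)))" for k u
 proof -
  have "\<bar>psi (fst u + r k *\<^sub>R snd u)\<bar> * (\<bar>eta (fst u)\<bar> * \<bar>Gs 1 (snd u)\<bar>) \<le> M * (\<bar>eta (fst u)\<bar> * \<bar>Gs 1 (snd u)\<bar>)"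
   by (intro mult_right_mono M) auto
  then show ?thesis using M0 by (simp add: h_def abs_mult mult.left_commute)
 qed
 have hint: "integrable lborel2 (h k)" for k
  by (rule Bochner_Integration.integrable_bound[OF dom]) (use hb in auto)
 have eq: "(\<integral>z. psi (fst z) * eta (snd z) * Gs ((r k)^2) (fst z - snd z) \<partial>lborel2) = (\<integral>u. h k u \<partial>lborel2)" for k
 proof -
  have rk: "(r k)^2 > 0" using r(1)[of k] by simp
  have i: "integrable lborel2 (%(x,y). psi x * eta y * Gs ((r k)^2) (x - y))"
   using gauss_identity(2)[OF rk Bd_int[OF psi(1)] eta] by (simp add: case_prod_unfold)
  have i': "integrable lborel2 (%(x,y). h k (x,y))" using hint[of k] by simp
  have inner: "(LBINT x. psi x * eta y * Gs ((r k)^2) (x - y)) = (LBINT z. h k (y, z))" for y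
  proof -
   have gi: "integrable lborel (%x. psi x * eta y * Gs ((r k)^2) (x - y))"
   proof (rule Bochner_Integration.integrable_bound[OF integrable_mult_right[OF Bd_int[OF psi(1)], of "eta y * Gs ((r k)^2) (0::'a)"]])
    have "\<bar>psi x\<bar> * \<bar>eta y\<bar> * Gs ((r k)^2) (x - y) \<le> \<bar>psi x\<bar> * \<bar>eta y\<bar> * Gs ((r k)^2) (0::'a)" for x
     using Gs_le[OF rk] by (intro mult_left_mono) auto
    then have "norm (psi x * eta y * Gs ((r k)^2) (x - y)) \<le> norm (eta y * Gs ((r k)^2) (0::'a) * psi x)" for x
     unfolding real_norm_def abs_mult abs_of_pos[OF Gs_pos[OF rk]] by (simp only: mult.assoc mult.commute mult.left_commute)
    then show "AE x in lborel. norm (psi x * eta y * Gs ((r k)^2) (x - y)) \<le> norm (eta y * Gs ((r k)^2) (0::'a) * psi x)"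
     by (intro AE_I2)
   qed measurable
   have sc: "r k ^ DIM('a) * Gs ((r k)^2) (r k *\<^sub>R z) = Gs 1 z" for z :: 'a
   proof -
    have A: "r k ^ DIM('a) * sqrt (pi / (r k)^2) ^ DIM('a) = sqrt pi ^ DIM('a)"
     using r(1)[of k] by (simp add: power_mult_distrib[symmetric] real_sqrt_divide)
    have Bq: "- ((norm (r k *\<^sub>R z))^2) / (4 * (r k)^2) = - ((norm z)^2) / 4"
     using r(1)[of k] by (simp add: power_mult_distrib)
    have Cq: "r k ^ DIM('a) * Gs ((r k)^2) (r k *\<^sub>R z) = 1 / (2*pi) ^ DIM('a) * ((r k ^ DIM('a) * sqrt (pi / (r k)^2) ^ DIM('a)) * exp (- ((norm (r k *\<^sub>R z))^2) / (4 * (r k)^2)))"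
     unfolding Gs_def by (simp only: mult.assoc mult.left_commute)
    show ?thesis unfolding Cq A Bq by (simp add: Gs_def)
   qed
   have "(LBINT x. psi x * eta y * Gs ((r k)^2) (x - y)) = r k ^ DIM('a) * (LBINT z. psi (y + r k *\<^sub>R z) * eta y * Gs ((r k)^2) (r k *\<^sub>R z))"
    using integral_affine[OF gi, of "r k" y] r(1)[of k] by simp
   also have "... = (LBINT z. h k (y, z))"
    unfolding integral_mult_right_zero[symmetric] h_def
    by (intro Bochner_Integration.integral_cong) (auto simp: sc[symmetric] algebra_simps)
   finally show ?thesis .
  qed
  have "(\<integral>z. psi (fst z) * eta (snd z) * Gs ((r k)^2) (fst z - snd z) \<partial>lborel2) = (LBINT y. (LBINT x. psi x * eta y * Gs ((r k)^2) (x - y)))"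
   using lborel_pair.integral_snd[OF i] by (simp add: case_prod_unfold)
  also have "... = (\<integral>u. h k u \<partial>lborel2)"
   unfolding inner using lborel_pair.integral_fst'[OF i'] by simp
  finally show ?thesis .
 qed
 have "(%k. \<integral>u. h k u \<partial>lborel2) ~> (\<integral>u. eta (fst u) * psi (fst u) * Gs 1 (snd u :: 'a) \<partial>lborel2)"
 proof (rule integral_dominated_convergence[where w="%u. norm (M * (eta (fst u) * Gs 1 (snd u :: 'a)))"])
  show "AE u in lborel2. (%k. h k u) ~> eta (fst u) * psi (fst u) * Gs 1 (snd u)"
  proof (rule AE_I2)
   fix u :: "'a \<times> 'a"
   have "(%k. fst u + r k *\<^sub>R snd u) ~> fst u + 0 *\<^sub>R snd u" by (intro tendsto_intros r)
   then have "(%k. psi (fst u + r k *\<^sub>R snd u)) ~> psi (fst u)"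
    using continuous_on_tendsto_compose[OF psi(2), of "%k. fst u + r k *\<^sub>R snd u"] by simp
   then show "(%k. h k u) ~> eta (fst u) * psi (fst u) * Gs 1 (snd u)"
    unfolding h_def mult.assoc by (intro tendsto_intros)
  qed
 qed (use dom hb in \<open>auto intro!: integrable_norm\<close>)
 also have "(\<integral>u. eta (fst u) * psi (fst u) * Gs 1 (snd u :: 'a) \<partial>lborel2) = (LBINT x. psi x * eta x)"
 proof -
  have "integrable lborel (%x. eta x * psi x)"
  proof (rule Bochner_Integration.integrable_bound[OF integrable_mult_right[OF eta, of M]])
   have "\<bar>psi x\<bar> * \<bar>eta x\<bar> \<le> M * \<bar>eta x\<bar>" for x by (intro mult_right_mono M) auto
   then show "AE x in lborel. norm (eta x * psi x) \<le> norm (M * eta x)" using M0 by (intro AE_I2) (simp add: abs_mult mult.commute)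
  qed measurable
  from integral_product[OF this Gs_one(1)] show ?thesis by (simp add: Gs_one mult.commute)
 qed
 finally show ?thesis unfolding eq .
qed

text \<open>Let the time tend to zero on both sides of \<open>gauss_identity\<close>. The test
  function makes the product of the transforms integrable, the other transform being merely
  bounded.\<close>

lemma parseval:
 fixes psi eta :: "'a::euclidean_space => real"
 assumes psi: "test_fun psi" and eta: "integrable lborel eta"
 shows "(LBINT x. psi x * eta x) = 1 / (2*pi) ^ DIM('a) * (LBINT xi. hart psi xi * hart eta xi)"
proof -
 define r where "r = (%k::nat. 1 / real (Suc k))"
 have r: "r k > 0" for k unfolding r_def by auto
 have r0: "r ~> 0" unfolding r_def using LIMSEQ_inverse_real_of_nat by (simp add: inverse_eq_divide)
 have [measurable]: "psi \<in> bmeas" "eta \<in> bmeas" using test_fun_Bd[OF psi] eta by (auto simp: Bd_def)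
 have i: "integrable lborel (%xi. hart psi xi * hart eta xi)"
 proof -
  have "integrable lborel (%xi. norm xi powr 0 * (hart psi xi * hart eta xi))" by (rule hart_weight2_integrable[OF psi eta]) simp
  moreover have "AE xi in lborel. norm xi powr 0 * (hart psi xi * hart eta xi) = hart psi xi * hart eta xi"
   using AE_lborel_singleton[of "0::'a"] by eventually_elim simp
  ultimately show ?thesis by (subst integrable_cong_AE[symmetric]) auto
 qed
 have "(%k. (LBINT xi. exp (- ((r k)^2) * (norm xi)^2) * (hart psi xi * hart eta xi))) ~> (LBINT xi. hart psi xi * hart eta xi)"
 proof (rule integral_dominated_convergence[where w="%xi. norm (hart psi xi * hart eta xi)"])
  show "AE xi in lborel. (%k. exp (- ((r k)^2) * (norm xi)^2) * (hart psi xi * hart eta xi)) ~> hart psi xi * hart eta xi"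
  proof (rule AE_I2)
   fix xi :: 'a
   have "(%k. exp (- ((r k)^2) * (norm xi)^2) * (hart psi xi * hart eta xi)) ~> exp (- (0^2) * (norm xi)^2) * (hart psi xi * hart eta xi)"
    by (intro tendsto_intros r0)
   then show "(%k. exp (- ((r k)^2) * (norm xi)^2) * (hart psi xi * hart eta xi)) ~> hart psi xi * hart eta xi" by simp
  qed
  show "AE xi in lborel. norm (exp (- ((r k)^2) * (norm xi)^2) * (hart psi xi * hart eta xi)) \<le> norm (hart psi xi * hart eta xi)" for k
   by (intro AE_I2) (auto simp: abs_mult intro!: mult_left_le_one_le)
 qed (use i in \<open>auto intro!: integrable_norm\<close>)
 from tendsto_mult_left[OF this, of "1 / (2*pi) ^ DIM('a)"]
 have "(%k. \<integral>z. psi (fst z) * eta (snd z) * Gs ((r k)^2) (fst z - snd z) \<partial>lborel2) ~> 1 / (2*pi) ^ DIM('a) * (LBINT xi. hart psi xi * hart eta xi)"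
  unfolding gauss_identity(1)[OF zero_less_power[OF r] Bd_int[OF test_fun_Bd[OF psi]] eta] .
 moreover have "(%k. \<integral>z. psi (fst z) * eta (snd z) * Gs ((r k)^2) (fst z - snd z) \<partial>lborel2) ~> (LBINT x. psi x * eta x)"
  using psi smooth_fun_continuous by (intro approx_id test_fun_Bd eta r r0) (auto simp: test_fun_iff)
 ultimately show ?thesis using LIMSEQ_unique by blast
qed

text \<open>The positive and negative parts of \<open>F\<close>, taken as densities, are finite
  measures that agree on the intersection-stable system of boxes.\<close>

lemma AE_zero_if_boxes:
 fixes F :: "'a::euclidean_space => real"
 assumes F: "integrable lborel F" and z: "!!l u. (LBINT x. F x * indicator (box l u) x) = 0"
 shows "AE x in lborel. F x = 0"
proof -
 have [measurable]: "F \<in> bmeas" using F by auto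
 define P where "P = density lborel (%x. ennreal (F x))"
 define N where "N = density lborel (%x. ennreal (- F x))"
 let ?E = "range (%(a, b). box a b::'a set)"
 have box: "emeasure P (box l u) = emeasure N (box l u)" for l u
 proof -
  have i: "integrable lborel (%x. F x * indicator (box l u) x)" using F by (intro integrable_real_mult_indicator) auto
  have i1: "integrable lborel (%x. max 0 (F x * indicator (box l u) x))" and i2: "integrable lborel (%x. max 0 (- (F x * indicator (box l u) x)))"
   using i by auto
  have "(LBINT x. max 0 (F x * indicator (box l u) x) - max 0 (- (F x * indicator (box l u) x))) = (LBINT x. F x * indicator (box l u) x)"
   by (intro Bochner_Integration.integral_cong) auto
  then have e: "(LBINT x. max 0 (F x * indicator (box l u) x)) = (LBINT x. max 0 (- (F x * indicator (box l u) x)))"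
   using i1 i2 z[of l u] by simp
  have "emeasure P (box l u) = (NN x. ennreal (max 0 (F x * indicator (box l u) x)))"
   unfolding P_def by (subst emeasure_density) (auto intro!: nn_integral_cong simp: indicator_def max_def ennreal_neg)
  also have "... = ennreal (LBINT x. max 0 (F x * indicator (box l u) x))" using i1 by (subst nn_integral_eq_integral) auto
  also have "... = ennreal (LBINT x. max 0 (- (F x * indicator (box l u) x)))" using e by simp
  also have "... = (NN x. ennreal (max 0 (- (F x * indicator (box l u) x))))" using i2 by (subst nn_integral_eq_integral) auto
  also have "... = emeasure N (box l u)"
   unfolding N_def by (subst emeasure_density) (auto intro!: nn_integral_cong simp: indicator_def max_def ennreal_neg)
  finally show ?thesis .
 qed
 have fin: "(NN x. ennreal (F x)) \<noteq> \<infinity>"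
 proof -
  have "(NN x. ennreal (F x)) \<le> (NN x. ennreal (norm (F x)))" by (intro nn_integral_mono ennreal_leI) auto
  also have "... < \<infinity>" using F by (simp add: integrable_iff_bounded)
  finally show ?thesis by simp
 qed
 have "P = N"
 proof (rule measure_eqI_generator_eq[where E="?E" and \<Omega>=UNIV and A="%n::nat. box (- (real n *\<^sub>R One)) (real n *\<^sub>R One)"])
  show "Int_stable ?E" by (auto simp: Int_stable_def box_Int_box)
  show "sets P = sigma_sets UNIV ?E" "sets N = sigma_sets UNIV ?E" by (simp_all add: P_def N_def borel_eq_box)
  show "range (%n::nat. box (- (real n *\<^sub>R One)) (real n *\<^sub>R One)) \<subseteq> ?E" by auto
  show "(\<Union>i::nat. box (- (real i *\<^sub>R One)) (real i *\<^sub>R One)) = (UNIV::'a set)" by (rule UN_box_eq_UNIV)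
  show "emeasure P (box (- (real i *\<^sub>R One)) (real i *\<^sub>R One)) \<noteq> \<infinity>" for i :: nat
  proof -
   have "emeasure P (box (- (real i *\<^sub>R One)) (real i *\<^sub>R One)) \<le> emeasure P UNIV" by (intro emeasure_mono) (auto simp: P_def)
   also have "... = (NN x. ennreal (F x))" unfolding P_def by (subst emeasure_density) auto
   finally show ?thesis using fin by (metis top.extremum_uniqueI infinity_ennreal_def)
  qed
 qed (use box in auto)
 then have "AE x in lborel. ennreal (F x) = ennreal (- F x)"
  unfolding P_def N_def using fin by (subst (asm) finite_density_unique) auto
 then show ?thesis
 proof eventually_elim
  case (elim x)
  then show "F x = 0" by (cases "F x \<ge> 0") (auto simp: ennreal_neg)
 qed
qed

text \<open>By \<open>gauss_identity\<close> every heat-regularised pairing with \<open>F\<close>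
  vanishes, hence by \<open>approx_id\<close> every pairing with a continuous function in
  \<open>Bd\<close>, and these approximate the indicators of boxes.\<close>

lemma hart_injective:
 fixes F :: "'a::euclidean_space => real"
 assumes F: "integrable lborel F" and z: "!!xi. hart F xi = 0"
 shows "AE x in lborel. F x = 0"
proof -
 have [measurable]: "F \<in> bmeas" using F by auto
 define r where "r = (%k::nat. 1 / real (Suc k))"
 have r: "r k > 0" for k unfolding r_def by auto
 have r0: "r ~> 0" unfolding r_def using LIMSEQ_inverse_real_of_nat by (simp add: inverse_eq_divide)
 have c: "(LBINT x. psi x * F x) = 0" if "Bd psi" "continuous_on UNIV psi" for psi
 proof -
  have "(\<integral>z. psi (fst z) * F (snd z) * Gs ((r k)^2) (fst z - snd z) \<partial>lborel2) = 0" for k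
   using r[of k] by (subst gauss_identity(1)[OF _ Bd_int[OF that(1)] F]) (auto simp: z)
  with approx_id[OF that F r r0] show ?thesis by (simp add: LIMSEQ_const_iff)
 qed
 show ?thesis
 proof (rule AE_zero_if_boxes[OF F])
  fix l u :: 'a
  show "(LBINT x. F x * indicator (box l u) x) = 0"
  proof (cases "box l u = {}")
   case False
   \<comment> \<open>Continuous, zero off the box, and increasing with k to its indicator.\<close>
   define psi where "psi = (%k::nat. %x. min 1 (real k * infdist x (- box l u)))"
   have ne: "- box l u \<noteq> {}" by (metis bounded_box not_bounded_UNIV double_compl compl_bot_eq)
   have cl: "closed (- box l u)" using open_box closed_Compl by blast
   have psic: "continuous_on UNIV (psi k)" for k unfolding psi_def by (intro continuous_intros)
   have out: "psi k x = 0" if "x \<notin> box l u" for k x using that ne by (simp add: psi_def infdist_zero)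
   have psiB: "Bd (psi k)" for k
    by (rule Bd_continuous_support[OF psic]) (rule bounded_subset[OF bounded_box[of l u]], use out in auto)
   have "(%k. (LBINT x. psi k x * F x)) ~> (LBINT x. F x * indicator (box l u) x)"
   proof (rule integral_dominated_convergence[where w="%x. norm (F x)"])
    show "AE x in lborel. (%k. psi k x * F x) ~> F x * indicator (box l u) x"
    proof (rule AE_I2)
     fix x
     show "(%k. psi k x * F x) ~> F x * indicator (box l u) x"
     proof (cases "x \<in> box l u")
      case True
      then have "infdist x (- box l u) > 0" using in_closed_iff_infdist_zero[OF cl ne, of x] infdist_nonneg[of x "- box l u"] by auto
      then obtain m :: nat where "real m * infdist x (- box l u) > 1" using reals_Archimedean3 by blast
      then have "real k * infdist x (- box l u) \<ge> 1" if "k \<ge> m" for k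
       using that mult_right_mono[of "real m" "real k" "infdist x (- box l u)"] infdist_nonneg[of x "- box l u"] by linarith
      then have "psi k x * F x = F x * indicator (box l u) x" if "k \<ge> m" for k using that True by (simp add: psi_def)
      then show ?thesis by (intro tendsto_eventually) (auto simp: eventually_sequentially)
     qed (simp add: out)
    qed
    show "AE x in lborel. norm (psi k x * F x) \<le> norm (F x)" for k
     by (intro AE_I2) (auto simp: psi_def abs_mult infdist_nonneg intro!: mult_left_le_one_le)
    show "!!k. (%x. psi k x * F x) \<in> borel_measurable lborel" using Bd_meas[OF psiB] by auto
   qed (use F in auto)
   then show ?thesis unfolding c[OF psiB psic] by (simp add: LIMSEQ_const_iff)
  qed simp
 qed
qed

text \<open>The powers of t make the family closed under differentiation up to linear combinations,
  the form needed for coinductive smoothness; \<open>k = 0\<close> is the classical flat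
  function.\<close>

definition bexp :: "nat => real => real" where
 "bexp k t = (if t > 0 then exp (- (1 / t)) / t ^ k else 0)"

lemma bexp_lim: "(bexp k \<longlongrightarrow> 0) (at 0)"
proof (rule filterlim_split_at_real)
 have "((%t::real. (inverse t) ^ k / exp (inverse t)) \<longlongrightarrow> 0) (at_right 0)"
  using filterlim_compose[OF tendsto_power_div_exp_0[of k] filterlim_inverse_at_top_right] .
 moreover have "eventually (%t::real. (inverse t) ^ k / exp (inverse t) = bexp k t) (at_right 0)"
  unfolding eventually_at_right_field
  by (intro exI[of _ 1]) (auto simp: bexp_def exp_minus field_simps)
 ultimately show "(bexp k \<longlongrightarrow> 0) (at_right 0)" by (rule Lim_transform_eventually)
 have "eventually (%t::real. 0 = bexp k t) (at_left 0)"
  unfolding eventually_at_left_field by (intro exI[of _ "-1"]) (auto simp: bexp_def)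
 then show "(bexp k \<longlongrightarrow> 0) (at_left 0)" by (rule Lim_transform_eventually[OF tendsto_const])
qed

lemma bexp_deriv: "(bexp k has_real_derivative bexp (k + 2) t - real k * bexp (k + 1) t) (at t)"
proof -
 consider "t > 0" | "t < 0" | "t = 0" by linarith
 then show ?thesis
 proof cases
  case 1
  have e: "((%t. exp (- (1 / t)) / t ^ k) has_real_derivative exp (- (1 / t)) / t ^ (k + 2) - real k * (exp (- (1 / t)) / t ^ (k + 1))) (at t)"
  proof (cases k)
   case 0
   then show ?thesis using 1 by (auto intro!: derivative_eq_intros simp: power2_eq_square)
  next
   case (Suc j)
   then show ?thesis using 1
    by (auto intro!: derivative_eq_intros simp: divide_simps) (simp add: algebra_simps power2_eq_square power_add, cases j, auto)
  qed
  have "(bexp k has_real_derivative exp (- (1 / t)) / t ^ (k + 2) - real k * (exp (- (1 / t)) / t ^ (k + 1))) (at t)"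
   by (rule has_field_derivative_transform_within_open[OF e, of "{0<..}"]) (use 1 in \<open>auto simp: bexp_def\<close>)
  then show ?thesis using 1 by (simp add: bexp_def)
 next
  case 2
  have "(bexp k has_real_derivative 0) (at t)"
   by (rule has_field_derivative_transform_within_open[of "%_. 0" _ _ "{..<0}"]) (use 2 in \<open>auto simp: bexp_def\<close>)
  then show ?thesis using 2 by (simp add: bexp_def)
 next
  case 3
  have "((%h. (bexp k h - bexp k 0) / (h - 0)) \<longlongrightarrow> 0) (at 0)"
  proof (rule Lim_transform_eventually[OF bexp_lim[of "k + 1"]])
   show "eventually (%h. bexp (k + 1) h = (bexp k h - bexp k 0) / (h - 0)) (at 0)"
    by (intro always_eventually) (auto simp: bexp_def)
  qed
  then have "(bexp k has_real_derivative 0) (at 0)" by (simp add: has_field_derivative_iff)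
  then show ?thesis using 3 by (simp add: bexp_def)
 qed
qed

text \<open>An algebra that contains the bump and is closed under directional derivatives: the
  coinduction set for its smoothness.\<close>

inductive_set bumps :: "('a::euclidean_space => real) set" where
 const: "(%x. c) \<in> bumps"
| inner: "(%x. x \<bullet> v) \<in> bumps"
| bexp: "(%x. bexp k (1 - x \<bullet> x)) \<in> bumps"
| add: "f \<in> bumps ==> g \<in> bumps ==> (%x. f x + g x) \<in> bumps"
| mult: "f \<in> bumps ==> g \<in> bumps ==> (%x. f x * g x) \<in> bumps"

lemma bumps_deriv:
 assumes "f \<in> bumps"
 shows "\<exists>D. (\<forall>x. (f has_derivative D x) (at x)) \<and> (\<forall>v. (%x. D x v) \<in> bumps)"
 using assms
proof induction
 case (const c)
 show ?case by (intro exI[of _ "%x v. 0"]) (auto intro: bumps.intros)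
next
 case (inner v)
 show ?case by (intro exI[of _ "%x w. w \<bullet> v"]) (auto intro: bumps.intros intro!: derivative_eq_intros)
next
 case (bexp k)
 let ?D = "%x v. (bexp (k + 2) (1 - x \<bullet> x) - real k * bexp (k + 1) (1 - x \<bullet> x)) * (- 2 * (x \<bullet> v))"
 have "((%x. bexp k (1 - x \<bullet> x)) has_derivative ?D x) (at x)" for x :: 'a
 proof -
  have 1: "((%x::'a. 1 - x \<bullet> x) has_derivative (%v. - 2 * (x \<bullet> v))) (at x)"
   by (auto intro!: derivative_eq_intros simp: inner_commute)
  have 2: "(bexp k has_derivative (%h. (bexp (k + 2) (1 - x \<bullet> x) - real k * bexp (k + 1) (1 - x \<bullet> x)) * h)) (at (1 - x \<bullet> x))"
   using bexp_deriv[of k "1 - x \<bullet> x"] by (simp add: has_field_derivative_def)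
  show ?thesis using has_derivative_compose[OF 1 2] .
 qed
 moreover have "(%x. ?D x v) \<in> bumps" for v
 proof -
  have "(%x. (bexp (k + 2) (1 - x \<bullet> x) + (- real k) * bexp (k + 1) (1 - x \<bullet> x)) * ((- 2) * (x \<bullet> v))) \<in> bumps"
   by (intro bumps.intros)
  then show ?thesis by simp
 qed
 ultimately show ?case by (intro exI[of _ ?D] conjI allI)
next
 case (add f g)
 then obtain D E where "!!x. (f has_derivative D x) (at x)" "!!v. (%x. D x v) \<in> bumps"
  "!!x. (g has_derivative E x) (at x)" "!!v. (%x. E x v) \<in> bumps" by blast
 then show ?case by (intro exI[of _ "%x v. D x v + E x v"]) (auto intro!: bumps.add has_derivative_add)
next
 case (mult f g)
 then obtain D E where "!!x. (f has_derivative D x) (at x)" "!!v. (%x. D x v) \<in> bumps"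
  "!!x. (g has_derivative E x) (at x)" "!!v. (%x. E x v) \<in> bumps" by blast
 then show ?case using mult.hyps
  by (intro exI[of _ "%x v. f x * E x v + D x v * g x"]) (auto intro!: bumps.add bumps.mult has_derivative_mult)
qed

lemma bumps_smooth: "f \<in> bumps ==> smooth_fun f"
proof (rule smooth_fun_coinductI[where X=bumps])
 fix f D v assume f: "f \<in> bumps" and D: "!!x. (f has_derivative D x) (at x)"
 from bumps_deriv[OF f] obtain E where E: "!!x. (f has_derivative E x) (at x)" "!!v. (%x. E x v) \<in> bumps" by blast
 have "D x = E x" for x using has_derivative_unique[OF D E(1)] .
 then show "(%x. D x v) \<in> bumps" using E(2) by simp
qed (use bumps_deriv in blast)+

definition bump0 :: "'a::euclidean_space => real" where "bump0 x = bexp 0 (1 - x \<bullet> x)"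

lemma bump0: "test_fun (bump0 :: 'a::euclidean_space => real)" "bump0 x \<ge> 0" "bump0 (- x) = bump0 (x::'a)"
 "bump0 (0::'a) > 0" "norm x \<ge> 1 ==> bump0 (x::'a) = 0"
proof -
 have z: "bump0 x = 0" if "norm x \<ge> 1" for x :: 'a
 proof -
  have "x \<bullet> x \<ge> 1" using that by (metis dot_square_norm one_le_power)
  then show ?thesis by (simp add: bump0_def bexp_def)
 qed
 have "bounded {x::'a. bump0 x \<noteq> 0}" unfolding bounded_iff using z by (intro exI[of _ 1]) force
 moreover have "smooth_fun (bump0 :: 'a => real)" unfolding bump0_def[abs_def] by (intro bumps_smooth bumps.intros)
 ultimately show "test_fun (bump0 :: 'a => real)" by (simp add: test_fun_iff)
 show "norm x \<ge> 1 ==> bump0 (x::'a) = 0" by (rule z)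
qed (auto simp: bump0_def bexp_def)

lemma integral_pos_continuous:
 fixes f :: "'a::euclidean_space => real"
 assumes "integrable lborel f" "continuous_on UNIV f" "!!x. f x \<ge> 0" "f a > 0"
 shows "(LBINT x. f x) > 0"
proof (rule ccontr)
 assume "\<not> ?thesis"
 then have "(LBINT x. f x) = 0" using assms(3) by (meson Bochner_Integration.integral_nonneg antisym not_less)
 then have ae: "AE x in lborel. f x = 0" using assms by (subst (asm) integral_nonneg_eq_0_iff_AE) auto
 have "open {x. 0 < f x}" using assms(2) by (intro open_Collect_less continuous_intros) auto
 then obtain e where e: "e > 0" "ball a e \<subseteq> {x. 0 < f x}" using assms(4) open_contains_ball by blast
 have "AE x in lborel. \<not> x \<in> ball a e" using ae by eventually_elim (use e in auto)
 then have "emeasure lborel {x \<in> space lborel. x \<in> ball a e} = 0" by (rule emeasure_eq_0_AE)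
 then have "emeasure lborel (ball a e) = 0" by (simp only: space_lborel space_borel UNIV_I simp_thms Collect_mem_eq)
 moreover have "emeasure lborel (ball a e) > 0"
  using emeasure_ball[of e a] e by (simp add: ennreal_zero_less_mult_iff)
 ultimately show False by simp
qed

text \<open>Weighted transforms of test functions have trivial orthogonal complement. Fix a test
  function whose transform is positive on a large ball. Orthogonality to all its translates says
  that g times its weighted transform has vanishing Hartley transform, so injectivity
  applies.\<close>

lemma hart_weight_dense:
 fixes g :: "'a::euclidean_space => real"
 assumes gm[measurable]: "g \<in> bmeas"
  and gi: "!!psi. test_fun psi ==> integrable lborel (%xi. g xi * (norm xi powr a * hart psi xi))"
  and g0: "!!psi. test_fun psi ==> (LBINT xi. g xi * (norm xi powr a * hart psi xi)) = 0"
 shows "AE xi in lborel. g xi = 0"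
proof -
 have loc: "AE xi in lborel. norm xi < real R \<longrightarrow> xi \<noteq> 0 \<longrightarrow> g xi = 0" for R :: nat
 proof -
  \<comment> \<open>The support radius \<open>1 / c\<close> keeps \<open>x \<bullet> xi\<close>
    within [-1, 1] for \<open>norm xi < R\<close>. There the cosine is positive, and so is the
    transform of \<open>phi\<close>.\<close>
  define c where "c = real R + 1"
  have c: "c > 0" unfolding c_def by simp
  define phi where "phi = (%x::'a. bump0 (c *\<^sub>R x))"
  have phit: "test_fun phi" using test_fun_affine[OF bump0(1), of c 0] c by (simp add: phi_def)
  have phiB: "Bd phi" by (rule test_fun_Bd[OF phit])
  have [measurable]: "phi \<in> bmeas" using phiB by (rule Bd_meas)
  have phie: "phi (- x) = phi x" for x by (simp add: phi_def bump0(3)[of "c *\<^sub>R x"])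
  have phi0: "phi x \<ge> 0" for x by (simp add: phi_def bump0)
  have phis: "phi x = 0" if "norm x \<ge> 1 / c" for x using that c bump0(5)[of "c *\<^sub>R x"] by (simp add: phi_def field_simps)
  note ti = trig_integrable[OF Bd_int[OF phiB]]
  have sz: "sinT phi xi = 0" for xi unfolding sinT_def
   by (rule integral_odd_zero[OF ti(2)]) (simp add: phie)
  have hpos: "hart phi xi > 0" if "norm xi < real R" for xi
  proof -
   have "hart phi xi = (LBINT x. phi x * cos (x \<bullet> xi))" using sz by (simp add: hart_def cosT_def)
   moreover have "(LBINT x. phi x * cos (x \<bullet> xi)) > 0"
   proof (rule integral_pos_continuous[OF ti(1), where a=0])
    show "continuous_on UNIV (%x. phi x * cos (x \<bullet> xi))"
     using phit smooth_fun_continuous by (intro continuous_intros) (auto simp: test_fun_iff)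
    show "phi 0 * cos (0 \<bullet> xi) > 0" by (simp add: phi_def bump0)
    fix x
    show "phi x * cos (x \<bullet> xi) \<ge> 0"
    proof (cases "norm x \<ge> 1 / c")
     case False
     have "\<bar>x \<bullet> xi\<bar> \<le> norm x * norm xi" by (rule Cauchy_Schwarz_ineq2)
     also have "... \<le> (1 / c) * c" using False that by (intro mult_mono) (auto simp: c_def)
     also have "... = 1" using c by simp
     finally have "\<bar>x \<bullet> xi\<bar> \<le> 1" .
     then have "cos (x \<bullet> xi) \<ge> 0" using pi_gt3 by (intro cos_ge_zero) auto
     then show ?thesis using phi0 by simp
    qed (simp add: phis)
   qed
   ultimately show ?thesis by simp
  qed
  define F where "F = (%xi. g xi * (norm xi powr a * hart phi xi))"
  have Fi: "integrable lborel F" unfolding F_def by (rule gi[OF phit])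
  \<comment> \<open>For an even function a translation by t multiplies the transform by the cosine
    minus the sine of \<open>t \<bullet> xi\<close>; orthogonality to the translates therefore reads
    \<open>hart F (- t) = 0\<close>.\<close>
  have tr: "hart (%x. phi (x + t)) xi = hart phi xi * cos (t \<bullet> xi) - hart phi xi * sin (t \<bullet> xi)" for t xi
  proof -
   have "hart (%x. phi (x + t)) xi = (LBINT x. phi (x + t) * cas (x \<bullet> xi))"
    by (rule hart_cas[OF integrable_translate[OF Bd_int[OF phiB]]])
   also have "... = (LBINT x. phi x * cas ((x - t) \<bullet> xi))"
   proof -
    have "integrable lborel (%x. phi x * cas ((x - t) \<bullet> xi))"
     by (rule Bochner_Integration.integrable_bound[OF integrable_mult_right[OF Bd_int[OF phiB], of 2]])
      (auto simp: abs_mult mult.commute intro!: AE_I2 mult_left_mono cas_bound)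
    from integral_translate[OF this, of t] show ?thesis by simp
   qed
   also have "... = (LBINT x. (cos (t \<bullet> xi) - sin (t \<bullet> xi)) * (phi x * cos (x \<bullet> xi)) + (cos (t \<bullet> xi) + sin (t \<bullet> xi)) * (phi x * sin (x \<bullet> xi)))"
    by (intro Bochner_Integration.integral_cong) (auto simp: inner_diff_left cos_diff sin_diff algebra_simps)
   also have "... = (cos (t \<bullet> xi) - sin (t \<bullet> xi)) * cosT phi xi + (cos (t \<bullet> xi) + sin (t \<bullet> xi)) * sinT phi xi"
    using ti[of xi] by (simp add: cosT_def sinT_def)
   finally show ?thesis using sz[of xi] by (simp add: hart_def algebra_simps)
  qed
  note Ft = trig_integrable[OF Fi]
  have "cosT F t - sinT F t = 0" for t
  proof -
   have tt: "test_fun (%x. phi (x + t))" using test_fun_affine[OF phit, of 1 t] by (simp add: add.commute)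
   have "cosT F t - sinT F t = (LBINT xi. F xi * cos (xi \<bullet> t) - F xi * sin (xi \<bullet> t))"
    using Ft[of t] by (simp add: cosT_def sinT_def)
   also have "... = (LBINT xi. g xi * (norm xi powr a * hart (%x. phi (x + t)) xi))"
    by (intro Bochner_Integration.integral_cong) (auto simp: tr F_def inner_commute algebra_simps)
   also have "... = 0" by (rule g0[OF tt])
   finally show ?thesis .
  qed
  then have "hart F xi = 0" for xi by (metis (no_types, opaque_lifting) hart_def trig_even diff_minus_eq_add minus_minus)
  from hart_injective[OF Fi this] show ?thesis
  proof eventually_elim
   case (elim xi)
   then show ?case using hpos[of xi] unfolding F_def by auto
  qed
 qed
 have "AE xi in lborel. \<forall>R::nat. norm xi < real R \<longrightarrow> xi \<noteq> 0 \<longrightarrow> g xi = 0" unfolding AE_all_countable using loc by blast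
 with AE_lborel_singleton[of "0::'a"] show ?thesis
 proof eventually_elim
  case (elim xi)
  obtain R :: nat where "norm xi < real R" using reals_Archimedean2 by blast
  then show ?case using elim by blast
 qed
qed

section \<open>Frequency weight and Riesz kernel as mixtures of Gaussians\<close>

lemma powr_le_exp:
 fixes m :: real assumes "m \<ge> 0"
 obtains C where "C > 0" "!!x. x \<ge> 0 ==> x powr m \<le> C * exp x"
proof (rule that[of "fact (nat \<lceil>m\<rceil>)"])
 fix x :: real assume x: "x \<ge> 0"
 let ?k = "nat \<lceil>m\<rceil>"
 have km: "m \<le> real ?k" by linarith
 have f1: "fact ?k \<ge> (1::real)" by simp
 show "x powr m \<le> fact ?k * exp x"
 proof (cases "x \<ge> 1")
  case True
  have "x powr m \<le> x powr real ?k" using True km by (intro powr_mono) auto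
  also have "... = x ^ ?k" using True by (simp add: powr_realpow)
  also have "x ^ ?k / fact ?k \<le> (\<Sum>n. x ^ n / fact n)"
  proof -
   have s: "summable (%n. x ^ n / fact n)" using summable_exp[of x] by (simp add: field_simps inverse_eq_divide)
   have "(\<Sum>n\<in>{?k}. x ^ n / fact n) \<le> (\<Sum>n. x ^ n / fact n)" by (rule sum_le_suminf[OF s]) (use x in auto)
   then show ?thesis by simp
  qed
  then have "x ^ ?k \<le> fact ?k * exp x" by (simp add: exp_def field_simps scaleR_conv_of_real)
  finally show ?thesis .
 next
  case False
  then have "x powr m \<le> 1" using x assms by (simp add: powr_le1)
  also have "1 \<le> fact ?k * exp x" using mult_mono[OF f1, of 1 "exp x"] x by simp
  finally show ?thesis .
 qed
qed simp

context crit
begin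

definition kap :: real where "kap = 1 / (2*pi) ^ DIM('a)"
lemma kap_pos: "kap > 0" unfolding kap_def by simp

text \<open>\<open>g1\<close> is Gamma(s), and \<open>h1\<close> is the same weight
  \<open>t powr (s - 1)\<close> integrated against the heat kernel at distance 1. As elements of
  \<open>ennreal\<close> both can be used in scaling identities before they are known to be
  finite.\<close>

definition g1 :: ennreal where "g1 = (NN t. indicator {0<..} t * ennreal (t powr (s - 1) * exp (- t)))"
definition h1 :: ennreal where "h1 = (NN t. indicator {0<..} t * ennreal (t powr (s - 1) * (kap * ((pi / t) powr (nn / 2) * exp (- (1 / (4 * t)))))))"

lemma nn_integral_indicator_pos:
 fixes f :: "real => real"
 assumes [measurable]: "f \<in> bmeas" and "!!t. t > 0 ==> f t > 0"
 shows "(NN t. indicator {0<..} t * ennreal (f t)) > 0"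
proof (rule ccontr)
 assume "\<not> ?thesis"
 then have "(NN t. indicator {0<..} t * ennreal (f t)) = 0" by (simp add: not_less)
 then have "AE t in lborel. indicator {0<..} t * ennreal (f t) = 0" by (subst (asm) nn_integral_0_iff_AE) auto
 then have "AE t in lborel. \<not> t \<in> {0<..<1::real}"
  by eventually_elim (use assms(2) in \<open>force simp: indicator_def split: if_splits\<close>)
 then have "emeasure lborel {t \<in> space lborel. t \<in> {0<..<1::real}} = 0" by (rule emeasure_eq_0_AE)
 then have "emeasure lborel {0<..<1::real} = 0" by (simp only: space_lborel space_borel UNIV_I simp_thms Collect_mem_eq)
 then show False by simp
qed

lemma g1: "g1 < \<infinity>" "g1 > 0"
proof -
 show "g1 > 0" unfolding g1_def by (rule nn_integral_indicator_pos) auto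
 \<comment> \<open>The exponent \<open>s + 1\<close> leaves \<open>t powr (- 2)\<close> at infinity;
   near 0 integrability rests on \<open>s - 1 > - 1\<close>.\<close>
 obtain C where C: "C > 0" "!!x. x \<ge> 0 ==> x powr (s + 1) \<le> C * exp x" using powr_le_exp[of "s + 1"] s0 by auto
 define b where "b = max 0 (1 - s)"
 have b: "0 \<le> b" "b < real DIM(real)" unfolding b_def using s0 by auto
 obtain C0 where C0: "!!r. r > 0 ==> (NN x. indicator (ball 0 r) (x::real) * ennreal (norm x powr (- b))) \<le> ennreal (C0 * r powr (real DIM(real) - b))"
  using radial_near[OF b] by metis
 obtain C1 where C1: "!!r. r > 0 ==> (NN x. indicator {x. norm x \<ge> r} (x::real) * ennreal (norm x powr (- 2))) \<le> ennreal (C1 * r powr (real DIM(real) - 2))"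
  using radial_far[where 'a=real, of 2] by auto
 have "g1 \<le> (NN x. indicator (ball 0 1) (x::real) * ennreal (norm x powr (- b)) + ennreal C * (indicator {x. norm x \<ge> 1} x * ennreal (norm x powr (- 2))))"
  unfolding g1_def
 proof (rule nn_integral_mono)
  fix t :: real
  show "indicator {0<..} t * ennreal (t powr (s - 1) * exp (- t)) \<le> indicator (ball 0 1) t * ennreal (norm t powr (- b)) + ennreal C * (indicator {x. norm x \<ge> 1} t * ennreal (norm t powr (- 2)))"
  proof (cases "t > 0")
   case t: True
   show ?thesis
   proof (cases "t < 1")
    case True
    have "t powr (s - 1) \<le> t powr (- b)" using t True unfolding b_def by (intro powr_mono') auto
    then have "t powr (s - 1) * exp (- t) \<le> t powr (- b)" using t by (smt (verit) mult_left_le exp_le_one_iff powr_ge_zero)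
    then show ?thesis using t True by (auto simp: indicator_def dist_real_def intro!: ennreal_leI)
   next
    case False
    have "t powr (s + 1) * exp (- t) \<le> C" using C(2)[of t] t by (simp add: exp_minus field_simps)
    then have "t powr (s + 1) * exp (- t) * t powr (- 2) \<le> C * t powr (- 2)" by (intro mult_right_mono) auto
    moreover have "t powr (s + 1) * exp (- t) * t powr (- 2) = t powr (s - 1) * exp (- t)" using powr_add[of t "s + 1" "-2"] by simp
    ultimately show ?thesis using t False C(1) by (auto simp: indicator_def ennreal_mult[symmetric] intro!: ennreal_leI)
   qed
  qed auto
 qed
 also have "... = (NN x. indicator (ball 0 1) (x::real) * ennreal (norm x powr (- b))) + ennreal C * (NN x. indicator {x. norm x \<ge> 1} (x::real) * ennreal (norm x powr (- 2)))"
  by (subst nn_integral_add) (auto simp: nn_integral_cmult intro!: borel_measurable_times_ennreal borel_measurable_indicator)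
 also have "... \<le> ennreal (C0 * 1 powr (real DIM(real) - b)) + ennreal C * ennreal (C1 * 1 powr (real DIM(real) - 2))"
  by (intro add_mono mult_left_mono C0 C1) auto
 also have "... < \<infinity>" by (simp add: ennreal_mult_less_top)
 finally show "g1 < \<infinity>" .
qed

lemma h1: "h1 < \<infinity>" "h1 > 0"
proof -
 show "h1 > 0" unfolding h1_def by (rule nn_integral_indicator_pos) (auto simp: kap_pos)
 define D where "D = kap * pi powr (nn / 2)"
 have D: "D > 0" unfolding D_def using kap_pos by simp
 \<comment> \<open>\<open>- m\<close> is the total power of t, namely \<open>s - 1 - nn / 2\<close>.
   Since \<open>m > 1\<close> it is integrable at infinity, and near 0 the exponential suppresses
   it.\<close>
 define m where "m = lam / 2 + 1"
 have m: "m > 1" unfolding m_def using lam_pos by simp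
 have e: "t powr (s - 1) * (kap * ((pi / t) powr (nn / 2) * exp (- (1 / (4 * t))))) = D * (t powr (- m) * exp (- (1 / (4 * t))))" if "t > 0" for t
 proof -
  have "t powr (- m) = t powr (s - 1) * t powr (- (nn / 2))"
  proof -
   have "- m = (s - 1) + - (nn / 2)" unfolding m_def by (simp add: field_simps)
   then show ?thesis by (simp only: powr_add)
  qed
  moreover have "(pi / t) powr (nn / 2) = pi powr (nn / 2) * t powr (- (nn / 2))" using that by (simp add: powr_divide powr_minus_divide)
  ultimately show ?thesis unfolding D_def by simp
 qed
 obtain C where C: "C > 0" "!!x. x \<ge> 0 ==> x powr m \<le> C * exp x" using powr_le_exp[of m] m by auto
 obtain C1 where C1: "!!r. r > 0 ==> (NN x. indicator {x. norm x \<ge> r} (x::real) * ennreal (norm x powr (- m))) \<le> ennreal (C1 * r powr (real DIM(real) - m))"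
  using radial_far[where 'a=real, of m] m by auto
 have "h1 \<le> (NN x. ennreal (D * (4 powr m * C)) * indicator {0<..<1} (x::real) + ennreal D * (indicator {x. norm x \<ge> 1} x * ennreal (norm x powr (- m))))"
  unfolding h1_def
 proof (rule nn_integral_mono)
  fix t :: real
  show "indicator {0<..} t * ennreal (t powr (s - 1) * (kap * ((pi / t) powr (nn / 2) * exp (- (1 / (4 * t)))))) \<le> ennreal (D * (4 powr m * C)) * indicator {0<..<1} t + ennreal D * (indicator {x. norm x \<ge> 1} t * ennreal (norm t powr (- m)))"
  proof (cases "t > 0")
   case t: True
   show ?thesis
   proof (cases "t < 1")
    case True
    have "(1 / (4 * t)) powr m \<le> C * exp (1 / (4 * t))" using t by (intro C(2)) auto
    then have "(1 / (4 * t)) powr m * exp (- (1 / (4 * t))) \<le> C" by (simp add: exp_minus field_simps)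
    then have "4 powr m * ((1 / (4 * t)) powr m * exp (- (1 / (4 * t)))) \<le> 4 powr m * C" by (intro mult_left_mono) auto
    moreover have "4 powr m * (1 / (4 * t)) powr m = t powr (- m)" using t by (simp add: powr_divide powr_mult powr_minus_divide)
    ultimately have "t powr (- m) * exp (- (1 / (4 * t))) \<le> 4 powr m * C" by (simp add: mult.assoc[symmetric])
    then have "D * (t powr (- m) * exp (- (1 / (4 * t)))) \<le> D * (4 powr m * C)" using D by (intro mult_left_mono) auto
    then show ?thesis using t True by (simp add: e indicator_def ennreal_leI)
   next
    case False
    have "t powr (- m) * exp (- (1 / (4 * t))) \<le> t powr (- m)" using t by (intro mult_left_le) auto
    then have "D * (t powr (- m) * exp (- (1 / (4 * t)))) \<le> D * t powr (- m)" using D by (intro mult_left_mono) auto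
    then show ?thesis using t False D by (simp add: e indicator_def ennreal_mult[symmetric] ennreal_leI)
   qed
  qed auto
 qed
 also have "... = ennreal (D * (4 powr m * C)) * emeasure lborel {0<..<1::real} + ennreal D * (NN x. indicator {x. norm x \<ge> 1} (x::real) * ennreal (norm x powr (- m)))"
  by (subst nn_integral_add) (auto simp: nn_integral_cmult nn_integral_cmult_indicator)
 also have "... \<le> ennreal (D * (4 powr m * C)) * 1 + ennreal D * ennreal (C1 * 1 powr (real DIM(real) - m))"
  by (intro add_mono mult_left_mono C1) auto
 also have "... < \<infinity>" by (simp add: ennreal_mult_less_top)
 finally show "h1 < \<infinity>" .
qed

text \<open>The Riesz constant: \<open>c0 * K\<close> is the kernel of the inverse of the fractional
  Laplacian.\<close>

definition c0 :: real where "c0 = enn2real h1 / enn2real g1"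
lemma c0_pos: "c0 > 0" unfolding c0_def using g1 h1 by (simp add: enn2real_positive_iff)

text \<open>Scaling t by the square of \<open>norm xi\<close> here, and by that of
  \<open>norm z\<close> in \<open>heat_kernel\<close>, exhibits the frequency weight and the kernel
  as mixtures over t, with the same weight, of the two sides of
  \<open>gauss_identity\<close>.\<close>

lemma heat_weight:
 assumes "xi \<noteq> (0::'a)"
 shows "(NN t. indicator {0<..} t * ennreal (t powr (s - 1) * exp (- t * (norm xi)^2))) = g1 * ennreal (norm xi powr (- 2 * s))"
proof -
 define rho where "rho = (norm xi)^2"
 have rho: "rho > 0" unfolding rho_def using assms by simp
 have "g1 = ennreal rho * (NN t. indicator {0<..} (rho * t) * ennreal ((rho * t) powr (s - 1) * exp (- (rho * t))))"
  unfolding g1_def using rho by (subst nn_integral_real_affine[of _ rho 0]) auto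
 also have "(NN t. indicator {0<..} (rho * t) * ennreal ((rho * t) powr (s - 1) * exp (- (rho * t))))
  = (NN t. ennreal (rho powr (s - 1)) * (indicator {0<..} t * ennreal (t powr (s - 1) * exp (- t * (norm xi)^2))))"
  using rho by (intro nn_integral_cong) (auto simp: indicator_def zero_less_mult_iff powr_mult ennreal_mult[symmetric] rho_def mult.commute mult.left_commute)
 also have "... = ennreal (rho powr (s - 1)) * (NN t. indicator {0<..} t * ennreal (t powr (s - 1) * exp (- t * (norm xi)^2)))"
  by (rule nn_integral_cmult) auto
 finally have "g1 = ennreal (rho powr s) * (NN t. indicator {0<..} t * ennreal (t powr (s - 1) * exp (- t * (norm xi)^2)))"
  using rho by (simp add: mult.assoc[symmetric] ennreal_mult[symmetric] powr_diff)
 moreover have "norm xi powr (- 2 * s) = rho powr (- s)" unfolding rho_def using assms by (simp add: powr_powr powr_numeral[symmetric] del: powr_numeral)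
 ultimately have "g1 * ennreal (norm xi powr (- 2 * s)) = ennreal (rho powr (- s) * rho powr s) * (NN t. indicator {0<..} t * ennreal (t powr (s - 1) * exp (- t * (norm xi)^2)))"
  by (simp add: ennreal_mult mult.assoc mult.commute mult.left_commute)
 then show ?thesis using rho by (simp add: powr_minus)
qed

lemma Gs_powr: "t > 0 ==> Gs t (z::'a) = kap * ((pi / t) powr (nn / 2) * exp (- ((norm z)^2) / (4 * t)))"
proof -
 assume t: "t > 0"
 have "sqrt (pi / t) ^ DIM('a) = (pi / t) powr (nn / 2)"
  using t by (simp add: powr_half_sqrt[symmetric] powr_realpow[symmetric] powr_powr)
 then show ?thesis by (simp add: Gs_def kap_def)
qed

lemma heat_kernel:
 assumes "z \<noteq> (0::'a)"
 shows "(NN t. indicator {0<..} t * ennreal (t powr (s - 1) * Gs t z)) = h1 * ennreal (K z)"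
proof -
 define rho where "rho = (norm z)^2"
 have rho: "rho > 0" unfolding rho_def using assms by simp
 let ?f = "%t. indicator {0<..} t * ennreal (t powr (s - 1) * (kap * ((pi / t) powr (nn / 2) * exp (- rho / (4 * t)))))"
 have "(NN t. indicator {0<..} t * ennreal (t powr (s - 1) * Gs t z)) = (NN t. ?f t)"
  by (intro nn_integral_cong) (auto simp: indicator_def Gs_powr rho_def)
 also have "... = ennreal rho * (NN t. ?f (rho * t))"
  using rho by (subst nn_integral_real_affine[of _ rho 0]) auto
 also have "(NN t. ?f (rho * t)) = (NN t. ennreal (rho powr (s - 1) * rho powr (- (nn / 2))) * (indicator {0<..} t * ennreal (t powr (s - 1) * (kap * ((pi / t) powr (nn / 2) * exp (- (1 / (4 * t))))))))"
 proof (intro nn_integral_cong)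
  fix t :: real
  show "?f (rho * t) = ennreal (rho powr (s - 1) * rho powr (- (nn / 2))) * (indicator {0<..} t * ennreal (t powr (s - 1) * (kap * ((pi / t) powr (nn / 2) * exp (- (1 / (4 * t)))))))"
  proof (cases "t > 0")
   case True
   have "(pi / (rho * t)) powr (nn / 2) = rho powr (- (nn / 2)) * (pi / t) powr (nn / 2)"
    using rho True by (simp add: powr_divide powr_mult powr_minus_divide)
   moreover have "- rho / (4 * (rho * t)) = - (1 / (4 * t))" using rho True by simp
   ultimately show ?thesis using True rho kap_pos by (simp add: ennreal_mult[symmetric] powr_mult mult.commute mult.left_commute)
  qed (use rho in \<open>auto simp: indicator_def zero_less_mult_iff\<close>)
 qed
 also have "... = ennreal (rho powr (s - 1) * rho powr (- (nn / 2))) * h1"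
  unfolding h1_def by (rule nn_integral_cmult) auto
 finally have "(NN t. indicator {0<..} t * ennreal (t powr (s - 1) * Gs t z)) = ennreal (rho * (rho powr (s - 1) * rho powr (- (nn / 2)))) * h1"
  using rho by (simp add: ennreal_mult mult.assoc)
 also have "rho * (rho powr (s - 1) * rho powr (- (nn / 2))) = rho powr (- lam / 2)"
  using rho powr_add[of rho 1 "s - 1 - nn / 2"] by (simp add: powr_add[symmetric] field_simps)
 also have "... = K z"
 proof -
  have "rho = norm z powr 2" unfolding rho_def using assms by simp
  then have "rho powr (- lam / 2) = norm z powr (2 * (- lam / 2))" by (simp only: powr_powr)
  also have "2 * (- lam / 2) = - lam" by simp
  finally show ?thesis unfolding K_def .
 qed
 finally show ?thesis by (simp add: mult.commute)
qed

end

section \<open>Convergence of pairings\<close>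

lemma conv_Np:
 fixes f :: "nat => 'a::euclidean_space => real"
 assumes r: "r \<ge> 0" and f: "!!k. Lp r (f k)" and u[measurable]: "u \<in> bmeas"
  and c: "(%k. (NN x. ennreal (\<bar>f k x - u x\<bar> powr r))) ~> 0"
 shows "Lp r u" "(%k. Np r (%x. f k x - u x)) ~> 0"
proof -
 have [measurable]: "f k \<in> bmeas" for k using f by (rule Lp_meas)
 have "eventually (%k. (NN x. ennreal (\<bar>f k x - u x\<bar> powr r)) < 1) sequentially"
  using order_tendstoD(2)[OF c, of 1] by simp
 then obtain k where k: "(NN x. ennreal (\<bar>f k x - u x\<bar> powr r)) < 1" by (auto simp: eventually_sequentially)
 have "Lp r (%x. f k x - u x)"
  by (rule LpI_nn(1)[where N=1]) (use k in \<open>auto simp: less_imp_le\<close>)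
 from Lp_diff(1)[OF f[of k] this r] show L: "Lp r u" by simp
 have "(%k. ennreal (Np r (%x. f k x - u x))) ~> 0"
  using c nn_Np[OF Lp_diff(1)[OF f L r]] by simp
 then show "(%k. Np r (%x. f k x - u x)) ~> 0" by (simp add: ennreal_tendsto_0_iff)
qed

lemma powr_tendsto_0: "r > 0 ==> f ~> 0 ==> (!!k. f k \<ge> 0) ==> (%k. f k powr r) ~> (0::real)"
 using tendsto_powr'[of f 0 sequentially "%_. r" r] by auto

lemma pair_conv:
 fixes f :: "nat => 'a::euclidean_space => real"
 assumes pq: "p > 1" "q > 1" "1/p + 1/q = 1" and f: "!!k. Lp p (f k)" "Lp p u" "(%k. Np p (%x. f k x - u x)) ~> 0" and v: "Lp q v"
 shows "(%k. (LBINT x. f k x * v x)) ~> (LBINT x. u x * v x)"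
proof -
 have p0: "p \<ge> 0" using pq by simp
 have d: "\<bar>(LBINT x. f k x * v x) - (LBINT x. u x * v x)\<bar> \<le> Np p (%x. f k x - u x) powr (1/p) * Np q v powr (1/q)" for k
 proof -
  have "(LBINT x. f k x * v x) - (LBINT x. u x * v x) = (LBINT x. (f k x - u x) * v x)"
   using Holder(1)[OF pq f(1)[of k] v] Holder(1)[OF pq f(2) v] by (simp add: left_diff_distrib)
  then show ?thesis using Holder_abs[OF pq Lp_diff(1)[OF f(1)[of k] f(2) p0] v] by simp
 qed
 have "(%k. Np p (%x. f k x - u x) powr (1/p) * Np q v powr (1/q)) ~> 0"
  using powr_tendsto_0[OF _ f(3), of "1/p"] pq by (intro tendsto_mult_left_zero) auto
 from Lim_null_comparison[OF _ this, of "%k. (LBINT x. f k x * v x) - (LBINT x. u x * v x)"] d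
 show ?thesis by (simp add: LIM_zero_iff)
qed

lemma L2_pair_conv:
 fixes f g :: "nat => 'a::euclidean_space => real"
 assumes f: "!!k. Lp 2 (f k)" "Lp 2 u" "(%k. Np 2 (%x. f k x - u x)) ~> 0"
  and g: "!!k. Lp 2 (g k)" "Lp 2 v" "(%k. Np 2 (%x. g k x - v x)) ~> 0"
 shows "(%k. (LBINT x. f k x * g k x)) ~> (LBINT x. u x * v x)"
proof -
 have 2: "(2::real) > 1" "1/2 + 1/2 = (1::real)" by auto
 note H = Holder(1)[OF 2(1) 2(1) 2(2)]
 \<comment> \<open>Expansion around both limits: one product of two small factors, and terms that
   are linear in a single sequence.\<close>
 have e: "(LBINT x. f k x * g k x) = (LBINT x. (f k x - u x) * (g k x - v x)) + (LBINT x. f k x * v x) + (LBINT x. g k x * u x) - (LBINT x. u x * v x)" for k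
  using H[OF f(1)[of k] g(1)[of k]] H[OF f(1)[of k] g(2)] H[OF g(1)[of k] f(2)] H[OF f(2) g(2)]
  by (simp add: left_diff_distrib right_diff_distrib mult.commute)
 have "(%k. (LBINT x. (f k x - u x) * (g k x - v x))) ~> 0"
 proof (rule Lim_null_comparison)
  have "\<bar>LBINT x. (f k x - u x) * (g k x - v x)\<bar> \<le> Np 2 (%x. f k x - u x) powr (1/2) * Np 2 (%x. g k x - v x) powr (1/2)" for k
   by (rule Holder_abs[OF 2(1) 2(1) 2(2) Lp_diff(1)[OF f(1) f(2)] Lp_diff(1)[OF g(1) g(2)]]) auto
  then show "eventually (%k. norm (LBINT x. (f k x - u x) * (g k x - v x)) \<le> Np 2 (%x. f k x - u x) powr (1/2) * Np 2 (%x. g k x - v x) powr (1/2)) sequentially"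
   by simp
  have "(%k. Np 2 (%x. f k x - u x) powr (1/2) * Np 2 (%x. g k x - v x) powr (1/2)) ~> 0 * 0"
   by (intro tendsto_mult powr_tendsto_0 f g) auto
  then show "(%k. Np 2 (%x. f k x - u x) powr (1/2) * Np 2 (%x. g k x - v x) powr (1/2)) ~> 0" by simp
 qed
 moreover note pair_conv[OF 2(1) 2(1) 2(2) f g(2)] pair_conv[OF 2(1) 2(1) 2(2) g f(2)]
 ultimately have "(%k. (LBINT x. f k x * g k x)) ~> 0 + (LBINT x. u x * v x) + (LBINT x. v x * u x) - (LBINT x. u x * v x)"
  unfolding e by (intro tendsto_intros)
 then show ?thesis by (simp add: mult.commute)
qed

lemma Bd_lincomb: assumes "Bd f" "Bd g" shows "Bd (%x. a * f x + b * g x)"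
proof -
 obtain M N where MN: "!!x. \<bar>f x\<bar> \<le> M" "!!x. \<bar>g x\<bar> \<le> N" using assms by (auto simp: Bd_def)
 have "\<bar>a * f x + b * g x\<bar> \<le> \<bar>a\<bar> * M + \<bar>b\<bar> * N" for x
  by (rule order_trans[OF abs_triangle_ineq]) (auto simp: abs_mult intro!: add_mono mult_left_mono MN)
 then show ?thesis using assms by (auto simp: Bd_def)
qed

context crit
begin

text \<open>Subordination. \<open>X t\<close> is the Gaussian form of \<open>w\<close> at time t,
  and its integral against \<open>t powr (s - 1)\<close> is computed twice. On the frequency side
  all terms are nonnegative and Tonelli applies; on the kernel side HLS supplies the absolute
  integrability for Fubini. The finite kernel side then proves that the frequency integral is
  finite.\<close>

lemma hart_weight_neg_square:
 assumes w: "Bd (w :: 'a => real)"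
 shows "integrable lborel (%xi. norm xi powr (- 2 * s) * (hart w xi)^2)"
  and "c0 * B w w = kap * (LBINT xi. norm xi powr (- 2 * s) * (hart w xi)^2)"
proof -
 have wi: "integrable lborel w" and [measurable]: "w \<in> bmeas" using w by (auto simp: Bd_def)
 have wp: "Lp p w" using Bd_Lp[OF w] p1 by simp
 obtain M where M: "!!xi. \<bar>hart w xi\<bar> \<le> M" using trig_bound(3)[OF wi] by blast
 interpret P: pair_sigma_finite "lborel2 :: ('a \<times> 'a) measure" "lborel :: real measure"
  unfolding lborel_prod by unfold_locales
 define W where "W = (%z. w (fst z) * w (snd z))"
 define X where "X = (%t. \<integral>z. W z * Gs t (fst z - snd z) \<partial>(lborel \<Otimes>\<^sub>M (lborel :: 'a measure)))"
 have Xk: "X t = kap * (LBINT xi. exp (- t * (norm xi)^2) * (hart w xi)^2)" if "t > 0" for t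
  using gauss_identity(1)[OF that wi wi] unfolding X_def W_def kap_def by (simp add: power2_eq_square)
 have gi: "integrable lborel (%xi::'a. exp (- t * (norm xi)^2) * (hart w xi)^2)" if "t > 0" for t
 proof (rule Bochner_Integration.integrable_bound[OF integrable_mult_right[OF gauss_cos(1)[OF that], of "M^2"]])
  have "exp (- t * (norm xi)^2) * (hart w xi)^2 \<le> M^2 * exp (- t * (norm xi)^2)" for xi
   using power_mono[OF M[of xi], of 2] by (simp add: mult.commute)
  then show "AE xi in lborel. norm (exp (- t * (norm xi)^2) * (hart w xi)^2) \<le> norm (M^2 * exp (- t * (norm xi)^2))"
   by (intro AE_I2) simp
 qed measurable
 have X0: "X t \<ge> 0" if "t > 0" for t unfolding Xk[OF that] using kap_pos by simp
 define I where "I = (NN xi. ennreal (norm xi powr (- 2 * s) * (hart w xi)^2))"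
 have A: "(NN t. indicator {0<..} t * ennreal (t powr (s - 1) * X t)) = ennreal kap * (g1 * I)"
 proof -
  have "(NN t. indicator {0<..} t * ennreal (t powr (s - 1) * X t))
   = (NN t. (NN xi. indicator {0<..} t * ennreal (t powr (s - 1) * exp (- t * (norm xi)^2)) * ennreal (kap * (hart w (xi::'a))^2)))"
  proof (intro nn_integral_cong)
   fix t :: real
   show "indicator {0<..} t * ennreal (t powr (s - 1) * X t) = (NN xi. indicator {0<..} t * ennreal (t powr (s - 1) * exp (- t * (norm xi)^2)) * ennreal (kap * (hart w (xi::'a))^2))"
   proof (cases "t > 0")
    case True
    have "ennreal (t powr (s - 1) * X t) = ennreal (LBINT xi. (t powr (s - 1) * kap) * (exp (- t * (norm xi)^2) * (hart w xi)^2))"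
     using Xk[OF True] by (simp add: mult.assoc)
    also have "... = (NN xi. ennreal ((t powr (s - 1) * kap) * (exp (- t * (norm xi)^2) * (hart w xi)^2)))"
     using gi[OF True] kap_pos by (intro nn_integral_eq_integral[symmetric] integrable_mult_right) auto
    also have "... = (NN xi. indicator {0<..} t * ennreal (t powr (s - 1) * exp (- t * (norm xi)^2)) * ennreal (kap * (hart w (xi::'a))^2))"
     using True kap_pos by (intro nn_integral_cong) (simp add: ennreal_mult[symmetric] mult.assoc mult.commute mult.left_commute)
    finally show ?thesis using True by simp
   qed (simp add: indicator_def)
  qed
  also have "... = (NN xi. (NN t. indicator {0<..} t * ennreal (t powr (s - 1) * exp (- t * (norm xi)^2)) * ennreal (kap * (hart w (xi::'a))^2)))"
   by (rule lborel_pair.Fubini') measurable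
  also have "... = (NN xi. (ennreal kap * g1) * ennreal (norm xi powr (- 2 * s) * (hart w (xi::'a))^2))"
  proof (rule nn_integral_cong_AE)
   show "AE xi in lborel. (NN t. indicator {0<..} t * ennreal (t powr (s - 1) * exp (- t * (norm xi)^2)) * ennreal (kap * (hart w xi)^2)) = (ennreal kap * g1) * ennreal (norm xi powr (- 2 * s) * (hart w (xi::'a))^2)"
    using AE_lborel_singleton[of "0::'a"]
   proof eventually_elim
    case (elim xi)
    have "(NN t. indicator {0<..} t * ennreal (t powr (s - 1) * exp (- t * (norm xi)^2)) * ennreal (kap * (hart w xi)^2))
     = (NN t. indicator {0<..} t * ennreal (t powr (s - 1) * exp (- t * (norm xi)^2))) * ennreal (kap * (hart w xi)^2)"
     by (rule nn_integral_multc) measurable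
    then show ?case unfolding heat_weight[OF elim] using kap_pos by (simp add: ennreal_mult mult.assoc mult.commute mult.left_commute)
   qed
  qed
  also have "... = (ennreal kap * g1) * I" unfolding I_def by (rule nn_integral_cmult) measurable
  finally show ?thesis by (simp add: mult.assoc)
 qed
 define h where "h = enn2real h1"
 have h: "h > 0" "ennreal h = h1" unfolding h_def using h1 by (auto simp: enn2real_positive_iff)
 define H where "H = (%z t. W z * (indicator {0<..} t * (t powr (s - 1) * Gs t (fst z - snd z :: 'a))))"
 have Hm: "case_prod H \<in> borel_measurable (lborel2 \<Otimes>\<^sub>M lborel)" unfolding H_def W_def Gs_def by measurable
 have dg: "AE z in lborel \<Otimes>\<^sub>M (lborel :: 'a measure). fst z - snd z \<noteq> 0"
 proof (rule lborel_pair.AE_pair_measure)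
  show "{z \<in> space lborel2. fst z - snd z \<noteq> (0::'a)} \<in> sets lborel2" by measurable
  show "AE x in lborel. AE y in lborel. fst (x, y) - snd (x, y) \<noteq> (0::'a)"
  proof (rule AE_I2)
   fix x :: 'a
   show "AE y in lborel. fst (x, y) - snd (x, y) \<noteq> 0" using AE_lborel_singleton[of x] by eventually_elim auto
  qed
 qed
 have inner_nn: "(NN t. ennreal (norm (H z t))) = ennreal (\<bar>W z\<bar> * (h * K (fst z - snd z)))" if "fst z - snd z \<noteq> 0" for z
 proof -
  have "(NN t. ennreal (norm (H z t))) = (NN t. ennreal \<bar>W z\<bar> * (indicator {0<..} t * ennreal (t powr (s - 1) * Gs t (fst z - snd z))))"
   by (intro nn_integral_cong) (auto simp: H_def indicator_def abs_mult ennreal_mult[symmetric] less_imp_le[OF Gs_pos])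
  also have "... = ennreal \<bar>W z\<bar> * (NN t. indicator {0<..} t * ennreal (t powr (s - 1) * Gs t (fst z - snd z)))"
   unfolding Gs_def by (rule nn_integral_cmult) measurable
  also have "... = ennreal (\<bar>W z\<bar> * (h * K (fst z - snd z)))"
   unfolding heat_kernel[OF that] using h by (simp add: h(2)[symmetric] ennreal_mult)
  finally show ?thesis .
 qed
 have WKi: "integrable lborel2 (%z. W z * K (fst z - snd z))"
  using B_integrable(1)[OF wp wp] unfolding W_def by (simp add: mult.assoc mult.commute mult.left_commute)
 have Hi: "integrable (lborel2 \<Otimes>\<^sub>M lborel) (case_prod H)"
 proof (rule integrableI_bounded[OF Hm])
  have "(\<integral>\<^sup>+u. ennreal (norm (case_prod H u)) \<partial>(lborel2 \<Otimes>\<^sub>M lborel)) = (\<integral>\<^sup>+z. (NN t. ennreal (norm (H z t))) \<partial>lborel2)"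
   using lborel.nn_integral_fst[of "%u. ennreal (norm (case_prod H u))" "lborel2"] Hm by (simp add: prod.case)
  also have "... = (\<integral>\<^sup>+z. ennreal (\<bar>W z\<bar> * (h * K (fst z - snd z))) \<partial>lborel2)"
  proof (rule nn_integral_cong_AE)
   show "AE z in lborel2. (NN t. ennreal (norm (H z t))) = ennreal (\<bar>W z\<bar> * (h * K (fst z - snd z)))"
    using dg by eventually_elim (rule inner_nn)
  qed
  also have "... = ennreal (\<integral>z. \<bar>W z\<bar> * (h * K (fst z - snd z)) \<partial>lborel2)"
  proof (rule nn_integral_eq_integral)
   have "integrable lborel2 (%z. h * \<bar>W z * K (fst z - snd z)\<bar>)" using WKi by auto
   then show "integrable lborel2 (%z. \<bar>W z\<bar> * (h * K (fst z - snd z)))" by (simp add: abs_mult mult.left_commute)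
  qed (use h in auto)
  also have "... < \<infinity>" by simp
  finally show "(\<integral>\<^sup>+u. ennreal (norm (case_prod H u)) \<partial>(lborel2 \<Otimes>\<^sub>M lborel)) < \<infinity>" .
 qed
 have inner: "(LBINT t. H z t) = W z * (h * K (fst z - snd z))" if "fst z - snd z \<noteq> 0" for z
 proof -
  have "(LBINT t. indicator {0<..} t * (t powr (s - 1) * Gs t (fst z - snd z))) = h * K (fst z - snd z)"
  proof (rule integral_eq_nn_integral[THEN trans])
   have "(NN t. ennreal (indicator {0<..} t * (t powr (s - 1) * Gs t (fst z - snd z)))) = (NN t. indicator {0<..} t * ennreal (t powr (s - 1) * Gs t (fst z - snd z)))"
    by (intro nn_integral_cong) (auto simp: indicator_def)
   also have "... = ennreal (h * K (fst z - snd z))" unfolding heat_kernel[OF that] using h by (simp add: h(2)[symmetric] ennreal_mult)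
   finally show "enn2real (NN t. ennreal (indicator {0<..} t * (t powr (s - 1) * Gs t (fst z - snd z)))) = h * K (fst z - snd z)"
    using h by simp
   show "(%t. indicator {0<..} t * (t powr (s - 1) * Gs t (fst z - snd z))) \<in> borel_measurable lborel" unfolding Gs_def by measurable
   show "AE t in lborel. 0 \<le> indicator {0<..} t * (t powr (s - 1) * Gs t (fst z - snd z))"
    by (intro AE_I2) (auto simp: indicator_def less_imp_le[OF Gs_pos])
  qed
  then show ?thesis unfolding H_def by simp
 qed
 have "(LBINT t. indicator {0<..} t * (t powr (s - 1) * X t)) = (LBINT t. \<integral>z. H z t \<partial>lborel2)"
  unfolding X_def H_def integral_mult_right_zero[symmetric]
  by (intro Bochner_Integration.integral_cong) (auto simp: mult.assoc mult.commute mult.left_commute)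
 also have "... = (\<integral>z. (LBINT t. H z t) \<partial>lborel2)"
  using P.Fubini_integral[OF Hi] .
 also have "... = (\<integral>z. h * (W z * K (fst z - snd z)) \<partial>lborel2)"
 proof (rule integral_cong_AE)
  show "AE z in lborel2. (LBINT t. H z t) = h * (W z * K (fst z - snd z))"
   using dg by eventually_elim (simp add: inner)
  show "(%z. (LBINT t. H z t)) \<in> borel_measurable lborel2"
   using P.integrable_fst'[OF Hi] by auto
  show "(%z. h * (W z * K (fst z - snd z))) \<in> borel_measurable lborel2" unfolding W_def by measurable
 qed
 also have "... = h * B w w" unfolding B_def W_def by (simp add: mult.assoc mult.commute mult.left_commute)
 finally have R: "(LBINT t. indicator {0<..} t * (t powr (s - 1) * X t)) = h * B w w" .
 have Ri: "integrable lborel (%t. indicator {0<..} t * (t powr (s - 1) * X t))"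
 proof -
  have "integrable lborel (%t. \<integral>z. H z t \<partial>lborel2)" using P.integrable_snd[OF Hi] .
  moreover have "(%t. \<integral>z. H z t \<partial>lborel2) = (%t. indicator {0<..} t * (t powr (s - 1) * X t))"
   unfolding X_def H_def integral_mult_right_zero[symmetric]
   by (intro ext Bochner_Integration.integral_cong) (auto simp: mult.assoc mult.commute mult.left_commute)
  ultimately show ?thesis by simp
 qed
 have "ennreal (h * B w w) = (NN t. ennreal (indicator {0<..} t * (t powr (s - 1) * X t)))"
  unfolding R[symmetric] using Ri X0 by (intro nn_integral_eq_integral[symmetric]) (auto simp: indicator_def)
 also have "... = (NN t. indicator {0<..} t * ennreal (t powr (s - 1) * X t))"
  by (intro nn_integral_cong) (auto simp: indicator_def)
 finally have E: "ennreal (h * B w w) = ennreal kap * (g1 * I)" using A by simp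
 have BB: "h * B w w \<ge> 0" unfolding R[symmetric] using X0 by (intro integral_nonneg_AE AE_I2) (auto simp: indicator_def)
 define g where "g = enn2real g1"
 have g: "g > 0" "ennreal g = g1" unfolding g_def using g1 by (auto simp: enn2real_positive_iff)
 have "ennreal kap * (g1 * I) \<noteq> \<infinity>" using E[symmetric] by simp
 then have If: "I \<noteq> \<infinity>" using g1 kap_pos by (auto simp: ennreal_mult_eq_top_iff)
 show i: "integrable lborel (%xi. norm xi powr (- 2 * s) * (hart w xi)^2)"
  by (rule integrableI_nonneg) (use If in \<open>auto simp: I_def less_top[symmetric]\<close>)
 have "I = ennreal (LBINT xi. norm xi powr (- 2 * s) * (hart w xi)^2)"
  unfolding I_def by (rule nn_integral_eq_integral[OF i]) auto
 moreover have "ennreal kap * (ennreal g * ennreal (LBINT xi. norm xi powr (- 2 * s) * (hart w xi)^2)) = ennreal (kap * (g * (LBINT xi. norm xi powr (- 2 * s) * (hart w xi)^2)))"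
  by (simp only: ennreal_mult'[OF less_imp_le[OF g(1)]] ennreal_mult'[OF less_imp_le[OF kap_pos]])
 ultimately have "ennreal (h * B w w) = ennreal (kap * (g * (LBINT xi. norm xi powr (- 2 * s) * (hart w xi)^2)))"
  using E unfolding g(2) by simp
 then have "h * B w w = kap * (g * (LBINT xi. norm xi powr (- 2 * s) * (hart w xi)^2))"
  using BB g kap_pos by (subst (asm) ennreal_inj) auto
 then show "c0 * B w w = kap * (LBINT xi. norm xi powr (- 2 * s) * (hart w xi)^2)"
  unfolding c0_def h_def[symmetric] g_def[symmetric] using g by (simp add: field_simps)
qed

text \<open>Half powers of the symbol: up to \<open>kap\<close>, \<open>PH\<close> carries the
  \<open>H^s\<close> form, and \<open>PS\<close> the form \<open>c0 * B\<close>, to the inner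
  product of \<open>L^2\<close>, while the ordinary pairing of functions becomes the product of
  \<open>PH\<close> with \<open>PS\<close>.\<close>

definition PH :: "('a => real) => 'a => real" where "PH f xi = norm xi powr s * hart f xi"
definition PS :: "('a => real) => 'a => real" where "PS f xi = norm xi powr (- s) * hart f xi"

lemma PH_L2: assumes "test_fun psi" shows "Lp 2 (PH psi)"
proof -
 have [measurable]: "psi \<in> bmeas" using test_fun_Bd[OF assms] by (rule Bd_meas)
 have "- real DIM('a) < 2 * s" using s0 nn_pos by simp
 from hart_weight2_integrable[OF assms Bd_int[OF test_fun_Bd[OF assms]] this]
 have "integrable lborel (%xi. norm xi powr (2 * s) * (hart psi xi * hart psi xi))" .
 moreover have "norm xi powr (2 * s) * (hart psi xi * hart psi xi) = \<bar>PH psi xi\<bar> powr 2" for xi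
 proof -
  have "norm xi powr (2 * s) = norm xi powr s * norm xi powr s" by (simp add: powr_add[symmetric])
  then show ?thesis by (simp add: PH_def power2_eq_square abs_mult)
 qed
 ultimately show ?thesis unfolding Lp_def PH_def[abs_def] by simp
qed

lemma PS_L2: assumes w: "Bd w" shows "Lp 2 (PS w)"
proof -
 have [measurable]: "w \<in> bmeas" using w by (rule Bd_meas)
 have "norm xi powr (- 2 * s) * (hart w xi)^2 = \<bar>PS w xi\<bar> powr 2" for xi
 proof -
  have "norm xi powr (- 2 * s) = norm xi powr (- s) * norm xi powr (- s)" by (simp add: powr_add[symmetric])
  then show ?thesis by (simp add: PS_def power2_eq_square abs_mult)
 qed
 then show ?thesis using hart_weight_neg_square(1)[OF w] unfolding Lp_def PS_def[abs_def] by simp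
qed

lemmas HL2 = Holder(1)[of 2 2, simplified]

lemma ff_PH:
 assumes "test_fun f" "test_fun g"
 shows "frac_form s f g = kap * (LBINT xi. PH f xi * PH g xi)"
proof -
 have "norm xi powr (2 * s) * (hart f xi * hart g xi) = PH f xi * PH g xi" for xi
 proof -
  have "norm xi powr (2 * s) = norm xi powr s * norm xi powr s" by (simp add: powr_add[symmetric])
  then show ?thesis by (simp add: PH_def)
 qed
 then show ?thesis using frac_form_hart[OF assms s0] by (simp add: kap_def)
qed

lemma parseval_PH_PS:
 assumes "test_fun psi" "Bd eta"
 shows "(LBINT x. psi x * eta x) = kap * (LBINT xi. PH psi xi * PS eta xi)"
proof -
 have [measurable]: "psi \<in> bmeas" "eta \<in> bmeas" using assms test_fun_Bd[OF assms(1)] by (auto simp: Bd_def)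
 have "(LBINT xi. PH psi xi * PS eta xi) = (LBINT xi. hart psi xi * hart eta xi)"
 proof (rule integral_cong_AE)
  show "AE xi in lborel. PH psi xi * PS eta xi = hart psi xi * hart eta xi"
   using AE_lborel_singleton[of "0::'a"]
   by eventually_elim (simp add: PH_def PS_def powr_minus field_simps)
 qed (unfold PH_def[abs_def] PS_def[abs_def], measurable)
 then show ?thesis using parseval[OF assms(1) Bd_int[OF assms(2)]] by (simp add: kap_def)
qed

lemma hart_lin_Bd: "Bd f ==> Bd g ==> hart (%x. a * f x + b * g x) xi = a * hart f xi + b * hart g xi"
 by (intro trig_lin Bd_int)

lemma PS_lin: "Bd f ==> Bd g ==> PS (%x. a * f x + b * g x) xi = a * PS f xi + b * PS g xi"
 by (simp add: PS_def hart_lin_Bd ring_distribs)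
lemma PH_lin: "test_fun f ==> test_fun g ==> PH (%x. a * f x + b * g x) xi = a * PH f xi + b * PH g xi"
 by (simp add: PH_def hart_lin_Bd test_fun_Bd ring_distribs)
lemma PH_diff: "test_fun f ==> test_fun g ==> PH (%x. f x - g x) xi = PH f xi - PH g xi"
 using PH_lin[of f g 1 "-1"] by simp

lemma B_PS_self: "Bd w ==> c0 * B w w = kap * (LBINT xi. PS w xi * PS w xi)"
proof -
 assume w: "Bd w"
 have "norm xi powr (- 2 * s) * (hart w xi)^2 = PS w xi * PS w xi" for xi
 proof -
  have "norm xi powr (- 2 * s) = norm xi powr (- s) * norm xi powr (- s)" by (simp add: powr_add[symmetric])
  then show ?thesis by (simp add: PS_def power2_eq_square)
 qed
 then show ?thesis using hart_weight_neg_square(2)[OF w] by simp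
qed

text \<open>Polarisation of \<open>B_PS_self\<close>, expanded at \<open>w + v\<close>.\<close>

lemma B_PS: assumes w: "Bd w" and v: "Bd v"
 shows "c0 * B w v = kap * (LBINT xi. PS w xi * PS v xi)"
proof -
 have Lw: "Lp p w" and Lv: "Lp p v" using Bd_Lp[OF w, of p] Bd_Lp[OF v, of p] p1 by simp_all
 have wv: "Bd (%x. w x + v x)" using Bd_lincomb[OF w v, of 1 1] by simp
 have s: "PS (%x. w x + v x) xi = PS w xi + PS v xi" for xi using PS_lin[OF w v, of 1 1] by simp
 have "B (%x. w x + v x) (%x. w x + v x) = B w w + 2 * B w v + B v v"
  using B_add[OF Lw Lv Lp_add(1)[OF Lw Lv p0]] B_add[OF Lw Lv Lw] B_add[OF Lw Lv Lv] B_sym[OF Lw Lv] by simp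
 then have "c0 * B w w + 2 * (c0 * B w v) + c0 * B v v = kap * (LBINT xi. (PS w xi + PS v xi) * (PS w xi + PS v xi))"
  using B_PS_self[OF wv] unfolding s by (simp add: algebra_simps)
 also have "(LBINT xi. (PS w xi + PS v xi) * (PS w xi + PS v xi)) = (LBINT xi. PS w xi * PS w xi + 2 * (PS w xi * PS v xi) + PS v xi * PS v xi)"
  by (intro Bochner_Integration.integral_cong) (auto simp: algebra_simps)
 also have "... = (LBINT xi. PS w xi * PS w xi) + 2 * (LBINT xi. PS w xi * PS v xi) + (LBINT xi. PS v xi * PS v xi)"
  using HL2[OF PS_L2[OF w] PS_L2[OF w]] HL2[OF PS_L2[OF w] PS_L2[OF v]] HL2[OF PS_L2[OF v] PS_L2[OF v]] by simp
 finally show ?thesis using B_PS_self[OF w] B_PS_self[OF v] by (simp add: algebra_simps)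
qed

end

section \<open>Sobolev inequality and potentials\<close>

lemma Np2: "Np 2 f = (LBINT x. f x * f x)"
 unfolding Np_def by (intro Bochner_Integration.integral_cong) (auto simp: power2_eq_square)

lemma CS2:
 assumes "Lp 2 f" "Lp 2 g"
 shows "\<bar>LBINT x. f x * g x\<bar> \<le> sqrt (LBINT x. f x * f x) * sqrt (LBINT x. g x * g x)"
 using Holder_abs[OF _ _ _ assms] unfolding Np2 by (simp add: powr_half_sqrt Np2[symmetric])

context crit
begin

text \<open>Closes the duality arguments: testing a function of mass \<open>A\<close> in
  \<open>L^q\<close> with its own dual function bounds A by \<open>D * A powr (1/p)\<close>.\<close>

lemma dual_trick:
 assumes "A \<ge> 0" "D \<ge> 0" "A \<le> D * A powr (1/p)"
 shows "A powr (1/q) \<le> D"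
proof (cases "A = 0")
 case False
 then have A: "A > 0" using assms by simp
 have "1/q = 1 - 1/p" using pq by simp
 then have "A powr (1/q) = A / A powr (1/p)" using A by (simp add: powr_diff)
 also have "... \<le> D" using assms(3) A by (simp add: pos_divide_le_eq)
 finally show ?thesis .
qed (use assms in simp)

text \<open>The nonlinearity of the equation. It gives equality in Hoelder's inequality and maps
  \<open>L^q\<close> to \<open>L^p\<close> preserving mass.\<close>

definition dual :: "('a => real) => 'a => real" where "dual u x = \<bar>u x\<bar> powr (q - 2) * u x"

lemma dual_abs: "\<bar>dual u x\<bar> = \<bar>u x\<bar> powr (q - 1)"
proof (cases "u x = 0")
 case False
 then show ?thesis using powr_add[of "\<bar>u x\<bar>" "q - 2" 1] by (simp add: dual_def abs_mult)
qed (simp add: dual_def)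

lemma dual_mult: "u x * dual u x = \<bar>u x\<bar> powr q"
proof (cases "u x = 0")
 case False
 have "u x * dual u x = \<bar>u x\<bar> powr (q - 2) * \<bar>u x\<bar> powr 2" by (simp add: dual_def power2_eq_square)
 also have "... = \<bar>u x\<bar> powr (q - 2 + 2)" by (simp only: powr_add)
 finally show ?thesis by simp
qed (simp add: dual_def)

lemma dual_powr: "\<bar>dual u x\<bar> powr p = \<bar>u x\<bar> powr q"
 unfolding dual_abs using pm1_q by (simp add: powr_powr)

lemma dual_meas[measurable]: "u \<in> bmeas ==> dual u \<in> bmeas"
 unfolding dual_def by measurable

lemma dual_Lp: "Lp q u ==> Lp p (dual u)" "Np p (dual u) = Np q u"
 by (auto simp: Lp_def Np_def dual_powr)

lemma dual_int: "(LBINT x. u x * dual u x) = Np q u"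
 unfolding dual_mult Np_def ..

definition SC :: real where "SC = sqrt (c0 * BC)"
lemma SC_pos: "SC > 0" unfolding SC_def using c0_pos BC by simp

lemma ff_nonneg: "test_fun (f :: 'a => real) ==> frac_form s f f \<ge> 0"
 using kap_pos by (simp add: ff_PH)

text \<open>The Sobolev inequality as the dual of HLS: pair \<open>psi\<close> with its dual
  function, pass to frequencies by Parseval, apply Cauchy-Schwarz there and bound the second factor
  by \<open>B_bound\<close>.\<close>

lemma sobolev:
 assumes "test_fun (psi :: 'a => real)"
 shows "Np q psi powr (1/q) \<le> SC * sqrt (frac_form s psi psi)"
proof (rule dual_trick)
 show "Np q psi \<ge> 0" by simp
 show "0 \<le> SC * sqrt (frac_form s psi psi)" using SC_pos ff_nonneg[OF assms] by simp
 have Bpsi: "Bd psi" by (rule test_fun_Bd[OF assms])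
 then have Lq: "Lp q psi" using q1 by (intro Bd_Lp) auto
 have [measurable]: "psi \<in> bmeas" using Bpsi by (rule Bd_meas)
 obtain M where M: "!!x. \<bar>psi x\<bar> \<le> M" using Bpsi by (auto simp: Bd_def)
 obtain R where R: "!!x. psi x \<noteq> 0 ==> norm x \<le> R" using assms by (auto simp: test_fun_iff bounded_iff)
 have Bd: "Bd (dual psi)"
 proof (rule BdI_support[where M="M powr (q - 1)" and R=R])
  show "\<bar>dual psi x\<bar> \<le> M powr (q - 1)" for x unfolding dual_abs using M[of x] q1 by (intro powr_mono2) auto
  show "dual psi x \<noteq> 0 ==> norm x \<le> R" for x by (rule R) (auto simp: dual_def)
 qed measurable
 let ?I = "LBINT xi. PH psi xi * PH psi xi" and ?J = "LBINT xi. PS (dual psi) xi * PS (dual psi) xi"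
 have IJ: "?I \<ge> 0" "?J \<ge> 0" by simp_all
 have "Np q psi = kap * (LBINT xi. PH psi xi * PS (dual psi) xi)"
  using parseval_PH_PS[OF assms Bd] dual_int by simp
 also have "... \<le> kap * (sqrt ?I * sqrt ?J)"
  using CS2[OF PH_L2[OF assms] PS_L2[OF Bd]] kap_pos by (intro mult_left_mono) auto
 also have "... = sqrt (kap * ?I) * sqrt (kap * ?J)"
  using kap_pos by (simp add: real_sqrt_mult)
 also have "... = sqrt (frac_form s psi psi) * sqrt (c0 * B (dual psi) (dual psi))"
  by (simp add: ff_PH[OF assms assms] B_PS_self[OF Bd])
 also have "... \<le> sqrt (frac_form s psi psi) * (SC * Np q psi powr (1/p))"
 proof (intro mult_left_mono)
  have "c0 * B (dual psi) (dual psi) \<le> c0 * (BC * Np q psi powr (1/p) * Np q psi powr (1/p))"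
   using B_bound[OF dual_Lp(1)[OF Lq] dual_Lp(1)[OF Lq]] c0_pos by (intro mult_left_mono) (auto simp: dual_Lp(2))
  then have "sqrt (c0 * B (dual psi) (dual psi)) \<le> sqrt (c0 * BC * (Np q psi powr (1/p))^2)"
   by (simp add: power2_eq_square mult.assoc)
  also have "... = SC * Np q psi powr (1/p)" unfolding SC_def by (simp add: real_sqrt_mult)
  finally show "sqrt (c0 * B (dual psi) (dual psi)) \<le> SC * Np q psi powr (1/p)" .
 qed (use ff_nonneg[OF assms] in auto)
 finally show "Np q psi \<le> SC * sqrt (frac_form s psi psi) * Np q psi powr (1/p)" by (simp add: mult.assoc mult.commute mult.left_commute)
qed

section \<open>Existence of potentials by minimisation\<close>

lemma ff_expand:
 assumes f: "test_fun (f :: 'a => real)" and g: "test_fun g"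
 shows "frac_form s (%x. a * f x + b * g x) (%x. a * f x + b * g x) = a^2 * frac_form s f f + 2 * a * b * frac_form s f g + b^2 * frac_form s g g"
proof -
 have "(LBINT xi. (a * PH f xi + b * PH g xi) * (a * PH f xi + b * PH g xi))
  = (LBINT xi. a^2 * (PH f xi * PH f xi) + 2 * a * b * (PH f xi * PH g xi) + b^2 * (PH g xi * PH g xi))"
  by (intro Bochner_Integration.integral_cong) (auto simp: algebra_simps power2_eq_square)
 also have "... = a^2 * (LBINT xi. PH f xi * PH f xi) + 2 * a * b * (LBINT xi. PH f xi * PH g xi) + b^2 * (LBINT xi. PH g xi * PH g xi)"
  using HL2[OF PH_L2[OF f] PH_L2[OF f]] HL2[OF PH_L2[OF f] PH_L2[OF g]] HL2[OF PH_L2[OF g] PH_L2[OF g]] by simp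
 finally show ?thesis using ff_PH[OF test_fun_lincomb[OF f g, of a b] test_fun_lincomb[OF f g, of a b]] ff_PH[OF f f] ff_PH[OF f g] ff_PH[OF g g]
  by (simp add: PH_lin[OF f g] algebra_simps)
qed

lemma test_Lq: "test_fun (f :: 'a => real) ==> Lp q f" using Bd_Lp[OF test_fun_Bd, of f q] q1 by simp

text \<open>u is the weak solution in \<open>H^s\<close> of the linear equation with right-hand side
  \<open>w\<close>, tested with test functions. An approximating sequence belongs to the relation
  because the form at u is only defined as a limit.\<close>

definition Rep :: "('a => real) => ('a => real) => (nat => 'a => real) => bool" where
 "Rep w u phi \<longleftrightarrow> Lp p w \<and> u \<in> bmeas \<and> Hs_approx s u phi \<and>
  (\<forall>psi. test_fun psi \<longrightarrow> (%k. frac_form s (phi k) psi) ~> (LBINT x. psi x * w x))"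

lemma Hs_approxD:
 assumes u: "(u :: 'a => real) \<in> bmeas" and H: "Hs_approx s u phi"
 shows "test_fun (phi k)" "Lp q u" "(%k. Np q (%x. phi k x - u x)) ~> 0"
  "e > 0 ==> \<exists>N. \<forall>k\<ge>N. \<forall>l\<ge>N. sqrt (frac_form s (%x. phi k x - phi l x) (%x. phi k x - phi l x)) < e"
proof -
 show t: "test_fun (phi k)" for k using H unfolding Hs_approx_def by auto
 have c: "(%k. (NN x. ennreal (\<bar>phi k x - u x\<bar> powr q))) ~> 0"
  using H unfolding Hs_approx_def q_def by simp
 show "Lp q u" "(%k. Np q (%x. phi k x - u x)) ~> 0"
  using conv_Np[OF _ test_Lq[OF t] u c] q1 by auto
 show "e > 0 ==> \<exists>N. \<forall>k\<ge>N. \<forall>l\<ge>N. sqrt (frac_form s (%x. phi k x - phi l x) (%x. phi k x - phi l x)) < e"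
  using H unfolding Hs_approx_def by auto
qed

text \<open>Riesz representation carried out in the incomplete space of test functions: minimise the
  quadratic functional \<open>J\<close>. Minimising sequences are Cauchy by the parallelogram
  identity, satisfy the Euler-Lagrange equation in the limit, and converge in \<open>L^q\<close> by
  \<open>sobolev\<close>.\<close>

lemma ex_Rep:
 assumes w: "Lp p (w :: 'a => real)"
 shows "\<exists>u phi. Rep w u phi"
proof -
 define f2 where "f2 = (frac_form s :: ('a => real) => _)"
 have wb: "\<bar>LBINT x. psi x * w x\<bar> \<le> SC * sqrt (f2 psi psi) * Np p w powr (1/p)" if "test_fun psi" for psi
 proof -
  have "\<bar>LBINT x. psi x * w x\<bar> \<le> Np q psi powr (1/q) * Np p w powr (1/p)"
   by (rule Holder_abs[OF q1 p1 qp test_Lq[OF that] w])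
  also have "... \<le> SC * sqrt (f2 psi psi) * Np p w powr (1/p)"
   unfolding f2_def by (intro mult_right_mono sobolev that) auto
  finally show ?thesis .
 qed
 define L where "L = (%psi. (LBINT x. psi x * w x))"
 define J where "J = (%psi. f2 psi psi - 2 * L psi)"
 have Llin: "L (%x. a * f x + b * g x) = a * L f + b * L g" if "test_fun f" "test_fun g" for a b f g
  unfolding L_def using Holder(1)[OF q1 p1 qp test_Lq[OF that(1)] w] Holder(1)[OF q1 p1 qp test_Lq[OF that(2)] w]
  by (simp add: ring_distribs mult.assoc)
 define D where "D = SC * Np p w powr (1/p)"
 have Jb: "J psi \<ge> - (D^2)" if "test_fun psi" for psi
 proof -
  define r where "r = sqrt (f2 psi psi)"
  have r: "f2 psi psi = r^2" unfolding r_def f2_def using ff_nonneg[OF that] by simp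
  have "L psi \<le> D * r" using wb[OF that] unfolding L_def D_def r_def by (simp add: mult.assoc mult.commute mult.left_commute)
  moreover have "0 \<le> (r - D)^2" by simp
  ultimately show ?thesis unfolding J_def r by (simp add: power2_diff mult.commute)
 qed
 define m where "m = Inf (J ` {psi. test_fun psi})"
 have bdd: "bdd_below (J ` {psi. test_fun psi})" using Jb by (intro bdd_belowI[of _ "- (D^2)"]) auto
 have ml: "m \<le> J psi" if "test_fun psi" for psi unfolding m_def by (rule cInf_lower[OF _ bdd]) (use that in auto)
 define eps where "eps = (%k::nat. 1 / real (Suc k))"
 have eps: "eps k > 0" for k unfolding eps_def by simp
 have eps0: "eps ~> 0" unfolding eps_def using LIMSEQ_inverse_real_of_nat by (simp add: inverse_eq_divide)
 have "\<exists>psi. test_fun psi \<and> J psi < m + eps k" for k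
 proof -
  have "J ` {psi. test_fun psi} \<noteq> {}" using bump0(1) by blast
  from cInf_lessD[OF this, of "m + eps k"] show ?thesis using eps[of k] unfolding m_def by auto
 qed
 then obtain phi where phi: "!!k. test_fun (phi k)" "!!k. J (phi k) < m + eps k" by metis
 have expand: "J (%x. a * f x + b * g x) = a^2 * f2 f f + 2 * a * b * f2 f g + b^2 * f2 g g - 2 * (a * L f + b * L g)"
  if "test_fun f" "test_fun g" for a b f g
  unfolding J_def Llin[OF that] using ff_expand[OF that, of a b] by (simp add: f2_def)
 \<comment> \<open>Compare with the midpoint of \<open>phi k\<close> and \<open>phi l\<close>, whose
   value is at least \<open>m\<close>.\<close>
 have cau: "f2 (%x. phi k x - phi l x) (%x. phi k x - phi l x) \<le> 2 * eps k + 2 * eps l" for k l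
 proof -
  have "m \<le> J (%x. (1/2) * phi k x + (1/2) * phi l x)" by (intro ml test_fun_lincomb phi)
  then have "m \<le> (1/4) * f2 (phi k) (phi k) + (1/2) * f2 (phi k) (phi l) + (1/4) * f2 (phi l) (phi l) - L (phi k) - L (phi l)"
   unfolding expand[OF phi(1) phi(1)] by (simp add: power2_eq_square)
  moreover have "f2 (%x. phi k x - phi l x) (%x. phi k x - phi l x) = f2 (phi k) (phi k) - 2 * f2 (phi k) (phi l) + f2 (phi l) (phi l)"
   using ff_expand[OF phi(1) phi(1), of 1 k "-1" l] by (simp add: f2_def)
  ultimately show ?thesis using phi(2)[of k] phi(2)[of l] unfolding J_def by linarith
 qed
 have var: "(%k. f2 (phi k) psi) ~> L psi" if psi: "test_fun psi" for psi
 proof -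
  have "\<bar>f2 (phi k) psi - L psi\<bar> \<le> sqrt (eps k) * (1 + f2 psi psi)" for k
  proof -
   define c where "c = f2 (phi k) psi - L psi"
   define e where "e = sqrt (eps k)"
   have e: "e > 0" "e^2 = eps k" unfolding e_def using eps[of k] by auto
   \<comment> \<open>The competitor is \<open>phi k + t * psi\<close>. Below, t = e and t = - e with
     \<open>e^2 = eps k\<close> balance the defect \<open>eps k\<close> against the quadratic
     term.\<close>
   have q: "0 \<le> eps k + 2 * t * c + t^2 * f2 psi psi" for t
   proof -
    have "m \<le> J (%x. 1 * phi k x + t * psi x)" by (intro ml test_fun_lincomb phi psi)
    then show ?thesis unfolding expand[OF phi(1) psi] using phi(2)[of k] unfolding J_def c_def by (simp add: algebra_simps)
   qed
   have A: "f2 psi psi \<ge> 0" unfolding f2_def by (rule ff_nonneg[OF psi])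
   have "2 * (e * \<bar>c\<bar>) \<le> e * (e * (1 + f2 psi psi))"
    using q[of e] q[of "- e"] e by (cases "c \<ge> 0") (auto simp: algebra_simps power2_eq_square)
   then have "e * (2 * \<bar>c\<bar>) \<le> e * (e * (1 + f2 psi psi))" by simp
   then have "2 * \<bar>c\<bar> \<le> e * (1 + f2 psi psi)" using e(1) by (rule mult_left_le_imp_le)
   moreover have "\<bar>c\<bar> \<ge> 0" by simp
   ultimately have "\<bar>c\<bar> \<le> e * (1 + f2 psi psi)" by linarith
   then show ?thesis by (simp only: c_def e_def)
  qed
  moreover have "(%k. sqrt (eps k) * (1 + f2 psi psi)) ~> 0"
  proof -
   have "(%k. sqrt (eps k)) ~> 0" using tendsto_real_sqrt[OF eps0] by simp
   then show ?thesis by (rule tendsto_mult_left_zero)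
  qed
  ultimately have "(%k. f2 (phi k) psi - L psi) ~> 0"
   by (intro Lim_null_comparison[of "%k. f2 (phi k) psi - L psi" "%k. sqrt (eps k) * (1 + f2 psi psi)"] always_eventually allI) (simp_all only: real_norm_def)
  then show ?thesis by (rule LIM_zero_cancel)
 qed
 have small: "\<exists>N. \<forall>k\<ge>N. \<forall>l\<ge>N. sqrt (f2 (%x. phi k x - phi l x) (%x. phi k x - phi l x)) < e" if "e > 0" for e
 proof -
  have "eventually (%k. eps k < e^2 / 4) sequentially" using order_tendstoD(2)[OF eps0, of "e^2/4"] that by simp
  then obtain N where N: "!!k. k \<ge> N ==> eps k < e^2 / 4" by (auto simp: eventually_sequentially)
  have "sqrt (f2 (%x. phi k x - phi l x) (%x. phi k x - phi l x)) < e" if kl: "k \<ge> N" "l \<ge> N" for k l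
  proof -
   have "f2 (%x. phi k x - phi l x) (%x. phi k x - phi l x) < e^2" using cau[of k l] N[OF kl(1)] N[OF kl(2)] by linarith
   then have "sqrt (f2 (%x. phi k x - phi l x) (%x. phi k x - phi l x)) < sqrt (e^2)" by (rule real_sqrt_less_mono)
   then show ?thesis using \<open>e > 0\<close> by simp
  qed
  then show ?thesis by blast
 qed
 have meas: "phi k \<in> bmeas" for k using test_fun_Bd[OF phi(1)] by (rule Bd_meas)
 have q0: "q > 0" using q1 by simp
 have cauq: "\<exists>N. \<forall>k\<ge>N. \<forall>l\<ge>N. (NN x. ennreal (\<bar>phi k x - phi l x\<bar> powr q)) \<le> ennreal e" if e: "e > 0" for e
 proof -
  define d where "d = e powr (1/q) / SC"
  have d: "d > 0" unfolding d_def using e SC_pos by simp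
  from small[OF d] obtain N where N: "!!k l. k \<ge> N ==> l \<ge> N ==> sqrt (f2 (%x. phi k x - phi l x) (%x. phi k x - phi l x)) < d" by blast
  have "(NN x. ennreal (\<bar>phi k x - phi l x\<bar> powr q)) \<le> ennreal e" if kl: "k \<ge> N" "l \<ge> N" for k l
  proof -
   let ?d = "%x. phi k x - phi l x"
   have t: "test_fun ?d" by (intro test_fun_diff phi)
   have "Np q ?d powr (1/q) \<le> SC * sqrt (f2 ?d ?d)" unfolding f2_def by (rule sobolev[OF t])
   also have "... \<le> SC * d" using N[OF kl] SC_pos by (intro mult_left_mono) auto
   also have "... = e powr (1/q)" unfolding d_def using SC_pos by simp
   finally have F: "Np q ?d powr (1/q) \<le> e powr (1/q)" .
   have "(Np q ?d powr (1/q)) powr q \<le> (e powr (1/q)) powr q" by (rule powr_mono2[OF less_imp_le[OF q0] powr_ge_zero F])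
   moreover have "(Np q ?d powr (1/q)) powr q = Np q ?d" "(e powr (1/q)) powr q = e" using q0 e by (simp_all add: powr_powr)
   ultimately have "Np q ?d \<le> e" by linarith
   then show ?thesis using nn_Np[OF test_Lq[OF t]] by (simp add: ennreal_leI)
  qed
  then show ?thesis by blast
 qed
 obtain u where u: "u \<in> bmeas" "(%k. (NN x. ennreal (\<bar>phi k x - u x\<bar> powr q))) ~> 0"
  by (rule Lp_complete[of q phi], rule q0, rule meas, rule cauq, assumption, blast)
 have "Hs_approx s u phi"
  unfolding Hs_approx_def using phi(1) small u(2) unfolding f2_def q_def by auto
 then have "Rep w u phi" unfolding Rep_def using w u var unfolding f2_def L_def by auto
 then show ?thesis by blast
qed

section \<open>Limits in frequency space and reciprocity of potentials\<close>

lemma Hs_limit: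
 assumes u: "(u :: 'a => real) \<in> bmeas" and H: "Hs_approx s u phi"
 obtains h where "Lp 2 h" "(%k. Np 2 (%xi. PH (phi k) xi - h xi)) ~> 0"
proof -
 note t = Hs_approxD(1)[OF u H]
 have m: "PH (phi k) \<in> bmeas" for k using PH_L2[OF t] by (rule Lp_meas)
 have cau: "\<exists>N. \<forall>k\<ge>N. \<forall>l\<ge>N. (NN x. ennreal (\<bar>PH (phi k) x - PH (phi l) x\<bar> powr 2)) \<le> ennreal e" if e: "e > 0" for e
 proof -
  define d where "d = sqrt (kap * e)"
  have d: "d > 0" "d^2 = kap * e" unfolding d_def using e kap_pos by auto
  from Hs_approxD(4)[OF u H d(1)] obtain N where N: "!!k l. k \<ge> N ==> l \<ge> N ==> sqrt (frac_form s (%x. phi k x - phi l x) (%x. phi k x - phi l x)) < d" by blast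
  have "(NN x. ennreal (\<bar>PH (phi k) x - PH (phi l) x\<bar> powr 2)) \<le> ennreal e" if kl: "k \<ge> N" "l \<ge> N" for k l
  proof -
   let ?d = "%x. phi k x - phi l x"
   have td: "test_fun ?d" by (intro test_fun_diff t)
   have "sqrt (frac_form s ?d ?d) \<le> sqrt (d^2)" using N[OF kl] d(1) by simp
   then have "frac_form s ?d ?d \<le> d^2" by (simp only: real_sqrt_le_iff)
   then have "Np 2 (PH ?d) \<le> e" using kap_pos unfolding ff_PH[OF td td] d(2) Np2 by simp
   then have "(NN x. ennreal (\<bar>PH ?d x\<bar> powr 2)) \<le> ennreal e" using nn_Np[OF PH_L2[OF td]] by (simp add: ennreal_leI)
   then show ?thesis unfolding PH_diff[OF t t] .
  qed
  then show ?thesis by blast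
 qed
 obtain h where h: "h \<in> bmeas" "(%k. (NN x. ennreal (\<bar>PH (phi k) x - h x\<bar> powr 2))) ~> 0"
  by (rule Lp_complete[of 2 "%k. PH (phi k)"], simp, rule m, rule cau, assumption, blast)
 from conv_Np[OF _ PH_L2[OF t] h] that show ?thesis by auto
qed

lemma const_seq_L2: "Lp 2 f ==> (%k::nat. Np 2 (%xi. f xi - f xi)) ~> 0" by (simp add: Np_def)

lemma Hs_limit_ff:
 assumes "!!k. test_fun (phi k)" "Lp 2 h" "(%k. Np 2 (%xi. PH (phi k) xi - h xi)) ~> 0"
  and "!!k. test_fun (psi k)" "Lp 2 g" "(%k. Np 2 (%xi. PH (psi k) xi - g xi)) ~> 0"
 shows "(%k. frac_form s (phi k) (psi k)) ~> kap * (LBINT xi. h xi * g xi)"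
 unfolding ff_PH[OF assms(1) assms(4)]
 by (intro tendsto_intros L2_pair_conv PH_L2 assms)

lemma Hs_limit_pair:
 assumes u: "u \<in> bmeas" and H: "Hs_approx s u phi"
  and h: "Lp 2 h" "(%k. Np 2 (%xi. PH (phi k) xi - h xi)) ~> 0" and eta: "Bd eta"
 shows "(LBINT x. u x * eta x) = kap * (LBINT xi. h xi * PS eta xi)"
proof -
 note D = Hs_approxD[OF u H]
 have Leta: "Lp p eta" using Bd_Lp[OF eta, of p] p1 by simp
 have "(%k. (LBINT x. phi k x * eta x)) ~> (LBINT x. u x * eta x)"
  by (rule pair_conv[OF q1 p1 qp test_Lq[OF D(1)] D(2,3) Leta])
 moreover have "(%k. (LBINT x. phi k x * eta x)) ~> kap * (LBINT xi. h xi * PS eta xi)"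
  unfolding parseval_PH_PS[OF D(1) eta]
  by (intro tendsto_intros L2_pair_conv PH_L2 D h PS_L2 eta const_seq_L2)
 ultimately show ?thesis using LIMSEQ_unique by blast
qed

lemma dense_PH:
 assumes g: "Lp 2 g" and z: "!!psi. test_fun psi ==> (LBINT xi. g xi * PH psi xi) = 0"
 shows "AE xi in lborel. g xi = 0"
 by (rule hart_weight_dense[OF Lp_meas[OF g], of s]) (use z HL2[OF g PH_L2] in \<open>auto simp: PH_def\<close>)

lemma dense_PS:
 assumes g: "Lp 2 g" and z: "!!psi. test_fun psi ==> (LBINT xi. g xi * PS psi xi) = 0"
 shows "AE xi in lborel. g xi = 0"
 by (rule hart_weight_dense[OF Lp_meas[OF g], of "- s"]) (use z HL2[OF g PS_L2[OF test_fun_Bd]] in \<open>auto simp: PS_def\<close>)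

lemma Rep_limit:
 assumes R: "Rep w u phi" and h: "Lp 2 h" "(%k. Np 2 (%xi. PH (phi k) xi - h xi)) ~> 0" and psi: "test_fun psi"
 shows "(LBINT x. psi x * w x) = kap * (LBINT xi. h xi * PH psi xi)"
proof -
 have u: "u \<in> bmeas" "Hs_approx s u phi" using R by (auto simp: Rep_def)
 have "(%k. frac_form s (phi k) psi) ~> kap * (LBINT xi. h xi * PH psi xi)"
  by (rule Hs_limit_ff[OF Hs_approxD(1)[OF u] h psi PH_L2[OF psi] const_seq_L2[OF PH_L2[OF psi]]])
 moreover have "(%k. frac_form s (phi k) psi) ~> (LBINT x. psi x * w x)" using R psi by (auto simp: Rep_def)
 ultimately show ?thesis using LIMSEQ_unique by blast
qed

lemma Np_AE_eq:
 assumes "AE x in lborel. f x = g x" "f \<in> bmeas" "g \<in> bmeas"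
 shows "Np r f = Np r g"
 unfolding Np_def by (rule integral_cong_AE) (use assms in auto)

text \<open>For a bounded source the equation is solved in frequency: the limit of
  \<open>PH (phi k)\<close> and \<open>PS eta\<close> have the same pairing with every
  \<open>PH psi\<close>, and by \<open>dense_PH\<close> these pairings determine a function.\<close>

lemma Rep_limit_Bd:
 assumes R: "Rep eta u phi" and eta: "Bd eta" and h: "Lp 2 h" "(%k. Np 2 (%xi. PH (phi k) xi - h xi)) ~> 0"
 shows "AE xi in lborel. h xi = PS eta xi"
proof -
 have "AE xi in lborel. h xi - PS eta xi = 0"
 proof (rule dense_PH)
  show "Lp 2 (%xi. h xi - PS eta xi)" by (intro Lp_diff h PS_L2 eta) auto
  fix psi :: "'a => real" assume psi: "test_fun psi"
  have "kap * (LBINT xi. h xi * PH psi xi) = kap * (LBINT xi. PS eta xi * PH psi xi)"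
   using Rep_limit[OF R h psi] parseval_PH_PS[OF psi eta] by (simp add: mult.commute)
  then show "(LBINT xi. (h xi - PS eta xi) * PH psi xi) = 0"
   using kap_pos HL2[OF h(1) PH_L2[OF psi]] HL2[OF PS_L2[OF eta] PH_L2[OF psi]] by (simp add: left_diff_distrib)
 qed
 then show ?thesis by simp
qed

text \<open>Truncation in size and in space at once. It lands in \<open>Bd\<close>, is dominated by
  \<open>w\<close> and is eventually equal to it at each point, so identities extend from
  \<open>Bd\<close> to \<open>L^p\<close>.\<close>

definition trunc :: "nat => ('a => real) => 'a => real" where
 "trunc j w x = (if \<bar>w x\<bar> \<le> real j \<and> norm x \<le> real j then w x else 0)"

lemma trunc_Bd: assumes [measurable]: "w \<in> bmeas" shows "Bd (trunc j w)"
proof (rule BdI_support[where M="real j" and R="real j"])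
 show "trunc j w \<in> bmeas" unfolding trunc_def by measurable
qed (auto simp: trunc_def split: if_splits)
lemma trunc_le: "\<bar>trunc j w x\<bar> \<le> \<bar>w x\<bar>" by (simp add: trunc_def)
lemma trunc_lim: "(%j. trunc j w x) ~> w x"
proof (rule tendsto_eventually)
 obtain N :: nat where N: "max \<bar>w x\<bar> (norm x) \<le> real N" using real_arch_simple by blast
 then show "eventually (%j. trunc j w x = w x) sequentially"
  unfolding eventually_sequentially by (intro exI[of _ N]) (auto simp: trunc_def)
qed

lemma pair_trunc:
 assumes u: "Lp q u" and v: "Lp p v"
 shows "(%j. (LBINT x. u x * trunc j v x)) ~> (LBINT x. u x * v x)"
proof (rule integral_dominated_convergence[where w="%x. \<bar>u x * v x\<bar>"])
 have [measurable]: "u \<in> bmeas" "v \<in> bmeas" using u v by (auto simp: Lp_def)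
 show "(%x. u x * v x) \<in> borel_measurable lborel" by simp
 show "(%x. u x * trunc j v x) \<in> borel_measurable lborel" for j using Bd_meas[OF trunc_Bd, of v j] by simp
 show "integrable lborel (%x. \<bar>u x * v x\<bar>)" using Holder(1)[OF q1 p1 qp u v] by auto
 show "AE x in lborel. (%j. u x * trunc j v x) ~> u x * v x" by (intro AE_I2 tendsto_intros trunc_lim)
 show "AE x in lborel. norm (u x * trunc j v x) \<le> \<bar>u x * v x\<bar>" for j
  by (intro AE_I2) (auto simp: abs_mult intro!: mult_left_mono trunc_le)
qed

lemma B_trunc:
 assumes w: "Lp p w" and v: "Lp p v"
 shows "(%j. B w (trunc j v)) ~> B w v"
 unfolding B_def
proof (rule integral_dominated_convergence[where w="%z. \<bar>w (fst z) * K (fst z - snd z) * v (snd z)\<bar>"])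
 have [measurable]: "w \<in> bmeas" "v \<in> bmeas" using w v by (auto simp: Lp_def)
 have [measurable]: "trunc j v \<in> bmeas" for j by (rule Bd_meas[OF trunc_Bd]) simp
 show "(%z. w (fst z) * K (fst z - snd z) * v (snd z)) \<in> borel_measurable lborel2" by measurable
 show "(%z. w (fst z) * K (fst z - snd z) * trunc j v (snd z)) \<in> borel_measurable lborel2" for j by measurable
 show "integrable lborel2 (%z. \<bar>w (fst z) * K (fst z - snd z) * v (snd z)\<bar>)" using B_integrable(1)[OF w v] by auto
 show "AE z in lborel2. (%j. w (fst z) * K (fst z - snd z) * trunc j v (snd z)) ~> w (fst z) * K (fst z - snd z) * v (snd z)"
  by (intro AE_I2 tendsto_intros trunc_lim)
 show "AE z in lborel2. norm (w (fst z) * K (fst z - snd z) * trunc j v (snd z)) \<le> \<bar>w (fst z) * K (fst z - snd z) * v (snd z)\<bar>" for j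
  by (intro AE_I2) (auto simp: abs_mult intro!: mult_left_mono trunc_le)
qed

lemma Rep_Bd_pair:
 assumes R: "Rep eta u phi" and eta: "Bd eta" and v: "Lp p v"
 shows "(LBINT x. u x * v x) = c0 * B eta v"
proof -
 have u: "u \<in> bmeas" "Hs_approx s u phi" using R by (auto simp: Rep_def)
 obtain h where h: "Lp 2 h" "(%k. Np 2 (%xi. PH (phi k) xi - h xi)) ~> 0" using Hs_limit[OF u] by blast
 have hm: "h \<in> bmeas" using h by (auto simp: Lp_def)
 have ae: "AE xi in lborel. h xi = PS eta xi" by (rule Rep_limit_Bd[OF R eta h])
 have z: "(LBINT x. u x * \<zeta> x) = c0 * B eta \<zeta>" if \<zeta>: "Bd \<zeta>" for \<zeta>
 proof -
  have "(LBINT xi. h xi * PS \<zeta> xi) = (LBINT xi. PS eta xi * PS \<zeta> xi)"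
   by (rule integral_cong_AE) (use ae hm Lp_meas[OF PS_L2[OF \<zeta>]] Lp_meas[OF PS_L2[OF eta]] in \<open>auto elim!: eventually_mono\<close>)
  then show ?thesis using Hs_limit_pair[OF u h \<zeta>] B_PS[OF eta \<zeta>] by simp
 qed
 have Leta: "Lp p eta" using R by (simp add: Rep_def)
 have "(%j. c0 * B eta (trunc j v)) ~> (LBINT x. u x * v x)"
  using pair_trunc[OF Hs_approxD(2)[OF u] v] unfolding z[OF trunc_Bd[OF Lp_meas[OF v]]] .
 moreover have "(%j. c0 * B eta (trunc j v)) ~> c0 * B eta v" by (intro tendsto_intros B_trunc Leta v)
 ultimately show ?thesis using LIMSEQ_unique by blast
qed

text \<open>The abstract u is the Riesz potential of \<open>w\<close>. For general \<open>w\<close>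
  there is no formula for the limit \<open>h\<close>, so reciprocity is used: with \<open>y\<close>
  the potential of a bounded \<open>eta\<close>, the pairing of u with \<open>eta\<close> and that
  of \<open>y\<close> with \<open>w\<close> both equal \<open>kap\<close> times the integral of
  \<open>h * g\<close>, and \<open>Rep_Bd_pair\<close> evaluates the second. Truncating
  \<open>v\<close> removes the boundedness of the test function.\<close>

lemma Rep_pair:
 assumes R: "Rep w u phi" and v: "Lp p v"
 shows "(LBINT x. u x * v x) = c0 * B w v"
proof -
 have u: "u \<in> bmeas" "Hs_approx s u phi" and w: "Lp p w" using R by (auto simp: Rep_def)
 obtain h where h: "Lp 2 h" "(%k. Np 2 (%xi. PH (phi k) xi - h xi)) ~> 0" using Hs_limit[OF u] by blast
 have hm: "h \<in> bmeas" using h by (auto simp: Lp_def)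
 have z: "(LBINT x. u x * eta x) = c0 * B w eta" if eta: "Bd eta" for eta
 proof -
  have Leta: "Lp p eta" using Bd_Lp[OF eta, of p] p1 by simp
  obtain y \<theta> where Y: "Rep eta y \<theta>" using ex_Rep[OF Leta] by blast
  have y: "y \<in> bmeas" "Hs_approx s y \<theta>" using Y by (auto simp: Rep_def)
  note D = Hs_approxD[OF y]
  obtain g where g: "Lp 2 g" "(%k. Np 2 (%xi. PH (\<theta> k) xi - g xi)) ~> 0" using Hs_limit[OF y] by blast
  have gm: "g \<in> bmeas" using g by (auto simp: Lp_def)
  have "(%l. (LBINT x. \<theta> l x * w x)) ~> (LBINT x. y x * w x)"
   by (rule pair_conv[OF q1 p1 qp test_Lq[OF D(1)] D(2,3) w])
  moreover have "(%l. (LBINT x. \<theta> l x * w x)) ~> kap * (LBINT xi. h xi * g xi)"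
   unfolding Rep_limit[OF R h D(1)]
   by (intro tendsto_intros L2_pair_conv PH_L2 D g h const_seq_L2)
  ultimately have "(LBINT x. y x * w x) = kap * (LBINT xi. h xi * g xi)" using LIMSEQ_unique by blast
  moreover have "(LBINT xi. h xi * g xi) = (LBINT xi. h xi * PS eta xi)"
   by (rule integral_cong_AE) (use Rep_limit_Bd[OF Y eta g] hm gm Lp_meas[OF PS_L2[OF eta]] in \<open>auto elim!: eventually_mono\<close>)
  ultimately have "(LBINT x. u x * eta x) = (LBINT x. y x * w x)"
   using Hs_limit_pair[OF u h eta] by simp
  then show ?thesis using Rep_Bd_pair[OF Y eta w] B_sym[OF Leta w] by simp
 qed
 have "(%j. c0 * B w (trunc j v)) ~> (LBINT x. u x * v x)"
  using pair_trunc[OF Hs_approxD(2)[OF u] v] unfolding z[OF trunc_Bd[OF Lp_meas[OF v]]] .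
 moreover have "(%j. c0 * B w (trunc j v)) ~> c0 * B w v" by (intro tendsto_intros B_trunc w v)
 ultimately show ?thesis using LIMSEQ_unique by blast
qed

text \<open>\<open>c0 * B w w\<close> is the squared \<open>H^s\<close> norm of the potential of
  \<open>w\<close>.\<close>

lemma B_psd: assumes w: "Lp p w" shows "B w w \<ge> 0"
proof -
 obtain u phi where R: "Rep w u phi" using ex_Rep[OF w] by blast
 have u: "u \<in> bmeas" "Hs_approx s u phi" using R by (auto simp: Rep_def)
 note D = Hs_approxD[OF u]
 obtain h where h: "Lp 2 h" "(%k. Np 2 (%xi. PH (phi k) xi - h xi)) ~> 0" using Hs_limit[OF u] by blast
 have "(%l. (LBINT x. phi l x * w x)) ~> (LBINT x. u x * w x)"
  by (rule pair_conv[OF q1 p1 qp test_Lq[OF D(1)] D(2,3) w])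
 moreover have "(%l. (LBINT x. phi l x * w x)) ~> kap * (LBINT xi. h xi * h xi)"
  unfolding Rep_limit[OF R h D(1)]
  by (intro tendsto_intros L2_pair_conv PH_L2 D h const_seq_L2)
 ultimately have "(LBINT x. u x * w x) = kap * (LBINT xi. h xi * h xi)" using LIMSEQ_unique by blast
 moreover have "... \<ge> 0" using kap_pos by simp
 ultimately have "c0 * B w w \<ge> 0" using Rep_pair[OF R w] by simp
 then show ?thesis using c0_pos by (simp add: zero_le_mult_iff)
qed

text \<open>The definite description in \<open>Hs_form\<close> ranges over all approximating
  sequences, so the limit in frequency space must not depend on the sequence. Its pairing with
  \<open>PS eta\<close> is, up to \<open>kap\<close>, the integral of \<open>u * eta\<close>, and
  this determines it by \<open>dense_PS\<close>.\<close>

lemma Hs_form_Rep: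
 assumes R: "Rep w u phi" and v: "v \<in> Hs s"
 shows "Hs_form s u v = (LBINT x. w x * v x)"
proof -
 have u: "u \<in> bmeas" "Hs_approx s u phi" and w: "Lp p w" using R by (auto simp: Rep_def)
 have vm: "v \<in> bmeas" using v by (simp add: Hs_def)
 obtain h where h: "Lp 2 h" "(%k. Np 2 (%xi. PH (phi k) xi - h xi)) ~> 0" using Hs_limit[OF u] by blast
 have main: "(%k. frac_form s (phi' k) (psi k)) ~> (LBINT x. w x * v x)"
  if phi': "Hs_approx s u phi'" and psi: "Hs_approx s v psi" for phi' psi
 proof -
  note D = Hs_approxD[OF u(1) phi'] and E = Hs_approxD[OF vm psi]
  obtain h' where h': "Lp 2 h'" "(%k. Np 2 (%xi. PH (phi' k) xi - h' xi)) ~> 0" using Hs_limit[OF u(1) phi'] by blast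
  obtain g where g: "Lp 2 g" "(%k. Np 2 (%xi. PH (psi k) xi - g xi)) ~> 0" using Hs_limit[OF vm psi] by blast
  have "AE xi in lborel. h' xi - h xi = 0"
  proof (rule dense_PS)
   show "Lp 2 (%xi. h' xi - h xi)" by (intro Lp_diff h h') auto
   fix eta :: "'a => real" assume eta: "test_fun eta"
   have "kap * (LBINT xi. h' xi * PS eta xi) = kap * (LBINT xi. h xi * PS eta xi)"
    using Hs_limit_pair[OF u h test_fun_Bd[OF eta]] Hs_limit_pair[OF u(1) phi' h' test_fun_Bd[OF eta]] by simp
   then show "(LBINT xi. (h' xi - h xi) * PS eta xi) = 0"
    using kap_pos HL2[OF h(1) PS_L2[OF test_fun_Bd[OF eta]]] HL2[OF h'(1) PS_L2[OF test_fun_Bd[OF eta]]] by (simp add: left_diff_distrib)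
  qed
  then have e: "(LBINT xi. h' xi * g xi) = (LBINT xi. h xi * g xi)"
   by (intro integral_cong_AE) (use Lp_meas[OF h(1)] Lp_meas[OF h'(1)] Lp_meas[OF g(1)] in \<open>auto elim!: eventually_mono\<close>)
  have "(%k. frac_form s (phi' k) (psi k)) ~> kap * (LBINT xi. h' xi * g xi)"
   by (rule Hs_limit_ff[OF D(1) h' E(1) g])
  moreover have "(%k. (LBINT x. psi k x * w x)) ~> (LBINT x. v x * w x)"
   by (rule pair_conv[OF q1 p1 qp test_Lq[OF E(1)] E(2,3) w])
  moreover have "(%k. (LBINT x. psi k x * w x)) ~> kap * (LBINT xi. h xi * g xi)"
   unfolding Rep_limit[OF R h E(1)]
   by (intro tendsto_intros L2_pair_conv PH_L2 E g h const_seq_L2)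
  ultimately show ?thesis unfolding e using LIMSEQ_unique by (metis (no_types, lifting) mult.commute Bochner_Integration.integral_cong)
 qed
 obtain psi where psi: "Hs_approx s v psi" using v by (auto simp: Hs_def)
 show ?thesis unfolding Hs_form_def
 proof (rule the_equality)
  show "\<forall>phi psi. Hs_approx s u phi \<longrightarrow> Hs_approx s v psi \<longrightarrow> (%k. frac_form s (phi k) (psi k)) ~> (LBINT x. w x * v x)"
   using main by blast
  fix b assume "\<forall>phi psi. Hs_approx s u phi \<longrightarrow> Hs_approx s v psi \<longrightarrow> (%k. frac_form s (phi k) (psi k)) ~> b"
  then have "(%k. frac_form s (phi k) (psi k)) ~> b" using u psi by blast
  with main[OF u(2) psi] show "b = (LBINT x. w x * v x)" using LIMSEQ_unique by blast
 qed
qed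

lemma Rep_AE:
 assumes R: "Rep w u phi" and u': "u' \<in> bmeas" "AE x in lborel. u x = u' x"
 shows "Rep w u' phi"
proof -
 have "(NN x. ennreal (\<bar>phi k x - u x\<bar> powr q)) = (NN x. ennreal (\<bar>phi k x - u' x\<bar> powr q))" for k
  by (rule nn_integral_cong_AE) (use u'(2) in \<open>auto elim!: eventually_mono\<close>)
 then have "Hs_approx s u' phi" using R unfolding Rep_def Hs_approx_def q_def by simp
 then show ?thesis using R u' unfolding Rep_def by auto
qed

lemma weak_solution_Rep:
 assumes R: "Rep (dual u) u phi"
 shows "u \<in> Hs s" "weak_solution s q u" "Hs_form s u u = Np q u"
proof -
 show H: "u \<in> Hs s" using R unfolding Rep_def Hs_def by auto
 show "weak_solution s q u" unfolding weak_solution_def using H Hs_form_Rep[OF R] by (simp add: dual_def)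
 show "Hs_form s u u = Np q u" using Hs_form_Rep[OF R H] dual_int[of u] by (simp add: mult.commute)
qed

end

section \<open>Maximisers yield solutions\<close>

lemma AE_offdiag: "AE z in lborel \<Otimes>\<^sub>M (lborel :: 'a::euclidean_space measure). fst z \<noteq> snd z"
proof (rule lborel_pair.AE_pair_measure)
 show "{z \<in> space lborel2. fst z \<noteq> (snd z::'a)} \<in> sets lborel2" by measurable
 show "AE x in lborel. AE y in lborel. fst (x, y) \<noteq> (snd (x, y)::'a)"
 proof (rule AE_I2)
  fix x :: 'a
  show "AE y in lborel. fst (x, y) \<noteq> snd (x, y)" using AE_lborel_singleton[of x] by eventually_elim auto
 qed
qed

lemma sign_changing_scale: "c > 0 ==> sign_changing u ==> sign_changing (%x. c * u x)"
 by (simp add: sign_changing_def zero_less_mult_iff mult_less_0_iff)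

context crit
begin

text \<open>The form of the inverse operator: \<open>be w w\<close> is the energy of the potential
  of \<open>w\<close>.\<close>

definition be :: "('a => real) => ('a => real) => real" where "be v w = c0 * B v w"

lemma be_add:
 assumes "Lp p v" "Lp p v'" "Lp p w"
 shows "be (%x. v x + v' x) w = be v w + be v' w" "be w (%x. v x + v' x) = be w v + be w v'"
 using B_add[OF assms] by (simp_all add: be_def ring_distribs)
lemma be_diff:
 assumes "Lp p v" "Lp p v'" "Lp p w"
 shows "be (%x. v x - v' x) w = be v w - be v' w" "be w (%x. v x - v' x) = be w v - be w v'"
 using B_diff[OF assms] by (simp_all add: be_def ring_distribs)
lemma be_cmult: "be (%x. c * v x) w = c * be v w" "be v (%x. c * w x) = c * be v w"
 by (simp_all add: be_def B_cmult)
lemma be_sym: "Lp p v ==> Lp p w ==> be v w = be w v" by (simp add: be_def B_sym)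
lemma be_psd: "Lp p w ==> be w w \<ge> 0" using B_psd c0_pos by (simp add: be_def)
lemma be_bound: "Lp p v ==> Lp p w ==> \<bar>be v w\<bar> \<le> c0 * BC * Np p v powr (1/p) * Np p w powr (1/p)"
 using B_bound[of v w] c0_pos by (simp add: be_def abs_mult mult.assoc mult_left_mono)

lemma be_diff_self:
 assumes "Lp p v" "Lp p w"
 shows "be (%x. v x - w x) (%x. v x - w x) = be v v - 2 * be v w + be w w"
 using be_diff(1)[OF assms Lp_diff(1)[OF assms p0]] be_diff(2)[OF assms assms(1)] be_diff(2)[OF assms assms(2)] be_sym[OF assms] by simp

lemma be_CS:
 assumes v: "Lp p v" and w: "Lp p w"
 shows "\<bar>be v w\<bar> \<le> sqrt (be v v) * sqrt (be w w)"
proof -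
 let ?a = "be v v" and ?b = "be v w" and ?c = "be w w"
 have q: "0 \<le> ?a + 2 * t * ?b + t^2 * ?c" for t
 proof -
  have tw: "Lp p (%x. - t * w x)" by (rule Lp_cmult(1)[OF w])
  have "0 \<le> be (%x. v x - - t * w x) (%x. v x - - t * w x)" by (rule be_psd[OF Lp_diff(1)[OF v tw p0]])
  then show ?thesis unfolding be_diff_self[OF v tw] be_cmult by (simp add: power2_eq_square algebra_simps)
 qed
 have ac: "?a \<ge> 0" "?c \<ge> 0" using be_psd v w by auto
 have "?b^2 \<le> ?a * ?c"
 proof (cases "?c = 0")
  case True
  \<comment> \<open>With \<open>?c = 0\<close> the quadratic polynomial is affine in t and
    nonnegative, so its slope vanishes.\<close>
  have "?b = 0"
  proof (rule ccontr)
   assume b: "?b \<noteq> 0"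
   have "2 * (- (?a + 1) / (2 * ?b)) * ?b = - (?a + 1)" using b by simp
   then show False using q[of "- (?a + 1) / (2 * ?b)"] True by simp
  qed
  then show ?thesis using True by simp
 next
  case False
  then have c: "?c > 0" using ac by simp
  have "2 * (- ?b / ?c) * ?b + (- ?b / ?c)^2 * ?c = - (?b^2 / ?c)" using c by (simp add: field_simps power2_eq_square)
  then have "?b^2 / ?c \<le> ?a" using q[of "- ?b / ?c"] by linarith
  then show ?thesis using c by (simp add: pos_divide_le_eq)
 qed
 then have "sqrt (?b^2) \<le> sqrt (?a * ?c)" by (rule real_sqrt_le_mono)
 then show ?thesis by (simp add: real_sqrt_mult)
qed

text \<open>A chosen representative. Two choices agree only almost everywhere, so linearity and
  symmetry of \<open>pot\<close> are statements almost everywhere.\<close>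

definition pot :: "('a => real) => 'a => real" where "pot w = (SOME u. \<exists>phi. Rep w u phi)"

lemma pot_Rep: "Lp p w ==> \<exists>phi. Rep w (pot w) phi"
 unfolding pot_def using ex_Rep by (rule someI_ex)

lemma pot_pair: "Lp p w ==> Lp p v ==> (LBINT x. pot w x * v x) = be w v"
 unfolding be_def using pot_Rep Rep_pair by blast

lemma pot_Lq: "Lp p w ==> Lp q (pot w)"
 using pot_Rep[of w] Hs_approxD(2) unfolding Rep_def by blast

lemma q0: "q \<ge> 0" using q1 by simp

lemma AE_eq_if_pair_eq:
 fixes u v :: "'a => real"
 assumes u: "Lp q u" and v: "Lp q v" and e: "!!w. Lp p w ==> (LBINT x. u x * w x) = (LBINT x. v x * w x)"
 shows "AE x in lborel. u x = v x"
proof -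
 have d: "Lp q (%x. u x - v x)" by (rule Lp_diff(1)[OF u v q0])
 let ?w = "dual (%x. u x - v x)"
 have w: "Lp p ?w" by (rule dual_Lp(1)[OF d])
 have "Np q (%x. u x - v x) = (LBINT x. (u x - v x) * ?w x)" by (rule dual_int[symmetric])
 also have "... = 0" using Holder(1)[OF q1 p1 qp u w] Holder(1)[OF q1 p1 qp v w] e[OF w] by (simp add: left_diff_distrib)
 finally have "AE x in lborel. u x - v x = 0" by (rule Np_zero_AE[OF d])
 then show ?thesis by simp
qed

text \<open>The duality of \<open>sobolev\<close> once more: the mass of the potential is its
  pairing with its own dual function, which \<open>be_CS\<close> bounds by the two energies.\<close>

lemma pot_bound:
 assumes w: "Lp p w"
 shows "Np q (pot w) powr (1/q) \<le> SC * sqrt (be w w)"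
proof (rule dual_trick)
 show "0 \<le> SC * sqrt (be w w)" using SC_pos be_psd[OF w] by simp
 let ?A = "Np q (pot w)"
 have d: "Lp p (dual (pot w))" by (rule dual_Lp(1)[OF pot_Lq[OF w]])
 have "?A = be w (dual (pot w))" using pot_pair[OF w d] dual_int by simp
 also have "... \<le> sqrt (be w w) * sqrt (be (dual (pot w)) (dual (pot w)))" using be_CS[OF w d] by simp
 also have "... \<le> sqrt (be w w) * (SC * ?A powr (1/p))"
 proof (intro mult_left_mono)
  have "be (dual (pot w)) (dual (pot w)) \<le> c0 * BC * (?A powr (1/p))^2"
   using be_bound[OF d d] by (simp add: dual_Lp(2) power2_eq_square mult.assoc)
  then have "sqrt (be (dual (pot w)) (dual (pot w))) \<le> sqrt (c0 * BC * (?A powr (1/p))^2)" by (rule real_sqrt_le_mono)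
  then show "sqrt (be (dual (pot w)) (dual (pot w))) \<le> SC * ?A powr (1/p)" unfolding SC_def by (simp add: real_sqrt_mult)
 qed (use be_psd[OF w] in auto)
 finally show "?A \<le> SC * sqrt (be w w) * ?A powr (1/p)" by (simp add: mult.assoc mult.commute mult.left_commute)
qed simp

lemma pot_diff:
 assumes w: "Lp p w" and v: "Lp p v"
 shows "Np q (%x. pot w x - pot v x) \<le> (SC * sqrt (be (%x. w x - v x) (%x. w x - v x))) powr q"
proof -
 have d: "Lp p (%x. w x - v x)" by (rule Lp_diff(1)[OF w v p0])
 have L: "Lp q (%x. pot w x - pot v x)" by (rule Lp_diff(1)[OF pot_Lq[OF w] pot_Lq[OF v] q0])
 \<comment> \<open>The three potentials are independent choices; linearity is recovered by pairing
   with all of \<open>L^p\<close>.\<close>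
 have "AE x in lborel. pot (%x. w x - v x) x = pot w x - pot v x"
 proof (rule AE_eq_if_pair_eq[OF pot_Lq[OF d] L])
  fix f :: "'a => real" assume f: "Lp p f"
  have "(LBINT x. (pot w x - pot v x) * f x) = be w f - be v f"
   using Holder(1)[OF q1 p1 qp pot_Lq[OF w] f] Holder(1)[OF q1 p1 qp pot_Lq[OF v] f] pot_pair[OF w f] pot_pair[OF v f]
   by (simp add: left_diff_distrib)
  then show "(LBINT x. pot (%x. w x - v x) x * f x) = (LBINT x. (pot w x - pot v x) * f x)"
   using pot_pair[OF d f] be_diff(1)[OF w v f] by simp
 qed
 then have e: "Np q (pot (%x. w x - v x)) = Np q (%x. pot w x - pot v x)"
  using Lp_meas[OF pot_Lq[OF d]] Lp_meas[OF L] by (rule Np_AE_eq)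
 have "(Np q (pot (%x. w x - v x)) powr (1/q)) powr q \<le> (SC * sqrt (be (%x. w x - v x) (%x. w x - v x))) powr q"
  by (rule powr_mono2[OF q0 powr_ge_zero pot_bound[OF d]])
 moreover have "(Np q (pot (%x. w x - v x)) powr (1/q)) powr q = Np q (pot (%x. w x - v x))" using q1 by (simp add: powr_powr)
 ultimately show ?thesis using e by simp
qed

definition Sx :: "('a => real) set => real" where "Sx X = Sup {be w w | w. w \<in> X \<and> Np p w \<le> 1}"

text \<open>Cauchy in energy only. By \<open>pot_diff\<close> the potentials then converge in
  \<open>L^q\<close>, and the maximiser is rebuilt from their limit instead of being a limit of the
  sequence in \<open>L^p\<close>.\<close>

definition beCauchy :: "(nat => 'a => real) => bool" where
 "beCauchy w \<longleftrightarrow> (\<forall>e>0. \<exists>N. \<forall>j\<ge>N. \<forall>l\<ge>N. be (%x. w j x - w l x) (%x. w j x - w l x) \<le> e)"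

lemma be_le1: assumes "Lp p w" "Np p w \<le> 1" shows "be w w \<le> c0 * BC"
proof -
 have "Np p w powr (1/p) \<le> 1" using assms(2) p1 by (simp add: powr_le1)
 then have "(c0 * BC) * (Np p w powr (1/p) * Np p w powr (1/p)) \<le> (c0 * BC) * (1 * 1)"
  using c0_pos BC by (intro mult_left_mono mult_mono) auto
 then show ?thesis using be_bound[OF assms(1) assms(1)] by (simp add: mult.assoc)
qed

lemma Sx_props:
 assumes X: "!!w. w \<in> X ==> Lp p w" and z: "(%x. 0) \<in> X"
 shows "w \<in> X ==> Np p w \<le> 1 ==> be w w \<le> Sx X"
  and "e > 0 ==> \<exists>w\<in>X. Np p w \<le> 1 \<and> Sx X - e < be w w"
  and "Sx X \<le> c0 * BC"
proof -
 let ?T = "{be w w | w. w \<in> X \<and> Np p w \<le> 1}"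
 have bdd: "bdd_above ?T" using be_le1 X by (intro bdd_aboveI[of _ "c0 * BC"]) blast
 have ne: "?T \<noteq> {}" using z by (auto simp: Np_def intro!: exI[of _ "%x. 0"])
 show "w \<in> X ==> Np p w \<le> 1 ==> be w w \<le> Sx X" unfolding Sx_def by (rule cSup_upper[OF _ bdd]) blast
 show "\<exists>w\<in>X. Np p w \<le> 1 \<and> Sx X - e < be w w" if "e > 0"
 proof -
  have "Sx X - e < Sup ?T" using that by (simp add: Sx_def)
  then obtain y where "y \<in> ?T" "Sx X - e < y" using less_cSup_iff[OF ne bdd] by blast
  then show ?thesis by blast
 qed
 show "Sx X \<le> c0 * BC" unfolding Sx_def by (rule cSup_least[OF ne]) (use be_le1 X in blast)
qed

text \<open>Homogeneity of the energy. That the exponent \<open>2/p\<close> exceeds 1 is what later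
  penalises a splitting of the mass.\<close>

lemma Sx_scaled:
 assumes X: "!!w. w \<in> X ==> Lp p w" and sc: "!!w c. w \<in> X ==> (%x. c * w x) \<in> X" and w: "w \<in> X"
 shows "be w w \<le> Sx X * Np p w powr (2/p)"
proof -
 have z: "(%x. 0) \<in> X" using sc[OF w, of 0] by simp
 have L: "Lp p w" using X w by simp
 show ?thesis
 proof (cases "Np p w = 0")
  case True
  then show ?thesis using be_bound[OF L L] by simp
 next
  case False
  define a where "a = Np p w powr (1/p)"
  have a: "a > 0" "a powr p = Np p w" unfolding a_def using False Np_nonneg[of p w] p1 by (auto simp: powr_powr)
  have "Np p (%x. (1/a) * w x) \<le> 1" unfolding Lp_cmult(2)[OF L] using a False by (simp add: powr_divide)
  from Sx_props(1)[OF X z sc[OF w] this] have "be w w \<le> Sx X * (a * a)" using a unfolding be_cmult by (simp add: field_simps)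
  moreover have "a * a = Np p w powr (2/p)" unfolding a_def by (simp add: powr_add[symmetric])
  ultimately show ?thesis by simp
 qed
qed

text \<open>Let u be the limit of the potentials in \<open>L^q\<close>, \<open>A\<close> its mass
  and \<open>w\<close> its normalised dual function. Hoelder gives
  \<open>S \<le> A powr (1/q)\<close>, the pairing of \<open>v k\<close> with \<open>w\<close> tends
  to \<open>A powr (1/q)\<close>, and Cauchy-Schwarz bounds that limit by
  \<open>sqrt S * sqrt (be w w) \<le> S\<close>. All these are therefore equalities:
  \<open>w\<close> is a maximiser, \<open>v k\<close> tends to it in energy, and u is its potential.
  Rescaling removes the multiplier.\<close>

lemma maximizer_solution:
 assumes X: "!!w. w \<in> X ==> Lp p w" and sc: "!!w c. w \<in> X ==> (%x. c * w x) \<in> X"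
  and cl: "!!w u. (!!k. w k \<in> X) ==> Lp q u ==> (%k. Np q (%x. pot (w k) x - u x)) ~> 0
    ==> dual u \<in> X \<and> (Np q u > 0 \<longrightarrow> sign_changing u)"
  and pos: "Sx X > 0"
  and v: "!!k. v k \<in> X" "!!k. Np p (v k) \<le> 1" "(%k::nat. be (v k) (v k)) ~> Sx X" "beCauchy v"
 shows "\<exists>w\<in>X. Np p w \<le> 1 \<and> be w w = Sx X"
  and "\<exists>u :: 'a => real. u \<in> Hs s \<and> weak_solution s q u \<and> sign_changing u \<and> Hs_form s u u = Sx X powr (- q / (q - 2))"
proof -
 define S where "S = Sx X"
 have S: "S > 0" using pos by (simp add: S_def)
 have z: "(%x. 0) \<in> X" using sc[OF v(1)[of 0], of 0] by simp
 note vL = X[OF v(1)]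
 define u' where "u' = (%k. pot (v k))"
 have uL: "Lp q (u' k)" for k unfolding u'_def by (rule pot_Lq[OF vL])
 have um: "u' k \<in> bmeas" for k by (rule Lp_meas[OF uL])
 have q0': "q > 0" using q1 by simp
 have cau: "\<exists>N. \<forall>k\<ge>N. \<forall>l\<ge>N. (NN x. ennreal (\<bar>u' k x - u' l x\<bar> powr q)) \<le> ennreal e" if e: "e > 0" for e
 proof -
  define d where "d = (e powr (1/q) / SC)^2"
  have d: "d > 0" unfolding d_def using e SC_pos by simp
  from v(4) d obtain N where N: "!!j l. j \<ge> N ==> l \<ge> N ==> be (%x. v j x - v l x) (%x. v j x - v l x) \<le> d" unfolding beCauchy_def by blast
  have "(NN x. ennreal (\<bar>u' k x - u' l x\<bar> powr q)) \<le> ennreal e" if kl: "k \<ge> N" "l \<ge> N" for k l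
  proof -
   have "sqrt (be (%x. v k x - v l x) (%x. v k x - v l x)) \<le> sqrt d" using N[OF kl] by (rule real_sqrt_le_mono)
   also have "sqrt d = e powr (1/q) / SC" unfolding d_def using SC_pos by simp
   finally have 1: "SC * sqrt (be (%x. v k x - v l x) (%x. v k x - v l x)) \<le> e powr (1/q)"
    using SC_pos by (simp add: pos_le_divide_eq mult.commute)
   have 2: "0 \<le> SC * sqrt (be (%x. v k x - v l x) (%x. v k x - v l x))"
    using SC_pos be_psd[OF Lp_diff(1)[OF vL vL p0]] by simp
   have "Np q (%x. u' k x - u' l x) \<le> (e powr (1/q)) powr q"
    unfolding u'_def by (rule order_trans[OF pot_diff[OF vL vL] powr_mono2[OF q0 2 1]])
   also have "... = e" using e q0' by (simp add: powr_powr)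
   finally show ?thesis using nn_Np[OF Lp_diff(1)[OF uL uL q0], of k l] by (simp add: ennreal_leI)
  qed
  then show ?thesis by blast
 qed
 obtain u where u: "u \<in> bmeas" "(%k. (NN x. ennreal (\<bar>u' k x - u x\<bar> powr q))) ~> 0"
  by (rule Lp_complete[of q u'], rule q0', rule um, rule cau, assumption, blast)
 have uq: "Lp q u" and uc: "(%k. Np q (%x. u' k x - u x)) ~> 0" using conv_Np[OF q0 uL u] by auto
 have dX: "dual u \<in> X" and sgn: "Np q u > 0 \<longrightarrow> sign_changing u" using cl[OF v(1) uq] uc unfolding u'_def by auto
 define A where "A = Np q u"
 have dL: "Lp p (dual u)" by (rule X[OF dX])
 have pair1: "(%k. be (v k) (dual u)) ~> A"
  using pair_conv[OF q1 p1 qp uL uq uc dL] unfolding u'_def pot_pair[OF vL dL] dual_int A_def .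
 \<comment> \<open>The energy of \<open>v k\<close> is its pairing with its own potential, which is
   close to u in \<open>L^q\<close>, and \<open>v k\<close> lies in the unit ball.\<close>
 have SA: "S \<le> A powr (1/q)"
 proof -
  have "be (v k) (v k) \<le> A powr (1/q) + Np q (%x. u' k x - u x) powr (1/q)" for k
  proof -
   have n1: "Np p (v k) powr (1/p) \<le> 1" using v(2)[of k] p1 by (simp add: powr_le1)
   have "be (v k) (v k) = (LBINT x. u x * v k x) + (LBINT x. (u' k x - u x) * v k x)"
    using pot_pair[OF vL vL, of k k] Holder(1)[OF q1 p1 qp uL vL, of k k] Holder(1)[OF q1 p1 qp uq vL, of k]
    by (simp add: u'_def left_diff_distrib)
   moreover have "(LBINT x. u x * v k x) \<le> A powr (1/q) * 1"
    by (rule order_trans[OF order_trans[OF abs_ge_self Holder_abs[OF q1 p1 qp uq vL]]], unfold A_def, intro mult_left_mono n1) auto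
   moreover have "(LBINT x. (u' k x - u x) * v k x) \<le> Np q (%x. u' k x - u x) powr (1/q) * 1"
    by (rule order_trans[OF order_trans[OF abs_ge_self Holder_abs[OF q1 p1 qp Lp_diff(1)[OF uL uq q0] vL]]], intro mult_left_mono n1) auto
   ultimately show ?thesis by simp
  qed
  moreover have "(%k. A powr (1/q) + Np q (%x. u' k x - u x) powr (1/q)) ~> A powr (1/q) + 0"
   by (intro tendsto_intros powr_tendsto_0 uc) (use q0' in auto)
  ultimately show ?thesis using LIMSEQ_le[OF v(3)] unfolding S_def by auto
 qed
 have A0: "A > 0"
 proof (rule ccontr)
  assume "\<not> A > 0" then have "A = 0" unfolding A_def using Np_nonneg[of q u] by linarith
  then show False using SA S by simp
 qed
 define w where "w = (%x. A powr (- 1/p) * dual u x)"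
 have wX: "w \<in> X" unfolding w_def by (rule sc[OF dX])
 have wL: "Lp p w" by (rule X[OF wX])
 have "(A powr (- 1/p)) powr p = A powr (- 1)" unfolding powr_powr using p1 by simp
 then have wN: "Np p w = 1" unfolding w_def Lp_cmult(2)[OF dL] dual_Lp(2) using A0 by (simp add: A_def[symmetric] powr_minus)
 have wS: "be w w \<le> S" unfolding S_def by (rule Sx_props(1)[OF X z wX]) (simp_all add: wN)
 have vw: "(%k. be (v k) w) ~> A powr (1/q)"
 proof -
  have "(%k. A powr (- 1/p) * be (v k) (dual u)) ~> A powr (- 1/p) * A" by (intro tendsto_intros pair1)
  moreover have "A powr (- 1/p) * A = A powr (1/q)"
  proof -
   have "A powr (- 1/p) * A powr 1 = A powr (- 1/p + 1)" by (simp only: powr_add)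
   moreover have "- 1/p + 1 = 1/q" using pq by linarith
   ultimately show ?thesis using A0 by simp
  qed
  ultimately show ?thesis unfolding w_def be_cmult by simp
 qed
 have lim_sqrt: "(%k. sqrt (be (v k) (v k)) * sqrt (be w w)) ~> sqrt S * sqrt (be w w)"
  unfolding S_def by (intro tendsto_intros v(3))
 have AS: "A powr (1/q) \<le> sqrt S * sqrt (be w w)"
  using LIMSEQ_le[OF vw lim_sqrt] be_CS[OF vL wL] by (meson abs_le_D1)
 have ww: "be w w = S"
 proof -
  have "sqrt S * sqrt S \<le> sqrt S * sqrt (be w w)" using SA AS S by simp
  then have "sqrt S \<le> sqrt (be w w)" by (rule mult_left_le_imp_le) (use S in simp)
  then have "S \<le> be w w" by simp
  then show ?thesis using wS by simp
 qed
 then have AqS: "A powr (1/q) = S" using AS SA S by simp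
 show "\<exists>w\<in>X. Np p w \<le> 1 \<and> be w w = Sx X" using wX wN ww unfolding S_def by (intro bexI[of _ w]) auto
 \<comment> \<open>By the equalities the squared energy distance of \<open>v k\<close> and
   \<open>w\<close> tends to S - 2 S + S = 0.\<close>
 have "(%k. be (v k) (v k) - 2 * be (v k) w + be w w) ~> S - 2 * S + S"
  using vw v(3) unfolding AqS ww S_def[symmetric] by (intro tendsto_intros)
 then have be0: "(%k. be (%x. v k x - w x) (%x. v k x - w x)) ~> 0" unfolding be_diff_self[OF vL wL] by simp
 have ae: "AE x in lborel. u x = pot w x"
 proof -
  have pw: "Lp q (pot w)" by (rule pot_Lq[OF wL])
  have d: "Lp q (%x. u x - pot w x)" by (rule Lp_diff(1)[OF uq pw q0])
  have le: "Np q (%x. u x - pot w x) \<le> 2 powr q * (Np q (%x. u' k x - u x) + (SC * sqrt (be (%x. v k x - w x) (%x. v k x - w x))) powr q)" for k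
  proof -
   have "Np q (%x. (u' k x - pot w x) - (u' k x - u x)) \<le> 2 powr q * (Np q (%x. u' k x - pot w x) + Np q (%x. u' k x - u x))"
    by (rule Lp_diff(2)[OF Lp_diff(1)[OF uL pw q0] Lp_diff(1)[OF uL uq q0] q0])
   also have "... \<le> 2 powr q * ((SC * sqrt (be (%x. v k x - w x) (%x. v k x - w x))) powr q + Np q (%x. u' k x - u x))"
    unfolding u'_def by (intro mult_left_mono add_mono pot_diff vL wL) auto
   finally show ?thesis by (simp add: add.commute)
  qed
  have "(%k. 2 powr q * (Np q (%x. u' k x - u x) + (SC * sqrt (be (%x. v k x - w x) (%x. v k x - w x))) powr q)) ~> 2 powr q * (0 + 0)"
  proof (intro tendsto_mult tendsto_add tendsto_const uc powr_tendsto_0 q0')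
   show "(%k. SC * sqrt (be (%x. v k x - w x) (%x. v k x - w x))) ~> 0"
    using tendsto_mult_left[OF tendsto_real_sqrt[OF be0], of SC] by simp
   show "0 \<le> SC * sqrt (be (%x. v k x - w x) (%x. v k x - w x))" for k
    using SC_pos be_psd[OF Lp_diff(1)[OF vL wL p0]] by simp
  qed
  then have "Np q (%x. u x - pot w x) \<le> 0" using LIMSEQ_le_const[of _ _ "Np q (%x. u x - pot w x)"] le by fastforce
  then have "Np q (%x. u x - pot w x) = 0" using Np_nonneg[of q "%x. u x - pot w x"] by linarith
  from Np_zero_AE[OF d this] show ?thesis by simp
 qed
 \<comment> \<open>The scale at which the multiplier disappears: \<open>\<tau> powr (q - 2)\<close>
   has to equal \<open>A powr (- 1/p)\<close>, the factor between \<open>dual u\<close> and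
   \<open>w\<close>.\<close>
 define \<tau> where "\<tau> = A powr (- 1 / (p * (q - 2)))"
 have \<tau>: "\<tau> > 0" unfolding \<tau>_def using A0 by simp
 have \<tau>e: "\<tau> powr (q - 2) = A powr (- 1/p)" unfolding \<tau>_def using q2 p1 by (simp add: powr_powr)
 define y where "y = (%x. \<tau> * u x)"
 have dy: "dual y = (%x. \<tau> * w x)"
 proof
  fix x
  have "dual y x = \<tau> powr (q - 2) * \<tau> * dual u x" unfolding dual_def y_def using \<tau> by (simp add: abs_mult powr_mult)
  then show "dual y x = \<tau> * w x" unfolding \<tau>e w_def by simp
 qed
 have yL: "Lp q y" unfolding y_def by (rule Lp_cmult(1)[OF uq])
 have \<tau>w: "Lp p (%x. \<tau> * w x)" by (rule Lp_cmult(1)[OF wL])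
 have "AE x in lborel. pot (%x. \<tau> * w x) x = y x"
 proof (rule AE_eq_if_pair_eq[OF pot_Lq[OF \<tau>w] yL])
  fix f :: "'a => real" assume f: "Lp p f"
  have "(LBINT x. y x * f x) = \<tau> * (LBINT x. u x * f x)" unfolding y_def by (simp add: mult.assoc)
  also have "(LBINT x. u x * f x) = (LBINT x. pot w x * f x)"
   by (rule integral_cong_AE) (use ae Lp_meas[OF uq] Lp_meas[OF pot_Lq[OF wL]] Lp_meas[OF f] in \<open>auto elim!: eventually_mono\<close>)
  finally show "(LBINT x. pot (%x. \<tau> * w x) x * f x) = (LBINT x. y x * f x)"
   unfolding pot_pair[OF \<tau>w f] pot_pair[OF wL f] be_cmult by simp
 qed
 then obtain phi where R: "Rep (dual y) y phi" using pot_Rep[OF \<tau>w] Rep_AE[OF _ Lp_meas[OF yL]] unfolding dy by blast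
 have "Np q y = \<tau> powr q * A" unfolding y_def Lp_cmult(2)[OF uq] A_def using \<tau> by simp
 also have "... = A powr (- 1 / (p * (q - 2)) * q + 1)" unfolding \<tau>_def powr_powr powr_add using A0 by simp
 also have "- 1 / (p * (q - 2)) * q + 1 = 1/q * (- q / (q - 2))"
 proof -
  have "q / p = q - 1" using pq q1 p1 by (simp add: field_simps)
  then have "- 1 / (p * (q - 2)) * q = - (q - 1) / (q - 2)" by (metis (no_types, opaque_lifting) divide_divide_eq_left minus_divide_left mult_minus_left mult_1 times_divide_eq_left)
  then show ?thesis using q2 by (simp add: field_simps)
 qed
 also have "A powr (1/q * (- q / (q - 2))) = S powr (- q / (q - 2))" unfolding AqS[symmetric] powr_powr ..
 finally have E: "Np q y = S powr (- q / (q - 2))" .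
 have "sign_changing y" unfolding y_def using sign_changing_scale[OF \<tau>] sgn A0 unfolding A_def by blast
 then show "\<exists>u :: 'a => real. u \<in> Hs s \<and> weak_solution s q u \<and> sign_changing u \<and> Hs_form s u u = Sx X powr (- q / (q - 2))"
  using weak_solution_Rep[OF R] E[unfolded S_def] by (intro exI[of _ y]) simp
qed

text \<open>The abstract scheme. In \<open>cp\<close> the sequence may be exchanged for another one
  with the same energies before a subsequence is taken, which leaves room for dilations. The energy
  of a solution is a negative power of the maximum, so unbounded energies amount to arbitrarily
  small maxima.\<close>

theorem family_solutions:
 fixes X :: "nat => ('a => real) set"
 assumes X: "!!m w. w \<in> X m ==> Lp p w" and sc: "!!m w c. w \<in> X m ==> (%x. c * w x) \<in> X m"
  and cl: "!!m w u. (!!k. w k \<in> X m) ==> Lp q u ==> (%k. Np q (%x. pot (w k) x - u x)) ~> 0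
    ==> dual u \<in> X m \<and> (Np q u > 0 \<longrightarrow> sign_changing u)"
  and ex: "!!m. \<exists>w\<in>X m. be w w > 0"
  and orth: "!!m l w v. m < l ==> w \<in> X m ==> v \<in> X l ==> be w v = 0"
  and cp: "!!m w S. (!!k. w k \<in> X (m k)) ==> (!!k. Np p (w k) \<le> 1) ==> S > 0 ==> (%k::nat. be (w k) (w k)) ~> S
    ==> (%k. Sx (X (m k))) ~> S
    ==> \<exists>w' r. (\<forall>k. w' k \<in> X (m k) \<and> Np p (w' k) \<le> 1 \<and> be (w' k) (w' k) = be (w k) (w k)) \<and> strict_mono (r :: nat => nat) \<and> beCauchy (w' \<circ> r)"
 shows "\<exists>u :: nat => 'a => real. (\<forall>k. u k \<in> Hs s \<and> weak_solution s q (u k) \<and> sign_changing (u k)) \<and> filterlim (%k. Hs_form s (u k) (u k)) at_top sequentially"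
proof -
 have z: "(%x. 0) \<in> X m" for m using ex[of m] sc[of _ m 0] by auto
 have Sxm1: "be w w \<le> Sx (X m)" if "w \<in> X m" "Np p w \<le> 1" for m w
  by (rule Sx_props(1)[of "X m"]) (use X z that in auto)
 have Sxm2: "\<exists>w\<in>X m. Np p w \<le> 1 \<and> Sx (X m) - e < be w w" if "e > 0" for m e
  by (rule Sx_props(2)[of "X m"]) (use X z that in auto)
 have Sxm3: "Sx (X m) \<le> c0 * BC" for m by (rule Sx_props(3)[of "X m"]) (use X z in auto)
 have pos: "Sx (X m) > 0" for m
 proof -
  obtain w where w: "w \<in> X m" "be w w > 0" using ex by blast
  have "be w w \<le> Sx (X m) * Np p w powr (2/p)" by (rule Sx_scaled[of "X m"]) (use X sc w in auto)
  then have "0 < Sx (X m) * Np p w powr (2/p)" using w(2) by linarith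
  then show ?thesis by (simp add: zero_less_mult_iff not_less)
 qed
 have seq: "\<exists>v. (\<forall>k. v k \<in> X m) \<and> (\<forall>k. Np p (v k) \<le> 1) \<and> (%k::nat. be (v k) (v k)) ~> Sx (X m) \<and> beCauchy v" for m
 proof -
  define eps where "eps = (%k::nat. 1 / real (Suc k))"
  have eps: "eps k > 0" for k unfolding eps_def by simp
  have eps0: "eps ~> 0" unfolding eps_def using LIMSEQ_inverse_real_of_nat by (simp add: inverse_eq_divide)
  have "\<forall>k. \<exists>w. w \<in> X m \<and> Np p w \<le> 1 \<and> Sx (X m) - eps k < be w w"
   using Sxm2[OF eps] by blast
  then obtain w where w: "!!k. w k \<in> X m" "!!k. Np p (w k) \<le> 1" "!!k. Sx (X m) - eps k < be (w k) (w k)" by metis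
  have lim: "(%k. be (w k) (w k)) ~> Sx (X m)"
  proof (rule tendsto_sandwich)
   show "(%k. Sx (X m) - eps k) ~> Sx (X m)" using tendsto_diff[OF tendsto_const eps0, of "Sx (X m)"] by simp
   show "\<forall>\<^sub>F k in sequentially. be (w k) (w k) \<le> Sx (X m)" using Sxm1[OF w(1,2)] by simp
   show "\<forall>\<^sub>F k in sequentially. Sx (X m) - eps k \<le> be (w k) (w k)" using w(3) by (simp add: less_imp_le)
  qed simp
  from cp[of w "%_. m", OF w(1,2) pos lim tendsto_const] obtain w' r where
   w': "!!k. w' k \<in> X m" "!!k. Np p (w' k) \<le> 1" "!!k. be (w' k) (w' k) = be (w k) (w k)" "strict_mono (r :: nat => nat)" "beCauchy (w' \<circ> r)" by blast
  have "(%k. be ((w' \<circ> r) k) ((w' \<circ> r) k)) ~> Sx (X m)"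
   using LIMSEQ_subseq_LIMSEQ[OF lim w'(4)] w'(3) by (simp add: o_def)
  then show ?thesis using w' by (intro exI[of _ "w' \<circ> r"]) auto
 qed
 have mx: "\<exists>w\<in>X m. Np p w \<le> 1 \<and> be w w = Sx (X m)" for m

 proof -
  obtain v where v: "!!k. v k \<in> X m" "!!k. Np p (v k) \<le> 1" "(%k::nat. be (v k) (v k)) ~> Sx (X m)" "beCauchy v"
   using seq[of m] by blast
  show ?thesis by (rule maximizer_solution(1)[of "X m" v], erule X, erule sc, rule cl[of _ m], blast, assumption, assumption, rule pos, (rule v)+)
 qed
 have sol: "\<exists>u :: 'a => real. u \<in> Hs s \<and> weak_solution s q u \<and> sign_changing u \<and> Hs_form s u u = Sx (X m) powr (- q / (q - 2))" for m

 proof -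
  obtain v where v: "!!k. v k \<in> X m" "!!k. Np p (v k) \<le> 1" "(%k::nat. be (v k) (v k)) ~> Sx (X m)" "beCauchy v"
   using seq[of m] by blast
  show ?thesis by (rule maximizer_solution(2)[of "X m" v], erule X, erule sc, rule cl[of _ m], blast, assumption, assumption, rule pos, (rule v)+)
 qed
 \<comment> \<open>Otherwise choose classes of increasing index whose maxima converge. Their
   maximisers would have a subsequence that is Cauchy in energy, yet by orthogonality the squared
   distance of two of them is the sum of two maxima, at least \<open>2 * \<delta>\<close>.\<close>
 have small: "\<exists>m. Sx (X m) < \<delta>" if \<delta>: "\<delta> > 0" for \<delta>
 proof (rule ccontr)
  assume "\<not> ?thesis"
  then have ge: "Sx (X m) \<ge> \<delta>" for m by (simp add: not_less)
  have "Sx (X m) \<in> {\<delta>..c0 * BC}" for m using ge Sxm3[of m] by simp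
  then obtain S r where S: "S \<in> {\<delta>..c0 * BC}" "strict_mono r" "((%m. Sx (X m)) \<circ> r) ~> S"
   using compact_Icc[of \<delta> "c0 * BC"] unfolding compact_def by (elim allE[of _ "%m. Sx (X m)"]) blast
  have "\<forall>k. \<exists>w. w \<in> X (r k) \<and> Np p w \<le> 1 \<and> be w w = Sx (X (r k))" using mx by blast
  then obtain w where w: "!!k. w k \<in> X (r k)" "!!k. Np p (w k) \<le> 1" "!!k. be (w k) (w k) = Sx (X (r k))" by metis
  have lim: "(%k. Sx (X (r k))) ~> S" using S(3) by (simp add: o_def)
  have S0: "S > 0" using S(1) \<delta> by simp
  from cp[of w r, OF w(1,2) S0 lim[folded w(3)] lim] obtain w' t where
   w': "!!k. w' k \<in> X (r k)" "!!k. be (w' k) (w' k) = be (w k) (w k)" "strict_mono (t :: nat => nat)" "beCauchy (w' \<circ> t)" by blast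
  from w'(4) \<delta> obtain N where N: "!!j l. j \<ge> N ==> l \<ge> N ==> be (%x. w' (t j) x - w' (t l) x) (%x. w' (t j) x - w' (t l) x) \<le> \<delta>"
   unfolding beCauchy_def by (metis comp_apply)
  have "r (t N) < r (t (Suc N))" using S(2) w'(3) by (simp add: strict_mono_def)
  from orth[OF this w'(1) w'(1)] have "be (w' (t N)) (w' (t (Suc N))) = 0" .
  then have "be (%x. w' (t N) x - w' (t (Suc N)) x) (%x. w' (t N) x - w' (t (Suc N)) x) = Sx (X (r (t N))) + Sx (X (r (t (Suc N))))"
   unfolding be_diff_self[OF X[OF w'(1)] X[OF w'(1)]] w'(2) w(3) by simp
  then show False using N[of N "Suc N"] ge[of "r (t N)"] ge[of "r (t (Suc N))"] \<delta> by simp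
 qed
 have big: "\<exists>u :: 'a => real. u \<in> Hs s \<and> weak_solution s q u \<and> sign_changing u \<and> Hs_form s u u \<ge> real k" for k :: nat
 proof -
  \<comment> \<open>Shifted by one, so that the base of the powers is positive also for
    \<open>k = 0\<close>.\<close>
  define M where "M = real k + 1"
  have M: "M > 0" unfolding M_def by simp
  define e where "e = q / (q - 2)"
  have e: "e > 0" unfolding e_def using q2 by simp
  obtain m where m: "Sx (X m) < M powr (- 1 / e)" using small[of "M powr (- 1 / e)"] M by auto
  have "M = (M powr (- 1 / e)) powr (- e)" using M e by (simp add: powr_powr)
  also have "... \<le> Sx (X m) powr (- e)" using m pos[of m] e by (intro powr_mono2') auto
  also have "... = Sx (X m) powr (- q / (q - 2))" unfolding e_def by simp
  finally show ?thesis using sol[of m] unfolding M_def by force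
 qed
 then have "\<forall>k. \<exists>u :: 'a => real. u \<in> Hs s \<and> weak_solution s q u \<and> sign_changing u \<and> Hs_form s u u \<ge> real k" by blast
 from choice[OF this] obtain u :: "nat => 'a => real" where u: "!!k. u k \<in> Hs s \<and> weak_solution s q (u k) \<and> sign_changing (u k) \<and> Hs_form s (u k) (u k) \<ge> real k" by blast
 have "filterlim (%k. Hs_form s (u k) (u k)) at_top sequentially"
  by (rule filterlim_at_top_mono[OF filterlim_real_sequentially]) (use u in auto)
 then show ?thesis using u by (intro exI[of _ u]) auto
qed

end

section \<open>Precompactness\<close>

lemma mult_div_le:
 fixes x e k :: real
 assumes "x \<ge> 0" "e > 0" "k > 0"
 shows "x * (e / (k * (x + 1))) \<le> e / k"
proof -
 have "x * (e / (k * (x + 1))) = (x / (x + 1)) * (e / k)" by simp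
 also have "... \<le> 1 * (e / k)" using assms by (intro mult_right_mono) auto
 finally show ?thesis by simp
qed

context crit
begin

lemma ball_L1:
 fixes f :: "'a => real"
 assumes f: "Lp p f"
 shows "integrable lborel (%x. f x * indicator (cball 0 R) x)"
  and "(LBINT x. \<bar>f x * indicator (cball 0 R) x\<bar>) \<le> Np p f powr (1/p) * measure lborel (cball (0::'a) R) powr (1/q)"
proof -
 have e: "(%x. \<bar>indicator (cball (0::'a) R) x :: real\<bar> powr q) = indicator (cball 0 R)" by (auto simp: indicator_def fun_eq_iff)
 have i: "integrable lborel (indicator (cball (0::'a) R) :: 'a => real)" using emeasure_lborel_cball_finite[of "0::'a" R] by simp
 have L: "Lp q (indicator (cball (0::'a) R) :: 'a => real)" unfolding Lp_def e using i by auto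
 have N: "Np q (indicator (cball (0::'a) R) :: 'a => real) = measure lborel (cball (0::'a) R)" unfolding Np_def e by simp
 show "integrable lborel (%x. f x * indicator (cball 0 R) x)" by (rule Holder(1)[OF p1 q1 pq f L])
 show "(LBINT x. \<bar>f x * indicator (cball 0 R) x\<bar>) \<le> Np p f powr (1/p) * measure lborel (cball (0::'a) R) powr (1/q)"
  using Holder(2)[OF p1 q1 pq f L] unfolding N .
qed

text \<open>The kernel with its singularity capped at distance \<delta>. Being continuous, it turns
  bounded sequences of \<open>L^p\<close> into equicontinuous families on balls.\<close>

definition Kd :: "real => 'a => real" where "Kd \<delta> z = max (norm z) \<delta> powr (- lam)"

lemma Kd_cont: "\<delta> > 0 ==> continuous_on A (Kd \<delta>)"
 unfolding Kd_def by (intro continuous_intros) (auto simp: max_def)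

lemma Kd_meas [measurable]: "Kd \<delta> \<in> bmeas"
 unfolding Kd_def by measurable

lemma Kd_bounds: "\<delta> > 0 ==> 0 \<le> Kd \<delta> z \<and> Kd \<delta> z \<le> \<delta> powr (- lam) \<and> (z \<noteq> 0 \<longrightarrow> Kd \<delta> z \<le> K z)"
 unfolding Kd_def K_def using lam_pos by (auto intro!: powr_mono2')

lemma Kd_eq: "norm z \<ge> \<delta> ==> Kd \<delta> z = K z" unfolding Kd_def K_def by (simp add: max_absorb1)

definition FK :: "real => real => ('a => real) => 'a => real" where
 "FK \<delta> R w x = (LBINT y. Kd \<delta> (x - y) * (w y * indicator (cball 0 R) y))"

lemma FK_int:
 fixes w :: "'a => real"
 assumes w: "Lp p w" and d: "\<delta> > 0"
 shows "integrable lborel (%y. Kd \<delta> (x - y) * (w y * indicator (cball 0 R) y))"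
proof (rule Bochner_Integration.integrable_bound)
 show "integrable lborel (%y. \<delta> powr (-lam) * (w y * indicator (cball 0 R) y))" using ball_L1(1)[OF w] by simp
 have [measurable]: "w \<in> bmeas" by (rule Lp_meas[OF w])
 have [measurable]: "(indicator (cball 0 R) :: 'a => real) \<in> bmeas" by (rule borel_measurable_indicator) auto
 show "(%y. Kd \<delta> (x - y) * (w y * indicator (cball 0 R) y)) \<in> borel_measurable lborel" by measurable
 show "AE y in lborel. norm (Kd \<delta> (x - y) * (w y * indicator (cball 0 R) y)) \<le> norm (\<delta> powr (-lam) * (w y * indicator (cball 0 R) y))"
  using Kd_bounds[OF d] by (intro AE_I2) (auto simp: abs_mult intro!: mult_right_mono)
qed

text \<open>Arzela-Ascoli. On a ball the unit mass bounds the \<open>L^1\<close> norms by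
  \<open>A\<close>, and differences of points of the ball stay in the ball of radius
  \<open>R + R\<close>, where the capped kernel is uniformly continuous.\<close>

lemma FK_subseq:
 fixes w :: "nat => 'a => real"
 assumes w: "!!k. Lp p (w k)" "!!k. Np p (w k) \<le> 1" and d: "\<delta> > 0"
 shows "\<exists>r. strict_mono (r :: nat => nat) \<and> (\<forall>e>0. \<exists>N. \<forall>j\<ge>N. \<forall>l\<ge>N. \<forall>x\<in>cball 0 R. \<bar>FK \<delta> R (w (r j)) x - FK \<delta> R (w (r l)) x\<bar> \<le> e)"
proof -
 define A where "A = measure lborel (cball (0::'a) R) powr (1/q) + 1"
 have A: "A > 0" unfolding A_def by (simp add: add_nonneg_pos)
 have L1: "(LBINT x. \<bar>w k x * indicator (cball 0 R) x\<bar>) \<le> A" for k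
 proof -
  have "Np p (w k) powr (1/p) * measure lborel (cball (0::'a) R) powr (1/q) \<le> 1 * measure lborel (cball (0::'a) R) powr (1/q)"
   using w(2)[of k] p1 by (intro mult_right_mono) (auto simp: powr_le1)
  then show ?thesis using ball_L1(2)[OF w(1)[of k], of R] unfolding A_def by linarith
 qed
 \<comment> \<open>One estimate for two uses: \<open>c = 0\<close> gives the uniform bound,
   \<open>c = 1\<close> the equicontinuity.\<close>
 have bd: "\<bar>FK \<delta> R (w k) x - FK \<delta> R (w k) y * c\<bar> \<le> b * A"
  if b: "!!z. z \<in> cball 0 R ==> \<bar>Kd \<delta> (x - z) - Kd \<delta> (y - z) * c\<bar> \<le> b" "b \<ge> 0" for k x y b c
 proof -
  have "FK \<delta> R (w k) x - FK \<delta> R (w k) y * c = (LBINT z. (Kd \<delta> (x - z) - Kd \<delta> (y - z) * c) * (w k z * indicator (cball 0 R) z))"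
  proof -
   let ?g = "%x z. Kd \<delta> (x - z) * (w k z * indicator (cball 0 R) z)"
   have "(LBINT z. ?g x z - ?g y z * c) = (LBINT z. ?g x z) - (LBINT z. ?g y z) * c"
    using FK_int[OF w(1) d, of x k R] FK_int[OF w(1) d, of y k R] by simp
   then show ?thesis unfolding FK_def by (simp add: left_diff_distrib mult.assoc mult.commute[of c] mult.left_commute[of c])
  qed
  also have "\<bar>...\<bar> \<le> (LBINT z. b * \<bar>w k z * indicator (cball 0 R) z\<bar>)"
  proof (rule order_trans[OF integral_abs_bound integral_mono'])
   show "integrable lborel (%z. b * \<bar>w k z * indicator (cball 0 R) z\<bar>)" using ball_L1(1)[OF w(1)[of k], of R] by simp
   show "\<bar>(Kd \<delta> (x - z) - Kd \<delta> (y - z) * c) * (w k z * indicator (cball 0 R) z)\<bar> \<le> b * \<bar>w k z * indicator (cball 0 R) z\<bar>" for z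
    using b(1)[of z] by (cases "z \<in> cball 0 R") (auto simp: abs_mult intro!: mult_right_mono)
   show "0 \<le> b * \<bar>w k z * indicator (cball 0 R) z\<bar>" for z using b(2) by simp
  qed
  also have "... \<le> b * A" using L1[of k] b(2) by (simp add: mult_left_mono)
  finally show ?thesis .
 qed
 have "\<exists>g r. strict_mono (r :: nat => nat) \<and> (\<forall>e>0. \<exists>N. \<forall>n x. n \<ge> N \<and> x \<in> cball 0 R \<longrightarrow> norm (FK \<delta> R (w (r n)) x - g x) < e)"
 proof -
  have b1: "norm (FK \<delta> R (w n) x) \<le> \<delta> powr (-lam) * A" for n x
   using bd[of x x 0 "\<delta> powr (-lam)" n] Kd_bounds[OF d] by auto
  have b2: "\<exists>h. 0 < h \<and> (\<forall>n y. y \<in> cball 0 R \<and> norm (x - y) < h \<longrightarrow> norm (FK \<delta> R (w n) x - FK \<delta> R (w n) y) < e)"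
   if x: "x \<in> cball 0 R" and e: "e > 0" for x e
  proof -
   have "uniformly_continuous_on (cball (0::'a) (R + R)) (Kd \<delta>)"
    by (intro compact_uniformly_continuous Kd_cont d compact_cball)
   then obtain h where h: "h > 0" "!!z z'. z \<in> cball 0 (R + R) ==> z' \<in> cball 0 (R + R) ==> dist z' z < h ==> dist (Kd \<delta> z') (Kd \<delta> z) < e / (2 * A)"
    unfolding uniformly_continuous_on_def using e A by (metis divide_pos_pos mult_pos_pos zero_less_numeral)
   have "norm (FK \<delta> R (w n) x - FK \<delta> R (w n) y) < e" if y: "y \<in> cball 0 R" "norm (x - y) < h" for n y
   proof -
    have "\<bar>FK \<delta> R (w n) x - FK \<delta> R (w n) y * 1\<bar> \<le> e / (2 * A) * A"
    proof (rule bd)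
     fix z :: 'a assume z: "z \<in> cball 0 R"
     have "x - z \<in> cball 0 (R + R)" "y - z \<in> cball 0 (R + R)"
      using x y z norm_triangle_ineq4[of x z] norm_triangle_ineq4[of y z] by auto
     then have "dist (Kd \<delta> (x - z)) (Kd \<delta> (y - z)) < e / (2 * A)" by (intro h(2)) (use y in \<open>auto simp: dist_norm\<close>)
     then show "\<bar>Kd \<delta> (x - z) - Kd \<delta> (y - z) * 1\<bar> \<le> e / (2 * A)" by (simp add: dist_real_def)
    qed (use e A in auto)
    also have "... < e" using e A by simp
    finally show ?thesis by simp
   qed
   then show ?thesis using h(1) by blast
  qed
  show ?thesis
  proof (rule Arzela_Ascoli[OF compact_cball[of 0 R] b1 b2], assumption, assumption)
   fix g k assume "strict_mono (k :: nat => nat)"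
    "!!e. 0 < e ==> \<exists>N. \<forall>n x. n \<ge> N \<and> x \<in> cball 0 R \<longrightarrow> norm (FK \<delta> R (w (k n)) x - g x) < e"
   then show "\<exists>g r. strict_mono (r :: nat => nat) \<and> (\<forall>e>0. \<exists>N. \<forall>n x. n \<ge> N \<and> x \<in> cball 0 R \<longrightarrow> norm (FK \<delta> R (w (r n)) x - g x) < e)"
    by (intro exI[of _ g] exI[of _ k] conjI allI impI) simp_all
  qed
 qed
 then obtain g r where r: "strict_mono (r :: nat => nat)" "!!e. e > 0 ==> \<exists>N. \<forall>n x. n \<ge> N \<and> x \<in> cball 0 R \<longrightarrow> norm (FK \<delta> R (w (r n)) x - g x) < e" by blast
 have "\<exists>N. \<forall>j\<ge>N. \<forall>l\<ge>N. \<forall>x\<in>cball 0 R. \<bar>FK \<delta> R (w (r j)) x - FK \<delta> R (w (r l)) x\<bar> \<le> e" if "e > 0" for e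
 proof -
  from r(2)[of "e/2"] that obtain N where N: "!!n x. n \<ge> N ==> x \<in> cball 0 R ==> \<bar>FK \<delta> R (w (r n)) x - g x\<bar> < e/2" by auto
  show ?thesis
  proof (intro exI[of _ N] allI impI ballI)
   fix j l x assume "N \<le> j" "N \<le> l" "x \<in> cball (0::'a) R"
   then show "\<bar>FK \<delta> R (w (r j)) x - FK \<delta> R (w (r l)) x\<bar> \<le> e" using N[of j x] N[of l x] by (simp add: abs_if split: if_splits)
  qed
 qed
 then show ?thesis using r(1) by blast
qed

text \<open>The difference \<open>K - Kd \<delta>\<close> lives within distance \<delta> of the
  diagonal and falls under \<open>near_diagonal\<close>. The capped part is the pairing of
  \<open>v\<close> with a function that is at most \<open>eta\<close> on the ball.\<close>

lemma be_split_kernel: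
 fixes v :: "'a => real"
 assumes v: "Lp p v" and sup: "!!x. x \<notin> cball 0 R ==> v x = 0" and d: "\<delta> > 0" and M: "Np p v \<le> M"
  and m: "m \<ge> 0" "!!z. Np p (%x. v x * indicator (ball z (2*\<delta>)) x) \<le> m"
  and eta: "!!x. x \<in> cball 0 R ==> \<bar>FK \<delta> R v x\<bar> \<le> eta"
 shows "be v v \<le> c0 * (2 powr nn * HC * m powr (2/p - 1) * M + eta * (M powr (1/p) * measure lborel (cball (0::'a) R) powr (1/q)))"
proof -
 let ?P = "lborel \<Otimes>\<^sub>M (lborel :: 'a measure)"
 have [measurable]: "v \<in> bmeas" by (rule Lp_meas[OF v])
 have [measurable]: "K \<in> bmeas" unfolding K_def by measurable
 have M0: "M \<ge> 0" using M Np_nonneg[of p v] by linarith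
 have vr: "v x * indicator (cball 0 R) x = v x" for x using sup[of x] by (cases "x \<in> cball 0 R") auto
 define D where "D = (%z::'a \<times> 'a. v (fst z) * (K (fst z - snd z) - Kd \<delta> (fst z - snd z)) * v (snd z))"
 define k where "k = (%z::'a \<times> 'a. ennreal (\<bar>v (fst z)\<bar> * K (fst z - snd z) * \<bar>v (snd z)\<bar>) * indicator {z. dist (fst z) (snd z) < \<delta>} z)"
 have [measurable]: "D \<in> borel_measurable ?P" unfolding D_def by (simp add: measurable_lborel1)
 have iB: "integrable ?P (%z. v (fst z) * K (fst z - snd z) * v (snd z))" by (rule B_integrable(1)[OF v v])
 have Dk: "AE z in ?P. ennreal \<bar>D z\<bar> \<le> k z"
  using AE_offdiag
 proof eventually_elim
  case (elim z)
  have nz: "fst z - snd z \<noteq> 0" using elim by simp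
  show ?case
  proof (cases "dist (fst z) (snd z) < \<delta>")
   case True
   have "\<bar>D z\<bar> \<le> \<bar>v (fst z)\<bar> * K (fst z - snd z) * \<bar>v (snd z)\<bar>" unfolding D_def abs_mult
    using Kd_bounds[OF d, of "fst z - snd z"] nz by (intro mult_right_mono mult_left_mono) auto
   then show ?thesis using True by (simp add: k_def ennreal_leI)
  next
   case False
   then show ?thesis using Kd_eq[of \<delta> "fst z - snd z"] by (simp add: D_def dist_norm)
  qed
 qed
 have kb: "(\<integral>\<^sup>+z. k z \<partial>?P) \<le> ennreal (2 powr nn * HC * m powr (2/p - 1) * M)"
 proof -
  have [measurable]: "k \<in> borel_measurable (borel \<Otimes>\<^sub>M borel)" unfolding k_def by measurable
  then have km: "k \<in> borel_measurable ?P" by (simp add: measurable_cong_sets[OF sets_pair_measure_cong[OF sets_lborel sets_lborel] refl])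
  have "(\<integral>\<^sup>+z. k z \<partial>?P) = (NN x. (NN y. k (x, y)))" by (rule lborel.nn_integral_fst[of k lborel, OF km, symmetric])
  also have "... = (NN x. (NN y. ennreal (\<bar>v x\<bar> * K (x - y) * \<bar>v y\<bar>) * indicator (ball x \<delta>) y))"
   by (intro nn_integral_cong) (auto simp: k_def indicator_def)
  also have "... \<le> ennreal (2 powr nn * HC * m powr (2/p - 1) * M)"
  proof (rule near_diagonal)
   show "(NN x. ennreal (\<bar>v x\<bar> powr p)) \<le> ennreal M" unfolding nn_Np[OF v] using M by (rule ennreal_leI)
   fix z
   have "(NN x. ennreal (\<bar>v x\<bar> powr p) * indicator (ball z (2 * \<delta>)) x) = (NN x. ennreal (\<bar>v x * indicator (ball z (2 * \<delta>)) x\<bar> powr p))"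
    using p0 p1 by (intro nn_integral_cong) (auto simp: indicator_def)
   also have "... = ennreal (Np p (%x. v x * indicator (ball z (2 * \<delta>)) x))" by (rule nn_Np[OF Lp_mult_ind(1)[OF v _ p0]]) auto
   finally show "(NN x. ennreal (\<bar>v x\<bar> powr p) * indicator (ball z (2 * \<delta>)) x) \<le> ennreal m" using m(2)[of z] by (simp add: ennreal_leI)
  qed (use M0 d m in auto)
  finally show ?thesis .
 qed
 have HC0: "0 \<le> 2 powr nn * HC * m powr (2/p - 1) * M" using HC M0 by simp
 have Dn: "(\<integral>\<^sup>+z. ennreal \<bar>D z\<bar> \<partial>?P) \<le> ennreal (2 powr nn * HC * m powr (2/p - 1) * M)"
  by (rule order_trans[OF nn_integral_mono_AE[OF Dk] kb])
 have iD: "integrable ?P D"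
 proof (rule integrableI_bounded)
  show "(\<integral>\<^sup>+z. ennreal (norm (D z)) \<partial>?P) < \<infinity>" using order_le_less_trans[OF Dn ennreal_less_top] by simp
 qed measurable
 have Di: "(\<integral>z. D z \<partial>?P) \<le> 2 powr nn * HC * m powr (2/p - 1) * M"
 proof -
  have "ennreal (\<integral>z. \<bar>D z\<bar> \<partial>?P) = (\<integral>\<^sup>+z. ennreal \<bar>D z\<bar> \<partial>?P)" using iD by (intro nn_integral_eq_integral[symmetric]) auto
  then have "ennreal (\<integral>z. \<bar>D z\<bar> \<partial>?P) \<le> ennreal (2 powr nn * HC * m powr (2/p - 1) * M)" using Dn by simp
  then have "(\<integral>z. \<bar>D z\<bar> \<partial>?P) \<le> 2 powr nn * HC * m powr (2/p - 1) * M" using HC0 by simp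
  then show ?thesis using integral_abs_bound[of ?P D] by linarith
 qed
 define E where "E = (%z::'a \<times> 'a. v (fst z) * Kd \<delta> (fst z - snd z) * v (snd z))"
 have iE: "integrable ?P E" using Bochner_Integration.integrable_diff[OF iB iD] by (simp add: D_def E_def algebra_simps)
 have "(\<integral>z. E z \<partial>?P) = (LBINT x. (LBINT y. E (x, y)))" by (rule lborel_pair.integral_fst'[OF iE, symmetric])
 also have "... = (LBINT x. FK \<delta> R v x * v x)"
 proof (intro Bochner_Integration.integral_cong refl)
  fix x
  have "(LBINT y. E (x, y)) = (LBINT y. v x * (Kd \<delta> (x - y) * v y))" by (simp add: E_def mult.assoc)
  then show "(LBINT y. E (x, y)) = FK \<delta> R v x * v x" by (simp add: FK_def vr mult.commute)
 qed
 also have "... \<le> (LBINT x. eta * \<bar>v x * indicator (cball 0 R) x\<bar>)"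
 proof (rule integral_mono')
  show "integrable lborel (%x. eta * \<bar>v x * indicator (cball 0 R) x\<bar>)" using ball_L1(1)[OF v, of R] by simp
  fix x :: 'a
  show "FK \<delta> R v x * v x \<le> eta * \<bar>v x * indicator (cball 0 R) x\<bar>"
  proof (cases "x \<in> cball 0 R")
   case True
   have "FK \<delta> R v x * v x \<le> \<bar>FK \<delta> R v x\<bar> * \<bar>v x\<bar>" using abs_ge_self[of "FK \<delta> R v x * v x"] by (simp add: abs_mult)
   also have "... \<le> eta * \<bar>v x\<bar>" using eta[OF True] by (rule mult_right_mono) simp
   finally show ?thesis unfolding vr .
  qed (simp add: sup)
  show "0 \<le> eta * \<bar>v x * indicator (cball 0 R) x\<bar>"
   using eta[of x] by (cases "x \<in> cball 0 R") (auto intro!: mult_nonneg_nonneg)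
 qed
 also have "... \<le> eta * (M powr (1/p) * measure lborel (cball (0::'a) R) powr (1/q))"
 proof (cases "cball (0::'a) R = {}")
  case True then show ?thesis by simp
 next
  case False
  then have "eta \<ge> 0" using eta abs_ge_zero order_trans by blast
  moreover have "Np p v powr (1/p) * measure lborel (cball (0::'a) R) powr (1/q) \<le> M powr (1/p) * measure lborel (cball (0::'a) R) powr (1/q)"
   using M Np_nonneg[of p v] p1 by (intro mult_right_mono powr_mono2) auto
  ultimately show ?thesis using ball_L1(2)[OF v, of R] by (simp add: mult_left_mono)
 qed
 finally have "(\<integral>z. E z \<partial>?P) \<le> eta * (M powr (1/p) * measure lborel (cball (0::'a) R) powr (1/q))" .
 moreover have "B v v = (\<integral>z. D z \<partial>?P) + (\<integral>z. E z \<partial>?P)"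
  unfolding B_def Bochner_Integration.integral_add[OF iD iE, symmetric] by (simp add: D_def E_def algebra_simps)
 ultimately show ?thesis unfolding be_def using Di c0_pos by (intro mult_left_mono) auto
qed

section \<open>Tightness, non-concentration and the compactness criterion\<close>

definition tight :: "(nat => 'a => real) => bool" where
 "tight w \<longleftrightarrow> (\<forall>e>0. \<exists>R N. \<forall>k\<ge>N. Np p (%x. w k x * indicator (- cball 0 R) x) \<le> e)"

definition nonconc :: "(nat => 'a => real) => bool" where
 "nonconc w \<longleftrightarrow> (\<forall>e>0. \<exists>d>0. \<exists>N. \<forall>k\<ge>N. \<forall>z. Np p (%x. w k x * indicator (ball z d) x) \<le> e)"

lemma tight_subseq: "tight w ==> strict_mono (r :: nat => nat) ==> tight (w \<circ> r)"
 unfolding tight_def o_def by (meson le_trans seq_suble)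

lemma nonconc_subseq: "nonconc w ==> strict_mono (r :: nat => nat) ==> nonconc (w \<circ> r)"
 unfolding nonconc_def o_def by (meson le_trans seq_suble)

lemma diff_ind:
 fixes f g :: "'a => real"
 assumes "Lp p f" "Lp p g" "A \<in> sets borel" "Np p (%x. f x * indicator A x) \<le> e" "Np p (%x. g x * indicator A x) \<le> e"
 shows "Np p (%x. (f x - g x) * indicator A x) \<le> 2 powr p * (e + e)"
proof -
 have "Np p (%x. f x * indicator A x - g x * indicator A x) \<le> 2 powr p * (Np p (%x. f x * indicator A x) + Np p (%x. g x * indicator A x))"
  by (rule Lp_diff(2)[OF Lp_mult_ind(1)[OF assms(1,3) p0] Lp_mult_ind(1)[OF assms(2,3) p0] p0])
 also have "... \<le> 2 powr p * (e + e)" using assms by (intro mult_left_mono add_mono) auto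
 finally show ?thesis by (simp add: left_diff_distrib)
qed

text \<open>The difference of two members is cut into its part in a large ball and a tail. Tightness
  makes the tail cheap; in the ball non-concentration controls the near-diagonal part of the kernel
  and Arzela-Ascoli the capped part.\<close>

lemma precompact_eps:
 fixes w :: "nat => 'a => real"
 assumes w: "!!k. Lp p (w k)" "!!k. Np p (w k) \<le> 1" and T: "tight w" and NC: "nonconc w" and e: "e > 0"
 shows "\<exists>r. strict_mono (r :: nat => nat) \<and> (\<exists>N. \<forall>j\<ge>N. \<forall>l\<ge>N. be (%x. w (r j) x - w (r l) x) (%x. w (r j) x - w (r l) x) \<le> e)"
proof -
 define M where "M = 2 powr p * (1 + 1)"
 define C where "C = c0 * BC * M powr (1/p)"
 have M: "M > 0" unfolding M_def by simp
 have C: "C \<ge> 0" unfolding C_def using c0_pos BC by simp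
 \<comment> \<open>With this tail mass each of the two terms that contain the tail is at most
   \<open>e / 8\<close>; the choices of \<open>m\<close> and \<open>eta\<close> below contribute
   \<open>e / 4\<close> each. The summand 1 in the denominators guards against a vanishing
   constant.\<close>
 define t where "t = (e / (8 * (C + 1))) powr p / (2 * 2 powr p)"
 have t: "t > 0" unfolding t_def using e C by simp
 have t': "C * (2 powr p * (t + t)) powr (1/p) \<le> e / 8"
 proof -
  have "2 powr p * (t + t) = (e / (8 * (C + 1))) powr p" unfolding t_def by simp
  then have "(2 powr p * (t + t)) powr (1/p) = e / (8 * (C + 1))" using p1 e C by (simp add: powr_powr)
  then show ?thesis using mult_div_le[OF C e, of 8] by simp
 qed
 define G where "G = c0 * (2 powr nn * HC * M)"
 have G: "G \<ge> 0" unfolding G_def using c0_pos HC M by simp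
 define a where "a = 2/p - 1"
 have a: "a > 0" unfolding a_def using two_div_p p1 p2 by (simp add: field_simps)
 define m where "m = (e / (4 * (G + 1))) powr (1/a)"
 have m: "m > 0" unfolding m_def using e G by simp
 have m': "G * m powr a \<le> e / 4"
 proof -
  have "m powr a = e / (4 * (G + 1))" unfolding m_def using a e G by (simp add: powr_powr)
  then show ?thesis using mult_div_le[OF G e, of 4] by simp
 qed
 from T t obtain R N1 where R: "!!k. k \<ge> N1 ==> Np p (%x. w k x * indicator (- cball 0 R) x) \<le> t" unfolding tight_def by blast
 define m1 where "m1 = m / (2 * 2 powr p)"
 have m1: "m1 > 0" "2 powr p * (m1 + m1) = m" unfolding m1_def using m by simp_all
 have "\<exists>d>0. \<exists>N. \<forall>k\<ge>N. \<forall>z. Np p (%x. w k x * indicator (ball z d) x) \<le> m1" using NC m1(1) unfolding nonconc_def by blast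
 then obtain d N2 where d: "d > 0" "!!k z. k \<ge> N2 ==> Np p (%x. w k x * indicator (ball z d) x) \<le> m1" by blast
 \<comment> \<open>\<open>near_diagonal\<close> at distance \<delta> asks for the mass of balls of
   radius \<open>2 * \<delta>\<close>.\<close>
 define \<delta> where "\<delta> = d / 2"
 have \<delta>: "\<delta> > 0" "2 * \<delta> = d" unfolding \<delta>_def using d by auto
 define V where "V = c0 * (M powr (1/p) * measure lborel (cball (0::'a) R) powr (1/q))"
 have V: "V \<ge> 0" unfolding V_def using c0_pos by simp
 define eta where "eta = e / (4 * (V + 1))"
 have eta: "eta > 0" unfolding eta_def using e V by simp
 have eta': "eta * V \<le> e / 4"
  using mult_div_le[OF V e, of 4] unfolding eta_def by (simp add: mult.commute)
 have "\<exists>r. strict_mono (r :: nat => nat) \<and> (\<forall>e>0. \<exists>N. \<forall>j\<ge>N. \<forall>l\<ge>N. \<forall>x\<in>cball 0 R. \<bar>FK \<delta> R (w (r j)) x - FK \<delta> R (w (r l)) x\<bar> \<le> e)"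
  by (rule FK_subseq[OF w \<delta>(1)])
 then obtain r where r: "strict_mono (r :: nat => nat)"
  "!!e. e > 0 ==> \<exists>N. \<forall>j\<ge>N. \<forall>l\<ge>N. \<forall>x\<in>cball 0 R. \<bar>FK \<delta> R (w (r j)) x - FK \<delta> R (w (r l)) x\<bar> \<le> e" by blast
 from r(2)[OF eta] obtain N3 where N3: "!!j l x. j \<ge> N3 ==> l \<ge> N3 ==> x \<in> cball 0 R ==> \<bar>FK \<delta> R (w (r j)) x - FK \<delta> R (w (r l)) x\<bar> \<le> eta" by blast
 have main: "be (%x. w (r j) x - w (r l) x) (%x. w (r j) x - w (r l) x) \<le> e"
  if jl: "j \<ge> max N1 (max N2 N3)" "l \<ge> max N1 (max N2 N3)" for j l
 proof -
  have rj: "r j \<ge> N1" "r j \<ge> N2" "r l \<ge> N1" "r l \<ge> N2" using jl seq_suble[OF r(1), of j] seq_suble[OF r(1), of l] by auto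
  define f g where "f = w (r j)" and "g = w (r l)"
  have L: "Lp p f" "Lp p g" unfolding f_def g_def using w by auto
  define v where "v = (%x. f x - g x)"
  have v: "Lp p v" unfolding v_def by (rule Lp_diff(1)[OF L p0])
  have vN: "Np p v \<le> M"
   unfolding v_def M_def by (rule order_trans[OF Lp_diff(2)[OF L p0]]) (intro mult_left_mono add_mono, auto simp: f_def g_def w)
  define v1 v2 where "v1 = (%x. v x * indicator (cball 0 R) x)" and "v2 = (%x. v x * indicator (- cball 0 R) x)"
  have v12: "v = (%x. v1 x + v2 x)" unfolding v1_def v2_def by (auto simp: fun_eq_iff indicator_def)
  have L1: "Lp p v1" "Np p v1 \<le> M" unfolding v1_def using Lp_mult_ind[OF v _ p0, of "cball 0 R"] vN by auto
  have L2: "Lp p v2" unfolding v2_def by (rule Lp_mult_ind(1)[OF v _ p0]) auto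
  have N2': "Np p v2 \<le> 2 powr p * (t + t)"
   unfolding v2_def v_def using R[OF rj(1)] R[OF rj(3)] by (intro diff_ind L) (auto simp: f_def g_def)
  have small: "\<bar>be h v2\<bar> \<le> e / 8" if h: "Lp p h" "Np p h \<le> M" for h
  proof -
   have "\<bar>be h v2\<bar> \<le> c0 * BC * Np p h powr (1/p) * Np p v2 powr (1/p)" by (rule be_bound[OF h(1) L2])
   also have "... \<le> c0 * BC * M powr (1/p) * (2 powr p * (t + t)) powr (1/p)"
    using h N2' Np_nonneg p1 c0_pos BC by (intro mult_mono mult_left_mono powr_mono2) auto
   also have "... \<le> e / 8" using t' unfolding C_def .
   finally show ?thesis .
  qed
  have "be v v = be v v1 + be v v2" by (subst (2) v12) (rule be_add(2)[OF L1(1) L2 v])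
  also have "be v v1 = be v1 v1 + be v2 v1" by (subst (1) v12) (rule be_add(1)[OF L1(1) L2 L1(1)])
  also have "be v2 v1 = be v1 v2" by (rule be_sym[OF L2 L1(1)])
  finally have e1: "be v v \<le> be v1 v1 + e / 4" using small[OF v vN] small[OF L1] by linarith
  have "be v1 v1 \<le> c0 * (2 powr nn * HC * m powr (2/p - 1) * M + eta * (M powr (1/p) * measure lborel (cball (0::'a) R) powr (1/q)))"
  proof (rule be_split_kernel[OF L1(1) _ \<delta>(1) L1(2)])
   show "x \<notin> cball 0 R ==> v1 x = 0" for x unfolding v1_def by simp
   show "m \<ge> 0" using m by simp
   fix z :: 'a
   have b1: "Lp p (%x. v x * indicator (ball z d) x)" by (rule Lp_mult_ind(1)[OF v _ p0]) auto
   have "Np p (%x. (v x * indicator (ball z d) x) * indicator (cball 0 R) x) \<le> Np p (%x. v x * indicator (ball z d) x)"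
    by (rule Lp_mult_ind(2)[OF b1 _ p0]) auto
   also have "... \<le> 2 powr p * (m1 + m1)"
    unfolding v_def using d(2)[OF rj(2)] d(2)[OF rj(4)] by (intro diff_ind L) (auto simp: f_def g_def)
   finally show "Np p (%x. v1 x * indicator (ball z (2 * \<delta>)) x) \<le> m" unfolding m1 \<delta>(2) v1_def by (simp add: mult.assoc mult.commute mult.left_commute)
  next
   fix x :: 'a assume x: "x \<in> cball 0 R"
   have "FK \<delta> R v1 x = FK \<delta> R f x - FK \<delta> R g x"
    unfolding FK_def v1_def v_def using FK_int[OF L(1) \<delta>(1), of x R] FK_int[OF L(2) \<delta>(1), of x R]
    by (simp add: left_diff_distrib right_diff_distrib mult.assoc indicator_inter_arith[symmetric])
   then show "\<bar>FK \<delta> R v1 x\<bar> \<le> eta" using N3[of j l x] x jl unfolding f_def g_def by simp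
  qed
  also have "... = G * m powr a + eta * V" unfolding G_def a_def V_def by (simp add: algebra_simps)
  also have "... \<le> e / 2" using m' eta' by simp
  finally show ?thesis using e1 e unfolding v_def f_def g_def by simp
 qed
 show ?thesis using r(1) main by blast
qed

text \<open>A diagonal sequence over the accuracies \<open>1 / Suc n\<close>, each of which survives
  the passage to subsequences.\<close>

theorem precompact:
 fixes w :: "nat => 'a => real"
 assumes w: "!!k. Lp p (w k)" "!!k. Np p (w k) \<le> 1" and T: "tight w" and NC: "nonconc w"
 shows "\<exists>r. strict_mono (r :: nat => nat) \<and> beCauchy (w \<circ> r)"
proof -
 define P where "P = (%n (s::nat => nat). \<exists>N. \<forall>j\<ge>N. \<forall>l\<ge>N. be (%x. w (s j) x - w (s l) x) (%x. w (s j) x - w (s l) x) \<le> 1 / real (Suc n))"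
 interpret subseqs P
 proof
  fix n s assume s: "strict_mono (s :: nat => nat)"
  from precompact_eps[of "w \<circ> s" "1 / real (Suc n)", OF _ _ tight_subseq[OF T s] nonconc_subseq[OF NC s]] w
  show "\<exists>r'. strict_mono r' \<and> P n (s \<circ> r')" unfolding P_def by auto
 qed
 have P: "P k (diagseq \<circ> ((+) (Suc k)))" for k
 proof (rule diagseq_holds)
  fix r s n assume r: "strict_mono (r :: nat => nat)" and "P n s"
  then show "P n (s \<circ> r)" unfolding P_def o_def by (meson le_trans seq_suble)
 qed
 have "beCauchy (w \<circ> diagseq)"
  unfolding beCauchy_def
 proof (intro allI impI)
  fix e :: real assume "e > 0"
  then obtain k where k: "inverse (real (Suc k)) < e" using reals_Archimedean by blast
  from P[of k] obtain N where N: "!!j l. j \<ge> N ==> l \<ge> N ==>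
   be (%x. w (diagseq (Suc k + j)) x - w (diagseq (Suc k + l)) x) (%x. w (diagseq (Suc k + j)) x - w (diagseq (Suc k + l)) x) \<le> 1 / real (Suc k)"
   unfolding P_def o_def by blast
  show "\<exists>N. \<forall>j\<ge>N. \<forall>l\<ge>N. be (%x. (w \<circ> diagseq) j x - (w \<circ> diagseq) l x) (%x. (w \<circ> diagseq) j x - (w \<circ> diagseq) l x) \<le> e"
  proof (intro exI[of _ "Suc k + N"] allI impI)
   fix j l assume jl: "Suc k + N \<le> j" "Suc k + N \<le> l"
   then obtain j' l' where "j = Suc k + j'" "l = Suc k + l'" "j' \<ge> N" "l' \<ge> N"
    using that[of "j - Suc k" "l - Suc k"] by simp
   then show "be (%x. (w \<circ> diagseq) j x - (w \<circ> diagseq) l x) (%x. (w \<circ> diagseq) j x - (w \<circ> diagseq) l x) \<le> e"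
    using N[of j' l'] k by (simp add: inverse_eq_divide)
  qed
 qed
 then show ?thesis using subseq_diagseq by blast
qed

end

section \<open>Conformal symmetry\<close>

text \<open>Haar uniqueness by hand: both sides, multiplied by the volume of the unit ball, equal the integral of
 \<open>f (L x + y)\<close> over all \<open>x\<close> and all \<open>y\<close> in that ball.\<close>

lemma nn_integral_isometry:
 fixes L :: "'a::euclidean_space => 'a" and f :: "'a => ennreal"
 assumes L: "linear L" "!!x. norm (L x) = norm x" and [measurable]: "f \<in> bmeas"
 shows "(NN x. f (L x)) = (NN x. f x)"
proof -
 have "continuous_on UNIV L" using L(1) by (simp add: linear_continuous_on linear_conv_bounded_linear)
 then have [measurable]: "L \<in> bmeas" by (rule borel_measurable_continuous_onI)
 have diff: "norm (L x - L y) = norm (x - y)" for x y using L(2)[of "x - y"] L(1) by (simp add: linear_diff)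
 have "inj L"
 proof (rule injI)
  fix x y assume "L x = L y" then show "x = y" using diff[of x y] by simp
 qed
 then have "surj L" by (rule linear_injective_imp_surjective[OF L(1)]) simp
 then obtain L' where L': "!!y. L (L' y) = y" unfolding surj_def by metis
 define g where "g = (indicator (ball (0::'a) 1) :: 'a => ennreal)"
 have [measurable]: "g \<in> bmeas" unfolding g_def by (rule borel_measurable_indicator) auto
 define V where "V = (NN y. g y)"
 have Ve: "V = ennreal (unit_ball_vol (real DIM('a)))" unfolding V_def g_def using emeasure_ball[of 1 "0::'a"] by simp
 have V: "V \<noteq> 0" "V \<noteq> \<infinity>" unfolding Ve using unit_ball_vol_pos[of "real DIM('a)"] by (simp_all del: unit_ball_vol_pos)
 have Vg: "(NN x. g (y - L x)) = V" for y
 proof -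
  have "g (y - L x) = g (x + - L' y)" for x
   using diff[of "L' y" x] unfolding g_def L' by (simp add: indicator_def norm_minus_commute)
  then show ?thesis unfolding V_def using nn_integral_translate[of g "- L' y"] by simp
 qed
 have "(NN x. f (L x)) * V = (NN y. (NN x. f (L x) * g y))"
  unfolding V_def by (simp add: nn_integral_cmult nn_integral_multc)
 also have "... = (NN y. (NN x. f (L x + y) * g y))"
 proof (rule nn_integral_cong)
  fix y
  have "(NN x. f (L (x + L' y)) * g y) = (NN x. f (L x) * g y)"
   by (rule nn_integral_translate[of "%x. f (L x) * g y"]) measurable
  then show "(NN x. f (L x) * g y) = (NN x. f (L x + y) * g y)"
   by (simp add: linear_add[OF L(1)] L')
 qed
 also have "... = (NN x. (NN y. f (L x + y) * g y))" by (rule lborel_pair.Fubini') measurable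
 also have "... = (NN x. (NN y. f y * g (y - L x)))"
 proof (rule nn_integral_cong)
  fix x
  have "(NN y. f (y + L x) * g (y + L x - L x)) = (NN y. f y * g (y - L x))"
   by (rule nn_integral_translate[of "%y. f y * g (y - L x)"]) measurable
  then show "(NN y. f (L x + y) * g y) = (NN y. f y * g (y - L x))" by (simp add: add.commute)
 qed
 also have "... = (NN y. (NN x. f y * g (y - L x)))" by (rule lborel_pair.Fubini') measurable
 also have "... = (NN y. f y * V)" by (intro nn_integral_cong) (simp add: nn_integral_cmult Vg)
 also have "... = (NN y. f y) * V" by (simp add: nn_integral_multc)
 finally show ?thesis using V by (simp add: mult.commute[of _ V] ennreal_mult_cancel_left)
qed

section \<open>Conformal maps and their action on potentials\<close>

context crit
begin

text \<open>A Moebius transformation with conformal factor \<open>rho\<close>. The identity for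
  distances is asked almost everywhere, as inversions have a pole, and the change of variables is
  part of the definition, so that \<open>T\<close> never has to be differentiated.\<close>

definition conf :: "('a => 'a) => ('a => real) => bool" where
 "conf T rho \<longleftrightarrow> T \<in> bmeas \<and> rho \<in> bmeas \<and> (\<forall>x. rho x > 0) \<and>
  (AE x in lborel. AE y in lborel. (norm (T x - T y))^2 = rho x * rho y * (norm (x - y))^2) \<and>
  (\<forall>g \<in> bmeas. (NN x. g (T x) * ennreal (rho x powr nn)) = (NN x. g x))"

lemma conf_isometry:
 fixes L :: "'a => 'a"
 assumes L: "linear L" "!!x. norm (L x) = norm x" shows "conf L (%x. 1)"
proof -
 have "continuous_on UNIV L" using L(1) by (simp add: linear_continuous_on linear_conv_bounded_linear)
 then have "L \<in> bmeas" by (rule borel_measurable_continuous_onI)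
 moreover have "norm (L x - L y) = norm (x - y)" for x y using L(2)[of "x - y"] L(1) by (simp add: linear_diff)
 ultimately show ?thesis unfolding conf_def using nn_integral_isometry[OF L] by simp
qed

context
 fixes T :: "'a => 'a" and rho :: "'a => real"
 assumes cf: "conf T rho"
begin

lemma T_meas: "T \<in> bmeas" and rho_meas: "rho \<in> bmeas" and rho_pos: "rho x > 0"
 and T_dist: "AE x in lborel. AE y in lborel. (norm (T x - T y))^2 = rho x * rho y * (norm (x - y))^2"
 and T_nn: "g \<in> bmeas ==> (NN x. g (T x) * ennreal (rho x powr nn)) = (NN x. g x)"
 using cf unfolding conf_def by auto

text \<open>Preimages of null sets are null, because the density in the change of variables is
  positive.\<close>

lemma conf_AE:
 assumes "AE y in lborel. P y"
 shows "AE x in lborel. P (T x)"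
proof -
 note [measurable] = T_meas rho_meas
 obtain N where N: "{y \<in> space lborel. \<not> P y} \<subseteq> N" "emeasure lborel N = 0" "N \<in> sets lborel" using AE_E[OF assms] by blast
 have Nb: "N \<in> sets borel" using N(3) by simp
 have [measurable]: "(indicator N :: 'a => ennreal) \<in> bmeas" by (rule borel_measurable_indicator[OF Nb])
 have "(NN x. indicator N (T x) * ennreal (rho x powr nn)) = 0" using T_nn[of "indicator N"] N by simp
 then have "AE x in lborel. indicator N (T x) * ennreal (rho x powr nn) = 0" by (subst (asm) nn_integral_0_iff_AE) auto
 then show ?thesis
 proof eventually_elim
  case (elim x)
  then have "T x \<notin> N" using rho_pos[of x] by (auto simp: indicator_def split: if_splits)
  then show ?case using N(1) by auto
 qed
qed

lemma conf_distr: "distr (density lborel (%x. ennreal (rho x powr nn))) borel T = (lborel :: 'a measure)"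
proof (rule measure_eqI)
 note [measurable] = T_meas rho_meas
 fix A assume "A \<in> sets (distr (density lborel (%x. ennreal (rho x powr nn))) borel T)"
 then have A: "A \<in> sets borel" by simp
 have [measurable]: "(indicator A :: 'a => ennreal) \<in> bmeas" by (rule borel_measurable_indicator[OF A])
 have Ts: "T -` A \<in> sets borel" using measurable_sets[OF T_meas A] by simp
 have "emeasure (distr (density lborel (%x. ennreal (rho x powr nn))) borel T) A = emeasure (density lborel (%x. ennreal (rho x powr nn))) (T -` A)"
  using A by (subst emeasure_distr) auto
 also have "... = (NN x. ennreal (rho x powr nn) * indicator (T -` A) x)" using Ts by (subst emeasure_density) auto
 also have "... = (NN x. indicator A (T x) * ennreal (rho x powr nn))" by (intro nn_integral_cong) (auto simp: indicator_def)
 also have "... = emeasure lborel A" using A by (subst T_nn) auto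
 finally show "emeasure (distr (density lborel (%x. ennreal (rho x powr nn))) borel T) A = emeasure lborel A" .
qed simp

lemma conf_integral:
 fixes g :: "'a => real"
 assumes [measurable]: "g \<in> bmeas"
 shows "(LBINT x. rho x powr nn * g (T x)) = (LBINT x. g x)" "integrable lborel (%x. rho x powr nn * g (T x)) \<longleftrightarrow> integrable lborel g"
proof -
 note [measurable] = T_meas rho_meas
 have "(LBINT x. g x) = (\<integral>x. g (T x) \<partial>(density lborel (%x. ennreal (rho x powr nn))))"
  by (subst conf_distr[symmetric], subst integral_distr) auto
 also have "... = (LBINT x. rho x powr nn * g (T x))" by (subst integral_density) auto
 finally show "(LBINT x. rho x powr nn * g (T x)) = (LBINT x. g x)" by simp
 have "integrable lborel g \<longleftrightarrow> integrable (density lborel (%x. ennreal (rho x powr nn))) (%x. g (T x))"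
  by (subst conf_distr[symmetric], subst integrable_distr_eq) auto
 then show "integrable lborel (%x. rho x powr nn * g (T x)) \<longleftrightarrow> integrable lborel g" by (subst (asm) integrable_density) auto
qed

lemma conf_Np:
 fixes f :: "'a => real"
 assumes f: "Lp r f" and r: "r > 0"
 shows "Lp r (%x. rho x powr (nn/r) * f (T x))" "Np r (%x. rho x powr (nn/r) * f (T x)) = Np r f"
proof -
 note [measurable] = T_meas rho_meas
 have [measurable]: "f \<in> bmeas" by (rule Lp_meas[OF f])
 have e: "\<bar>rho x powr (nn/r) * f (T x)\<bar> powr r = rho x powr nn * (\<bar>f (T x)\<bar> powr r)" for x
  using r by (simp add: abs_mult powr_mult powr_powr)
 have m: "(%x. \<bar>f x\<bar> powr r) \<in> bmeas" by measurable
 have m2: "(%x. rho x powr (nn/r) * f (T x)) \<in> bmeas" by measurable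
 show "Lp r (%x. rho x powr (nn/r) * f (T x))" using f m2 conf_integral(2)[OF m] unfolding Lp_def e by simp
 show "Np r (%x. rho x powr (nn/r) * f (T x)) = Np r f" unfolding Np_def e using conf_integral(1)[OF m] by simp
qed

end

definition KP :: "('a => real) => 'a => real" where "KP w x = (LBINT y. K (x - y) * w y)"

lemma KP_meas [measurable]:
 assumes [measurable]: "w \<in> bmeas"
 shows "KP w \<in> bmeas"
 unfolding KP_def using lborel.borel_measurable_lebesgue_integral[of "%x y. K (x - y) * w y" borel] by simp

lemma KP_pair:
 assumes w: "Lp p w" and f: "Lp p f"
 shows "integrable lborel (%x. KP w x * f x)" "(LBINT x. KP w x * f x) = B f w"
proof -
 have i: "integrable lborel2 (%z. f (fst z) * K (fst z - snd z) * w (snd z))" by (rule B_integrable(1)[OF f w])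
 have e: "(LBINT y. f (fst (x, y)) * K (fst (x, y) - snd (x, y)) * w (snd (x, y))) = KP w x * f x" for x
  unfolding KP_def by (simp add: mult.assoc mult.commute[of _ "f x"])
 show "integrable lborel (%x. KP w x * f x)" using lborel_pair.integrable_fst'[OF i] unfolding e .
 show "(LBINT x. KP w x * f x) = B f w" using lborel_pair.integral_fst'[OF i] unfolding e B_def .
qed

text \<open>Identifies the abstractly chosen potential with the kernel integral, for which conformal
  covariance can be computed pointwise. The difference of the two is tested with its own sign on
  balls.\<close>

lemma pot_KP:
 assumes w: "Lp p w"
 shows "AE x in lborel. pot w x = c0 * KP w x"
proof -
 have [measurable]: "w \<in> bmeas" "pot w \<in> bmeas" using Lp_meas[OF w] Lp_meas[OF pot_Lq[OF w]] by auto
 define d where "d = (%x. pot w x - c0 * KP w x)"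
 have [measurable]: "d \<in> bmeas" unfolding d_def by measurable
 have "AE x in lborel. \<forall>m::nat. \<bar>d x * indicator (cball 0 (real m)) x\<bar> = 0"
 proof (subst AE_all_countable, intro allI)
  fix m :: nat
  define f where "f = (%x. sgn (d x) * indicator (cball 0 (real m)) x)"
  have [measurable]: "(indicator (cball 0 (real m)) :: 'a => real) \<in> bmeas" by (rule borel_measurable_indicator) auto
  have "Bd f" by (rule BdI_support[of _ 1 "real m"]) (auto simp: f_def indicator_def sgn_real_def)
  then have f: "Lp p f" using p1 by (intro Bd_Lp) auto
  have i1: "integrable lborel (%x. pot w x * f x)" by (rule Holder(1)[OF q1 p1 qp pot_Lq[OF w] f])
  have df: "d x * f x = \<bar>d x * indicator (cball 0 (real m)) x\<bar>" for x
   by (auto simp: f_def indicator_def abs_mult_sgn[symmetric] sgn_real_def)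
  have e: "d x * f x = pot w x * f x - c0 * (KP w x * f x)" for x unfolding d_def by (simp add: algebra_simps)
  have id: "integrable lborel (%x. d x * f x)" unfolding e using i1 KP_pair(1)[OF w f] by simp
  have "(LBINT x. d x * f x) = be w f - c0 * B f w"
   unfolding e using i1 KP_pair[OF w f] pot_pair[OF w f] by simp
  then have "(LBINT x. d x * f x) = 0" unfolding be_def by (simp add: B_sym[OF w f])
  then show "AE x in lborel. \<bar>d x * indicator (cball 0 (real m)) x\<bar> = 0"
   using id unfolding df by (subst (asm) integral_nonneg_eq_0_iff_AE) auto
 qed
 then show ?thesis
 proof eventually_elim
  case (elim x)
  obtain m :: nat where "norm x \<le> real m" using real_arch_simple by blast
  then show ?case using elim[rule_format, of m] unfolding d_def by (simp add: indicator_def)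
 qed
qed

context
 fixes T :: "'a => 'a" and rho :: "'a => real"
 assumes cf: "conf T rho"
begin

lemma lam_exp: "nn - lam / 2 = nn / p" "lam / 2 = nn / q"
 unfolding p_def q_def using nn_pos lam_pos s0 by (simp_all add: field_simps)

text \<open>Substitute \<open>T y\<close> for y. The density \<open>rho y powr nn\<close> and the
  two factors that the kernel releases combine to the weight \<open>nn / p\<close> for sources and
  \<open>nn / q\<close> for potentials, by \<open>lam_exp\<close>.\<close>

lemma conf_KP:
 assumes w: "Lp p w"
 shows "AE x in lborel. rho x powr (nn / q) * KP w (T x) = KP (%x. rho x powr (nn/p) * w (T x)) x"
 using T_dist[OF cf]
proof eventually_elim
 case (elim x)
 note [measurable] = T_meas[OF cf] rho_meas[OF cf] Lp_meas[OF w]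
 note pos = rho_pos[OF cf]
 have "KP w (T x) = (LBINT y. rho y powr nn * (K (T x - T y) * w (T y)))"
  unfolding KP_def by (rule conf_integral(1)[OF cf, symmetric, of "%y. K (T x - y) * w y"]) measurable
 then have "rho x powr (nn / q) * KP w (T x) = (LBINT y. rho x powr (nn / q) * (rho y powr nn * (K (T x - T y) * w (T y))))" by simp
 also have "... = (LBINT y. K (x - y) * (rho y powr (nn/p) * w (T y)))"
 proof (rule integral_cong_AE)
  show "AE y in lborel. rho x powr (nn / q) * (rho y powr nn * (K (T x - T y) * w (T y))) = K (x - y) * (rho y powr (nn/p) * w (T y))"
   using elim
  proof eventually_elim
   case (elim y)
   have sq: "K z = ((norm z)^2) powr (- (lam/2))" for z :: 'a
   proof -
    have "((norm z)^2) powr (- (lam/2)) = (norm z powr 2) powr (- (lam/2))" by simp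
    also have "... = norm z powr (2 * - (lam/2))" by (rule powr_powr)
    also have "2 * - (lam/2) = - lam" by (simp add: field_simps)
    finally show ?thesis by (simp only: K_def)
   qed
   have "K (T x - T y) = (rho x * rho y * (norm (x - y))^2) powr (- (lam/2))" by (simp only: sq[of "T x - T y"] elim)
   also have "... = rho x powr (- (lam/2)) * rho y powr (- (lam/2)) * K (x - y)"
    by (simp only: powr_mult sq[of "x - y"])
   finally have k: "K (T x - T y) = rho x powr (- (lam/2)) * rho y powr (- (lam/2)) * K (x - y)" .
   have y: "rho y powr nn * rho y powr (- (lam/2)) = rho y powr (nn / p)"
    by (simp only: powr_add[symmetric] lam_exp(1)[symmetric] diff_conv_add_uminus)
   have "rho x powr (nn / q) * rho x powr (- (lam/2)) = rho x powr 0"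
    by (simp only: powr_add[symmetric] lam_exp(2) add.right_inverse)
   also have "rho x powr 0 = 1" using pos[of x] by simp
   finally have x: "rho x powr (nn / q) * rho x powr (- (lam/2)) = 1" .
   have "rho x powr (nn / q) * (rho y powr nn * (rho x powr (- (lam/2)) * rho y powr (- (lam/2)) * K (x - y) * w (T y)))
    = (rho x powr (nn / q) * rho x powr (- (lam/2))) * (K (x - y) * ((rho y powr nn * rho y powr (- (lam/2))) * w (T y)))"
    by (simp only: mult.assoc mult.commute mult.left_commute)
   then show ?case by (simp only: k x y mult_1)
  qed
 qed measurable
 finally show ?case unfolding KP_def .
qed

lemma KP_AE: "AE x in lborel. w x = v x ==> w \<in> bmeas ==> v \<in> bmeas ==> KP w = KP v"
 unfolding KP_def by (intro ext integral_cong_AE) (auto elim!: eventually_mono)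

lemma KP_cmult: "KP (%x. c * w x) x = c * KP w x" unfolding KP_def by (simp add: mult.left_commute)

lemma conf_pot:
 assumes w: "Lp p w"
 shows "AE x in lborel. rho x powr (nn/q) * pot w (T x) = pot (%x. rho x powr (nn/p) * w (T x)) x"
proof -
 have p': "p > 0" using p1 by simp
 show ?thesis using conf_KP[OF w] conf_AE[OF cf pot_KP[OF w]] pot_KP[OF conf_Np(1)[OF cf w p']]
 proof eventually_elim
  case (elim x)
  then show ?case by (simp add: mult.left_commute)
 qed
qed

lemma pot_AE_eq:
 assumes "AE x in lborel. w x = eps * v x" "Lp p w" "Lp p v"
 shows "AE x in lborel. pot w x = eps * pot v x"
proof -
 have k: "KP w = KP (%x. eps * v x)" by (rule KP_AE[OF assms(1) Lp_meas[OF assms(2)] Lp_meas[OF Lp_cmult(1)[OF assms(3)]]])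
 show ?thesis using pot_KP[OF assms(2)] pot_KP[OF assms(3)]
  by eventually_elim (simp add: k KP_cmult)
qed

lemma conf_pot_inv:
 assumes w: "Lp p w" and inv: "AE x in lborel. rho x powr (nn/p) * w (T x) = eps * w x"
 shows "AE x in lborel. rho x powr (nn/q) * pot w (T x) = eps * pot w x"
proof -
 have p': "p > 0" using p1 by simp
 show ?thesis using conf_pot[OF w] pot_AE_eq[OF inv conf_Np(1)[OF cf w p'] w] by eventually_elim simp
qed

text \<open>The weights of source and potential, \<open>nn / p\<close> and \<open>nn / q\<close>,
  add up to \<open>nn\<close>, the weight of the change of variables.\<close>

lemma conf_be:
 assumes w: "Lp p w" and v: "Lp p v"
 shows "be (%x. rho x powr (nn/p) * w (T x)) (%x. rho x powr (nn/p) * v (T x)) = be w v"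
proof -
 have p': "p > 0" using p1 by simp
 note [measurable] = T_meas[OF cf] rho_meas[OF cf] Lp_meas[OF w] Lp_meas[OF v] Lp_meas[OF pot_Lq[OF w]]
  Lp_meas[OF pot_Lq[OF conf_Np(1)[OF cf w p']]]
 have "be w v = (LBINT x. rho x powr nn * (pot w (T x) * v (T x)))"
  unfolding pot_pair[OF w v, symmetric] by (rule conf_integral(1)[OF cf, symmetric, of "%x. pot w x * v x"]) measurable
 also have "... = (LBINT x. pot (%x. rho x powr (nn/p) * w (T x)) x * (rho x powr (nn/p) * v (T x)))"
 proof (rule integral_cong_AE)
  show "AE x in lborel. rho x powr nn * (pot w (T x) * v (T x)) = pot (%x. rho x powr (nn/p) * w (T x)) x * (rho x powr (nn/p) * v (T x))"
   using conf_pot[OF w]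
  proof eventually_elim
   case (elim x)
   have "nn = nn / q + nn / p" using lam_exp by linarith
   then have "rho x powr nn = rho x powr (nn/q) * rho x powr (nn/p)" by (simp flip: powr_add)
   then have "rho x powr nn * (pot w (T x) * v (T x)) = (rho x powr (nn/q) * pot w (T x)) * (rho x powr (nn/p) * v (T x))" by simp
   then show ?case unfolding elim .
  qed
 qed measurable
 also have "... = be (%x. rho x powr (nn/p) * w (T x)) (%x. rho x powr (nn/p) * v (T x))"
  by (rule pot_pair[OF conf_Np(1)[OF cf w p'] conf_Np(1)[OF cf v p']])
 finally show ?thesis by simp
qed

end

section \<open>Symmetry classes\<close>

lemma be_AE:
 assumes "Lp p w" "Lp p w'" "Lp p v" "Lp p v'" "AE x in lborel. w x = w' x" "AE x in lborel. v x = v' x"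
 shows "be w v = be w' v'"
 unfolding be_def using B_AE[of w w' v v'] assms by (simp add: Lp_meas)

text \<open>In each triple \<open>T\<close>, acting with the weight of \<open>L^p\<close>,
  multiplies the function by \<open>eps\<close>. The equations hold almost everywhere, so that they
  survive limits of potentials.\<close>

definition symc :: "(('a => 'a) \<times> ('a => real) \<times> real) set => ('a => real) set" where
 "symc H = {w. Lp p w \<and> (\<forall>(T, rho, eps) \<in> H. AE x in lborel. rho x powr (nn/p) * w (T x) = eps * w x)}"

lemma symc_Lp: "w \<in> symc H ==> Lp p w" unfolding symc_def by auto

lemma symc_scale: "w \<in> symc H ==> (%x. c * w x) \<in> symc H"
 unfolding symc_def by (auto intro!: Lp_cmult(1) elim!: eventually_mono simp: mult.left_commute split: prod.splits dest!: bspec)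

text \<open>\<open>T\<close> fixes \<open>w\<close> and negates \<open>v\<close>, so invariance of
  the energy gives \<open>be v w = - be v w\<close>.\<close>

lemma symc_orth:
 assumes w: "w \<in> symc H" "(T, rho, 1) \<in> H" and v: "v \<in> symc H'" "(T, rho, -1) \<in> H'" and cf: "conf T rho"
 shows "be v w = 0"
proof -
 have 1: "AE x in lborel. rho x powr (nn/p) * w (T x) = 1 * w x" using w unfolding symc_def by fastforce
 have 2: "AE x in lborel. rho x powr (nn/p) * v (T x) = (-1) * v x" using v unfolding symc_def by fastforce
 have L: "Lp p v" "Lp p w" using symc_Lp v(1) w(1) by auto
 have p': "p > 0" using p1 by simp
 have "be v w = be (%x. (-1) * v x) (%x. 1 * w x)"
  unfolding conf_be[OF cf L, symmetric]
  by (rule be_AE[OF conf_Np(1)[OF cf L(1) p'] Lp_cmult(1)[OF L(1)] conf_Np(1)[OF cf L(2) p'] Lp_cmult(1)[OF L(2)] 2 1])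
 then show ?thesis unfolding be_cmult by simp
qed

text \<open>Potentials inherit the symmetry with weight \<open>nn / q\<close>, limits in
  \<open>L^q\<close> keep it, and the dual function turns the weight into
  \<open>nn / q * (q - 1) = nn / p\<close>. The limit of potentials thus leads back into the class,
  as \<open>maximizer_solution\<close> requires.\<close>

lemma symc_limit:
 assumes H: "!!T rho eps. (T, rho, eps) \<in> H ==> conf T rho \<and> \<bar>eps\<bar> = 1" and neg: "(T0, rho0, -1) \<in> H"
  and w: "!!k. w k \<in> symc H" and u: "Lp q u" and lim: "(%k. Np q (%x. pot (w k) x - u x)) ~> 0"
 shows "dual u \<in> symc H \<and> (Np q u > 0 \<longrightarrow> sign_changing u)"
proof -
 have inv: "AE x in lborel. rho x powr (nn/q) * u (T x) = eps * u x" if h: "(T, rho, eps) \<in> H" for T rho eps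
 proof -
  have cf: "conf T rho" and e: "\<bar>eps\<bar> = 1" using H[OF h] by auto
  have q': "q > 0" using q1 by simp
  define U where "U = (%f x. rho x powr (nn/q) * f (T x) :: real)"
  have pL: "Lp q (pot (w k))" for k by (rule pot_Lq[OF symc_Lp[OF w]])
  have wi: "AE x in lborel. U (pot (w k)) x = eps * pot (w k) x" for k
   unfolding U_def by (rule conf_pot_inv[OF cf symc_Lp[OF w]]) (use w[of k] h in \<open>auto simp: symc_def\<close>)
  have UL: "Lp q (U f)" "Np q (U f) = Np q f" if "Lp q f" for f unfolding U_def using conf_Np[OF cf that q'] by auto
  have eL: "Lp q (%x. eps * f x)" "Np q (%x. eps * f x) = Np q f" if "Lp q f" for f :: "'a => real" using Lp_cmult[OF that, of eps] e by auto
  have d: "Lp q (%x. U u x - eps * u x)" by (rule Lp_diff(1)[OF UL(1)[OF u] eL(1)[OF u] q0])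
  have le: "Np q (%x. U u x - eps * u x) \<le> 2 powr q * (Np q (%x. pot (w k) x - u x) + Np q (%x. pot (w k) x - u x))" for k
  proof -
   let ?g = "%x. pot (w k) x - u x"
   have g: "Lp q ?g" by (rule Lp_diff(1)[OF pL u q0])
   have "Np q (%x. U u x - eps * u x) = Np q (%x. eps * ?g x - U ?g x)"
   proof (rule Np_AE_eq)
    show "AE x in lborel. U u x - eps * u x = eps * ?g x - U ?g x"
     using wi[of k] by eventually_elim (simp add: U_def algebra_simps)
   qed (use Lp_meas[OF d] Lp_meas[OF UL(1)[OF g]] Lp_meas[OF eL(1)[OF g]] in auto)
   also have "... \<le> 2 powr q * (Np q (%x. eps * ?g x) + Np q (U ?g))" by (rule Lp_diff(2)[OF eL(1)[OF g] UL(1)[OF g] q0])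
   finally show ?thesis unfolding eL(2)[OF g] UL(2)[OF g] .
  qed
  have "(%k. 2 powr q * (Np q (%x. pot (w k) x - u x) + Np q (%x. pot (w k) x - u x))) ~> 2 powr q * (0 + 0)"
   by (intro tendsto_intros lim)
  from LIMSEQ_le_const[OF this, of "Np q (%x. U u x - eps * u x)"] le have "Np q (%x. U u x - eps * u x) \<le> 0" by fastforce
  then have "Np q (%x. U u x - eps * u x) = 0" using Np_nonneg[of q "%x. U u x - eps * u x"] by linarith
  from Np_zero_AE[OF d this] show ?thesis unfolding U_def by simp
 qed
 have "AE x in lborel. rho x powr (nn/p) * dual u (T x) = eps * dual u x" if h: "(T, rho, eps) \<in> H" for T rho eps
  using inv[OF h]
 proof eventually_elim
  case (elim x)
  have e: "\<bar>eps\<bar> = 1" and r: "rho x > 0" using H[OF h] rho_pos by auto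
  have np: "nn / p = nn / q * (q - 1)" using pm1_q q1 p1 by (simp add: field_simps)
  have "dual (%x. rho x powr (nn/q) * u (T x)) x = rho x powr (nn/p) * dual u (T x)"
  proof -
   have "rho x powr (nn/p) = (rho x powr (nn/q)) powr (q - 2) * rho x powr (nn/q)"
   proof -
    have "a * (q - 1) = a * (q - 2) + a" for a by (simp add: algebra_simps)
    then show ?thesis unfolding np powr_powr powr_add[symmetric] by simp
   qed
   then show ?thesis unfolding dual_def by (simp add: abs_mult powr_mult)
  qed
  moreover have "dual (%x. rho x powr (nn/q) * u (T x)) x = eps * dual u x"
   unfolding dual_def elim using e by (simp add: abs_mult)
  ultimately show ?case by simp
 qed
 then have 1: "dual u \<in> symc H" unfolding symc_def using dual_Lp(1)[OF u] by auto
 have cf: "conf T0 rho0" using H[OF neg] by auto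
 have [measurable]: "u \<in> bmeas" by (rule Lp_meas[OF u])
 \<comment> \<open>A function of one sign keeps that sign under \<open>T0\<close>, while by the odd
   symmetry it is turned into its negative up to a positive weight; so it vanishes. The factor
   \<open>c\<close> lets one argument serve both signs.\<close>
 have zero: "Np q u = 0" if P: "AE x in lborel. P (u x)" and n: "!!t. P t ==> t * c \<ge> 0" and c: "c \<noteq> 0" for P and c :: real
 proof -
  have "AE x in lborel. u x = 0" using inv[OF neg] P conf_AE[OF cf P]
  proof eventually_elim
   case (elim x)
   have "0 \<le> rho0 x powr (nn/q) * (u (T0 x) * c)" using n[OF elim(3)] by simp
   then have "u x * c \<le> 0" using arg_cong[OF elim(1), of "%t. t * c"] by (simp add: mult.assoc)
   then show ?case using n[OF elim(2)] c by (metis antisym mult_eq_0_iff)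
  qed
  then have "Np q u = Np q (%x::'a. 0)" by (rule Np_AE_eq) auto
  then show ?thesis by (simp add: Np_def)
 qed
 have pos: "emeasure lborel {x. 0 < u x * c} > 0" if "Np q u > 0" and c: "c \<noteq> 0" for c :: real
 proof (rule ccontr)
  assume "\<not> ?thesis"
  then have "emeasure lborel {x. 0 < u x * c} = 0" by (simp add: not_less)
  then have "AE x in lborel. \<not> 0 < u x * c" by (intro AE_I[of _ _ "{x. 0 < u x * c}"]) auto
  then have "AE x in lborel. u x * c \<le> 0" by (auto simp: not_less)
  from zero[OF this, of "- c"] c that show False by simp
 qed
 have "Np q u > 0 \<longrightarrow> sign_changing u" unfolding sign_changing_def using pos[of 1] pos[of "-1"] by simp
 then show ?thesis using 1 by blast
qed

text \<open>By invariance A and each of its preimages under \<open>T i\<close> carry the same mass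
  of \<open>w\<close>, and the preimages are disjoint up to a null set.\<close>

lemma mass_disjoint:
 assumes w: "Lp p w" and cf: "!!i. i < M ==> conf (T i) (rho i)"
  and inv: "!!i. i < M ==> AE x in lborel. rho i x powr (nn/p) * w (T i x) = w x"
  and A: "A \<in> sets borel" and dis: "AE x in lborel. \<forall>i<M. \<forall>j<M. i \<noteq> j \<longrightarrow> T i x \<in> A \<longrightarrow> T j x \<notin> A"
 shows "real M * Np p (%x. w x * indicator A x) \<le> Np p w"
proof -
 have [measurable]: "w \<in> bmeas" by (rule Lp_meas[OF w])
 have wA: "Lp p (%x. w x * indicator A x)" by (rule Lp_mult_ind(1)[OF w A p0])
 have TA: "T i -` A \<in> sets borel" if "i < M" for i using measurable_sets[OF T_meas[OF cf[OF that]] A] by simp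
 have p': "p > 0" using p1 by simp
 have e: "Np p (%x. w x * indicator A x) = Np p (%x. w x * indicator (T i -` A) x)" if i: "i < M" for i
 proof -
  note c = conf_Np[OF cf[OF i] wA p']
  have "Np p (%x. rho i x powr (nn/p) * (w (T i x) * indicator A (T i x))) = Np p (%x. w x * indicator (T i -` A) x)"
  proof (rule Np_AE_eq)
   show "AE x in lborel. rho i x powr (nn/p) * (w (T i x) * indicator A (T i x)) = w x * indicator (T i -` A) x"
    using inv[OF i] by eventually_elim (simp add: indicator_def)
  qed (use Lp_meas[OF c(1)] Lp_meas[OF Lp_mult_ind(1)[OF w TA[OF i] p0]] in auto)
  then show ?thesis using c(2) by simp
 qed
 have int: "integrable lborel (%x. \<bar>w x * indicator (T i -` A) x\<bar> powr p)" if "i < M" for i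
  using Lp_mult_ind(1)[OF w TA[OF that] p0] unfolding Lp_def by simp
 have "real M * Np p (%x. w x * indicator A x) = (\<Sum>i<M. Np p (%x. w x * indicator (T i -` A) x))"
  by (subst sum.cong[OF refl e[symmetric]]) auto
 also have "... = (LBINT x. (\<Sum>i<M. \<bar>w x * indicator (T i -` A) x\<bar> powr p))"
  unfolding Np_def using int by (subst Bochner_Integration.integral_sum) auto
 also have "... \<le> (LBINT x. \<bar>w x\<bar> powr p)"
 proof (rule integral_mono_AE)
  show "integrable lborel (%x. \<Sum>i<M. \<bar>w x * indicator (T i -` A) x\<bar> powr p)" using int by (intro Bochner_Integration.integrable_sum) auto
  show "integrable lborel (%x. \<bar>w x\<bar> powr p)" using w unfolding Lp_def by simp
  show "AE x in lborel. (\<Sum>i<M. \<bar>w x * indicator (T i -` A) x\<bar> powr p) \<le> \<bar>w x\<bar> powr p"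
   using dis
  proof eventually_elim
  case dis: (elim x)
  show ?case
  proof (cases "\<exists>i<M. T i x \<in> A")
   case True
   then obtain i where i: "i < M" "T i x \<in> A" by blast
   have "(\<Sum>j<M. \<bar>w x * indicator (T j -` A) x\<bar> powr p) = (\<Sum>j<M. if j = i then \<bar>w x\<bar> powr p else 0)"
    using dis i p' by (intro sum.cong) (auto simp: indicator_def)
   then show ?thesis using i by simp
  next
   case False
   then have "(\<Sum>i<M. \<bar>w x * indicator (T i -` A) x\<bar> powr p) = 0" using p' by (intro sum.neutral) (auto simp: indicator_def)
   then show ?thesis by simp
  qed
  qed
 qed
 finally show ?thesis unfolding Np_def .
qed

section \<open>Positivity of the energy\<close>

lemma be_zero_Rep:
 assumes w: "Lp p w" and z: "be w w = 0"
 shows "\<exists>phi. Rep w (%x. 0) phi"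
proof -
 obtain phi where R: "Rep w (pot w) phi" using pot_Rep[OF w] by blast
 have "Np q (pot w) powr (1/q) \<le> 0" using pot_bound[OF w] z by simp
 then have "Np q (pot w) = 0" using Np_nonneg[of q "pot w"] by (metis antisym powr_eq_0_iff powr_ge_zero)
 from Np_zero_AE[OF pot_Lq[OF w] this] show ?thesis using Rep_AE[OF R, of "%x. 0"] by auto
qed

text \<open>If the energy vanished, the zero function would be a potential of \<open>w\<close> as
  well as of 0. The form at the zero function then has both values, so \<open>w\<close> is
  orthogonal to all test functions, which a bump near \<open>a\<close> refutes.\<close>

lemma be_pos:
 assumes w: "Lp p w" and c: "continuous_on UNIV w" and a: "w a \<noteq> 0"
 shows "be w w > 0"
proof (rule ccontr)
 assume "\<not> ?thesis"
 then have "be w w = 0" using be_psd[OF w] by simp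
 then obtain phi where R: "Rep w (%x. 0) phi" using be_zero_Rep[OF w] by blast
 have z: "Lp p (%x::'a. 0::real)" by (simp add: Lp_def)
 have "be (%x. 0) (%x. 0) = 0" using be_cmult(1)[of 0 w "%x. 0"] by simp
 then obtain phi' where R': "Rep (%x. 0) (%x. 0) phi'" using be_zero_Rep[OF z] by blast
 have "continuous (at a) w" using c by (simp add: continuous_on_eq_continuous_at)
 then obtain d where d: "d > 0" "!!x. dist x a < d ==> dist (w x) (w a) < \<bar>w a\<bar>"
  unfolding continuous_at_eps_delta using a by (metis zero_less_abs_iff)
 define psi where "psi = (%x. bump0 ((- (1/d)) *\<^sub>R a + (1/d) *\<^sub>R x))"
 have psit: "test_fun psi" unfolding psi_def using d by (intro test_fun_affine bump0(1)) auto
 have arg: "(- (1/d)) *\<^sub>R a + (1/d) *\<^sub>R x = (1/d) *\<^sub>R (x - a)" for x by (simp add: algebra_simps)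
 have sup: "dist x a < d" if "psi x \<noteq> 0" for x
 proof (rule ccontr)
  assume "\<not> ?thesis"
  then have "norm ((1/d) *\<^sub>R (x - a)) \<ge> 1" using d(1) unfolding norm_scaleR dist_norm by (simp add: field_simps)
  then show False using that bump0(5) unfolding psi_def arg by blast
 qed
 have "Hs_approx s psi (%k. psi)"
 proof -
  have "frac_form s (%x::'a. 0) (%x. 0) = 0" unfolding frac_form_def by simp
  then show ?thesis unfolding Hs_approx_def using psit by simp
 qed
 then have psiH: "psi \<in> Hs s" unfolding Hs_def using Bd_meas[OF test_fun_Bd[OF psit]] by auto
 have eq: "(LBINT x. w x * psi x) = 0" using Hs_form_Rep[OF R psiH] Hs_form_Rep[OF R' psiH] by simp
 have "(LBINT x. w a * (w x * psi x)) > 0"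
 proof (rule integral_pos_continuous)
  have "integrable lborel (%x. w x * psi x)"
   by (rule Holder(1)[OF p1 q1 pq w Bd_Lp[OF test_fun_Bd[OF psit]]]) (use q1 in simp)
  then show "integrable lborel (%x. w a * (w x * psi x))" by simp
  have "continuous_on UNIV psi" using psit unfolding test_fun_iff by (intro smooth_fun_continuous) auto
  then show "continuous_on UNIV (%x. w a * (w x * psi x))" using c by (intro continuous_intros)
  show "w a * (w x * psi x) \<ge> 0" for x
  proof (cases "psi x = 0")
   case False
   then have "\<bar>w x - w a\<bar> < \<bar>w a\<bar>" using d(2)[OF sup] by (simp add: dist_real_def)
   then have "w a * w x \<ge> 0" by (cases "w a > 0") (auto simp: abs_if mult_nonneg_nonneg mult_nonpos_nonpos split: if_splits)
   moreover have "psi x \<ge> 0" unfolding psi_def by (rule bump0(2))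
   ultimately show ?thesis by (simp flip: mult.assoc)
  qed simp
  have "psi a > 0" unfolding psi_def arg using bump0(4) by simp
  moreover have "w a * w a > 0" using a by (simp add: zero_less_mult_iff) linarith
  ultimately show "w a * (w a * psi a) > 0" by (simp flip: mult.assoc)
 qed
 then show False using eq by simp
qed

end

section \<open>Complex structures\<close>

definition prj :: "'b::euclidean_space set => 'b => 'b" where "prj S x = (\<Sum>b\<in>S. (x \<bullet> b) *\<^sub>R b)"

text \<open>A complex structure on the coordinate subspace spanned by \<open>S\<close>, extended by \<open>0\<close> to the orthogonal complement.\<close>

definition pcs :: "('b::euclidean_space => 'b) => 'b set => bool" where
 "pcs J S \<longleftrightarrow> S \<subseteq> Basis \<and> linear J \<and> (\<forall>x y. J x \<bullet> y = - (x \<bullet> J y)) \<and> (\<forall>x. J (J x) = - prj S x)"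

text \<open>Rodrigues' formula: rotation by \<theta> on the subspace where \<open>J\<close> is a
  complex structure, identity on its complement. The projection need not be named, as
  \<open>J (J x)\<close> is its negative.\<close>

definition rot :: "('b::euclidean_space => 'b) => real => 'b => 'b" where
 "rot J \<theta> x = x + sin \<theta> *\<^sub>R J x + (1 - cos \<theta>) *\<^sub>R J (J x)"

text \<open>Generator of the rotations in one coordinate plane, turning \<open>b1\<close> into
  \<open>b2\<close>.\<close>

definition plane :: "'b::euclidean_space => 'b => 'b => 'b" where
 "plane b1 b2 x = (x \<bullet> b1) *\<^sub>R b2 - (x \<bullet> b2) *\<^sub>R b1"

lemma prj_Basis: "prj Basis x = x" unfolding prj_def by (rule euclidean_representation)

lemma prj_inner: "S \<subseteq> Basis ==> b \<in> Basis ==> prj S x \<bullet> b = (if b \<in> S then x \<bullet> b else 0)"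
proof -
 assume S: "S \<subseteq> Basis" and b: "b \<in> Basis"
 have fin: "finite S" using S finite_Basis by (rule finite_subset)
 have "prj S x \<bullet> b = (\<Sum>c\<in>S. if c = b then x \<bullet> b else 0)"
  unfolding prj_def inner_sum_left using S b by (intro sum.cong) (auto simp: inner_Basis subset_iff)
 then show ?thesis using fin by simp
qed

lemma prj_prj: "S \<subseteq> Basis ==> prj S (x - prj S x) = 0"
 by (rule euclidean_eqI) (auto simp: prj_inner inner_diff_left)

context
 fixes J :: "'b::euclidean_space => 'b" and S
 assumes J: "pcs J S"
begin

lemma pcs_lin: "linear J" "J x \<bullet> y = - (x \<bullet> J y)" "J (J x) = - prj S x" "S \<subseteq> Basis"
 using J unfolding pcs_def by auto

lemma pcs_self: "x \<bullet> J x = 0" using pcs_lin(2)[of x x] by (simp add: inner_commute)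

lemma pcs_kernel: "prj S y = 0 ==> J y = 0"
 using pcs_lin(2)[of y "J y"] pcs_lin(3)[of y] by simp

lemma pcs_cube: "J (J (J x)) = - J x"
proof -
 have "J (x - prj S x) = 0" by (rule pcs_kernel[OF prj_prj[OF pcs_lin(4)]])
 then show ?thesis using pcs_lin(1) pcs_lin(3)[of x] by (simp add: linear_diff linear_neg)
qed

lemma pcs_out: "b \<in> Basis ==> b \<notin> S ==> J b = 0"
 by (rule pcs_kernel, rule euclidean_eqI) (use pcs_lin(4) in \<open>auto simp: prj_inner inner_Basis\<close>)

lemma rot_linear: "linear (rot J \<theta>)"
proof -
 note l = linear_add[OF pcs_lin(1)] linear_scale[OF pcs_lin(1)]
 show ?thesis by (rule linearI) (simp_all add: rot_def l algebra_simps)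
qed

lemma rot_norm: "norm (rot J \<theta> x) = norm x"
proof -
 define a b where "a = sin \<theta>" and "b = 1 - cos \<theta>"
 have i: "x \<bullet> J (J x) = - (J x \<bullet> J x)" "J x \<bullet> J (J x) = 0" "J (J x) \<bullet> J (J x) = J x \<bullet> J x" "x \<bullet> J x = 0"
  using pcs_lin(2)[of x "J x"] pcs_self[of "J x"] pcs_lin(2)[of "J x" "J (J x)"] pcs_cube[of x] pcs_self[of x] by simp_all
 have "rot J \<theta> x \<bullet> rot J \<theta> x = x \<bullet> x + (a^2 + b^2 - 2 * b) * (J x \<bullet> J x)"
 proof -
  have sq: "(x + a *\<^sub>R u + b *\<^sub>R v) \<bullet> (x + a *\<^sub>R u + b *\<^sub>R v)
   = x \<bullet> x + a^2 * (u \<bullet> u) + b^2 * (v \<bullet> v) + 2 * a * (x \<bullet> u) + 2 * b * (x \<bullet> v) + 2 * a * b * (u \<bullet> v)" for u v :: 'b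
   by (simp add: inner_add_left inner_add_right inner_commute power2_eq_square algebra_simps)
  then show ?thesis unfolding rot_def a_def[symmetric] b_def[symmetric] sq[of "J x" "J (J x)"] i by (simp add: algebra_simps)
 qed
 also have "a^2 + b^2 - 2 * b = (sin \<theta>)^2 + (cos \<theta>)^2 - 1" unfolding a_def b_def by (simp add: power2_eq_square algebra_simps)
 finally show ?thesis by (simp add: norm_eq_sqrt_inner)
qed

lemma rot_pair:
 assumes b: "J b1 = b2" "J b2 = - b1"
 shows "Complex (rot J \<theta> x \<bullet> b1) (rot J \<theta> x \<bullet> b2) = cis \<theta> * Complex (x \<bullet> b1) (x \<bullet> b2)"
proof -
 have "J x \<bullet> b1 = - (x \<bullet> b2)" "J x \<bullet> b2 = x \<bullet> b1" for x using pcs_lin(2)[of x b1] pcs_lin(2)[of x b2] b by auto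
 then show ?thesis by (simp add: rot_def complex_eq_iff inner_add_left algebra_simps)
qed

lemma rot_fix: assumes b: "J b = 0" shows "rot J \<theta> x \<bullet> b = x \<bullet> b"
proof -
 have "J x \<bullet> b = 0" for x using pcs_lin(2)[of x b] b by auto
 then show ?thesis by (simp add: rot_def inner_add_left)
qed

lemma pcs_add_plane:
 assumes b: "b1 \<in> Basis - S" "b2 \<in> Basis - S" "b1 \<noteq> b2"
 shows "pcs (%x. J x + plane b1 b2 x) (insert b1 (insert b2 S))"
proof -
 note l = linear_add[OF pcs_lin(1)] linear_scale[OF pcs_lin(1)]
 have fin: "finite S" using pcs_lin(4) finite_Basis by (rule finite_subset)
 have i: "b1 \<bullet> b1 = 1" "b2 \<bullet> b2 = 1" "b1 \<bullet> b2 = 0" "b2 \<bullet> b1 = 0" using b by (auto simp: inner_Basis)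
 have z: "J b1 = 0" "J b2 = 0" using pcs_out b by auto
 have zi: "J x \<bullet> b1 = 0" "J x \<bullet> b2 = 0" for x using pcs_lin(2)[of x b1] pcs_lin(2)[of x b2] z by auto
 have "prj (insert b1 (insert b2 S)) x = (x \<bullet> b1) *\<^sub>R b1 + ((x \<bullet> b2) *\<^sub>R b2 + prj S x)" for x
  unfolding prj_def using fin b by (subst sum.insert, simp, simp, subst sum.insert) auto
 moreover have "J (J x + plane b1 b2 x) = - prj S x" for x
  unfolding plane_def using pcs_lin(3) by (simp add: l linear_diff[OF pcs_lin(1)] z)
 moreover have "plane b1 b2 (J x + plane b1 b2 x) = - (x \<bullet> b1) *\<^sub>R b1 - (x \<bullet> b2) *\<^sub>R b2" for x
  unfolding plane_def by (simp add: inner_add_left inner_diff_left zi i)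
 moreover have "linear (%x. J x + plane b1 b2 x)"
  by (rule linearI) (simp_all add: l plane_def inner_add_left algebra_simps)
 moreover have "(J x + plane b1 b2 x) \<bullet> y = - (x \<bullet> (J y + plane b1 b2 y))" for x y
  using pcs_lin(2)[of x y] by (simp add: plane_def inner_add_left inner_add_right inner_diff_left inner_diff_right algebra_simps inner_commute)
 ultimately show ?thesis using b pcs_lin(4) unfolding pcs_def by auto
qed

end

lemma pcs_zero: "pcs (%x. 0) {}" unfolding pcs_def by (simp add: prj_def linear_iff)

lemma pcs_plane: "b1 \<in> Basis ==> b2 \<in> Basis ==> b1 \<noteq> b2 ==> pcs (plane b1 b2) {b1, b2}"
 using pcs_add_plane[OF pcs_zero, of b1 b2] by simp

text \<open>Basis vectors are paired off two at a time by \<open>pcs_add_plane\<close>; this is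
  where parity enters.\<close>

lemma ex_pcs:
 fixes S :: "'b::euclidean_space set"
 assumes "S \<subseteq> Basis" "even (card S)"
 shows "\<exists>J. pcs J S"
 using assms
proof (induction "card S" arbitrary: S rule: less_induct)
 case less
 have fin: "finite S" using less.prems(1) finite_Basis by (rule finite_subset)
 show ?case
 proof (cases "S = {}")
  case True
  then show ?thesis using pcs_zero by blast
 next
  case False
  then obtain b1 where b1: "b1 \<in> S" by blast
  have "S \<noteq> {b1}" using less.prems(2) by auto
  then obtain b2 where b2: "b2 \<in> S" "b1 \<noteq> b2" using b1 by blast
  let ?S = "S - {b1, b2}"
  have c: "card ?S = card S - 2" using b1 b2 fin by (subst card_Diff_subset) auto
  have "card {b1, b2} \<le> card S" by (rule card_mono[OF fin]) (use b1 b2 in auto)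
  then have "card S \<ge> 2" using b2 by simp
  then have "card ?S < card S" "even (card ?S)" using c less.prems(2) by auto
  then obtain J where J: "pcs J ?S" using less.hyps[of ?S] less.prems(1) by blast
  have "insert b1 (insert b2 ?S) = S" using b1 b2 by auto
  then show ?thesis using pcs_add_plane[OF J, of b1 b2] b1 b2 less.prems(1) by auto
 qed
qed

lemma rot_total:
 fixes J :: "'b::euclidean_space => 'b"
 assumes J: "pcs J Basis"
 shows "(norm (rot J \<theta> x - rot J phi x))^2 = ((cos \<theta> - cos phi)^2 + (sin \<theta> - sin phi)^2) * (norm x)^2"
proof -
 have JJ: "J (J x) = - x" using pcs_lin(3)[OF J] prj_Basis by auto
 have e: "rot J \<theta> x - rot J phi x = (cos \<theta> - cos phi) *\<^sub>R x + (sin \<theta> - sin phi) *\<^sub>R J x"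
  unfolding rot_def JJ by (simp add: algebra_simps)
 have "J x \<bullet> J x = x \<bullet> x" using pcs_lin(2)[OF J, of x "J x"] JJ by simp
 moreover have "(A *\<^sub>R x + B *\<^sub>R J x) \<bullet> (A *\<^sub>R x + B *\<^sub>R J x) = A^2 * (x \<bullet> x) + B^2 * (J x \<bullet> J x)" for A B
  by (simp add: inner_add_left inner_add_right pcs_self[OF J] inner_commute[of "J x" x] power2_eq_square algebra_simps)
 ultimately show ?thesis unfolding e power2_norm_eq_inner by (simp add: ring_distribs)
qed

text \<open>Freeness of the action made quantitative. By \<open>rot_total\<close> the displacement
  depends only on the two angles and on \<open>norm x\<close>, so \<open>c\<close> is a minimum over
  finitely many pairs of angles, common to all complex structures.\<close>

lemma rot_separated:
 fixes M :: nat
 assumes M: "M > 0"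
 obtains c where "c > 0" "!!(J :: 'b::euclidean_space => 'b) i j x. pcs J Basis ==> i < M ==> j < M ==> i \<noteq> j ==>
  norm (rot J (2 * pi * real i / real M) x - rot J (2 * pi * real j / real M) x) \<ge> c * norm x"
proof -
 define t where "t = (%i. 2 * pi * real i / real M)"
 define h where "h = (%(i, j). sqrt ((cos (t i) - cos (t j))^2 + (sin (t i) - sin (t j))^2))"
 define P where "P = {(i, j). i < M \<and> j < M \<and> i \<noteq> j}"
 have P: "finite P" unfolding P_def by (rule finite_subset[of _ "{..<M} \<times> {..<M}"]) auto
 have pos: "h z > 0" if "z \<in> P" for z
 proof -
  obtain i j where z0: "z = (i, j)" using prod.exhaust by blast
  with that have z: "z = (i, j)" "i < M" "j < M" "i \<noteq> j" unfolding P_def by auto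
  have "\<not> (cos (t i) - cos (t j) = 0 \<and> sin (t i) - sin (t j) = 0)"
  proof
   assume "cos (t i) - cos (t j) = 0 \<and> sin (t i) - sin (t j) = 0"
   then have "sin (t i) = sin (t j) \<and> cos (t i) = cos (t j)" by simp
   then obtain k :: int where "t i = t j + 2 * pi * of_int k" unfolding sin_cos_eq_iff by auto
   then have "(2 * pi) * (real i / real M) = (2 * pi) * (real j / real M + of_int k)" unfolding t_def by (simp add: ring_distribs)
   then have "real i / real M = real j / real M + of_int k" by (subst (asm) mult_cancel_left) auto
   then have "real i = (real j / real M + of_int k) * real M" using M by (metis of_nat_0_less_iff nonzero_eq_divide_eq order_less_irrefl divide_eq_eq)
   then have "real i = real j + of_int k * real M" using M by (simp add: ring_distribs)
   then have "real_of_int (int i) = real_of_int (int j + k * int M)" by simp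
   then have "int i = int j + k * int M" by (simp only: of_int_eq_iff)
   then have "int i mod int M = int j mod int M" by simp
   then show False using z by simp
  qed
  then show ?thesis unfolding h_def z by (simp add: sum_power2_gt_zero_iff)
 qed
 define c where "c = (if P = {} then 1 else Min (h ` P))"
 have c: "c > 0" unfolding c_def using P pos by auto
 have "norm (rot J (2 * pi * real i / real M) x - rot J (2 * pi * real j / real M) x) \<ge> c * norm x"
  if J: "pcs J Basis" and ij: "i < M" "j < M" "i \<noteq> j" for J :: "'b => 'b" and i j x
 proof -
  have "(i, j) \<in> P" using ij unfolding P_def by simp
  then have "c \<le> h (i, j)" unfolding c_def using P by auto
  then have "c * norm x \<le> h (i, j) * norm x" by (rule mult_right_mono) simp
  also have "... = sqrt ((norm (rot J (t i) x - rot J (t j) x))^2)" unfolding rot_total[OF J] h_def by (simp add: real_sqrt_mult)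
  finally show ?thesis unfolding t_def by simp
 qed
 with c show ?thesis by (rule that)
qed

definition zc :: "'b::euclidean_space => 'b => 'b => complex" where "zc b1 b2 x = Complex (x \<bullet> b1) (x \<bullet> b2)"

lemma zc_cont: "continuous_on A (zc b1 b2)"
proof -
 have "zc b1 b2 = (%x. of_real (x \<bullet> b1) + \<i> * of_real (x \<bullet> b2))" by (auto simp: zc_def complex_eq_iff fun_eq_iff)
 then show ?thesis by (auto intro!: continuous_intros)
qed

lemma zc_plane:
 assumes b: "b1 \<in> Basis" "b2 \<in> Basis" "b1 \<noteq> b2"
 shows "zc b1 b2 (rot (plane b1 b2) \<theta> x) = cis \<theta> * zc b1 b2 x"
 unfolding zc_def using b by (intro rot_pair[OF pcs_plane[OF b]]) (auto simp: plane_def inner_Basis)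

section \<open>The classes of planar rotations\<close>

context crit
begin

lemma conf_rot: "pcs J S ==> conf (rot J \<theta> :: 'a => 'a) (%x. 1)"
 by (rule conf_isometry) (auto simp: rot_norm intro: rot_linear)

definition \<tau> :: "'a => 'a => nat => 'a => 'a" where "\<tau> b1 b2 m = rot (plane b1 b2) (pi / 2^m)"

text \<open>Class m is invariant under the rotations by \<open>pi / 2^j\<close> for
  \<open>j < m\<close> and odd under the one by \<open>pi / 2^m\<close>. For \<open>m < l\<close>
  the latter acts with opposite signs on the classes m and l, whence orthogonality; oddness also
  forces sign changes.\<close>

definition Hm :: "(('a => 'a) \<times> ('a => real)) set => 'a => 'a => nat => (('a => 'a) \<times> ('a => real) \<times> real) set" where
 "Hm G b1 b2 m = {(T, rho, 1) | T rho. (T, rho) \<in> G} \<union> {(\<tau> b1 b2 j, %x. 1, 1) | j. j < m} \<union> {(\<tau> b1 b2 m, %x. 1, -1)}"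

lemma symc_Hm:
 "w \<in> symc (Hm G b1 b2 m) \<longleftrightarrow> Lp p w \<and> (\<forall>T rho. (T, rho) \<in> G \<longrightarrow> (AE x in lborel. rho x powr (nn/p) * w (T x) = w x)) \<and>
  (\<forall>j<m. AE x in lborel. w (\<tau> b1 b2 j x) = w x) \<and> (AE x in lborel. w (\<tau> b1 b2 m x) = - w x)"
proof -
 have "w \<in> symc (Hm G b1 b2 m) \<longleftrightarrow> Lp p w \<and> (\<forall>T rho eps. (T, rho, eps) \<in> Hm G b1 b2 m \<longrightarrow> (AE x in lborel. rho x powr (nn/p) * w (T x) = eps * w x))"
  unfolding symc_def by blast
 also have "... \<longleftrightarrow> Lp p w \<and> (\<forall>T rho. (T, rho) \<in> G \<longrightarrow> (AE x in lborel. rho x powr (nn/p) * w (T x) = 1 * w x)) \<and>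
  (\<forall>j<m. AE x in lborel. 1 powr (nn/p) * w (\<tau> b1 b2 j x) = 1 * w x) \<and> (AE x in lborel. 1 powr (nn/p) * w (\<tau> b1 b2 m x) = (-1) * w x)"
  unfolding Hm_def by blast
 finally show ?thesis by simp
qed

text \<open>The interface for both parities. The sequence \<open>w'\<close> differs from
  \<open>w\<close> by dilations for even n and is \<open>w\<close> itself for odd n.\<close>

lemma solutions_from_compactness:
 assumes b: "b1 \<in> Basis" "b2 \<in> Basis" "b1 \<noteq> b2" and G: "!!T rho. (T, rho) \<in> G ==> conf T rho"
  and ex: "!!m. \<exists>w\<in>symc (Hm G b1 b2 m). be w w > 0"
  and cp: "!!m w S. (!!k. w k \<in> symc (Hm G b1 b2 (m k))) ==> (!!k. Np p (w k) \<le> 1) ==> S > 0 ==> (%k::nat. be (w k) (w k)) ~> S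
    ==> (%k. Sx (symc (Hm G b1 b2 (m k)))) ~> S
    ==> \<exists>w'. (\<forall>k. w' k \<in> symc (Hm G b1 b2 (m k)) \<and> Np p (w' k) \<le> 1 \<and> be (w' k) (w' k) = be (w k) (w k)) \<and> tight w' \<and> nonconc w'"
 shows "\<exists>u :: nat => 'a => real. (\<forall>k. u k \<in> Hs s \<and> weak_solution s q (u k) \<and> sign_changing (u k)) \<and> filterlim (%k. Hs_form s (u k) (u k)) at_top sequentially"
proof (rule family_solutions[of "%m. symc (Hm G b1 b2 m)"])
 have cf: "conf T rho \<and> \<bar>eps\<bar> = 1" if "(T, rho, eps) \<in> Hm G b1 b2 m" for T rho eps m
  using that G conf_rot[OF pcs_plane[OF b]] unfolding Hm_def \<tau>_def by auto
 have neg: "(\<tau> b1 b2 m, %x. 1, -1) \<in> Hm G b1 b2 m" for m unfolding Hm_def by auto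
 show "Lp p w" if "w \<in> symc (Hm G b1 b2 m)" for m w using that by (rule symc_Lp)
 show "(%x. c * w x) \<in> symc (Hm G b1 b2 m)" if "w \<in> symc (Hm G b1 b2 m)" for m w c using that by (rule symc_scale)
 show "dual u \<in> symc (Hm G b1 b2 m) \<and> (0 < Np q u \<longrightarrow> sign_changing u)"
  if "!!k. w k \<in> symc (Hm G b1 b2 m)" "Lp q u" "(%k. Np q (%x. pot (w k) x - u x)) ~> 0" for m w and u :: "'a => real"
  by (rule symc_limit[OF cf neg that])
 show "\<exists>w\<in>symc (Hm G b1 b2 m). 0 < be w w" for m by (rule ex)
 show "be w v = 0" if ml: "m < l" and w: "w \<in> symc (Hm G b1 b2 m)" and v: "v \<in> symc (Hm G b1 b2 l)" for m l w v
 proof (rule symc_orth[OF v _ w neg])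
  show "(\<tau> b1 b2 m, %x. 1, 1) \<in> Hm G b1 b2 l" unfolding Hm_def using ml by auto
  show "conf (\<tau> b1 b2 m) (%x. 1)" using cf[OF neg] by simp
 qed
 fix m w and S :: real assume h: "!!k. w k \<in> symc (Hm G b1 b2 (m k))" "!!k. Np p (w k) \<le> 1" "S > 0" "(%k::nat. be (w k) (w k)) ~> S"
  "(%k. Sx (symc (Hm G b1 b2 (m k)))) ~> S"
 obtain w' where w': "!!k. w' k \<in> symc (Hm G b1 b2 (m k)) \<and> Np p (w' k) \<le> 1 \<and> be (w' k) (w' k) = be (w k) (w k)" "tight w'" "nonconc w'"
  using cp[OF h] by blast
 have "\<exists>r. strict_mono (r :: nat => nat) \<and> beCauchy (w' \<circ> r)"
  by (rule precompact[OF _ _ w'(2,3)]) (use w'(1) in \<open>auto intro: symc_Lp\<close>)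
 then show "\<exists>w' r. (\<forall>k. w' k \<in> symc (Hm G b1 b2 (m k)) \<and> Np p (w' k) \<le> 1 \<and> be (w' k) (w' k) = be (w k) (w k)) \<and> strict_mono (r :: nat => nat) \<and> beCauchy (w' \<circ> r)"
  using w'(1) by blast
qed

text \<open>With \<open>k = 2^m\<close> the polynomial \<open>Re (z1^k * cnj z2^k)\<close> is
  invariant under a common rotation of both variables, while rotating \<open>z1\<close> alone by
  \<open>pi / 2^j\<close> multiplies it by -1 for \<open>j = m\<close> and by 1 for
  \<open>j < m\<close>. It is the building block for nonzero members of class m.\<close>

lemma power_pattern:
 fixes z1 z2 :: complex
 shows "Re ((cis \<theta> * z1)^k * cnj (cis \<theta> * z2)^k) = Re (z1^k * cnj z2^k)"
  and "Re ((cis (pi / 2^m) * z1)^(2^m) * z2) = - Re (z1^(2^m) * z2)"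
  and "j < m ==> Re ((cis (pi / 2^j) * z1)^(2^m) * z2) = Re (z1^(2^m) * z2)"
proof -
 have "cis \<theta> ^ k * cnj (cis \<theta>) ^ k = (cis \<theta> * cnj (cis \<theta>))^k" by (simp add: power_mult_distrib)
 also have "cis \<theta> * cnj (cis \<theta>) = 1" by (simp add: complex_eq_iff flip: power2_eq_square)
 finally have 1: "cis \<theta> ^ k * cnj (cis \<theta>) ^ k = 1" by simp
 have "(cis \<theta> * z1)^k * cnj (cis \<theta> * z2)^k = (cis \<theta> ^ k * cnj (cis \<theta>) ^ k) * (z1^k * cnj z2^k)"
  by (simp add: power_mult_distrib mult_ac)
 then show "Re ((cis \<theta> * z1)^k * cnj (cis \<theta> * z2)^k) = Re (z1^k * cnj z2^k)" unfolding 1 by simp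
 have "cis (pi / 2^m) ^ (2^m) = -1" by (simp add: Complex.DeMoivre)
 then show "Re ((cis (pi / 2^m) * z1)^(2^m) * z2) = - Re (z1^(2^m) * z2)" by (simp add: power_mult_distrib)
 assume j: "j < m"
 then obtain d where d: "m = j + Suc d" using less_iff_Suc_add by auto
 have "cis (pi / 2^j) ^ (2^m) = (cis (pi / 2^j) ^ (2^j)) ^ (2 ^ Suc d)" unfolding d power_add power_mult[symmetric] ..
 also have "cis (pi / 2^j) ^ (2^j) = -1" by (simp add: Complex.DeMoivre)
 finally have "cis (pi / 2^j) ^ (2^m) = 1" by simp
 then show "Re ((cis (pi / 2^j) * z1)^(2^m) * z2) = Re (z1^(2^m) * z2)" by (simp add: power_mult_distrib)
qed

end

section \<open>Even dimension\<close>

lemma powr_small: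
 fixes c x e :: real
 assumes "x > 0" "e > 0"
 shows "\<exists>M::nat. M \<ge> 2 \<and> c * real M powr (- x) \<le> e"
proof -
 have "((%M::nat. c * real M powr (- x)) \<longlongrightarrow> c * 0) sequentially"
  by (intro tendsto_mult tendsto_const tendsto_neg_powr filterlim_real_sequentially) (use assms in auto)
 then have "eventually (%M. c * real M powr (- x) < e) sequentially" using assms by (simp add: order_tendsto_iff)
 then obtain N where "!!M. M \<ge> N ==> c * real M powr (- x) < e" unfolding eventually_sequentially by blast
 then have "c * real (max N 2) powr (- x) \<le> e" by (meson less_imp_le max.cobounded1)
 then show ?thesis by (intro exI[of _ "max N 2"]) simp
qed

section \<open>Masses of shells and strict subadditivity\<close>

context crit
begin

definition ms :: "('a => real) => 'a set => real" where "ms w A = Np p (%x. w x * indicator A x)"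

lemma p_pos: "p > 0" using p1 by simp

lemma ms_eq: "ms w A = (LBINT x. \<bar>w x\<bar> powr p * indicator A x)"
 unfolding ms_def Np_def using p_pos by (intro Bochner_Integration.integral_cong refl) (auto simp: indicator_def)

lemma ms_int:
 assumes "Lp p w" "A \<in> sets borel"
 shows "integrable lborel (%x. \<bar>w x\<bar> powr p * indicator A x)"
 using Lp_mult_ind(1)[OF assms p0] unfolding Lp_def
 by (auto elim!: Bochner_Integration.integrable_cong[THEN iffD1, rotated -1] simp: indicator_def)

lemma ms_Un:
 assumes w: "Lp p w" and A: "A \<in> sets borel" "D \<in> sets borel" "A \<inter> D = {}"
 shows "ms w (A \<union> D) = ms w A + ms w D"
 unfolding ms_eq Bochner_Integration.integral_add[OF ms_int[OF w A(1)] ms_int[OF w A(2)], symmetric]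
 using A(3) by (intro Bochner_Integration.integral_cong) (auto simp: indicator_def)

lemma ms_mono:
 assumes w: "Lp p w" and A: "A \<in> sets borel" "D \<in> sets borel" "A \<subseteq> D"
 shows "ms w A \<le> ms w D"
 unfolding ms_eq using A(3) by (intro integral_mono ms_int w A) (auto simp: indicator_def)

lemma ms_UNIV: "ms w UNIV = Np p w" unfolding ms_def by simp

lemma rad_sets:
 assumes "I \<in> sets borel"
 shows "{x::'a. norm x \<in> I} \<in> sets borel"
proof -
 have "(norm :: 'a => real) \<in> bmeas" by measurable
 from measurable_sets[OF this assms] show ?thesis by (simp add: vimage_def)
qed

lemma ball_set: "{x::'a. norm x < r} \<in> sets borel" using rad_sets[of "{..<r}"] by simp
lemma far_set: "{x::'a. norm x \<ge> r} \<in> sets borel" using rad_sets[of "{r..}"] by simp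
lemma shell_set: "{x::'a. r \<le> norm x \<and> norm x < r'} \<in> sets borel" using rad_sets[of "{r..<r'}"] by simp

lemma ms_split: "Lp p w ==> Np p w = ms w {x. norm x < r} + ms w {x. norm x \<ge> r}"
proof -
 assume w: "Lp p w"
 have "{x::'a. norm x < r} \<union> {x. norm x \<ge> r} = UNIV" by auto
 moreover have "ms w ({x. norm x < r} \<union> {x. norm x \<ge> r}) = ms w {x. norm x < r} + ms w {x. norm x \<ge> r}"
  by (rule ms_Un[OF w ball_set far_set]) auto
 ultimately show ?thesis using ms_UNIV[of w] by metis
qed

text \<open>M disjoint shells share a mass of at most 1, so one of them is poor, and cutting there
  costs little energy.\<close>

lemma shell_pigeonhole:
 assumes w: "Lp p w" "Np p w \<le> 1" and M: "M > 0" and r: "r > 0" and G: "G \<ge> 1"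
 shows "\<exists>i<M. ms w {x. r * G^i \<le> norm x \<and> norm x < r * G^(Suc i)} \<le> 1 / real M"
proof (rule ccontr)
 assume n: "\<not> ?thesis"
 have "(\<Sum>i<k. ms w {x. r * G^i \<le> norm x \<and> norm x < r * G^(Suc i)}) = ms w {x. r \<le> norm x \<and> norm x < r * G^k}" for k
 proof (induction k)
  case 0
  then show ?case by (simp add: ms_eq not_le[symmetric])
 next
  case (Suc k)
  have "r \<le> r * G^k" "r * G^k \<le> r * G^(Suc k)" using r G by (simp_all add: one_le_power mult_le_cancel_left_pos)
  then have "{x::'a. r \<le> norm x \<and> norm x < r * G^(Suc k)} = {x. r \<le> norm x \<and> norm x < r * G^k} \<union> {x. r * G^k \<le> norm x \<and> norm x < r * G^(Suc k)}"
   by auto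
  moreover have "ms w ({x. r \<le> norm x \<and> norm x < r * G^k} \<union> {x. r * G^k \<le> norm x \<and> norm x < r * G^(Suc k)})
   = ms w {x. r \<le> norm x \<and> norm x < r * G^k} + ms w {x. r * G^k \<le> norm x \<and> norm x < r * G^(Suc k)}"
   by (rule ms_Un[OF w(1) shell_set shell_set]) auto
  ultimately show ?case using Suc.IH by (simp only: sum.lessThan_Suc)
 qed
 moreover have "ms w {x. r \<le> norm x \<and> norm x < r * G^M} \<le> 1"
  using ms_mono[OF w(1) shell_set[of r "r * G^M"], of UNIV] w(2) unfolding ms_UNIV by simp
 moreover have "(\<Sum>i<M. 1 / real M) < (\<Sum>i<M. ms w {x. r * G^i \<le> norm x \<and> norm x < r * G^(Suc i)})"
  using n M by (intro sum_strict_mono) (auto simp: not_le)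
 ultimately show False using M by simp
qed

text \<open>For x inside radius \<open>rho\<close> and y beyond \<open>R = G * rho\<close> the
  kernel is at most a constant times \<open>norm y powr (- lam)\<close>, whose \<open>L^q\<close>
  norm beyond R is of order \<open>R powr (- (nn/q))\<close>. Hoelder on the inner ball contributes
  \<open>rho powr (nn/q)\<close>, and the scale \<open>rho\<close> cancels.\<close>

lemma cross_decay:
 obtains C where "C \<ge> 0" "!!(a :: 'a => real) (b :: 'a => real) (rho :: real) (G :: real). Lp p a ==> Lp p b ==> Np p a \<le> 1 ==> Np p b \<le> 1 ==> rho > 0 ==> G \<ge> 2 ==>
  (!!x. norm x \<ge> rho ==> a x = 0) ==> (!!x. norm x < G * rho ==> b x = 0) ==> \<bar>be a b\<bar> \<le> C * G powr (- (nn / q))"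
proof -
 have "2 * nn > real DIM('a)" using nn_pos by simp
 then obtain C2 where C2: "C2 \<ge> 0" "!!r. r > 0 ==>
  (NN x. indicator {x. norm x \<ge> r} (x::'a) * ennreal (norm x powr (-(2 * nn)))) \<le> ennreal (C2 * r powr (real DIM('a) - 2 * nn))"
  using radial_far[where 'a='a, of "2 * nn"] by blast
 define V where "V = unit_ball_vol nn"
 have V: "V \<ge> 0" unfolding V_def using nn_pos by simp
 have qpos: "q > 0" using q1 by simp
 define C where "C = c0 * (2 powr lam * C2 powr (1/q) * V powr (1/q))"
 have C: "C \<ge> 0" unfolding C_def using c0_pos by simp
 have "\<bar>be a b\<bar> \<le> C * G powr (- (nn / q))"
  if a: "Lp p a" "Np p a \<le> 1" and b: "Lp p b" "Np p b \<le> 1" and rho: "rho > 0" and G: "G \<ge> 2"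
   and as: "!!x. norm x \<ge> rho ==> a x = 0" and bs: "!!x. norm x < G * rho ==> b x = 0" for a b :: "'a => real" and rho G
 proof -
  define R where "R = G * rho"
  have R: "R > 0" "2 * rho \<le> R" unfolding R_def using rho G by auto
  define h where "h = (%y::'a. norm y powr (- lam) * indicator {y. norm y \<ge> R} y)"
  have [measurable]: "(indicator {y. norm y \<ge> R} :: 'a => real) \<in> bmeas" by (rule borel_measurable_indicator[OF far_set])
  have hm: "h \<in> bmeas" unfolding h_def by measurable
  have he: "ennreal (\<bar>h y\<bar> powr q) = indicator {x. norm x \<ge> R} y * ennreal (norm y powr (-(2 * nn)))" for y
  proof -
   have "lam * q = 2 * nn" unfolding q_def using lam_pos by simp
   then have "(norm y powr (- lam)) powr q = norm y powr (-(2 * nn))" unfolding powr_powr by (simp only: mult_minus_left)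
   then show ?thesis unfolding h_def using qpos by (simp add: indicator_def)
  qed
  have hL: "Lp q h" "Np q h \<le> C2 * R powr (- nn)"
   using LpI_nn[OF hm, of q "C2 * R powr (- nn)"] C2(2)[OF R(1)] C2(1) unfolding he by simp_all
  have hq: "Np q h powr (1/q) \<le> C2 powr (1/q) * R powr (- (nn / q))"
  proof -
   have "Np q h powr (1/q) \<le> (C2 * R powr (- nn)) powr (1/q)" using hL(2) qpos by (intro powr_mono2) auto
   then show ?thesis using C2(1) by (simp add: powr_mult powr_powr)
  qed
  define \<kappa> where "\<kappa> = 2 powr lam * (C2 powr (1/q) * R powr (- (nn / q)))"
  have KPb: "\<bar>KP b x\<bar> \<le> \<kappa>" if x: "norm x < rho" for x
  proof -
   have pt: "\<bar>K (x - y) * b y\<bar> \<le> 2 powr lam * \<bar>h y * b y\<bar>" for y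
   proof (cases "norm y \<ge> R")
    case True
    have "norm y \<le> norm (x - y) + norm x" using norm_triangle_ineq4[of x "x - y"] by simp
    then have n: "norm (x - y) \<ge> norm y / 2" using True x R by linarith
    have y0: "norm y > 0" using True R by linarith
    have "K (x - y) \<le> (norm y / 2) powr (- lam)" unfolding K_def using n y0 lam_pos by (intro powr_mono2') auto
    also have "... = 2 powr lam * norm y powr (- lam)"
    proof -
     have "(norm y / 2) powr (- lam) = norm y powr (- lam) / 2 powr (- lam)" by (rule powr_divide)
     also have "(2::real) powr (- lam) = inverse (2 powr lam)" by (rule powr_minus)
     finally show ?thesis by (simp only: divide_inverse inverse_inverse_eq mult.commute)
    qed
    finally have "\<bar>K (x - y) * b y\<bar> \<le> (2 powr lam * norm y powr (- lam)) * \<bar>b y\<bar>" unfolding abs_mult by (intro mult_right_mono) auto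
    then show ?thesis using True by (simp add: h_def abs_mult mult.assoc)
   next
    case False
    then show ?thesis using bs[of y] unfolding R_def by simp
   qed
   have ih: "integrable lborel (%y. h y * b y)" by (rule Holder(1)[OF q1 p1 qp hL(1) b(1)])
   have "\<bar>KP b x\<bar> \<le> (LBINT y. 2 powr lam * \<bar>h y * b y\<bar>)"
    unfolding KP_def
   proof (rule order_trans[OF integral_abs_bound integral_mono'])
    show "integrable lborel (%y. 2 powr lam * \<bar>h y * b y\<bar>)" using ih by simp
   qed (use pt in auto)
   also have "... \<le> 2 powr lam * (Np q h powr (1/q) * Np p b powr (1/p))"
    using Holder(2)[OF q1 p1 qp hL(1) b(1)] by (simp add: mult_left_mono)
   also have "... \<le> 2 powr lam * ((C2 powr (1/q) * R powr (- (nn / q))) * 1)"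
    using hq b(2) p_pos by (intro mult_left_mono mult_mono) (auto simp: powr_le1)
   finally show ?thesis unfolding \<kappa>_def by simp
  qed
  have ar: "a x * indicator (cball 0 rho) x = a x" for x using as[of x] by (cases "norm x \<le> rho") (auto simp: indicator_def)
  have "\<bar>B a b\<bar> = \<bar>LBINT x. KP b x * a x\<bar>" by (simp add: KP_pair(2)[OF b(1) a(1)])
  also have "... \<le> (LBINT x. \<kappa> * \<bar>a x * indicator (cball 0 rho) x\<bar>)"
  proof (rule order_trans[OF integral_abs_bound integral_mono'])
   show "integrable lborel (%x. \<kappa> * \<bar>a x * indicator (cball 0 rho) x\<bar>)" using ball_L1(1)[OF a(1), of rho] by simp
   show "\<bar>KP b x * a x\<bar> \<le> \<kappa> * \<bar>a x * indicator (cball 0 rho) x\<bar>" for x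
    unfolding ar using KPb[of x] as[of x] by (cases "norm x < rho") (auto simp: abs_mult intro!: mult_right_mono)
   show "0 \<le> \<kappa> * \<bar>a x * indicator (cball 0 rho) x\<bar>" for x unfolding \<kappa>_def by simp
  qed
  also have "... \<le> \<kappa> * (1 * (V * rho powr nn) powr (1/q))"
  proof -
   have "measure lborel (cball (0::'a) rho) = V * rho powr nn"
    unfolding V_def using content_cball[of rho "0::'a"] rho by (simp add: powr_realpow flip: DIM_nn)
   then have "(LBINT x. \<bar>a x * indicator (cball 0 rho) x\<bar>) \<le> Np p a powr (1/p) * (V * rho powr nn) powr (1/q)" using ball_L1(2)[OF a(1), of rho] by simp
   also have "... \<le> 1 * (V * rho powr nn) powr (1/q)" using a(2) p_pos by (intro mult_right_mono) (auto simp: powr_le1)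
   finally show ?thesis unfolding \<kappa>_def by (simp add: mult_left_mono)
  qed
  also have "... = (2 powr lam * C2 powr (1/q) * V powr (1/q)) * (R powr (- (nn/q)) * rho powr (nn/q))"
   unfolding \<kappa>_def using V by (simp add: powr_mult powr_powr)
  also have "R powr (- (nn/q)) * rho powr (nn/q) = G powr (- (nn/q))"
  proof -
   have "rho powr (- (nn/q)) * rho powr (nn/q) = 1" using rho by (simp add: powr_add[symmetric])
   then show ?thesis unfolding R_def by (simp add: powr_mult mult.assoc)
  qed
  finally show ?thesis unfolding be_def C_def using c0_pos by (simp add: abs_mult mult.assoc mult_left_mono)
 qed
 with C show ?thesis using that by blast
qed

text \<open>Symmetries that are linear isometries with trivial factor: radial cut-offs and dilations
  of a member then stay in its class.\<close>

definition lsym :: "(('a => 'a) \<times> ('a => real) \<times> real) set => bool" where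
 "lsym H \<longleftrightarrow> (\<forall>T rho eps. (T, rho, eps) \<in> H \<longrightarrow> linear T \<and> (\<forall>x. norm (T x) = norm x) \<and> rho = (%x. 1))"

lemma symc_radial:
 assumes H: "lsym H" and w: "w \<in> symc H" and I: "I \<in> sets borel"
 shows "(%x. w x * indicator {x. norm x \<in> I} x) \<in> symc H"
proof -
 have "AE x in lborel. rho x powr (nn/p) * (w (T x) * indicator {x. norm x \<in> I} (T x)) = eps * (w x * indicator {x. norm x \<in> I} x)"
  if h: "(T, rho, eps) \<in> H" for T rho eps
 proof -
  have "AE x in lborel. rho x powr (nn/p) * w (T x) = eps * w x" using w h unfolding symc_def by blast
  moreover have "norm (T x) = norm x" for x using H h unfolding lsym_def by blast
  ultimately show ?thesis by (auto elim!: eventually_mono simp: mult.assoc[symmetric] indicator_def)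
 qed
 then show ?thesis using Lp_mult_ind(1)[OF symc_Lp[OF w] rad_sets[OF I] p0] unfolding symc_def by blast
qed

lemma conf_dilate: assumes t: "t > 0" shows "conf (%x. t *\<^sub>R x) (%x. t)"
proof -
 have "(NN x. g (t *\<^sub>R x) * ennreal (t powr nn)) = (NN x. g x)" if [measurable]: "g \<in> bmeas" for g :: "'a => ennreal"
 proof -
  have "(NN x. g x) = ennreal (t ^ DIM('a)) * (NN x. g (t *\<^sub>R x))"
   using nn_integral_affine[of g t 0] t by simp
  moreover have "t ^ DIM('a) = t powr nn" using t by (simp add: powr_realpow flip: DIM_nn)
  moreover have "(NN x. g (t *\<^sub>R x) * ennreal (t powr nn)) = (NN x. g (t *\<^sub>R x)) * ennreal (t powr nn)"
   by (rule nn_integral_multc) measurable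
  ultimately show ?thesis by (simp add: mult.commute)
 qed
 moreover have "(norm (t *\<^sub>R x - t *\<^sub>R y))^2 = t * t * (norm (x - y))^2" for x y :: 'a
  by (simp add: power2_eq_square flip: scaleR_diff_right)
 ultimately show ?thesis unfolding conf_def using t by simp
qed

lemma symc_dilate:
 assumes H: "lsym H" "!!T rho eps. (T, rho, eps) \<in> H ==> conf T rho" and w: "w \<in> symc H" and t: "t > 0"
 shows "(%x. t powr (nn/p) * w (t *\<^sub>R x)) \<in> symc H"
proof -
 have "AE x in lborel. rho x powr (nn/p) * (t powr (nn/p) * w (t *\<^sub>R T x)) = eps * (t powr (nn/p) * w (t *\<^sub>R x))"
  if h: "(T, rho, eps) \<in> H" for T rho eps
 proof -
  have "AE x in lborel. rho x powr (nn/p) * w (T x) = eps * w x" using w h unfolding symc_def by blast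
  from conf_AE[OF conf_dilate[OF t] this] show ?thesis
  proof eventually_elim
   case (elim x)
   have "linear T" "rho = (%x. 1)" using H(1)[unfolded lsym_def, THEN spec, THEN spec, THEN spec, THEN mp, OF h] by simp_all
   then show ?case using elim by (simp add: linear_scale mult.left_commute)
  qed
 qed
 then show ?thesis using conf_Np(1)[OF conf_dilate[OF t] symc_Lp[OF w] p_pos] unfolding symc_def by blast
qed

lemma ms_dilate:
 assumes w: "Lp p w" and t: "t > 0" and I: "I \<in> sets borel"
 shows "ms (%x. t powr (nn/p) * w (t *\<^sub>R x)) {x. norm x \<in> I} = ms w {x. norm x / t \<in> I}"
proof -
 have m: "(%x. x / t) -` I \<in> sets borel" using measurable_sets[of "%x::real. x / t" borel borel I] I by simp
 have s: "{x::'a. norm x / t \<in> I} \<in> sets borel" using rad_sets[OF m] by (simp add: vimage_def)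
 have e: "(%x. t powr (nn/p) * w (t *\<^sub>R x) * indicator {x. norm x \<in> I} x)
  = (%x. t powr (nn/p) * (w (t *\<^sub>R x) * indicator {x. norm x / t \<in> I} (t *\<^sub>R x)))"
  using t by (auto simp: indicator_def fun_eq_iff)
 show ?thesis unfolding ms_def e by (rule conf_Np(2)[OF conf_dilate[OF t] Lp_mult_ind(1)[OF w s p0] p_pos])
qed

text \<open>Suppose mass at least \<open>eps\<close> sits on both sides of a long range of scales,
  and cut along a poor shell. The two pieces stay in the class, so their energies are at most
  \<open>Sx\<close> times their masses to the power \<open>2/p\<close>, which loses the factor
  \<open>1 - eta\<close>, more than the cutting costs. \<open>L\<close> and \<open>\<delta>\<close>
  depend on \<open>S\<close> and \<open>eps\<close> but not on the class, because the classes vary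
  along the sequence.\<close>

lemma no_splitting:
 assumes S: "S > 0" and eps: "0 < eps" "eps < 1"
 obtains L \<delta> where "L \<ge> 1" "\<delta> > 0" "!!H w r. lsym H ==> w \<in> symc H ==> Np p w \<le> 1 ==> be w w > S - \<delta> ==> Sx (symc H) < S + \<delta> ==> r > 0
  ==> ms w {x. norm x < r} < eps \<or> ms w {x. norm x \<ge> L * r} < eps"
proof -
 obtain C where C: "C \<ge> 0" "!!(a :: 'a => real) (b :: 'a => real) (rho :: real) (G :: real). Lp p a ==> Lp p b ==> Np p a \<le> 1 ==> Np p b \<le> 1 ==> rho > 0 ==> G \<ge> 2 ==>
  (!!x. norm x \<ge> rho ==> a x = 0) ==> (!!x. norm x < G * rho ==> b x = 0) ==> \<bar>be a b\<bar> \<le> C * G powr (- (nn / q))"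
  using cross_decay by blast
 define a where "a = 2 / p - 1"
 have a: "a > 0" unfolding a_def using p1 p2 by (simp add: field_simps)
 \<comment> \<open>The relative loss: a mass t of at most \<open>1 - eps\<close> satisfies
   \<open>t powr (2/p) \<le> t * (1 - eta)\<close>.\<close>
 define eta where "eta = 1 - (1 - eps) powr a"
 have "(1 - eps) powr a < 1 powr a" using eps a by (intro powr_less_mono2) auto
 then have eta: "eta > 0" "eta \<le> 1" unfolding eta_def by auto
 \<comment> \<open>The budget: the shell, the cross terms and the two defects in the assumptions
   cost at most \<open>4 * \<delta>\<close> together, half of the gain
   \<open>S * eta\<close>.\<close>
 define \<delta> where "\<delta> = S * eta / 8"
 have \<delta>: "\<delta> > 0" unfolding \<delta>_def using S eta by simp
 have "1 / p > 0" "nn / q > 0" using p_pos nn_pos q1 by simp_all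
 \<comment> \<open>The 3 counts the terms of the expansion that contain the shell part
   \<open>f3\<close>, the 2 the cross terms between the two remaining pieces.\<close>
 then obtain M Gn :: nat where M: "M \<ge> 2" "3 * (c0 * BC) * real M powr (- (1/p)) \<le> \<delta>" and G: "Gn \<ge> 2" "2 * C * real Gn powr (- (nn/q)) \<le> \<delta>"
  using powr_small[of "1/p" \<delta> "3 * (c0 * BC)"] powr_small[of "nn/q" \<delta> "2 * C"] \<delta> by blast
 define G where "G = real Gn"
 have G2: "G \<ge> 2" "2 * C * G powr (- (nn/q)) \<le> \<delta>" unfolding G_def using G by auto
 define L where "L = G ^ M"
 have L: "L \<ge> 1" unfolding L_def using G2 by (simp add: one_le_power)
 show ?thesis
 proof (rule that[OF L \<delta>])
  fix H w and r :: real
  assume H: "lsym H" and w: "w \<in> symc H" "Np p w \<le> 1" "be w w > S - \<delta>" and Sx: "Sx (symc H) < S + \<delta>" and r: "r > 0"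
  show "ms w {x. norm x < r} < eps \<or> ms w {x. norm x \<ge> L * r} < eps"
  proof (rule ccontr)
   assume "\<not> ?thesis"
   then have n: "ms w {x. norm x < r} \<ge> eps" "ms w {x. norm x \<ge> L * r} \<ge> eps" by auto
   have wL: "Lp p w" by (rule symc_Lp[OF w(1)])
   obtain i where i: "i < M" "ms w {x. r * G^i \<le> norm x \<and> norm x < r * G^(Suc i)} \<le> 1 / real M"
    using shell_pigeonhole[OF wL w(2), of M r G] M r G2 by auto
   define rho where "rho = r * G^i"
   have G1: "G \<ge> 1" using G2 by simp
   have rho: "rho > 0" "r \<le> rho" "G * rho \<le> L * r"
   proof -
    show "rho > 0" "r \<le> rho" unfolding rho_def using r G1 by (simp_all add: one_le_power mult_le_cancel_left_pos)
    have "G^(Suc i) \<le> G^M" using i G1 by (intro power_increasing) auto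
    then show "G * rho \<le> L * r" unfolding rho_def L_def using r by (simp add: mult.commute mult.left_commute mult_left_mono)
   qed
   have shell: "r * G^(Suc i) = G * rho" unfolding rho_def by simp
   define f1 f2 f3 where "f1 = (%x. w x * indicator {x. norm x \<in> {..<rho}} x)" and "f2 = (%x. w x * indicator {x. norm x \<in> {G * rho..}} x)"
    and "f3 = (%x. w x * indicator {x. norm x \<in> {rho..<G * rho}} x)"
   have X: "f1 \<in> symc H" "f2 \<in> symc H" unfolding f1_def f2_def using symc_radial[OF H w(1), of "{..<rho}"] symc_radial[OF H w(1), of "{G * rho..}"] by simp_all
   have f3: "Lp p f3" unfolding f3_def by (rule Lp_mult_ind(1)[OF wL rad_sets p0]) simp
   note f12 = symc_Lp[OF X(1)] symc_Lp[OF X(2)]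
   define f where "f = (%x. f1 x + f2 x)"
   have f: "Lp p f" unfolding f_def by (rule Lp_add(1)[OF f12 p0])
   have "rho \<le> G * rho" using G1 rho by simp
   then have wf: "w = (%x. f x + f3 x)" unfolding f_def f1_def f2_def f3_def by (auto simp: indicator_def fun_eq_iff)
   have Nf: "Np p f \<le> 1"
    by (rule order_trans[OF Lp_bounded_by(2)[OF wL Lp_meas[OF f] _ p0] w(2)]) (use \<open>rho \<le> G * rho\<close> in \<open>auto simp: f_def f1_def f2_def indicator_def\<close>)
   have N3: "Np p f3 \<le> 1 / real M" using i(2) unfolding ms_def shell f3_def rho_def by simp
   have "1 / real M \<le> 1" using M by simp
   then have N3': "Np p f3 \<le> 1" using N3 by linarith
   have N12: "Np p f1 \<le> 1" "Np p f2 \<le> 1"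
    unfolding f1_def f2_def using Lp_mult_ind(2)[OF wL rad_sets[of "{..<rho}"] p0] Lp_mult_ind(2)[OF wL rad_sets[of "{G * rho..}"] p0] w(2) by simp_all
   have small: "\<bar>be h f3\<bar> \<le> (c0 * BC) * real M powr (- (1/p))" if h: "Lp p h" "Np p h \<le> 1" for h
   proof -
    have D: "c0 * BC \<ge> 0" using c0_pos BC by simp
    have "Np p f3 powr (1/p) \<le> (1 / real M) powr (1/p)" using N3 p_pos by (intro powr_mono2) auto
    also have "... = real M powr (- (1/p))" using M by (simp add: powr_divide powr_minus_divide)
    finally have "(c0 * BC) * Np p h powr (1/p) * Np p f3 powr (1/p) \<le> (c0 * BC) * 1 * real M powr (- (1/p))"
     using h(2) p_pos c0_pos BC by (intro mult_mono mult_left_mono) (auto simp: powr_le1)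
    then show ?thesis using be_bound[OF h(1) f3] by simp
   qed
   have "be w w = be f w + be f3 w" by (subst (1) wf) (rule be_add(1)[OF f f3 wL])
   also have "be f w = be f f + be f f3" by (subst wf) (rule be_add(2)[OF f f3 f])
   also have "be f3 w = be f3 f + be f3 f3" by (subst wf) (rule be_add(2)[OF f f3 f3])
   also have "be f3 f = be f f3" by (rule be_sym[OF f3 f])
   finally have e1: "be w w \<le> be f f + \<delta>" using small[OF f Nf] small[OF f3 N3'] M(2) by linarith
   have cr: "\<bar>be f1 f2\<bar> \<le> C * G powr (- (nn / q))"
    by (rule C(2)[OF f12 N12 rho(1) G2(1)]) (auto simp: f1_def f2_def)
   have "be f f = be f1 f + be f2 f" by (subst (1) f_def) (rule be_add(1)[OF f12 f])
   also have "be f1 f = be f1 f1 + be f1 f2" by (subst f_def) (rule be_add(2)[OF f12 f12(1)])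
   also have "be f2 f = be f2 f1 + be f2 f2" by (subst f_def) (rule be_add(2)[OF f12 f12(2)])
   also have "be f2 f1 = be f1 f2" by (rule be_sym[OF f12(2) f12(1)])
   finally have e2: "be f f \<le> be f1 f1 + be f2 f2 + \<delta>" using cr G2(2) by linarith
   have b12: "be h h \<le> Sx (symc H) * Np p h powr (2/p)" if "h \<in> symc H" for h
    by (rule Sx_scaled[OF symc_Lp symc_scale that])
   define \<alpha> \<beta> where "\<alpha> = Np p f1" and "\<beta> = Np p f2"
   have \<alpha>: "\<alpha> = ms w {x. norm x < rho}" "\<beta> = ms w {x. norm x \<ge> G * rho}" unfolding \<alpha>_def \<beta>_def f1_def f2_def ms_def by simp_all
   have \<alpha>eps: "\<alpha> \<ge> eps" "\<beta> \<ge> eps"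
   proof -
    have "ms w {x. norm x < r} \<le> ms w {x. norm x < rho}" by (rule ms_mono[OF wL ball_set ball_set]) (use rho in auto)
    then show "\<alpha> \<ge> eps" unfolding \<alpha> using n by linarith
    have "ms w {x. norm x \<ge> L * r} \<le> ms w {x. norm x \<ge> G * rho}" by (rule ms_mono[OF wL far_set far_set]) (use rho in auto)
    then show "\<beta> \<ge> eps" unfolding \<alpha> using n by linarith
   qed
   have \<alpha>\<beta>: "\<alpha> + \<beta> \<le> 1"
   proof -
    have "ms w {x. norm x \<ge> G * rho} \<le> ms w {x. norm x \<ge> rho}" by (rule ms_mono[OF wL far_set far_set]) (use \<open>rho \<le> G * rho\<close> in auto)
    then show ?thesis using ms_split[OF wL, of rho] w(2) unfolding \<alpha> by linarith
   qed
   have pw: "t powr (2/p) \<le> t * (1 - eta)" if t: "0 \<le> t" "t \<le> 1 - eps" for t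
   proof (cases "t = 0")
    case False
    have "t powr (2/p) = t powr (1 + a)" unfolding a_def by simp
    also have "... = t * t powr a" using False t unfolding powr_add by simp
    also have "... \<le> t * (1 - eps) powr a" using t a by (intro mult_left_mono powr_mono2) auto
    finally show ?thesis unfolding eta_def by simp
   qed simp
   have "\<alpha> powr (2/p) + \<beta> powr (2/p) \<le> \<alpha> * (1 - eta) + \<beta> * (1 - eta)"
    using pw[of \<alpha>] pw[of \<beta>] \<alpha>eps \<alpha>\<beta> eps by (intro add_mono) auto
   also have "... = (\<alpha> + \<beta>) * (1 - eta)" by (simp add: ring_distribs)
   also have "... \<le> 1 * (1 - eta)" using \<alpha>\<beta> eta by (intro mult_right_mono) auto
   finally have sum: "\<alpha> powr (2/p) + \<beta> powr (2/p) \<le> 1 - eta" by simp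
   have z: "(%x. 0) \<in> symc H" using symc_scale[OF w(1), of 0] by simp
   have "be w w \<le> Sx (symc H)" by (rule Sx_props(1)[OF symc_Lp z w(1,2)])
   moreover have "S - \<delta> \<ge> 0" unfolding \<delta>_def using S eta by (simp add: mult_left_le)
   ultimately have Sx0: "Sx (symc H) \<ge> 0" using w(3) by linarith
   have "be f1 f1 + be f2 f2 \<le> Sx (symc H) * (\<alpha> powr (2/p) + \<beta> powr (2/p))"
    using b12[OF X(1)] b12[OF X(2)] unfolding \<alpha>_def \<beta>_def by (simp add: ring_distribs)
   also have "... \<le> Sx (symc H) * (1 - eta)" using sum Sx0 by (rule mult_left_mono)
   also have "... \<le> (S + \<delta>) * (1 - eta)" using Sx eta by (intro mult_right_mono) auto
   also have "... = S - S * eta + \<delta> - \<delta> * eta" by (simp add: algebra_simps)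
   finally have "S - \<delta> < S - S * eta + \<delta> - \<delta> * eta + 2 * \<delta>" using e1 e2 w(3) by linarith
   moreover have "\<delta> * eta \<ge> 0" using \<delta> eta by simp
   moreover have "S * eta = 8 * \<delta>" unfolding \<delta>_def by simp
   ultimately show False using \<delta> by linarith
  qed
 qed
qed

end

section \<open>Normalisation by dilation and compactness for even n\<close>

lemma bump0_pos: "norm (x::'a::euclidean_space) < 1 ==> bump0 x > 0"
proof -
 assume "norm x < 1"
 then have "x \<bullet> x < 1" by (simp add: dot_square_norm power_less_one_iff)
 then show ?thesis unfolding bump0_def bexp_def by simp
qed

context crit
begin

lemma ms_tendsto:
 fixes r :: "nat => real"
 assumes w: "Lp p w" and l: "!!x::'a. x \<noteq> 0 ==> eventually (%i. (norm x < r i) = b) sequentially"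
 shows "(%i. ms w {x. norm x < r i}) ~> (if b then Np p w else 0)"
proof -
 have [measurable]: "w \<in> bmeas" by (rule Lp_meas[OF w])
 have "(%i. (LBINT x. \<bar>w x\<bar> powr p * indicator {x. norm x < r i} x)) ~> (LBINT x. \<bar>w x\<bar> powr p * (if b then 1 else 0))"
 proof (rule integral_dominated_convergence)
  show "integrable lborel (%x. \<bar>w x\<bar> powr p)" using w unfolding Lp_def by simp
  show "AE x in lborel. (%i. \<bar>w x\<bar> powr p * indicator {x. norm x < r i} x) ~> \<bar>w x\<bar> powr p * (if b then 1 else 0)"
   using AE_lborel_singleton[of 0]
  proof eventually_elim
   case (elim x)
   show ?case by (rule tendsto_eventually, use l[OF elim] in eventually_elim) (auto simp: indicator_def)
  qed
  show "(%x. \<bar>w x\<bar> powr p * indicator {x. norm x < r i} x) \<in> borel_measurable lborel" for i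
   using borel_measurable_integrable[OF ms_int[OF w ball_set]] by simp
 qed (auto simp: indicator_def)
 then show ?thesis unfolding ms_eq Np_def by (cases b) simp_all
qed

text \<open>Takes the least dyadic radius at which the mass exceeds one half. Leaving a factor 2
  between the two radii spares an argument on continuity of the mass in the radius.\<close>

lemma dyadic_median:
 assumes w: "Lp p w" "1/2 < Np p w"
 shows "\<exists>t>0. ms w {x. norm x < t} \<le> 1/2 \<and> 1/2 < ms w {x. norm x < 2 * t}"
proof -
 have "(%i. ms w {x. norm x < 1 / 2^i}) ~> (if False then Np p w else 0)"
 proof (rule ms_tendsto[OF w(1)])
  fix x :: 'a assume "x \<noteq> 0"
  then have "eventually (%i. (1/2)^i < norm x) sequentially"
   using order_tendstoD(2)[OF LIMSEQ_realpow_zero[of "1/2"], of "norm x"] by simp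
  then show "eventually (%i. (norm x < 1 / 2^i) = False) sequentially" by eventually_elim (auto simp: power_divide)
 qed
 then have "eventually (%i. ms w {x. norm x < 1 / 2^i} < 1/2) sequentially" by (intro order_tendstoD(2)[of _ 0]) auto
 then obtain i where i: "ms w {x. norm x < 1 / 2^i} < 1/2" unfolding eventually_sequentially by blast
 have "(%l. ms w {x. norm x < 1 / 2^i * 2^l}) ~> (if True then Np p w else 0)"
 proof (rule ms_tendsto[OF w(1)])
  fix x :: 'a
  obtain n where n: "norm x * 2^i < 2^n" using real_arch_pow[of 2 "norm x * 2^i"] by auto
  have "norm x < (1 / 2^i) * 2^l" if "l \<ge> n" for l
  proof -
   have "(2::real)^n \<le> 2^l" using that by (intro power_increasing) auto
   then have "norm x * 2^i < 2^l" using n by linarith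
   then show ?thesis by (simp add: pos_less_divide_eq)
  qed
  then have "eventually (%l::nat. norm x < (1 / 2^i) * 2^l) sequentially" unfolding eventually_sequentially by blast
  then show "eventually (%l. (norm x < 1 / 2^i * 2^l) = True) sequentially" by simp
 qed
 then have "eventually (%l. 1/2 < ms w {x. norm x < 1 / 2^i * 2^l}) sequentially" using w(2) by (intro order_tendstoD(1)[of _ "Np p w"]) auto
 then obtain l0 where l0: "1/2 < ms w {x. norm x < 1 / 2^i * 2^l0}" unfolding eventually_sequentially by blast
 define P where "P = (%l. 1/2 < ms w {x. norm x < 1 / 2^i * 2^l})"
 define l where "l = (LEAST l. P l)"
 have l: "P l" unfolding l_def by (rule LeastI[of P l0], unfold P_def, rule l0)
 have "l \<noteq> 0" using l i by (intro notI) (simp add: P_def)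
 then obtain k where k: "l = Suc k" by (cases l) auto
 have "\<not> P k" by (rule not_less_Least) (simp add: l_def[symmetric] k)
 then have "\<not> 1/2 < ms w {x. norm x < 1 / 2^i * 2^k}" "1/2 < ms w {x. norm x < 1 / 2^i * 2^(Suc k)}" using l unfolding P_def k by auto
 then show ?thesis by (intro exI[of _ "1 / 2^i * 2^k"]) (simp add: mult.commute mult.left_commute not_less)
qed

text \<open>A dilation moves the median scale to 1, preserving class, mass and energy. The margin
  between 3/4 and 1/2 later leaves mass above 1/4 outside the unit ball.\<close>

lemma normalise:
 assumes H: "lsym H" "!!T rho eps. (T, rho, eps) \<in> H ==> conf T rho" and w: "w \<in> symc H" "Np p w \<le> 1"
 shows "\<exists>w'\<in>symc H. Np p w' = Np p w \<and> be w' w' = be w w \<and>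
  (3/4 < Np p w \<longrightarrow> ms w' {x. norm x < 1} \<le> 1/2 \<and> 1/2 < ms w' {x. norm x < 2})"
proof (cases "3/4 < Np p w")
 case True
 have wL: "Lp p w" by (rule symc_Lp[OF w(1)])
 have "1/2 < Np p w" using True by simp
 from dyadic_median[OF wL this] obtain t where t: "t > 0" "ms w {x. norm x < t} \<le> 1/2" "1/2 < ms w {x. norm x < 2 * t}" by blast
 define w' where "w' = (%x. t powr (nn/p) * w (t *\<^sub>R x))"
 have m: "ms w' {x. norm x < r} = ms w {x. norm x < r * t}" for r
  using ms_dilate[OF wL t(1), of "{..<r}"] t(1) unfolding w'_def by (simp add: pos_divide_less_eq)
 have "w' \<in> symc H" unfolding w'_def by (rule symc_dilate[OF H w(1) t(1)])
 moreover have "Np p w' = Np p w" unfolding w'_def by (rule conf_Np(2)[OF conf_dilate[OF t(1)] wL p_pos])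
 moreover have "be w' w' = be w w" unfolding w'_def by (rule conf_be[OF conf_dilate[OF t(1)] wL wL])
 ultimately show ?thesis using t m[of 1] m[of 2] by (intro bexI[of _ w']) auto
qed (use w in blast)

definition Gr :: "('a => 'a) => (('a => 'a) \<times> ('a => real)) set" where "Gr J = {(rot J \<theta>, %x. 1) | \<theta>. True}"

context
 fixes J J' :: "'a => 'a" and b1 b2 b3 b4 :: 'a
 assumes b: "b1 \<in> Basis" "b2 \<in> Basis" "b3 \<in> Basis" "b4 \<in> Basis" "distinct [b1, b2, b3, b4]"
  and J: "pcs J Basis" and Jb: "J b1 = b2" "J b2 = - b1" "J b3 = b4" "J b4 = - b3"
begin

abbreviation "HH m \<equiv> Hm (Gr J) b1 b2 m"

lemma b12: "b1 \<noteq> b2" using b by simp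

lemma HH_lsym: "lsym (HH m)"
 unfolding lsym_def Hm_def Gr_def \<tau>_def
 using rot_linear[OF J] rot_norm[OF J] rot_linear[OF pcs_plane[OF b(1,2) b12]] rot_norm[OF pcs_plane[OF b(1,2) b12]] by auto

lemma HH_conf: "(T, rho, eps) \<in> HH m ==> conf T rho"
 using conf_rot[OF J] conf_rot[OF pcs_plane[OF b(1,2) b12]] unfolding Hm_def Gr_def \<tau>_def by auto

text \<open>A radial bump times the pattern of \<open>power_pattern\<close> in two coordinate
  planes. Two planes are used because the rotation in the plane of \<open>b1\<close> and
  \<open>b2\<close> has to move one variable and fix the other.\<close>

lemma even_ex: "\<exists>w\<in>symc (HH m). be w w > 0"
proof -
 define w where "w = (%x::'a. bump0 x * Re ((zc b1 b2 x)^(2^m) * cnj (zc b3 b4 x)^(2^m)))"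
 have cb: "continuous_on UNIV (bump0 :: 'a => real)" using bump0(1) unfolding test_fun_iff by (intro smooth_fun_continuous) auto
 have c: "continuous_on UNIV w" unfolding w_def by (intro continuous_intros cb zc_cont)
 have bs: "bump0 x = 0 \<or> norm x < 1" for x :: 'a using bump0(5)[of x] by linarith
 have "bounded {x. w x \<noteq> 0}" unfolding bounded_iff
  by (rule exI[of _ 1]) (use bs in \<open>force simp: w_def\<close>)
 then have wL: "Lp p w" using p1 by (intro Bd_Lp Bd_continuous_support c) auto
 have bi: "bump0 y = bump0 x" if "norm y = norm x" for x y :: 'a using that by (simp add: bump0_def dot_square_norm)
 have "w (rot J \<theta> x) = w x" for \<theta> x
  unfolding w_def zc_def rot_pair[OF J Jb(1,2)] rot_pair[OF J Jb(3,4)] power_pattern(1) by (simp add: bi[OF rot_norm[OF J]])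
 moreover have t: "zc b1 b2 (\<tau> b1 b2 j x) = cis (pi / 2^j) * zc b1 b2 x" "zc b3 b4 (\<tau> b1 b2 j x) = zc b3 b4 x" "bump0 (\<tau> b1 b2 j x) = bump0 x" for j x
 proof -
  show "zc b1 b2 (\<tau> b1 b2 j x) = cis (pi / 2^j) * zc b1 b2 x" unfolding \<tau>_def by (rule zc_plane[OF b(1,2) b12])
  have "plane b1 b2 b3 = 0" "plane b1 b2 b4 = 0" using b by (auto simp: plane_def inner_Basis)
  then show "zc b3 b4 (\<tau> b1 b2 j x) = zc b3 b4 x" unfolding \<tau>_def zc_def by (simp add: rot_fix[OF pcs_plane[OF b(1,2) b12]])
  show "bump0 (\<tau> b1 b2 j x) = bump0 x" unfolding \<tau>_def by (rule bi[OF rot_norm[OF pcs_plane[OF b(1,2) b12]]])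
 qed
 moreover have "w (\<tau> b1 b2 m x) = - w x" for x unfolding w_def t power_pattern(2) by (rule mult_minus_right)
 moreover have "w (\<tau> b1 b2 j x) = w x" if "j < m" for j x unfolding w_def t power_pattern(3)[OF that] ..
 ultimately have ws: "w \<in> symc (HH m)" unfolding symc_Hm using wL by (auto simp: Gr_def)
 \<comment> \<open>Both complex coordinates of this point equal 1/4, and it lies inside the support
   of the bump.\<close>
 define a where "a = (1/4) *\<^sub>R b1 + (1/4) *\<^sub>R b3"
 have z: "zc b1 b2 a = complex_of_real (1/4)" "zc b3 b4 a = complex_of_real (1/4)" unfolding zc_def a_def using b
  by (auto simp: inner_add_left inner_Basis complex_eq_iff)
 have "norm a \<le> 1/4 + 1/4" unfolding a_def using b by (intro norm_triangle_le) simp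
 then have "bump0 a > 0" by (intro bump0_pos) simp
 moreover have "Re (complex_of_real (1/4) ^ (2^m) * cnj (complex_of_real (1/4)) ^ (2^m)) > 0"
  unfolding complex_cnj_complex_of_real of_real_power[symmetric] of_real_mult[symmetric] Re_complex_of_real by simp
 ultimately have "w a \<noteq> 0" unfolding w_def z by simp
 from be_pos[OF wL c this] ws show ?thesis by blast
qed

text \<open>Only 0 and infinity are fixed by the rotations. After \<open>normalise\<close>,
  \<open>no_splitting\<close> keeps mass away from both; around any other point the rotated copies
  of a small ball are disjoint.\<close>

lemma even_compact:
 fixes w :: "nat => 'a => real"
 assumes w: "!!k. w k \<in> symc (HH (m k))" "!!k. Np p (w k) \<le> 1" and S: "S > 0" and lim: "(%k::nat. be (w k) (w k)) ~> S"
  "(%k. Sx (symc (HH (m k)))) ~> S"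
 shows "\<exists>w'. (\<forall>k. w' k \<in> symc (HH (m k)) \<and> Np p (w' k) \<le> 1 \<and> be (w' k) (w' k) = be (w k) (w k)) \<and> tight w' \<and> nonconc w'"
proof -
 have "\<forall>k. \<exists>w'. w' \<in> symc (HH (m k)) \<and> Np p w' = Np p (w k) \<and> be w' w' = be (w k) (w k) \<and>
  (3/4 < Np p (w k) \<longrightarrow> ms w' {x. norm x < 1} \<le> 1/2 \<and> 1/2 < ms w' {x. norm x < 2})"
 proof
  fix k
  have "\<exists>w'\<in>symc (HH (m k)). Np p w' = Np p (w k) \<and> be w' w' = be (w k) (w k) \<and>
   (3/4 < Np p (w k) \<longrightarrow> ms w' {x. norm x < 1} \<le> 1/2 \<and> 1/2 < ms w' {x. norm x < 2})"
   by (rule normalise[OF HH_lsym _ w], erule HH_conf)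
  then show "\<exists>w'. w' \<in> symc (HH (m k)) \<and> Np p w' = Np p (w k) \<and> be w' w' = be (w k) (w k) \<and>
   (3/4 < Np p (w k) \<longrightarrow> ms w' {x. norm x < 1} \<le> 1/2 \<and> 1/2 < ms w' {x. norm x < 2})" by blast
 qed
 from choice[OF this] obtain w' where w': "!!k. w' k \<in> symc (HH (m k))" "!!k. Np p (w' k) = Np p (w k)" "!!k. be (w' k) (w' k) = be (w k) (w k)"
  "!!k. 3/4 < Np p (w k) ==> ms (w' k) {x. norm x < 1} \<le> 1/2 \<and> 1/2 < ms (w' k) {x. norm x < 2}" by blast
 have wL: "Lp p (w' k)" for k by (rule symc_Lp[OF w'(1)])
 have wN: "Np p (w' k) \<le> 1" for k using w(2) w'(2) by simp
 \<comment> \<open>With mass at most 3/4 the energy would be at most \<gamma> times the supremum,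
   which is too little for large k; so the median condition of \<open>normalise\<close> eventually
   holds.\<close>
 define \<gamma> where "\<gamma> = (3/4::real) powr (2/p)"
 have "\<gamma> < 1 powr (2/p)" unfolding \<gamma>_def using p_pos by (intro powr_less_mono2) auto
 then have \<gamma>: "\<gamma> < 1" by simp
 have "(%k. be (w k) (w k) - Sx (symc (HH (m k))) * \<gamma>) ~> S - S * \<gamma>" by (intro tendsto_intros lim)
 moreover have "S - S * \<gamma> > 0" using S \<gamma> by simp
 ultimately have "eventually (%k. 0 < be (w k) (w k) - Sx (symc (HH (m k))) * \<gamma>) sequentially" by (rule order_tendstoD(1))
 moreover have "eventually (%k. 0 < Sx (symc (HH (m k)))) sequentially" by (rule order_tendstoD(1)[OF lim(2) S])
 ultimately have "eventually (%k. 3/4 < Np p (w k)) sequentially"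
 proof eventually_elim
  case (elim k)
  have "be (w k) (w k) \<le> Sx (symc (HH (m k))) * Np p (w k) powr (2/p)" by (rule Sx_scaled[OF symc_Lp symc_scale w(1)])
  then have "Sx (symc (HH (m k))) * \<gamma> < Sx (symc (HH (m k))) * Np p (w k) powr (2/p)" using elim by linarith
  then have *: "\<gamma> < Np p (w k) powr (2/p)" using elim by simp
  show ?case
  proof (rule ccontr)
   assume "\<not> 3/4 < Np p (w k)"
   then have "Np p (w k) powr (2/p) \<le> \<gamma>" unfolding \<gamma>_def using p_pos by (intro powr_mono2) auto
   then show False using * by simp
  qed
 qed
 then obtain N0 where N0: "!!k. k \<ge> N0 ==> 3/4 < Np p (w k)" unfolding eventually_sequentially by blast
 \<comment> \<open>\<open>no_splitting\<close> is applied at \<open>r = 2\<close>, where the inside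
   has mass above 1/2, and at \<open>r = 1 / L\<close>, where the complement of the unit ball has
   mass above 1/4; \<open>eps \<le> 1/8\<close> decides the alternative both times.\<close>
 have spread: "\<exists>L\<ge>1. \<exists>N. \<forall>k\<ge>N. ms (w' k) {x. norm x \<ge> L} \<le> e \<and> ms (w' k) {x. norm x < 1 / L} \<le> e" if e: "e > 0" for e
 proof -
  define eps where "eps = min e (1/8)"
  have eps: "0 < eps" "eps < 1" "eps \<le> 1/8" "eps \<le> e" unfolding eps_def using e by auto
  obtain L \<delta> where L: "L \<ge> 1" "\<delta> > 0" "!!H w r. lsym H ==> w \<in> symc H ==> Np p w \<le> 1 ==> be w w > S - \<delta> ==> Sx (symc H) < S + \<delta> ==> r > 0
   ==> ms w {x. norm x < r} < eps \<or> ms w {x. norm x \<ge> L * r} < eps" using no_splitting[OF S eps(1,2)] by blast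
  have "eventually (%k. S - \<delta> < be (w k) (w k)) sequentially" by (rule order_tendstoD(1)[OF lim(1)]) (use L in simp)
  moreover have "eventually (%k. Sx (symc (HH (m k))) < S + \<delta>) sequentially" by (rule order_tendstoD(2)[OF lim(2)]) (use L in simp)
  ultimately have "eventually (%k. S - \<delta> < be (w k) (w k) \<and> Sx (symc (HH (m k))) < S + \<delta>) sequentially" by (rule eventually_conj)
  then obtain N where N: "!!k. k \<ge> N ==> S - \<delta> < be (w k) (w k) \<and> Sx (symc (HH (m k))) < S + \<delta>" unfolding eventually_sequentially by blast
  have "ms (w' k) {x. norm x \<ge> 2 * L} \<le> e \<and> ms (w' k) {x. norm x < 1 / (2 * L)} \<le> e" if k: "k \<ge> max N0 N" for k
  proof -
   have c: "3/4 < Np p (w k)" using N0 k by simp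
   note m = w'(4)[OF c]
   have d: "ms (w' k) {x. norm x < r} < eps \<or> ms (w' k) {x. norm x \<ge> L * r} < eps" if "r > 0" for r
    by (rule L(3)[OF HH_lsym w'(1) wN _ _ that]) (use N[of k] k w'(3) in auto)
   have sp: "Np p (w k) = ms (w' k) {x. norm x < r} + ms (w' k) {x. norm x \<ge> r}" for r
    using ms_split[OF wL[of k], of r] w'(2)[of k] by simp
   have 1: "ms (w' k) {x. norm x \<ge> L * 2} < eps" using d[of 2] m eps by auto
   have "L * (1/L) = 1" using L(1) by simp
   then have "ms (w' k) {x. norm x < 1/L} < eps \<or> ms (w' k) {x. norm x \<ge> 1} < eps" using d[of "1/L"] L(1) by simp
   moreover have "ms (w' k) {x. norm x \<ge> 1} > 1/4" using sp[of 1] m c by linarith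
   ultimately have "ms (w' k) {x. norm x < 1/L} < eps" using eps(3) by linarith
   moreover have "ms (w' k) {x. norm x < 1/(2*L)} \<le> ms (w' k) {x. norm x < 1/L}"
   proof (rule ms_mono[OF wL ball_set ball_set], rule Collect_mono, rule impI)
    fix x :: 'a assume "norm x < 1/(2*L)"
    moreover have "1/(2*L) \<le> 1/L" using L(1) by (intro divide_left_mono) auto
    ultimately show "norm x < 1/L" by linarith
   qed
   ultimately show ?thesis using 1 eps(4) by (simp add: mult.commute)
  qed
  then show ?thesis using L(1) by (intro exI[of _ "2 * L"] conjI exI[of _ "max N0 N"] allI impI) auto
 qed
 have "tight w'" unfolding tight_def
 proof (intro allI impI)
  fix e :: real assume "e > 0"
  from spread[OF this] obtain L N where L: "!!k. k \<ge> N ==> ms (w' k) {x. norm x \<ge> L} \<le> e" by blast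
  have "Np p (%x. w' k x * indicator (- cball 0 L) x) \<le> e" if "k \<ge> N" for k
   by (rule order_trans[OF ms_mono[OF wL, of _ "{x. norm x \<ge> L}", unfolded ms_def] L[OF that, unfolded ms_def]]) (auto simp: far_set)
  then show "\<exists>R N. \<forall>k\<ge>N. Np p (%x. w' k x * indicator (- cball 0 R) x) \<le> e" by blast
 qed
 moreover have "nonconc w'" unfolding nonconc_def
 proof (intro allI impI)
  fix e :: real assume e: "e > 0"
  from spread[OF this] obtain L N where L: "L \<ge> 1" "!!k. k \<ge> N ==> ms (w' k) {x. norm x < 1 / L} \<le> e" by blast
  obtain M :: nat where M: "1 / e < real M" using reals_Archimedean2 by blast
  have M0: "M > 0" using M e by (metis divide_pos_pos less_trans of_nat_0_less_iff zero_less_one)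
  obtain c where c: "c > 0" "!!(J :: 'a => 'a) i j x. pcs J Basis ==> i < M ==> j < M ==> i \<noteq> j ==>
   norm (rot J (2 * pi * real i / real M) x - rot J (2 * pi * real j / real M) x) \<ge> c * norm x" using rot_separated[OF M0] by blast
  \<comment> \<open>A ball centred within \<open>1 / (2 * L)\<close> of 0 lies in the ball of radius
    \<open>1 / L\<close>. Points of any other ball have norm above \<open>1 / (4 * L)\<close>, so
    their rotated copies are more than \<open>c / (4 * L) \<ge> 2 * d\<close> apart.\<close>
  define d where "d = min (1 / (4 * L)) (c / (8 * L))"
  have d: "d > 0" "d \<le> 1 / (4 * L)" "d \<le> c / (8 * L)" unfolding d_def using L c by auto
  have "Np p (%x. w' k x * indicator (ball z d) x) \<le> e" if k: "k \<ge> N" for k z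
  proof (cases "norm z < 1 / (2 * L)")
   case True
   have "ball z d \<subseteq> {x. norm x < 1 / L}"
   proof
    fix x assume "x \<in> ball z d"
    then have "norm (x - z) < d" by (simp add: dist_norm norm_minus_commute)
    moreover have "norm x \<le> norm (x - z) + norm z" by (metis diff_add_cancel norm_triangle_ineq)
    moreover have "1 / (2 * L) + 1 / (2 * L) = 1 / L" by simp
    moreover have dL: "1 / (4 * L) \<le> 1 / (2 * L)" using L(1) by (intro divide_left_mono) auto
    ultimately have "norm x < 1 / L" using True d dL by linarith
    then show "x \<in> {x. norm x < 1 / L}" by simp
   qed
   then show ?thesis using ms_mono[OF wL[of k] _ ball_set, of "ball z d" "1 / L"] L(2)[OF k] unfolding ms_def by simp
  next
   case False
   have "real M * Np p (%x. w' k x * indicator (ball z d) x) \<le> Np p (w' k)"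
   proof (rule mass_disjoint[OF wL, of M "%i. rot J (2 * pi * real i / real M)" "%i x. 1"])
    show "conf (rot J (2 * pi * real i / real M)) (%x. 1)" for i by (rule conf_rot[OF J])
    show "AE x in lborel. 1 powr (nn/p) * w' k (rot J (2 * pi * real i / real M) x) = w' k x" for i
     using w'(1)[of k] unfolding symc_Hm Gr_def by auto
    show "ball z d \<in> sets borel" by simp
    show "AE x in lborel. \<forall>i<M. \<forall>j<M. i \<noteq> j \<longrightarrow> rot J (2 * pi * real i / real M) x \<in> ball z d \<longrightarrow> rot J (2 * pi * real j / real M) x \<notin> ball z d"
    proof (intro AE_I2 allI impI)
    fix i j x assume ij: "i < M" "j < M" "i \<noteq> j" and x: "rot J (2 * pi * real i / real M) x \<in> ball z d"
    show "rot J (2 * pi * real j / real M) x \<notin> ball z d"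
    proof
     let ?a = "rot J (2 * pi * real i / real M) x" and ?b = "rot J (2 * pi * real j / real M) x"
     assume y: "?b \<in> ball z d"
     have "norm (?a - ?b) < 2 * d" using x y dist_triangle2[of ?a ?b z] by (simp add: dist_norm norm_minus_commute)
     moreover have "norm (?a - ?b) \<ge> c * norm x" by (rule c(2)[OF J ij])
     moreover have "norm x > 1 / (2 * L) - d" using x False norm_triangle_ineq2[of z ?a] rot_norm[OF J, of "2 * pi * real i / real M" x] by (simp add: dist_norm)
     ultimately have "c * (1 / (2 * L) - d) < 2 * d" using c(1) by (meson less_le_trans less_trans mult_strict_left_mono order.strict_trans1)
     moreover have "\<not> c * (1 / (2 * L) - d) < 2 * d" if "d \<le> 1 / (4 * L)"
     proof -
      have "c * (1 / (4 * L)) \<le> c * (1 / (2 * L) - d)" using that c(1) L(1) by (intro mult_left_mono) auto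
      moreover have "c * (1 / (4 * L)) = 2 * (c / (8 * L))" by simp
      ultimately show ?thesis using d(3) by linarith
     qed
     moreover have "d \<le> 1 / (4 * L)" by (rule d(2))
     ultimately show False by blast
    qed
    qed
   qed
   then have "real M * Np p (%x. w' k x * indicator (ball z d) x) \<le> 1" using wN[of k] by linarith
   then have "Np p (%x. w' k x * indicator (ball z d) x) \<le> 1 / real M" using M0 by (simp add: pos_le_divide_eq mult.commute)
   also have "... \<le> e" using M e M0 by (simp add: field_simps less_imp_le)
   finally show ?thesis .
  qed
  then show "\<exists>d>0. \<exists>N. \<forall>k\<ge>N. \<forall>z. Np p (%x. w' k x * indicator (ball z d) x) \<le> e" using d(1) by blast
 qed
 ultimately show ?thesis using w'(1,3) wN by blast
qed

end

theorem even_solutions: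
 assumes "even DIM('a)" "DIM('a) \<ge> 4"
 shows "\<exists>u :: nat => 'a => real. (\<forall>k. u k \<in> Hs s \<and> weak_solution s q (u k) \<and> sign_changing (u k)) \<and> filterlim (%k. Hs_form s (u k) (u k)) at_top sequentially"
proof -
 obtain A where A: "A \<subseteq> (Basis::'a set)" "card A = 4" by (meson assms(2) obtain_subset_with_card_n)
 then obtain b1 b2 b3 b4 where b: "A = {b1, b2, b3, b4}" "distinct [b1, b2, b3, b4]"
  by (auto simp: card_Suc_eq numeral_eq_Suc)
 have bB: "b1 \<in> Basis" "b2 \<in> Basis" "b3 \<in> Basis" "b4 \<in> Basis" using A b by auto
 \<comment> \<open>The complex structure has to pair \<open>b1\<close> with \<open>b2\<close> and
   \<open>b3\<close> with \<open>b4\<close>, the planes of the pattern in \<open>even_ex\<close>; on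
   the remaining coordinates any pairing will do.\<close>
 let ?S = "Basis - A"
 have "card ?S = DIM('a) - 4" using A by (simp add: card_Diff_subset finite_subset[OF A(1) finite_Basis])
 then have "even (card ?S)" using assms by simp
 then obtain J0 where J0: "pcs J0 ?S" using ex_pcs[of ?S] by auto
 let ?S1 = "insert b1 (insert b2 ?S)"
 define J1 where "J1 = (%x. J0 x + plane b1 b2 x)"
 have J1: "pcs J1 ?S1" unfolding J1_def by (rule pcs_add_plane[OF J0]) (use bB b in auto)
 define J where "J = (%x. J1 x + plane b3 b4 x)"
 have J: "pcs J (insert b3 (insert b4 ?S1))" unfolding J_def by (rule pcs_add_plane[OF J1]) (use bB b in auto)
 have "insert b3 (insert b4 ?S1) = Basis" using bB b by auto
 then have JB: "pcs J Basis" using J by simp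
 have z: "J0 b1 = 0" "J0 b2 = 0" "J0 b3 = 0" "J0 b4 = 0" using pcs_out[OF J0] bB b by auto
 have "J b1 = b2" "J b2 = - b1" "J b3 = b4" "J b4 = - b3"
  unfolding J_def J1_def z plane_def using b bB by (auto simp: inner_Basis)
 note c = bB b(2) JB this
 show ?thesis
  by (rule solutions_from_compactness[OF bB(1,2) b12[OF c] _ even_ex[OF c] even_compact[OF c]])
   (auto simp: Gr_def intro: conf_rot[OF JB])
qed

end

section \<open>Odd dimension\<close>

text \<open>Inversion in the unit sphere. Both integrals, weighted by the indicator of a shell \<open>1 \<le> |x| \<le> e\<close>, are integrals of
 the same function \<open>Q\<close>, which collects the values of \<open>f\<close> along the dilation orbit of \<open>x\<close>.\<close>

definition invn :: "'a::euclidean_space => 'a" where "invn x = (1 / (norm x)^2) *\<^sub>R x"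

lemma invn_meas [measurable]: "invn \<in> bmeas" unfolding invn_def by measurable

lemma invn_dist:
 assumes "x \<noteq> 0" "y \<noteq> 0"
 shows "(norm (invn x - invn y))^2 = (norm (x - y))^2 / ((norm x)^2 * (norm y)^2)"
proof -
 define a b where "a = (norm x)^2" and "b = (norm y)^2"
 have ab: "a > 0" "b > 0" "x \<bullet> x = a" "y \<bullet> y = b" unfolding a_def b_def using assms by (auto simp: power2_norm_eq_inner)
 have "(norm (invn x - invn y))^2 = 1 / a - 2 * (x \<bullet> y) / (a * b) + 1 / b"
  unfolding invn_def a_def[symmetric] b_def[symmetric] power2_norm_eq_inner
  using ab by (simp add: inner_diff_left inner_diff_right inner_commute field_simps)
 also have "... = (a - 2 * (x \<bullet> y) + b) / (a * b)" using ab by (simp add: field_simps)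
 also have "a - 2 * (x \<bullet> y) + b = (norm (x - y))^2"
  unfolding power2_norm_eq_inner using ab by (simp add: inner_diff_left inner_diff_right inner_commute)
 finally show ?thesis unfolding a_def b_def .
qed

lemma nn_integral_inversion:
 fixes f :: "'a::euclidean_space => ennreal"
 assumes [measurable]: "f \<in> bmeas"
 shows "(NN x. f (invn x) * ennreal (norm x powr (-(2 * real DIM('a))))) = (NN x. f x)"
proof -
 define n where "n = real DIM('a)"
 define Q where "Q = (%f (x::'a). (NN u. f (exp u *\<^sub>R x) * ennreal (exp (n * u))))"
 define k where "k = (indicator {1..exp 1} :: real => ennreal)"
 have [measurable]: "k \<in> bmeas" unfolding k_def by (rule borel_measurable_indicator) auto
 have key: "(NN x. f x) = (NN x. k (norm x) * Q f x)" if [measurable]: "f \<in> bmeas" for f :: "'a => ennreal"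
 proof -
  have dil: "(NN x. f (exp u *\<^sub>R x) * k (norm x) * ennreal (exp (n * u))) = (NN x. f x * k (exp (- u) * norm x))" for u :: real
  proof -
   define g where "g = (%x::'a. f x * k (exp (- u) * norm x))"
   have [measurable]: "g \<in> bmeas" unfolding g_def by measurable
   have g: "g (exp u *\<^sub>R x) = f (exp u *\<^sub>R x) * k (norm x)" for x unfolding g_def by (simp flip: mult.assoc exp_add)
   have "exp u ^ DIM('a) = exp (n * u)" unfolding n_def by (simp add: exp_of_nat_mult)
   then have "(NN x. g x) = ennreal (exp (n * u)) * (NN x. g (exp u *\<^sub>R x))"
    using nn_integral_affine[of g "exp u" 0] by simp
   also have "... = (NN x. g (exp u *\<^sub>R x) * ennreal (exp (n * u)))"
    by (subst nn_integral_multc) (auto simp: mult.commute)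
   also have "... = (NN x. f (exp u *\<^sub>R x) * k (norm x) * ennreal (exp (n * u)))" by (simp only: g)
   finally show ?thesis unfolding g_def ..
  qed
  \<comment> \<open>Along its dilation orbit every nonzero point spends logarithmic time exactly 1
    in the shell.\<close>
  have one: "(NN u. k (exp (- u) * norm x)) = 1" if x: "x \<noteq> 0" for x :: 'a
  proof -
   have "k (exp (- u) * norm x) = indicator {ln (norm x) - 1..ln (norm x)} u" for u
   proof -
    have "exp (- u) * norm x = exp (ln (norm x) - u)" using x by (simp add: exp_diff exp_minus field_simps)
    then show ?thesis unfolding k_def by (auto simp: indicator_def one_le_exp_iff)
   qed
   then show ?thesis by simp
  qed
  have "(NN x. f x) = (NN x. f x * (NN u. k (exp (- u) * norm x)))"
   by (rule nn_integral_cong_AE) (use AE_lborel_singleton[of "0::'a"] one in \<open>auto elim!: eventually_mono\<close>)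
  also have "... = (NN x. (NN u. f x * k (exp (- u) * norm x)))"
   by (intro nn_integral_cong nn_integral_cmult[symmetric]) measurable
  also have "... = (NN u. (NN x. f x * k (exp (- u) * norm x)))" by (rule lborel_pair.Fubini') measurable
  also have "... = (NN u. (NN x. f (exp u *\<^sub>R x) * k (norm x) * ennreal (exp (n * u))))" by (simp only: dil)
  also have "... = (NN x. (NN u. f (exp u *\<^sub>R x) * k (norm x) * ennreal (exp (n * u))))"
   by (rule lborel_pair.Fubini') measurable
  also have "... = (NN x. k (norm x) * Q f x)"
  proof (rule nn_integral_cong)
   fix x :: 'a
   have "(NN u. k (norm x) * (f (exp u *\<^sub>R x) * ennreal (exp (n * u)))) = k (norm x) * Q f x"
    unfolding Q_def by (rule nn_integral_cmult) measurable
   then show "(NN u. f (exp u *\<^sub>R x) * k (norm x) * ennreal (exp (n * u))) = k (norm x) * Q f x" by (simp add: mult_ac)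
  qed
  finally show ?thesis .
 qed
 define f' where "f' = (%x. f (invn x) * ennreal (norm x powr (-(2 * n))))"
 have [measurable]: "f' \<in> bmeas" unfolding f'_def by measurable
 \<comment> \<open>Inversion maps the dilation orbit of x to itself: the parameter is reversed and
   shifted by \<open>- 2 * ln (norm x)\<close>.\<close>
 have Q: "Q f' x = Q f x" if x: "x \<noteq> 0" for x
 proof -
  define h where "h = (%u. f (exp u *\<^sub>R x) * ennreal (exp (n * u)))"
  have [measurable]: "h \<in> bmeas" unfolding h_def by measurable
  define l where "l = ln (norm x)"
  have l: "norm x = exp l" unfolding l_def using x by simp
  have e: "f' (exp u *\<^sub>R x) * ennreal (exp (n * u)) = h (- 2 * l + -1 * u)" for u
  proof -
   have "exp u / (exp u * exp l)^2 = exp (- 2 * l + -1 * u)"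
   proof -
    have "(exp u * exp l)^2 = exp (2 * u + 2 * l)" by (simp add: power2_eq_square flip: exp_add)
    then show ?thesis by (simp flip: exp_diff)
   qed
   then have 1: "invn (exp u *\<^sub>R x) = exp (- 2 * l + -1 * u) *\<^sub>R x" unfolding invn_def by (simp add: l)
   have "norm (exp u *\<^sub>R x) powr (-(2 * n)) = exp (- (2 * n) * (u + l))" by (simp add: l powr_def flip: exp_add)
   then have "norm (exp u *\<^sub>R x) powr (-(2 * n)) * exp (n * u) = exp (n * (- 2 * l + -1 * u))"
    by (simp add: algebra_simps flip: exp_add)
   then have "ennreal (norm (exp u *\<^sub>R x) powr (-(2 * n))) * ennreal (exp (n * u)) = ennreal (exp (n * (- 2 * l + -1 * u)))"
    by (subst ennreal_mult[symmetric]) auto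
   then show ?thesis unfolding f'_def h_def 1 by (simp only: mult.assoc)
  qed
  have "(NN u. h u) = (NN u. h (- 2 * l + -1 * u))" using nn_integral_affine[of h "-1" "- 2 * l"] by simp
  then show ?thesis unfolding Q_def e h_def by simp
 qed
 have "(NN x. f' x) = (NN x. f x)" unfolding key[of f, OF assms] key[of f', OF \<open>f' \<in> bmeas\<close>]
  by (rule nn_integral_cong_AE) (use AE_lborel_singleton[of "0::'a"] Q in \<open>auto elim!: eventually_mono\<close>)
 then show ?thesis unfolding f'_def n_def .
qed

section \<open>Stereographic projection and reflections of the sphere\<close>

lemma inner_lincomb:
 fixes x y :: "'b::real_inner"
 shows "(\<alpha> *\<^sub>R x + \<beta> *\<^sub>R y) \<bullet> (\<alpha> *\<^sub>R x + \<beta> *\<^sub>R y) = \<alpha>^2 * (x \<bullet> x) + 2 * \<alpha> * \<beta> * (x \<bullet> y) + \<beta>^2 * (y \<bullet> y)"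
 by (simp add: inner_add_left inner_add_right inner_commute power2_eq_square algebra_simps)

text \<open>\<open>2 / mm x\<close> is the conformal factor of the inverse stereographic
  projection.\<close>

definition mm :: "'a::euclidean_space => real" where "mm x = 1 + (norm x)^2"

text \<open>Inverse stereographic projection onto the unit sphere.\<close>

definition stg :: "'a::euclidean_space => 'a \<times> real" where "stg x = ((2 / mm x) *\<^sub>R x, 1 - 2 / mm x)"

lemma mm_pos [simp]: "mm x > 0" "mm x \<ge> 1" "mm x \<noteq> 0"
 unfolding mm_def using zero_le_power2[of "norm x"] by (linarith, linarith, metis add_nonneg_eq_0_iff one_neq_zero zero_le_one zero_le_power2)

lemma mm_cont: "continuous_on A mm" unfolding mm_def by (intro continuous_intros)

lemma stg_cont: "continuous_on A stg"
 unfolding stg_def by (intro continuous_intros mm_cont) auto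

lemma stg_dist: "(norm (stg x - stg y))^2 = 4 * (norm (x - y))^2 / (mm x * mm y)"
proof -
 define a b where "a = mm x" and "b = mm y"
 have ab: "a > 0" "b > 0" "x \<bullet> x = a - 1" "y \<bullet> y = b - 1" unfolding a_def b_def by simp_all (simp_all add: mm_def power2_norm_eq_inner)
 have d: "stg x - stg y = ((2 / a) *\<^sub>R x + (- (2 / b)) *\<^sub>R y, 2 / b - 2 / a)" unfolding stg_def a_def b_def by simp
 have "(norm (stg x - stg y))^2 = (2 / a)^2 * (a - 1) + 2 * (2 / a) * (- (2 / b)) * (x \<bullet> y) + (- (2 / b))^2 * (b - 1) + (2 / b - 2 / a)^2"
  unfolding d power2_norm_eq_inner inner_prod_def fst_conv snd_conv inner_lincomb ab(3,4) by (simp add: power2_eq_square)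
 also have "... = 4 * ((a - 1) - 2 * (x \<bullet> y) + (b - 1)) / (a * b)" using ab(1,2) by (simp add: field_simps power2_eq_square)
 also have "(a - 1) - 2 * (x \<bullet> y) + (b - 1) = (norm (x - y))^2"
  unfolding power2_norm_eq_inner using ab by (simp add: inner_diff_left inner_diff_right inner_commute)
 finally show ?thesis unfolding a_def b_def .
qed

lemma stg_norm: "norm (stg x) = 1"
proof -
 define a where "a = mm x"
 have a: "a > 0" "x \<bullet> x = a - 1" unfolding a_def by simp (simp add: mm_def power2_norm_eq_inner)
 have "(norm (stg x))^2 = (4 / a^2) * (a - 1) + (1 - 2 / a)^2"
  unfolding stg_def a_def[symmetric] power2_norm_eq_inner by (simp add: a(2) power2_eq_square)
 also have "... = 1" using a(1) by (simp add: field_simps power2_eq_square)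
 finally show ?thesis by (simp add: power2_eq_1_iff) (metis norm_ge_zero not_one_le_zero neg_0_le_iff_le)
qed

definition refl :: "'b::euclidean_space => 'b => 'b" where "refl v z = z - (2 * (z \<bullet> v)) *\<^sub>R v"

text \<open>The inversion with centre \<open>c\<close> and squared radius \<open>1 + |c|\<^sup>2\<close> is the reflection of the sphere in \<open>(c, -1)\<close>.\<close>

lemma stg_inversion:
 fixes c x :: "'a::euclidean_space"
 assumes x: "x \<noteq> c" and v: "v = (1 / sqrt (mm c)) *\<^sub>R (c, -1)" and T: "T = c + mm c *\<^sub>R invn (x - c)"
 shows "mm T = mm c / (norm (x - c))^2 * mm x" "stg T = refl v (stg x)"
proof -
 define d where "d = (norm (x - c))^2"
 define r where "r = mm c"
 have d: "d > 0" unfolding d_def using x by simp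
 have r: "r > 0" unfolding r_def by simp
 have dd: "(x - c) \<bullet> (x - c) = d" unfolding d_def by (simp add: power2_norm_eq_inner)
 have cc: "c \<bullet> c = r - 1" unfolding r_def mm_def by (simp add: power2_norm_eq_inner)
 have xx: "mm x = d + 2 * (c \<bullet> (x - c)) + r"
  unfolding mm_def power2_norm_eq_inner using dd cc by (simp add: inner_diff_left inner_diff_right inner_commute)
 have Te: "T = c + (r / d) *\<^sub>R (x - c)" unfolding T invn_def d_def r_def by simp
 have "mm T = 1 + (c \<bullet> c + 2 * (r / d) * (c \<bullet> (x - c)) + (r / d)^2 * d)"
  unfolding mm_def power2_norm_eq_inner Te using inner_lincomb[of 1 c "r / d" "x - c"] by (simp only: dd scaleR_one) simp
 also have "... = r / d * mm x" unfolding xx cc using d by (simp add: field_simps power2_eq_square)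
 finally have mT: "mm T = r / d * mm x" .
 then show "mm T = mm c / (norm (x - c))^2 * mm x" unfolding r_def d_def .
 define a where "a = mm x"
 have a: "a > 0" unfolding a_def by simp
 have "stg x \<bullet> (c, -1) = (2 / a) * (x \<bullet> c) - (1 - 2 / a)" unfolding stg_def a_def by simp
 also have "... = (r - d) / a"
 proof -
  have "x \<bullet> c = c \<bullet> (x - c) + (r - 1)" using cc by (simp add: inner_diff_right inner_commute)
  then have "2 * (x \<bullet> c) = a - d + r - 2" unfolding a_def xx by simp
  then have "(2 / a) * (x \<bullet> c) = (a - d + r - 2) / a" by (metis times_divide_eq_left)
  then show ?thesis using a by (simp add: field_simps)
 qed
 finally have ip: "stg x \<bullet> (c, -1) = (r - d) / a" .
 have "refl v (stg x) = stg x - (2 * (stg x \<bullet> (c, -1)) / r) *\<^sub>R (c, -1)"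
 proof -
  have "(1 / sqrt r) * (1 / sqrt r) = 1 / r" using r by simp
  then show ?thesis unfolding refl_def v r_def[symmetric] inner_scaleR_right scaleR_scaleR by (simp add: mult.assoc mult.commute)
 qed
 also have "... = stg T"
 proof -
  have 2: "2 / mm T = 2 * d / (r * a)" unfolding mT a_def[symmetric] using d r a by (simp add: field_simps)
  have "(2 / a) *\<^sub>R x - (2 * ((r - d) / a) / r) *\<^sub>R c = (2 * d / (r * a)) *\<^sub>R (c + (r / d) *\<^sub>R (x - c))"
  proof -
   have "(2 * d / (r * a)) *\<^sub>R (c + (r / d) *\<^sub>R (x - c)) = (2 * d / (r * a) - 2 * d / (r * a) * (r / d)) *\<^sub>R c + (2 * d / (r * a) * (r / d)) *\<^sub>R x"
    by (simp add: algebra_simps)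
   also have "2 * d / (r * a) * (r / d) = 2 / a" using d r a by (simp add: field_simps)
   also have "2 * d / (r * a) - 2 / a = - (2 * ((r - d) / a) / r)" using r a by (simp add: field_simps)
   finally show ?thesis by simp
  qed
  moreover have "1 - 2 / a + 2 * ((r - d) / a) / r = 1 - 2 * d / (r * a)" using r a by (simp add: field_simps)
  ultimately show ?thesis unfolding ip unfolding stg_def 2 a_def[symmetric] by (simp add: Te)
 qed
 finally show "stg T = refl v (stg x)" by simp
qed

context crit
begin

lemma conf_compose:
 assumes 1: "conf T rho" and 2: "conf T' rho'"
 shows "conf (%x. T (T' x)) (%x. rho (T' x) * rho' x)"
proof -
 note [measurable] = T_meas[OF 1] T_meas[OF 2] rho_meas[OF 1] rho_meas[OF 2]
 note pos = rho_pos[OF 1] rho_pos[OF 2]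
 have "AE x in lborel. AE y in lborel. (norm (T (T' x) - T (T' y)))^2 = rho (T' x) * rho' x * (rho (T' y) * rho' y) * (norm (x - y))^2"
  using conf_AE[OF 2 T_dist[OF 1]] T_dist[OF 2]
 proof eventually_elim
  case (elim x)
  show ?case using conf_AE[OF 2 elim(1)] elim(2) by eventually_elim (simp add: mult_ac)
 qed
 moreover have "(NN x. g (T (T' x)) * ennreal ((rho (T' x) * rho' x) powr nn)) = (NN x. g x)"
  if [measurable]: "g \<in> bmeas" for g :: "'a => ennreal"
 proof -
  have "(NN x. g (T (T' x)) * ennreal ((rho (T' x) * rho' x) powr nn))
   = (NN x. (g (T (T' x)) * ennreal (rho (T' x) powr nn)) * ennreal (rho' x powr nn))"
   by (intro nn_integral_cong) (simp add: powr_mult ennreal_mult mult.assoc)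
  also have "... = (NN x. g (T x) * ennreal (rho x powr nn))"
   by (rule T_nn[OF 2, of "%x. g (T x) * ennreal (rho x powr nn)"]) measurable
  also have "... = (NN x. g x)" by (rule T_nn[OF 1]) measurable
  finally show ?thesis .
 qed
 moreover have "(%x. T (T' x)) \<in> bmeas" "(%x. rho (T' x) * rho' x) \<in> bmeas" by measurable
 ultimately show ?thesis unfolding conf_def using pos by auto
qed

lemma conf_translate: "conf (%x. x + c) (%x. 1)"
 unfolding conf_def by (auto simp: nn_integral_translate)

text \<open>At the pole the factor gets the default value 1, which keeps it positive everywhere as
  \<open>conf\<close> demands; the pole is a null set.\<close>

lemma conf_invn: "conf invn (%x. if x = 0 then 1 else 1 / (norm x)^2)"
proof -
 have z: "AE x in lborel. x \<noteq> (0::'a)" by (rule AE_lborel_singleton)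
 have "AE x in lborel. AE y in lborel. (norm (invn x - invn y))^2
   = (if x = 0 then 1 else 1 / (norm x)^2) * (if y = 0 then 1 else 1 / (norm y)^2) * (norm (x - (y::'a)))^2"
  using z
 proof eventually_elim
  case (elim x)
  show ?case using z by eventually_elim (use elim in \<open>simp add: invn_dist\<close>)
 qed
 moreover have "(NN x. g (invn x) * ennreal ((if x = 0 then 1 else 1 / (norm x)^2) powr nn)) = (NN x. g x)"
  if [measurable]: "g \<in> bmeas" for g :: "'a => ennreal"
 proof -
  have "(NN x. g (invn x) * ennreal ((if x = 0 then 1 else 1 / (norm x)^2) powr nn))
   = (NN x. g (invn x) * ennreal (norm x powr (-(2 * nn))))"
  proof (rule nn_integral_cong_AE, use z in eventually_elim)
   fix x :: 'a assume x: "x \<noteq> 0"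
   have "(1 / (norm x)^2) powr nn = (norm x powr (-2)) powr nn" using x by (simp add: powr_minus divide_inverse)
   also have "... = norm x powr (-(2 * nn))" unfolding powr_powr by simp
   finally show "g (invn x) * ennreal ((if x = 0 then 1 else 1 / (norm x)^2) powr nn) = g (invn x) * ennreal (norm x powr (-(2 * nn)))"
    using x by simp
  qed
  then show ?thesis using nn_integral_inversion[of g] by simp
 qed
 moreover have "(%x::'a. if x = 0 then 1 else 1 / (norm x)^2) \<in> bmeas" by measurable
 ultimately show ?thesis unfolding conf_def by auto
qed

text \<open>\<open>T\<close> is the map \<open>R\<close> of the sphere seen in the chart. By the
  second equation \<open>rho\<close> is the quotient of the values of \<open>mm\<close>, so
  \<open>mm x powr (- (nn / p))\<close> times an \<open>R\<close>-invariant function of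
  \<open>stg x\<close> is invariant under the weighted action.\<close>

definition sph :: "('a \<times> real => 'a \<times> real) => ('a => 'a) => ('a => real) => bool" where
 "sph R T rho \<longleftrightarrow> conf T rho \<and> (AE x in lborel. stg (T x) = R (stg x) \<and> mm (T x) = rho x * mm x)"

lemma sph_compose:
 assumes 1: "sph R T rho" and 2: "sph R' T' rho'"
 shows "sph (%z. R (R' z)) (%x. T (T' x)) (%x. rho (T' x) * rho' x)"
proof -
 have c: "conf T rho" "conf T' rho'" using 1 2 unfolding sph_def by auto
 have a: "AE x in lborel. stg (T x) = R (stg x) \<and> mm (T x) = rho x * mm x" "AE x in lborel. stg (T' x) = R' (stg x) \<and> mm (T' x) = rho' x * mm x"
  using 1 2 unfolding sph_def by auto
 have "AE x in lborel. stg (T (T' x)) = R (R' (stg x)) \<and> mm (T (T' x)) = rho (T' x) * rho' x * mm x"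
  using conf_AE[OF c(2) a(1)] a(2) by eventually_elim simp
 then show ?thesis unfolding sph_def using conf_compose[OF c] by blast
qed

lemma sph_linear:
 assumes L: "linear L" "!!x. norm (L x) = norm x"
 shows "sph (%z. (L (fst z), snd z)) L (%x. 1)"
 unfolding sph_def using conf_isometry[OF L] by (auto simp: stg_def mm_def L linear_scale[OF L(1)])

text \<open>The vectors \<open>(c, -1)\<close>, normalised, are the unit vectors with negative last
  coordinate; the reflections of the sphere in them come from a translation, an inversion, a
  dilation and the translation back.\<close>

lemma sph_refl: "\<exists>T rho. sph (refl ((1 / sqrt (mm c)) *\<^sub>R (c, -1))) T rho"
proof -
 let ?j = "%x::'a. if x = 0 then 1 else 1 / (norm x)^2"
 have c1: "conf (%x. invn (x + - c)) (%x. ?j (x + - c) * 1)" by (rule conf_compose[OF conf_invn conf_translate])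
 have c2: "conf (%x. mm c *\<^sub>R invn (x + - c)) (%x. mm c * (?j (x + - c) * 1))" by (rule conf_compose[OF conf_dilate c1]) simp
 have c3: "conf (%x. mm c *\<^sub>R invn (x + - c) + c) (%x. 1 * (mm c * (?j (x + - c) * 1)))" by (rule conf_compose[OF conf_translate c2])
 have "AE x in lborel. stg (mm c *\<^sub>R invn (x + - c) + c) = refl ((1 / sqrt (mm c)) *\<^sub>R (c, -1)) (stg x)
  \<and> mm (mm c *\<^sub>R invn (x + - c) + c) = 1 * (mm c * (?j (x + - c) * 1)) * mm x"
  using AE_lborel_singleton[of c]
 proof eventually_elim
  case (elim x)
  show ?case using stg_inversion[OF elim HOL.refl HOL.refl] elim by (simp add: add.commute)
 qed
 then show ?thesis using c3 unfolding sph_def by blast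
qed

section \<open>The free circle action on the sphere\<close>

context
 fixes J' :: "'a => 'a" and e0 b1 b2 :: 'a
 assumes b: "e0 \<in> Basis" "b1 \<in> Basis" "b2 \<in> Basis" "distinct [e0, b1, b2]"
  and J': "pcs J' (Basis - {e0})" and Jb: "J' b1 = b2" "J' b2 = - b1"
begin

text \<open>A complex structure on R^(n+1): \<open>J'\<close> acts on the complement of
  \<open>e0\<close>, and \<open>e0\<close> is paired with the additional coordinate.\<close>

definition Jt :: "'a \<times> real => 'a \<times> real" where "Jt z = (J' (fst z) - snd z *\<^sub>R e0, fst z \<bullet> e0)"

lemma Je0: "J' e0 = 0" by (rule pcs_out[OF J']) (use b in auto)

lemma J'e0: "J' x \<bullet> e0 = 0" using pcs_lin(2)[OF J', of x e0] Je0 by simp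

lemma e0e0: "e0 \<bullet> e0 = 1" using b by simp

lemma J'J': "J' (J' x) = - (x - (x \<bullet> e0) *\<^sub>R e0)"
proof -
 have "prj (Basis - {e0}) x = x - (x \<bullet> e0) *\<^sub>R e0"
  by (rule euclidean_eqI) (use b(1) in \<open>auto simp: prj_inner inner_diff_left inner_Basis\<close>)
 then show ?thesis using pcs_lin(3)[OF J', of x] by simp
qed

lemma Jt_Jt: "Jt (Jt z) = - z"
proof -
 note l = linear_diff[OF pcs_lin(1)[OF J']] linear_scale[OF pcs_lin(1)[OF J']]
 show ?thesis unfolding Jt_def by (simp add: l Je0 J'J' J'e0 e0e0 inner_diff_left prod_eq_iff)
qed

lemma Jt_pcs: "pcs Jt Basis"
proof -
 note l = linear_add[OF pcs_lin(1)[OF J']] linear_scale[OF pcs_lin(1)[OF J']]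
 have "linear Jt" by (rule linearI) (simp_all add: Jt_def l inner_add_left algebra_simps)
 moreover have "Jt z \<bullet> y = - (z \<bullet> Jt y)" for z y
  using pcs_lin(2)[OF J', of "fst z" "fst y"]
  by (simp add: Jt_def inner_prod_def inner_diff_left inner_diff_right inner_commute[of e0] algebra_simps)
 ultimately show ?thesis unfolding pcs_def prj_Basis using Jt_Jt by simp
qed

lemma rot_Jt: "rot Jt \<theta> z = cos \<theta> *\<^sub>R z + sin \<theta> *\<^sub>R Jt z"
 unfolding rot_def Jt_Jt by (simp add: algebra_simps)

text \<open>All chart maps of the rotations at once, instead of a choice for each angle;
  \<open>sph_rot\<close> shows that the angles below \<open>pi\<close> in modulus occur.\<close>

definition GS :: "(('a => 'a) \<times> ('a => real)) set" where "GS = {(T, rho). \<exists>\<theta>. sph (rot Jt \<theta>) T rho}"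

text \<open>The rotation factors into \<open>rot J' \<theta>\<close>, which is linear in the chart,
  and a rotation in the plane of \<open>e0\<close> and the additional coordinate. The latter is a
  product of two reflections in vectors at angle \<open>\<theta> / 2\<close>, that is of two
  inversions.\<close>

lemma sph_rot:
 assumes \<theta>: "\<bar>\<theta>\<bar> < pi"
 shows "\<exists>T rho. sph (rot Jt \<theta>) T rho"
proof -
 define phi where "phi = \<theta> / 2"
 have c: "cos phi > 0" by (rule cos_gt_zero_pi) (use \<theta> in \<open>auto simp: phi_def\<close>)
 \<comment> \<open>This centre makes the reflection vector \<open>(sin phi e0, - cos phi)\<close>;
   the bound on \<theta> keeps the tangent finite.\<close>
 define c1 where "c1 = tan phi *\<^sub>R e0"
 have "mm c1 = (1 / cos phi)^2"
 proof -
  have "mm c1 = 1 + (tan phi)^2" unfolding mm_def c1_def using b(1) by simp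
  then show ?thesis using tan_sec[of phi] c by (simp add: inverse_eq_divide)
 qed
 then have "sqrt (mm c1) = 1 / cos phi" using c by simp
 then have v1: "(1 / sqrt (mm c1)) *\<^sub>R (c1, -1) = (sin phi *\<^sub>R e0, - cos phi)" unfolding c1_def tan_def using c by simp
 have v0: "(1 / sqrt (mm (0::'a))) *\<^sub>R (0::'a, -1::real) = (0, -1)" unfolding mm_def by simp
 obtain T1 rho1 where 1: "sph (refl (sin phi *\<^sub>R e0, - cos phi)) T1 rho1" using sph_refl[of c1] unfolding v1 by blast
 obtain T0 rho0 where 0: "sph (refl (0, -1)) T0 rho0" using sph_refl[of 0] unfolding v0 by blast
 have L: "sph (%z. (rot J' \<theta> (fst z), snd z)) (rot J' \<theta>) (%x. 1)"
  by (rule sph_linear[OF rot_linear[OF J'] rot_norm[OF J']])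
 have "(%z. (rot J' \<theta> (fst (refl (sin phi *\<^sub>R e0, - cos phi) (refl (0, -1) z))), snd (refl (sin phi *\<^sub>R e0, - cos phi) (refl (0, -1) z)))) = rot Jt \<theta>"
 proof
  fix z :: "'a \<times> real"
  obtain y t where z: "z = (y, t)" using prod.exhaust by blast
  have th: "\<theta> = phi + phi" unfolding phi_def by simp
  have sc: "sin \<theta> = 2 * sin phi * cos phi" "cos \<theta> = 2 * (cos phi)^2 - 1" "1 - cos \<theta> = 2 * (sin phi)^2"
   using sin_double[of phi] cos_double_cos[of phi] cos_double_sin[of phi] by (simp_all add: phi_def)
  define u where "u = y \<bullet> e0"
  have 0: "refl (0, -1) z = (y, - t)" unfolding refl_def z by simp
  have 1: "refl (sin phi *\<^sub>R e0, - cos phi) (y, - t) = (y - ((1 - cos \<theta>) * u + sin \<theta> * t) *\<^sub>R e0, cos \<theta> * t + sin \<theta> * u)"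
   unfolding refl_def sc(3) unfolding sc(1,2) by (simp add: u_def[symmetric] power2_eq_square algebra_simps)
  note l = linear_diff[OF pcs_lin(1)[OF J']] linear_add[OF pcs_lin(1)[OF J']] linear_scale[OF pcs_lin(1)[OF J']]
  have "rot J' \<theta> (y - ((1 - cos \<theta>) * u + sin \<theta> * t) *\<^sub>R e0) = cos \<theta> *\<^sub>R y + sin \<theta> *\<^sub>R (J' y - t *\<^sub>R e0)"
   unfolding rot_def by (simp add: l Je0 J'J' inner_diff_left e0e0 u_def[symmetric] linear_0[OF pcs_lin(1)[OF J']] algebra_simps)
  then show "(rot J' \<theta> (fst (refl (sin phi *\<^sub>R e0, - cos phi) (refl (0, -1) z))), snd (refl (sin phi *\<^sub>R e0, - cos phi) (refl (0, -1) z))) = rot Jt \<theta> z"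
   unfolding 0 1 rot_Jt by (simp add: z Jt_def u_def)
 qed
 then show ?thesis using sph_compose[OF L sph_compose[OF 1 0]] by auto
qed

abbreviation "HO m \<equiv> Hm GS b1 b2 m"

text \<open>Since no point of the sphere is fixed, the images of a small cap are disjoint wherever
  it lies. The bound is uniform over all centres, the pole that stands for infinity included, and
  over all classes.\<close>

lemma odd_mass:
 assumes "e > 0"
 obtains d where "d > 0" "!!w m \<zeta>. w \<in> symc (HO m) ==> Np p w \<le> 1 ==> ms w {x. stg x \<in> ball \<zeta> d} \<le> e"
proof -
 obtain M :: nat where M: "1 / e < real M" using reals_Archimedean2 by blast
 have M0: "M > 0" using M assms by (metis divide_pos_pos less_trans of_nat_0_less_iff zero_less_one)
 \<comment> \<open>Of \<open>2 * M\<close> equally spaced angles only the first M are used, because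
   \<open>sph_rot\<close> reaches only angles below \<open>pi\<close>.\<close>
 obtain c where c: "c > 0" "!!(J :: 'a \<times> real => 'a \<times> real) i j x. pcs J Basis ==> i < 2 * M ==> j < 2 * M ==> i \<noteq> j ==>
   norm (rot J (2 * pi * real i / real (2 * M)) x - rot J (2 * pi * real j / real (2 * M)) x) \<ge> c * norm x"
  using rot_separated[of "2 * M"] M0 by (metis nat_0_less_mult_iff zero_less_numeral)
 define t where "t = (%i. 2 * pi * real i / real (2 * M))"
 have "\<exists>T rho. sph (rot Jt (t i)) T rho" if i: "i < M" for i
 proof (rule sph_rot)
  have "pi * real i < pi * real M" using i by simp
  then show "\<bar>t i\<bar> < pi" unfolding t_def using M0 by (simp add: pos_divide_less_eq abs_mult)
 qed
 then have "\<forall>i. \<exists>T rho. i < M \<longrightarrow> sph (rot Jt (t i)) T rho" by blast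
 then obtain T rho where T: "!!i. i < M ==> sph (rot Jt (t i)) (T i) (rho i)" by metis
 have "ms w {x. stg x \<in> ball \<zeta> (c / 2)} \<le> e" if w: "w \<in> symc (HO m)" "Np p w \<le> 1" for w m \<zeta>
 proof -
  let ?A = "{x. stg x \<in> ball \<zeta> (c / 2)}"
  have "real M * Np p (%x. w x * indicator ?A x) \<le> Np p w"
  proof (rule mass_disjoint[OF symc_Lp[OF w(1)]])
   show "conf (T i) (rho i)" if "i < M" for i using T[OF that] unfolding sph_def by blast
   show "AE x in lborel. rho i x powr (nn/p) * w (T i x) = w x" if "i < M" for i
    using w(1) T[OF that] unfolding symc_Hm GS_def by blast
   have "open (stg -` ball \<zeta> (c / 2) :: 'a set)" using stg_cont[of UNIV] by (intro open_vimage) auto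
   then show "?A \<in> sets borel" by (simp add: vimage_def)
   have "AE x in lborel. \<forall>i. i < M \<longrightarrow> stg (T i x) = rot Jt (t i) (stg x)"
    unfolding AE_all_countable using T unfolding sph_def by (auto elim!: eventually_mono)
   then show "AE x in lborel. \<forall>i<M. \<forall>j<M. i \<noteq> j \<longrightarrow> T i x \<in> ?A \<longrightarrow> T j x \<notin> ?A"
   proof eventually_elim
    case (elim x)
    show ?case
    proof (intro allI impI notI)
     fix i j assume ij: "i < M" "j < M" "i \<noteq> j" and A: "T i x \<in> ?A" "T j x \<in> ?A"
     have "norm (rot Jt (t i) (stg x) - rot Jt (t j) (stg x)) < c"
      using A elim ij dist_triangle2[of "rot Jt (t i) (stg x)" "rot Jt (t j) (stg x)" \<zeta>] by (simp add: dist_commute dist_norm[symmetric])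
     moreover have "norm (rot Jt (t i) (stg x) - rot Jt (t j) (stg x)) \<ge> c * norm (stg x)"
      unfolding t_def by (rule c(2)[OF Jt_pcs]) (use ij in auto)
     ultimately show False by (simp add: stg_norm)
    qed
   qed
  qed
  then have "real M * ms w ?A \<le> 1" using w(2) unfolding ms_def by linarith
  then have "ms w ?A \<le> 1 / real M" using M0 by (simp add: pos_le_divide_eq mult.commute)
  also have "... \<le> e" using M assms M0 by (simp add: field_simps less_imp_le)
  finally show ?thesis .
 qed
 then show ?thesis using that[of "c / 2"] c(1) by simp
qed

text \<open>Caps translate into the chart: a cap around the pole \<open>(0, 1)\<close> contains the
  outside of a large ball, and, \<open>stg\<close> being 2-Lipschitz, a cap around
  \<open>stg z\<close> contains a ball around z.\<close>

lemma odd_compact: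
 fixes w :: "nat => 'a => real"
 assumes w: "!!k. w k \<in> symc (HO (m k))" "!!k. Np p (w k) \<le> 1"
 shows "tight w" "nonconc w"
proof -
 have sb: "{x::'a. stg x \<in> ball \<zeta> d} \<in> sets borel" for \<zeta> d
 proof -
  have "open (stg -` ball \<zeta> d :: 'a set)" using stg_cont[of UNIV] by (intro open_vimage) auto
  then show ?thesis by (simp add: vimage_def)
 qed
 have sq: "x < y" if "x^2 < y^2" "y > 0" for x y :: real using that power2_less_imp_less[of x y] by simp
 show "tight w" unfolding tight_def
 proof (intro allI impI)
  fix e :: real assume "e > 0"
  then obtain d where d: "d > 0" "!!w m \<zeta>. w \<in> symc (HO m) ==> Np p w \<le> 1 ==> ms w {x. stg x \<in> ball \<zeta> d} \<le> e" using odd_mass by blast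
  have sub: "- cball 0 (2/d) \<subseteq> {x::'a. stg x \<in> ball (0, 1) d}"
  proof
   fix x :: 'a assume "x \<in> - cball 0 (2/d)"
   then have "2 / d < norm x" by simp
   then have "2 < norm x * d" using d(1) by (simp add: pos_divide_less_eq)
   then have "2^2 < (norm x * d)^2" by (intro power_strict_mono) auto
   then have x: "4 < d^2 * (norm x)^2" by (simp add: power_mult_distrib mult.commute)
   have xx: "x \<bullet> x = mm x - 1" by (simp add: mm_def power2_norm_eq_inner)
   \<comment> \<open>The squared chordal distance to the pole is \<open>4 / mm x\<close>.\<close>
   have "(norm (stg x - (0, 1)))^2 = (2 / mm x)^2 * (mm x - 1) + (2 / mm x)^2"
    unfolding stg_def power2_norm_eq_inner by (simp add: xx power2_eq_square)
   also have "... = 4 / mm x" using mm_pos[of x] by (simp add: field_simps power2_eq_square del: mm_pos)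
   also have "... < d^2"
   proof -
    have "4 < d^2 * mm x" using x zero_le_power2[of d] unfolding mm_def ring_distribs by linarith
    then show ?thesis by (simp add: pos_divide_less_eq)
   qed
   finally show "x \<in> {x. stg x \<in> ball (0, 1) d}" using sq d(1) by (simp add: dist_norm norm_minus_commute)
  qed
  have "Np p (%x. w k x * indicator (- cball 0 (2/d)) x) \<le> e" for k
   by (rule order_trans[OF ms_mono[OF symc_Lp[OF w(1)] _ sb sub, unfolded ms_def] d(2)[OF w, unfolded ms_def]]) simp
  then show "\<exists>R N. \<forall>k\<ge>N. Np p (%x. w k x * indicator (- cball 0 R) x) \<le> e" by blast
 qed
 show "nonconc w" unfolding nonconc_def
 proof (intro allI impI)
  fix e :: real assume "e > 0"
  then obtain d where d: "d > 0" "!!w m \<zeta>. w \<in> symc (HO m) ==> Np p w \<le> 1 ==> ms w {x. stg x \<in> ball \<zeta> d} \<le> e" using odd_mass by blast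
  have sub: "ball z (d/2) \<subseteq> {x. stg x \<in> ball (stg z) d}" for z :: 'a
  proof
   fix x assume "x \<in> ball z (d/2)"
   then have "norm (z - x) < d / 2" by (simp add: dist_norm)
   then have x: "(norm (z - x))^2 < (d/2)^2" by (intro power_strict_mono) auto
   have "mm z * mm x \<ge> 1 * 1" using mm_pos(1)[of z, THEN less_imp_le] by (intro mult_mono) auto
   then have "4 * (norm (z - x))^2 / (mm z * mm x) \<le> 4 * (norm (z - x))^2 / 1" by (intro divide_left_mono) auto
   then have "(norm (stg z - stg x))^2 \<le> 4 * (norm (z - x))^2" unfolding stg_dist by simp
   also have "... < d^2" using x by (simp add: power_divide)
   finally show "x \<in> {x. stg x \<in> ball (stg z) d}" using sq d(1) by (simp add: dist_norm)
  qed
  have "Np p (%x. w k x * indicator (ball z (d/2)) x) \<le> e" for k z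
   by (rule order_trans[OF ms_mono[OF symc_Lp[OF w(1)] _ sb sub, unfolded ms_def] d(2)[OF w, unfolded ms_def]]) simp
  then show "\<exists>d>0. \<exists>N. \<forall>k\<ge>N. \<forall>z. Np p (%x. w k x * indicator (ball z d) x) \<le> e" using d(1) by (intro exI[of _ "d/2"]) auto
 qed
qed

text \<open>\<open>mm x powr (- nn)\<close> is, up to a constant, the density of the surface measure
  of the sphere in the chart, hence integrable.\<close>

lemma mm_Lp:
 fixes f :: "'a => real"
 assumes f: "f \<in> bmeas" "!!x. \<bar>f x\<bar> \<le> mm x powr (- (nn / p))"
 shows "Lp p f"
proof -
 have "2 * nn > real DIM('a)" using nn_pos by simp
 then obtain C2 where C2: "C2 \<ge> 0" "!!r. r > 0 ==>
  (NN x. indicator {x. norm x \<ge> r} (x::'a) * ennreal (norm x powr (-(2 * nn)))) \<le> ennreal (C2 * r powr (real DIM('a) - 2 * nn))"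
  using radial_far[where 'a='a, of "2 * nn"] by blast
 define V where "V = unit_ball_vol nn"
 have V: "V \<ge> 0" unfolding V_def using nn_pos by simp
 have le: "ennreal (\<bar>f x\<bar> powr p) \<le> indicator (ball 0 1) x + indicator {x. norm x \<ge> 1} x * ennreal (norm x powr (-(2 * nn)))" for x
 proof -
  have "\<bar>f x\<bar> powr p \<le> (mm x powr (- (nn / p))) powr p" using f(2)[of x] p_pos by (intro powr_mono2) auto
  also have "... = mm x powr (- nn)" unfolding powr_powr using p_pos by simp
  finally have 1: "\<bar>f x\<bar> powr p \<le> mm x powr (- nn)" .
  show ?thesis
  proof (cases "norm x < 1")
   case True
   have "mm x powr (- nn) \<le> 1 powr (- nn)" using nn_pos by (intro powr_mono2') auto
   then show ?thesis using 1 True by (simp add: indicator_def ennreal_le_1)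
  next
   case False
   have n: "norm x > 0" using False by linarith
   have "mm x powr (- nn) \<le> ((norm x)^2) powr (- nn)" using nn_pos n unfolding mm_def by (intro powr_mono2') auto
   also have "(norm x)^2 = norm x powr 2" by simp
   also have "(norm x powr 2) powr (- nn) = norm x powr (-(2 * nn))" unfolding powr_powr by simp
   finally show ?thesis using 1 False by (simp add: indicator_def ennreal_leI)
  qed
 qed
 have [measurable]: "(indicator (ball 0 1) :: 'a => ennreal) \<in> bmeas" "(indicator {x. norm x \<ge> 1} :: 'a => ennreal) \<in> bmeas"
  using far_set[of 1] by (auto intro!: borel_measurable_indicator)
 have "(NN x. ennreal (\<bar>f x\<bar> powr p)) \<le> (NN x. indicator (ball (0::'a) 1) x + indicator {x. norm x \<ge> 1} x * ennreal (norm x powr (-(2 * nn))))"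
  by (rule nn_integral_mono) (rule le)
 also have "... = (NN x. indicator (ball (0::'a) 1) x) + (NN x. indicator {x. norm x \<ge> 1} (x::'a) * ennreal (norm x powr (-(2 * nn))))"
  by (rule nn_integral_add) measurable
 also have "... \<le> ennreal V + ennreal C2"
  using C2(2)[of 1] emeasure_ball[of 1 "0::'a"] unfolding V_def by (intro add_mono) auto
 also have "... = ennreal (V + C2)" using V C2 by simp
 finally show ?thesis by (rule LpI_nn(1)[OF f(1)]) (use V C2 in simp)
qed

text \<open>The pattern of \<open>power_pattern\<close> on the sphere, with \<open>zb\<close> for
  the plane of \<open>b1\<close> and \<open>b2\<close> and \<open>za\<close> for \<open>e0\<close>
  and the additional coordinate, carried to R^n by the conformal weight. The planar rotation moves
  \<open>zb\<close> and fixes \<open>za\<close>.\<close>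

lemma odd_ex: "\<exists>w\<in>symc (HO m). be w w > 0"
proof -
 define za zb where "za = zc (e0, 0::real) (0, 1::real)" and "zb = zc (b1, 0::real) (b2, 0)"
 define F where "F = (%z. Re (zb z ^ (2^m) * cnj (za z) ^ (2^m)))"
 define w where "w = (%x::'a. mm x powr (- (nn / p)) * F (stg x))"
 have bb: "b1 \<bullet> e0 = 0" "b2 \<bullet> e0 = 0" "e0 \<bullet> b1 = 0" "e0 \<bullet> b2 = 0" "b1 \<bullet> b2 = 0" "b2 \<bullet> b1 = 0" "b1 \<bullet> b1 = 1" "b2 \<bullet> b2 = 1" using b by (auto simp: inner_Basis)
 have FR: "F (rot Jt \<theta> z) = F z" for \<theta> z
 proof -
  have "za (rot Jt \<theta> z) = cis \<theta> * za z" unfolding za_def zc_def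
   by (rule rot_pair[OF Jt_pcs]) (simp_all add: Jt_def Je0 e0e0 linear_0[OF pcs_lin(1)[OF J']])
  moreover have "zb (rot Jt \<theta> z) = cis \<theta> * zb z" unfolding zb_def zc_def
   by (rule rot_pair[OF Jt_pcs]) (simp_all add: Jt_def Jb bb)
  ultimately show ?thesis unfolding F_def by (simp only: power_pattern(1))
 qed
 have zs: "zb (stg x) = complex_of_real (2 / mm x) * zc b1 b2 x" "za (stg x) = Complex ((2 / mm x) * (x \<bullet> e0)) (1 - 2 / mm x)" for x :: 'a
  unfolding za_def zb_def zc_def stg_def by (simp_all add: complex_eq_iff)
 have c: "continuous_on UNIV w"
 proof -
  have "continuous_on UNIV F" unfolding F_def za_def zb_def by (intro continuous_intros zc_cont)
  then have "continuous_on UNIV (%x. F (stg x))" by (rule continuous_on_compose2[OF _ stg_cont]) simp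
  then show ?thesis unfolding w_def by (intro continuous_intros mm_cont) auto
 qed
 have nz: "cmod (zc y y' z) \<le> norm z" if "y \<in> Basis" "y' \<in> Basis" "y \<noteq> y'" for y y' z :: "'a \<times> real"
 proof -
  have "(cmod (zc y y' z))^2 = (z \<bullet> y)^2 + (z \<bullet> y')^2" unfolding zc_def cmod_power2 by simp
  also have "... = (\<Sum>i\<in>{y, y'}. (z \<bullet> i)^2)" using that by simp
  also have "... \<le> (\<Sum>i\<in>Basis. (z \<bullet> i)^2)" using that by (intro sum_mono2) auto
  also have "... = (norm z)^2" unfolding power2_norm_eq_inner euclidean_inner[of z z] by (simp add: power2_eq_square)
  finally show ?thesis by (rule power2_le_imp_le) simp
 qed
 have B: "(e0, 0::real) \<in> Basis" "(0::'a, 1::real) \<in> Basis" "(b1, 0::real) \<in> Basis" "(b2, 0::real) \<in> Basis" using b by (auto simp: Basis_prod_def)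
 have "\<bar>F (stg x)\<bar> \<le> 1" for x :: 'a
 proof -
  have "cmod (za (stg x)) \<le> 1" "cmod (zb (stg x)) \<le> 1" unfolding za_def zb_def
   using nz[OF B(1,2), of "stg x"] nz[OF B(3,4), of "stg x"] b by (auto simp: stg_norm)
  then have "cmod (zb (stg x)) ^ (2^m) * cmod (za (stg x)) ^ (2^m) \<le> 1 * 1" by (intro mult_mono power_le_one) auto
  moreover have "\<bar>F (stg x)\<bar> \<le> cmod (zb (stg x) ^ (2^m) * cnj (za (stg x)) ^ (2^m))" unfolding F_def by (rule abs_Re_le_cmod)
  ultimately show ?thesis by (simp add: norm_mult norm_power)
 qed
 then have "\<bar>w x\<bar> \<le> mm x powr (- (nn / p))" for x unfolding w_def by (simp add: abs_mult mult_left_le)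
 with borel_measurable_continuous_onI[OF c] have wL: "Lp p w" by (rule mm_Lp)
 have "AE x in lborel. rho x powr (nn/p) * w (T x) = w x" if G: "(T, rho) \<in> GS" for T rho
 proof -
  obtain \<theta> where s: "sph (rot Jt \<theta>) T rho" using G unfolding GS_def by blast
  then have cf: "conf T rho" and ae: "AE x in lborel. stg (T x) = rot Jt \<theta> (stg x) \<and> mm (T x) = rho x * mm x" unfolding sph_def by auto
  from ae show ?thesis
  proof eventually_elim
   case (elim x)
   have "rho x powr (nn/p) * (rho x * mm x) powr (- (nn/p)) = mm x powr (- (nn/p))"
    using rho_pos[OF cf, of x] by (simp add: powr_mult powr_minus)
   then show ?case unfolding w_def using elim FR by (simp flip: mult.assoc)
  qed
 qed
 moreover have t: "zb (stg (\<tau> b1 b2 j x)) = cis (pi / 2^j) * zb (stg x)" "za (stg (\<tau> b1 b2 j x)) = za (stg x)" "mm (\<tau> b1 b2 j x) = mm x" for j x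
 proof -
  have b12: "b1 \<noteq> b2" using b by simp
  show m: "mm (\<tau> b1 b2 j x) = mm x" unfolding \<tau>_def mm_def rot_norm[OF pcs_plane[OF b(2,3) b12]] ..
  show "zb (stg (\<tau> b1 b2 j x)) = cis (pi / 2^j) * zb (stg x)" unfolding zs m unfolding \<tau>_def zc_plane[OF b(2,3) b12] by simp
  have "plane b1 b2 e0 = 0" using b by (auto simp: plane_def inner_Basis)
  then show "za (stg (\<tau> b1 b2 j x)) = za (stg x)" unfolding zs m unfolding \<tau>_def by (simp add: rot_fix[OF pcs_plane[OF b(2,3) b12]])
 qed
 moreover have "w (\<tau> b1 b2 m x) = - w x" for x unfolding w_def F_def t power_pattern(2) by (rule mult_minus_right)
 moreover have "w (\<tau> b1 b2 j x) = w x" if "j < m" for j x unfolding w_def F_def t power_pattern(3)[OF that] ..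
 ultimately have ws: "w \<in> symc (HO m)" unfolding symc_Hm using wL by auto
 \<comment> \<open>A unit vector, so \<open>stg a\<close> lies on the equator; the additional
   coordinate vanishes there, and both complex coordinates are real and positive.\<close>
 define a where "a = (1 / sqrt 2) *\<^sub>R e0 + (1 / sqrt 2) *\<^sub>R b1"
 have "a \<bullet> a = 1" unfolding a_def inner_lincomb using b(1,2) bb by (simp add: e0e0 power_divide)
 then have mma: "mm a = 2" unfolding mm_def power2_norm_eq_inner by simp
 have z: "za (stg a) = complex_of_real (1 / sqrt 2)" "zb (stg a) = complex_of_real (1 / sqrt 2)"
  unfolding zs mma unfolding zc_def a_def using bb by (simp_all add: inner_add_left e0e0 complex_eq_iff)
 have "F (stg a) > 0" unfolding F_def z
  unfolding complex_cnj_complex_of_real of_real_power[symmetric] of_real_mult[symmetric] Re_complex_of_real by simp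
 then have "w a \<noteq> 0" unfolding w_def mma by simp
 from be_pos[OF wL c this] ws show ?thesis by blast
qed

end

theorem odd_solutions:
 assumes "odd DIM('a)" "DIM('a) \<ge> 3"
 shows "\<exists>u :: nat => 'a => real. (\<forall>k. u k \<in> Hs s \<and> weak_solution s q (u k) \<and> sign_changing (u k)) \<and> filterlim (%k. Hs_form s (u k) (u k)) at_top sequentially"
proof -
 obtain A where A: "A \<subseteq> (Basis::'a set)" "card A = 3" by (meson assms(2) obtain_subset_with_card_n)
 then obtain e0 b1 b2 where b: "A = {e0, b1, b2}" "distinct [e0, b1, b2]"
  by (auto simp: card_Suc_eq numeral_eq_Suc)
 have bB: "e0 \<in> Basis" "b1 \<in> Basis" "b2 \<in> Basis" using A b by auto
 let ?S = "Basis - A"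
 have "card ?S = DIM('a) - 3" using A by (simp add: card_Diff_subset finite_subset[OF A(1) finite_Basis])
 then have "even (card ?S)" using assms by simp
 then obtain J0 where J0: "pcs J0 ?S" using ex_pcs[of ?S] by auto
 define J where "J = (%x. J0 x + plane b1 b2 x)"
 have "pcs J (insert b1 (insert b2 ?S))" unfolding J_def by (rule pcs_add_plane[OF J0]) (use bB b in auto)
 moreover have "insert b1 (insert b2 ?S) = Basis - {e0}" using bB b by auto
 ultimately have J: "pcs J (Basis - {e0})" by simp
 have z: "J0 b1 = 0" "J0 b2 = 0" using pcs_out[OF J0] bB b by auto
 have "J b1 = b2" "J b2 = - b1" unfolding J_def z plane_def using b bB by (auto simp: inner_Basis)
 note c = bB b(2) J this
 have b12: "b1 \<noteq> b2" using b by simp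
 show ?thesis
 proof (rule solutions_from_compactness[OF bB(2,3) b12 _ odd_ex[OF c]])
  show "conf T rho" if "(T, rho) \<in> GS J e0" for T rho using that unfolding GS_def[OF c] sph_def by blast
  fix m :: "nat => nat" and w :: "nat => 'a => real"
  assume h: "!!k. w k \<in> symc (Hm (GS J e0) b1 b2 (m k))" "!!k. Np p (w k) \<le> 1"
  have "tight w" "nonconc w" by (rule odd_compact[OF c, of w m], rule h, rule h)+
  then show "\<exists>w'. (\<forall>k. w' k \<in> symc (Hm (GS J e0) b1 b2 (m k)) \<and> Np p (w' k) \<le> 1 \<and> be (w' k) (w' k) = be (w k) (w k)) \<and> tight w' \<and> nonconc w'"
   using h by (intro exI[of _ w]) simp
 qed
qed

end

theorem theorem1:
  fixes s q :: real
  defines "n \<equiv> DIM('a::euclidean_space)"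
  assumes "2 * s < real n"
    and "(2 \<le> s \<and> s < real n / 2) \<or> (1 \<le> s \<and> s < 2 * real n / (real n + 1))
         \<or> (1 \<le> s \<and> s < real n / 2 \<and> even n)"
    and "q = 2 * real n / (real n - 2 * s)"
  shows "\<exists>u :: nat \<Rightarrow> 'a \<Rightarrow> real.
           (\<forall>k. u k \<in> Hs s \<and> weak_solution s q (u k) \<and> sign_changing (u k)) \<and>
           filterlim (\<lambda>k. Hs_form s (u k) (u k)) at_top sequentially"
proof -
  \<comment> \<open>Each alternative of the hypothesis contains \<open>1 \<le> s\<close>. With
    \<open>2 * s < n\<close> this gives \<open>n \<ge> 3\<close>, room for the three basis vectors
    of the odd case, and \<open>n \<ge> 4\<close> for even n.\<close>
  have s1: "s \<ge> 1" using assms(3) by auto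
  interpret crit s "real n" "TYPE('a)"
    by unfold_locales (use s1 assms(2) in \<open>auto simp: n_def\<close>)
  have q: "q = crit.q s (real n)" unfolding q_def using assms(4) by simp
  have "real n > 2" using s1 assms(2) by linarith
  then have n3: "n \<ge> 3" by simp
  show ?thesis
  proof (cases "even n")
    case True
    then have "n \<ge> 4" using n3 by (cases "n = 3") auto
    then show ?thesis using even_solutions True unfolding q n_def by blast
  next
    case False
    then show ?thesis using odd_solutions n3 unfolding q n_def by blast
  qed
qed

end
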